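(* Let $d\ge 2$ and let $\theta_1,\ldots,\theta_d\in\mathbb{T}=\mathbb{R}/\mathbb{Z}$. Assume there exist $\nu>0$ and $C>0$ such that for every $k\in\mathbb{Z}\setminus\{0\}$, $$\max(\|k\theta_1\|,\ldots,\|k\theta_d\|)\ \ge\ C|k|^{-\nu}.$$ Let $f_1,\ldots,f_d$ be $C^\infty$ orientation-preserving diffeomorphisms of the circle $\mathbb{T}$ such that $f_i$ has rotation number $\theta_i$ for each $i$, and such that $f_i\circ f_j=f_j\circ f_i$ for all $i,j$. Then there exists a $C^\infty$ orientation-preserving diffeomorphism $h$ of $\mathbb{T}$ such that $h\circ f_i\circ h^{-1}=R_{\theta_i}$ for every $1\le i\le d$, where $R_\alpha(x)=x+\alpha$.
   Context: $\|x\|$ denotes the distance from $x\in\mathbb{R}$ to the nearest integer. The rotation number of an orientation-preserving circle homeomorphism $f$ with lift $\tilde f$ is $\lim_{j\to\infty}(\tilde f^j(x)-x)/j \bmod 1$ (Poincaré). *)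

theory Defs
  imports "HOL-Analysis.Analysis"
begin

definition dist_int :: "real \<Rightarrow> real" where
  "dist_int x = \<bar>x - of_int (round x)\<bar>"

definition smooth_real :: "(real \<Rightarrow> real) \<Rightarrow> bool" where
  "smooth_real F \<longleftrightarrow> (\<forall>n x. ((deriv ^^ n) F) differentiable (at x))"

definition circle_diffeo_lift :: "(real \<Rightarrow> real) \<Rightarrow> bool" where
  "circle_diffeo_lift F \<longleftrightarrow>
     bij F \<and> smooth_real F \<and> smooth_real (inv F) \<and> strict_mono F \<and>
     (\<forall>x. F (x + 1) = F x + 1)"

text \<open>Rotation number (as a real, to be read modulo 1) of the circle map with lift F.\<close>
definition rotation_number :: "(real \<Rightarrow> real) \<Rightarrow> real" where
  "rotation_number F = lim (\<lambda>j. ((F ^^ j) 0 - 0) / real j)"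

end

theory Submission
  imports Defs
begin

text \<open>
  Some $\theta_i$ is irrational, so Denjoy's theorem gives a homeomorphism $h$ conjugating $F_i$, hence all the
  commuting $F_j$, to translations. Put $\Phi_r = h^{-1}(h + r)$; the set of $r$ with $\Phi_r$ a smooth
  diffeomorphism contains the group generated by 1 and the rotation numbers $c_j$. By the simultaneous Diophantine
  condition each small $\alpha$ in this group is followed by some $\alpha' = l c_j + p$ in it with
  $\alpha^P \le \alpha' \le \alpha/8$, where the first $l$ iterates of $F_j$ move every $\Phi$-segment of length
  $\alpha/8$ disjointly.

  Write $A_r = \ln \Phi_r'$ and $m_r = \Phi_r - \mathrm{id}$. Disjointness bounds the distortion and, via the
  Schwarzian, the derivatives of $A$ along these iterates by powers of $\eta/m_\alpha$, where the roughness $\eta$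
  is of the order of $\sup |A_\alpha| + \sup \sqrt{m_\alpha}$. Interpolation at the points $\Phi_{i\alpha} x$ then shows that
  $m_{\alpha'}$ is nearly constant on $[x, \Phi_\alpha x]$ unless $\alpha'$ is smaller than every power of $\alpha$,
  which the Diophantine condition forbids. Hence $\eta$ decays like a power of $\alpha$, so $m_\beta$ is comparable to
  $\beta$ and $h$ is bi-Lipschitz. Since $\Phi_v$ and $\Phi_w$ commute, the displacement $m_w$ is almost
  $\Phi_v$-invariant; interpolation turns this into bounds for one more derivative at a time. Finally $h$ is, up to a
  constant, the average of the $\Phi_r$ over $0 \le r \le 1$, whose Riemann sums have uniformly bounded derivatives.
\<close>

section \<open>Smooth functions on the line\<close>

definition higher_differentiable :: "nat \<Rightarrow> (real \<Rightarrow> real) \<Rightarrow> bool" where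
  "higher_differentiable n F \<longleftrightarrow> (\<forall>i<n. \<forall>x. ((deriv ^^ i) F) differentiable (at x))"

lemma smooth_iff_higher_differentiable: "smooth_real F \<longleftrightarrow> (\<forall>n. higher_differentiable n F)"
  unfolding smooth_real_def higher_differentiable_def by blast

lemma higher_differentiable_0 [simp]: "higher_differentiable 0 F"
  by (simp add: higher_differentiable_def)

lemma higher_differentiable_Suc:
  "higher_differentiable (Suc n) F \<longleftrightarrow>
    (\<forall>x. (F has_real_derivative deriv F x) (at x)) \<and> higher_differentiable n (deriv F)"
proof -
  have "(\<forall>i<Suc n. \<forall>x. ((deriv ^^ i) F) differentiable (at x)) \<longleftrightarrow>
      (\<forall>x. F differentiable (at x)) \<and> (\<forall>i<n. \<forall>x. ((deriv ^^ i) (deriv F)) differentiable (at x))"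
    unfolding All_less_Suc2 by (simp add: funpow_swap1)
  then show ?thesis by (simp add: higher_differentiable_def DERIV_deriv_iff_real_differentiable)
qed

lemma higher_differentiable_SucD: "higher_differentiable (Suc n) F \<Longrightarrow> higher_differentiable n F"
  by (auto simp: higher_differentiable_def)

lemma higher_differentiable_SucI:
  assumes "\<And>x. (F has_real_derivative G x) (at x)" "higher_differentiable n G"
  shows "higher_differentiable (Suc n) F"
proof -
  have "deriv F = G" using assms(1) DERIV_imp_deriv by blast
  then show ?thesis using assms by (simp add: higher_differentiable_Suc)
qed

lemma higher_differentiable_const [simp]: "higher_differentiable n (\<lambda>x. c)"
proof (induction n arbitrary: c)
  case (Suc n)
  show ?case by (rule higher_differentiable_SucI[where G="\<lambda>x. 0"]) (auto intro: Suc)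
qed simp

lemma higher_differentiable_ident [simp]: "higher_differentiable n (\<lambda>x. x)"
  by (cases n) (auto intro!: higher_differentiable_SucI[where G="\<lambda>x. 1"])

lemma higher_differentiable_add: "higher_differentiable n F \<Longrightarrow> higher_differentiable n G \<Longrightarrow>
    higher_differentiable n (\<lambda>x. F x + G x)"
proof (induction n arbitrary: F G)
  case (Suc n)
  show ?case
    by (rule higher_differentiable_SucI[where G="\<lambda>x. deriv F x + deriv G x"])
      (use Suc in \<open>auto simp: higher_differentiable_Suc intro!: derivative_intros\<close>)
qed simp

lemma higher_differentiable_mult: "higher_differentiable n F \<Longrightarrow> higher_differentiable n G \<Longrightarrow>
    higher_differentiable n (\<lambda>x. F x * G x)"
proof (induction n arbitrary: F G)
  case (Suc n)
  have derivs: "\<And>x. (F has_real_derivative deriv F x) (at x)" "\<And>x. (G has_real_derivative deriv G x) (at x)"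
    "higher_differentiable n (deriv F)" "higher_differentiable n (deriv G)"
    using Suc.prems by (auto simp: higher_differentiable_Suc)
  show ?case
  proof (rule higher_differentiable_SucI[where G="\<lambda>x. deriv F x * G x + F x * deriv G x"])
    show "((\<lambda>x. F x * G x) has_real_derivative deriv F x * G x + F x * deriv G x) (at x)" for x
      using DERIV_mult[OF derivs(1,2), of x]
      by (simp add: mult.commute)
    show "higher_differentiable n (\<lambda>x. deriv F x * G x + F x * deriv G x)"
      by (intro higher_differentiable_add Suc.IH derivs) (rule higher_differentiable_SucD, rule Suc.prems)+
  qed
qed simp

lemma higher_differentiable_compose: "higher_differentiable n F \<Longrightarrow> higher_differentiable n G \<Longrightarrow>
    higher_differentiable n (\<lambda>x. F (G x))"
proof (induction n arbitrary: F)
  case (Suc n)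
  have derivs: "\<And>x. (F has_real_derivative deriv F x) (at x)" "\<And>x. (G has_real_derivative deriv G x) (at x)"
    "higher_differentiable n (deriv F)" "higher_differentiable n (deriv G)"
    using Suc.prems by (auto simp: higher_differentiable_Suc)
  show ?case
  proof (rule higher_differentiable_SucI[where G="\<lambda>x. deriv F (G x) * deriv G x"])
    show "((\<lambda>x. F (G x)) has_real_derivative deriv F (G x) * deriv G x) (at x)" for x
      using DERIV_chain2[OF derivs(1,2)]
      by simp
    show "higher_differentiable n (\<lambda>x. deriv F (G x) * deriv G x)"
      using Suc.IH[OF derivs(3) higher_differentiable_SucD[OF Suc.prems(2)]] derivs(4)
      by (rule higher_differentiable_mult)
  qed
qed simp

lemma higher_differentiable_inverse:
  assumes "\<And>x. F x \<noteq> 0"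
  shows "higher_differentiable n F \<Longrightarrow> higher_differentiable n (\<lambda>x. inverse (F x))"
proof (induction n)
  case (Suc n)
  have derivs: "\<And>x. (F has_real_derivative deriv F x) (at x)" "higher_differentiable n (deriv F)"
    "higher_differentiable n F"
    using Suc.prems higher_differentiable_SucD[OF Suc.prems] by (auto simp: higher_differentiable_Suc)
  show ?case
  proof (rule
    higher_differentiable_SucI[where G="\<lambda>x. (-1) * (deriv F x * (inverse (F x) * inverse (F x)))"])
    show "((\<lambda>x. inverse (F x)) has_real_derivative
        (-1) * (deriv F x * (inverse (F x) * inverse (F x)))) (at x)" for x
      using DERIV_inverse_fun[OF derivs(1) assms, of x]
      by (simp add: power2_eq_square mult_ac)
  qed (intro higher_differentiable_mult higher_differentiable_const derivs Suc.IH)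
qed simp

lemma higher_differentiable_ln:
  assumes "\<And>x. F x > 0"
  shows "higher_differentiable n F \<Longrightarrow> higher_differentiable n (\<lambda>x. ln (F x))"
proof (cases n)
  case (Suc k)
  assume "higher_differentiable n F"
  then have derivs: "\<And>x. (F has_real_derivative deriv F x) (at x)" "higher_differentiable k (deriv F)"
    "higher_differentiable k F"
    using Suc higher_differentiable_SucD[of k F] by (auto simp: higher_differentiable_Suc)
  have nonzero: "F x \<noteq> 0" for x using assms[of x] by simp
  show ?thesis unfolding Suc
  proof (rule higher_differentiable_SucI[where G="\<lambda>x. deriv F x * inverse (F x)"])
    show "((\<lambda>x. ln (F x)) has_real_derivative deriv F x * inverse (F x)) (at x)" for x
      using DERIV_chain2[OF DERIV_ln_divide[OF assms] derivs(1), of x]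
      by (simp add: divide_inverse mult.commute)
  qed (intro higher_differentiable_mult higher_differentiable_inverse derivs nonzero)
qed simp

lemma higher_differentiable_exp: "higher_differentiable n F \<Longrightarrow> higher_differentiable n (\<lambda>x. exp (F x))"
proof (induction n)
  case (Suc n)
  have derivs: "\<And>x. (F has_real_derivative deriv F x) (at x)" "higher_differentiable n (deriv F)"
    "higher_differentiable n F"
    using Suc.prems higher_differentiable_SucD[OF Suc.prems] by (auto simp: higher_differentiable_Suc)
  show ?case
  proof (rule higher_differentiable_SucI[where G="\<lambda>x. deriv F x * exp (F x)"])
    show "((\<lambda>x. exp (F x)) has_real_derivative deriv F x * exp (F x)) (at x)" for x
      using DERIV_chain2[OF DERIV_exp derivs(1), of x] by (simp add: mult.commute)
  qed (intro higher_differentiable_mult derivs Suc.IH)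
qed simp

lemma smooth_const [simp, intro]: "smooth_real (\<lambda>x. c)"
  and smooth_ident [simp, intro]: "smooth_real (\<lambda>x. x)"
  and smooth_add [intro]: "smooth_real F \<Longrightarrow> smooth_real G \<Longrightarrow> smooth_real (\<lambda>x. F x + G x)"
  and smooth_mult [intro]: "smooth_real F \<Longrightarrow> smooth_real G \<Longrightarrow> smooth_real (\<lambda>x. F x * G x)"
  and smooth_compose: "smooth_real F \<Longrightarrow> smooth_real G \<Longrightarrow> smooth_real (\<lambda>x. F (G x))"
  and smooth_ln: "(\<And>x. F x > 0) \<Longrightarrow> smooth_real F \<Longrightarrow> smooth_real (\<lambda>x. ln (F x))"
  and smooth_exp [intro]: "smooth_real F \<Longrightarrow> smooth_real (\<lambda>x. exp (F x))"
  unfolding smooth_iff_higher_differentiable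
  using higher_differentiable_add higher_differentiable_mult higher_differentiable_compose
    higher_differentiable_ln higher_differentiable_exp by auto

lemma smooth_cmult [intro]: "smooth_real F \<Longrightarrow> smooth_real (\<lambda>x. c * F x)"
  by (rule smooth_mult) auto

lemma smooth_diff [intro]: "smooth_real F \<Longrightarrow> smooth_real G \<Longrightarrow> smooth_real (\<lambda>x. F x - G x)"
  using smooth_add[of F "\<lambda>x. (-1) * G x"] smooth_cmult[of G "-1"] by simp

lemma smooth_sum [intro]:
  "(\<And>i. i \<in> I \<Longrightarrow> smooth_real (F i)) \<Longrightarrow> smooth_real (\<lambda>x. \<Sum>i\<in>I. F i x)"
  by (induction I rule: infinite_finite_induct) auto

lemma smooth_deriv [intro]: "smooth_real F \<Longrightarrow> smooth_real (deriv F)"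
  unfolding smooth_iff_higher_differentiable using higher_differentiable_Suc by blast

lemma smooth_funpow_deriv [intro]: "smooth_real F \<Longrightarrow> smooth_real ((deriv ^^ n) F)"
  by (induction n) auto

lemma smooth_has_derivative: "smooth_real F \<Longrightarrow> (F has_real_derivative deriv F x) (at x)"
  unfolding smooth_iff_higher_differentiable using higher_differentiable_Suc by blast

lemma smooth_isCont: "smooth_real F \<Longrightarrow> isCont F x"
  using smooth_has_derivative DERIV_isCont by blast

lemma smooth_continuous_on: "smooth_real F \<Longrightarrow> continuous_on S F"
  using smooth_isCont continuous_at_imp_continuous_on by blast

lemma smooth_inverse_function:
  assumes F: "smooth_real F" and pos: "\<And>x. deriv F x > 0" and inv: "\<And>y. F (G y) = y" "\<And>x. G (F x) = x"
  shows "smooth_real G" "\<And>y. (G has_real_derivative inverse (deriv F (G y))) (at y)"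
proof -
  show deriv_G: "(G has_real_derivative inverse (deriv F (G y))) (at y)" for y
  proof (rule DERIV_inverse_function[where a="y-1" and b="y+1"])
    show "(F has_real_derivative deriv F (G y)) (at (G y))" by (rule smooth_has_derivative[OF F])
    show "deriv F (G y) \<noteq> 0" using pos[of "G y"] by simp
    have "isCont G (F (G y))"
      by (rule isCont_inverse_function[where d=1]) (auto simp: inv smooth_isCont[OF F])
    then show "isCont G y" by (simp add: inv)
  qed (auto simp: inv)
  have nonzero: "deriv F (G y) \<noteq> 0" for y using pos[of "G y"] by simp
  have deriv_F: "higher_differentiable n (deriv F)" for n
    using smooth_deriv[OF F] by (simp add: smooth_iff_higher_differentiable)
  have "higher_differentiable n G" for n
  proof (induction n)
    case (Suc n)
    show ?case by (rule higher_differentiable_SucI[OF deriv_G]) (intro higher_differentiable_inverse nonzero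
      higher_differentiable_compose[OF deriv_F Suc])
  qed simp
  then show "smooth_real G" by (simp add: smooth_iff_higher_differentiable)
qed

lemma deriv_add_smooth: "smooth_real F \<Longrightarrow> smooth_real G \<Longrightarrow>
    deriv (\<lambda>x. F x + G x) = (\<lambda>x. deriv F x + deriv G x)"
  by (rule ext, rule DERIV_imp_deriv) (intro DERIV_add smooth_has_derivative)

lemma deriv_diff_smooth: "smooth_real F \<Longrightarrow> smooth_real G \<Longrightarrow>
    deriv (\<lambda>x. F x - G x) = (\<lambda>x. deriv F x - deriv G x)"
  by (rule ext, rule DERIV_imp_deriv) (intro DERIV_diff smooth_has_derivative)

lemma deriv_mult_smooth:
  "smooth_real F \<Longrightarrow> smooth_real G \<Longrightarrow> deriv (\<lambda>x. F x * G x) = (\<lambda>x. deriv F x * G x + F x * deriv G x)"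
  using DERIV_mult[OF smooth_has_derivative smooth_has_derivative]
  by (intro ext DERIV_imp_deriv) (simp add: mult.commute)

lemma deriv_compose_smooth:
  "smooth_real F \<Longrightarrow> smooth_real G \<Longrightarrow> deriv (\<lambda>x. F (G x)) = (\<lambda>x. deriv F (G x) * deriv G x)"
  using DERIV_chain2[OF smooth_has_derivative smooth_has_derivative] by (intro ext DERIV_imp_deriv) simp

lemma deriv_exp_smooth: "smooth_real F \<Longrightarrow> deriv (\<lambda>x. exp (F x)) = (\<lambda>x. deriv F x * exp (F x))"
  using DERIV_chain2[OF DERIV_exp smooth_has_derivative]
  by (intro ext DERIV_imp_deriv) (simp add: mult.commute)

lemma deriv_cmult_smooth: "smooth_real F \<Longrightarrow> deriv (\<lambda>x. c * F x) = (\<lambda>x. c * deriv F x)"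
  by (rule ext, rule DERIV_imp_deriv) (intro DERIV_cmult smooth_has_derivative)

lemma funpow_deriv_Suc: "(deriv ^^ Suc n) F = (deriv ^^ n) (deriv F)"
  by (simp add: funpow_swap1)

lemma funpow_deriv_add:
  "smooth_real F \<Longrightarrow> smooth_real G \<Longrightarrow>
    (deriv ^^ n) (\<lambda>x. F x + G x) = (\<lambda>x. (deriv ^^ n) F x + (deriv ^^ n) G x)"
  by (induction n) (auto simp: deriv_add_smooth smooth_funpow_deriv)

lemma funpow_deriv_diff:
  "smooth_real F \<Longrightarrow> smooth_real G \<Longrightarrow>
    (deriv ^^ n) (\<lambda>x. F x - G x) = (\<lambda>x. (deriv ^^ n) F x - (deriv ^^ n) G x)"
  by (induction n) (auto simp: deriv_diff_smooth smooth_funpow_deriv)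

lemma funpow_deriv_cmult:
  "smooth_real F \<Longrightarrow> (deriv ^^ n) (\<lambda>x. c * F x) = (\<lambda>x. c * (deriv ^^ n) F x)"
  by (induction n) (auto simp: deriv_cmult_smooth smooth_funpow_deriv)

lemma funpow_deriv_const: "(deriv ^^ n) (\<lambda>x. c::real) = (\<lambda>x. if n = 0 then c else 0)"
  by (induction n) auto

lemma funpow_deriv_ident: "(deriv ^^ n) (\<lambda>x. x::real) = (\<lambda>x. if n = 0 then x else if n = 1 then 1 else 0)"
  by (induction n) auto

lemma funpow_deriv_sum:
  "finite I \<Longrightarrow> (\<And>i. i \<in> I \<Longrightarrow> smooth_real (F i)) \<Longrightarrow>
    (deriv ^^ n) (\<lambda>x. \<Sum>i\<in>I. F i x) = (\<lambda>x. \<Sum>i\<in>I. (deriv ^^ n) (F i) x)"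
  by (induction I rule: finite_induct) (auto simp: funpow_deriv_const funpow_deriv_add smooth_sum)

lemma deriv_periodic:
  assumes "\<And>x. F (x + 1) = F x + (c::real)"
  shows "deriv F (x + 1) = deriv F x"
proof -
  have "(F has_real_derivative D) (at (x + 1)) \<longleftrightarrow> (F has_real_derivative D) (at x)" for D
  proof -
    have "(F has_real_derivative D) (at (x + 1)) \<longleftrightarrow> ((\<lambda>t. F (t + 1)) has_real_derivative D) (at x)"
      by (rule DERIV_shift)
    also have "\<dots> \<longleftrightarrow> ((\<lambda>t. F t + c) has_real_derivative D) (at x)" by (simp add: assms)
    also have "\<dots> \<longleftrightarrow> (F has_real_derivative D) (at x)"
      using DERIV_add[of F D x UNIV "\<lambda>_. c" 0] DERIV_add[of "\<lambda>t. F t + c" D x UNIV "\<lambda>_. -c" 0] by auto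
    finally show ?thesis .
  qed
  then show ?thesis by (simp add: deriv_def)
qed

lemma funpow_deriv_periodic:
  assumes "\<And>x. F (x + 1) = F x"
  shows "(deriv ^^ n) F (x + 1) = (deriv ^^ n) F (x::real)"
proof (induction n arbitrary: x)
  case (Suc n)
  then show ?case using deriv_periodic[of "(deriv ^^ n) F" 0] by simp
qed (simp add: assms)

lemma shift_of_int:
  assumes "\<And>x::real. F (x + 1) = (F x :: real) + c"
  shows "F (x + of_int p) = F x + of_int p * c"
proof -
  have shift_nat: "F (x + of_nat n) = F x + of_nat n * c" for n x
  proof (induction n)
    case (Suc n)
    have "F (x + of_nat (Suc n)) = F ((x + of_nat n) + 1)" by (simp add: algebra_simps)
    also have "\<dots> = F x + of_nat n * c + c" using Suc by (simp only: assms)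
    finally show ?case by (simp add: algebra_simps)
  qed simp
  show ?thesis
  proof (cases "p \<ge> 0")
    case True then show ?thesis using shift_nat[of x "nat p"] by simp
  next
    case False then show ?thesis using shift_nat[of "x + of_int p" "nat (-p)"] by simp
  qed
qed

lemma periodic_attains_max:
  assumes "continuous_on UNIV F" "\<And>x. F (x + 1) = F (x::real)"
  obtains x0 where "\<And>x. F x \<le> (F x0 :: real)"
proof -
  obtain x0 where x0: "\<forall>x\<in>{0..1}. F x \<le> F x0"
    using continuous_attains_sup[of "{0..1::real}" F] continuous_on_subset[OF assms(1)] by auto
  have "F x \<le> F x0" for x
  proof -
    have "F (frac x + of_int \<lfloor>x\<rfloor>) = F (frac x)" using shift_of_int[of F 0] assms(2) by simp
    then have "F x = F (frac x)" by (simp add: frac_def)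
    then show ?thesis using x0 by (simp add: frac_ge_0 frac_lt_1 less_imp_le)
  qed
  then show ?thesis by (rule that)
qed

lemma periodic_bounded:
  assumes "continuous_on UNIV F" "\<And>x. F (x + 1) = F (x::real)"
  obtains B where "\<And>x. \<bar>F x :: real\<bar> \<le> B"
proof (rule periodic_attains_max[of "\<lambda>x. \<bar>F x\<bar>"])
  show "continuous_on UNIV (\<lambda>x. \<bar>F x\<bar>)" using assms(1) by (rule continuous_on_rabs)
qed (use assms(2) that in auto)

lemma finite_family_periodic_bounded:
  fixes w :: "'a \<Rightarrow> real \<Rightarrow> real"
  assumes "finite I" "\<And>i. i \<in> I \<Longrightarrow> continuous_on UNIV (w i)" "\<And>i x. i \<in> I \<Longrightarrow> w i (x + 1) = w i x"
  obtains B where "1 \<le> B" "\<And>i x. i \<in> I \<Longrightarrow> \<bar>w i x\<bar> \<le> B"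
proof -
  have "\<exists>B\<ge>1. \<forall>i\<in>I. \<forall>x. \<bar>w i x\<bar> \<le> B"
    using assms
  proof (induction I rule: finite_induct)
    case (insert j I)
    then obtain B where B: "B \<ge> 1" "\<forall>i\<in>I. \<forall>x. \<bar>w i x\<bar> \<le> B" by auto
    obtain B' where "\<And>x. \<bar>w j x\<bar> \<le> B'" using periodic_bounded[of "w j"] insert by auto
    then show ?case using B by (intro exI[of _ "max B B'"]) (auto simp: le_max_iff_disj)
  qed auto
  then show ?thesis using that by blast
qed

lemma smooth_mvt:
  assumes "smooth_real F" "a < b"
  obtains z where "a < z" "z < b" "F b - F a = (b - a) * deriv F z"
  using MVT2[OF assms(2), of F "deriv F"] smooth_has_derivative[OF assms(1)] by blast

lemma smooth_diff_le:
  assumes "smooth_real F" "convex S" "\<And>z. z \<in> S \<Longrightarrow> \<bar>deriv F z\<bar> \<le> B" "a \<in> S" "b \<in> S"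
  shows "\<bar>F b - F a\<bar> \<le> B * \<bar>b - a\<bar>"
  using field_differentiable_bound[OF assms(2), of F "deriv F" B b a] assms(3-5)
    has_field_derivative_at_within[OF smooth_has_derivative[OF assms(1)]] by simp

lemma abs_exp_minus_1_le: "\<bar>x\<bar> \<le> V \<Longrightarrow> \<bar>exp x - 1\<bar> \<le> exp V * \<bar>x\<bar>" for x V :: real
proof -
  assume x: "\<bar>x\<bar> \<le> V"
  have "exp x - 1 \<le> exp V * \<bar>x\<bar>"
  proof -
    have "1 - x \<le> exp (- x)" using exp_ge_add_one_self[of "- x"] by simp
    then have "exp x * (1 - x) \<le> exp x * exp (- x)" by (intro mult_left_mono) auto
    then have "exp x - 1 \<le> exp x * x" by (simp add: exp_minus algebra_simps)
    also have "\<dots> \<le> exp x * \<bar>x\<bar>" by simp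
    also have "\<dots> \<le> exp V * \<bar>x\<bar>" using x by (intro mult_right_mono) auto
    finally show ?thesis .
  qed
  moreover have "1 - exp x \<le> exp V * \<bar>x\<bar>"
  proof -
    have "1 - exp x \<le> 1 * \<bar>x\<bar>" using exp_ge_add_one_self[of x] by linarith
    also have "\<dots> \<le> exp V * \<bar>x\<bar>" using x by (intro mult_right_mono) auto
    finally show ?thesis .
  qed
  ultimately show ?thesis by simp
qed

lemma abs_le_exp_minus_1: "\<bar>x\<bar> \<le> V \<Longrightarrow> \<bar>x\<bar> \<le> exp V * \<bar>exp x - 1\<bar>" for x V :: real
proof (cases "x \<ge> 0")
  case True
  assume x: "\<bar>x\<bar> \<le> V"
  have "x \<le> exp x - 1" unfolding le_diff_eq add.commute[of x] by (rule exp_ge_add_one_self)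
  then have "\<bar>x\<bar> \<le> 1 * \<bar>exp x - 1\<bar>" using True by simp
  also have "\<dots> \<le> exp V * \<bar>exp x - 1\<bar>" using x by (intro mult_right_mono) auto
  finally show ?thesis .
next
  case False
  assume x: "\<bar>x\<bar> \<le> V"
  have "\<bar>x\<bar> \<le> exp (- x) - 1" using False exp_ge_add_one_self[of "- x"] by linarith
  also have "\<dots> = exp (- x) * (1 - exp x)" by (simp add: algebra_simps exp_minus)
  also have "\<dots> \<le> exp V * \<bar>exp x - 1\<bar>" using x False by (intro mult_mono) auto
  finally show ?thesis .
qed

section \<open>Bounds on jets\<close>

definition jet_bound :: "nat set \<Rightarrow> real \<Rightarrow> real \<Rightarrow> (real \<Rightarrow> real) \<Rightarrow> real \<Rightarrow> bool" where
  "jet_bound I E K F x \<longleftrightarrow> (\<forall>i\<in>I. \<bar>(deriv ^^ i) F x\<bar> \<le> E * K ^ i)"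

lemma jet_boundD: "jet_bound I E K F x \<Longrightarrow> i \<in> I \<Longrightarrow> \<bar>(deriv ^^ i) F x\<bar> \<le> E * K ^ i"
  by (simp add: jet_bound_def)

lemma jet_bound_mono: "jet_bound I E K F x \<Longrightarrow> J \<subseteq> I \<Longrightarrow> E \<le> E' \<Longrightarrow> 0 \<le> K \<Longrightarrow> jet_bound J E' K F x"
  unfolding jet_bound_def by (meson in_mono mult_right_mono order_trans zero_le_power)

lemma jet_bound_subset: "jet_bound I E K F x \<Longrightarrow> J \<subseteq> I \<Longrightarrow> jet_bound J E K F x"
  by (auto simp: jet_bound_def)

lemma jet_bound_atMost_Suc:
  "jet_bound {..Suc n} E K F x \<longleftrightarrow> jet_bound {..n} E K F x \<and> \<bar>(deriv ^^ Suc n) F x\<bar> \<le> E * K ^ Suc n"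
  by (auto simp: jet_bound_def atMost_Suc)

lemma jet_bound_nonneg: "jet_bound {..n} E K F x \<Longrightarrow> 0 \<le> E"
  using jet_boundD[of "{..n}" E K F x 0] by auto

lemma jet_bound_atMost_iff: "jet_bound {..n} E K F x \<longleftrightarrow> \<bar>F x\<bar> \<le> E \<and> jet_bound {1..n} E K F x"
proof -
  have "{..n} = insert 0 {1..n}" by auto
  then show ?thesis by (simp add: jet_bound_def)
qed

lemma jet_bound_deriv_iff: "jet_bound {..n} (E * K) K (deriv F) x \<longleftrightarrow> jet_bound {1..Suc n} E K F x"
  unfolding jet_bound_def image_Suc_atMost[symmetric] by (simp add: funpow_swap1 mult.assoc)

lemma jet_bound_add:
  assumes "smooth_real F" "smooth_real G" "jet_bound I E K F x" "jet_bound I E' K G x"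
  shows "jet_bound I (E + E') K (\<lambda>x. F x + G x) x"
  using assms
  by (auto simp: jet_bound_def funpow_deriv_add
    distrib_right intro!: order_trans[OF abs_triangle_ineq] add_mono)

lemma jet_bound_cmult:
  "smooth_real F \<Longrightarrow> jet_bound I E K F x \<Longrightarrow> jet_bound I (\<bar>c\<bar> * E) K (\<lambda>x. c * F x) x"
  unfolding jet_bound_def by (auto simp: funpow_deriv_cmult abs_mult mult.assoc intro!: mult_left_mono)

lemma jet_bound_sum:
  assumes "finite J" "\<And>j. j \<in> J \<Longrightarrow> smooth_real (F j)" "\<And>j. j \<in> J \<Longrightarrow> jet_bound I (E j) K (F j) x"
  shows "jet_bound I (\<Sum>j\<in>J. E j) K (\<lambda>x. \<Sum>j\<in>J. F j x) x"
  using assms(3)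
  by (auto simp: jet_bound_def funpow_deriv_sum[OF assms(1,2)] sum_distrib_right
      intro!: order_trans[OF sum_abs] sum_mono)

lemma jet_bound_diff_const:
  assumes "smooth_real F" "I \<subseteq> {1..}"
  shows "jet_bound I E K (\<lambda>x. F x - b) x \<longleftrightarrow> jet_bound I E K F x"
  using assms by (auto simp: jet_bound_def funpow_deriv_diff funpow_deriv_const subset_iff)

lemma jet_bound_mult:
  assumes "smooth_real F" "smooth_real G" "jet_bound {..n} E K F x" "jet_bound {..n} E' K G x" "0 \<le> K"
  shows "jet_bound {..n} (2 ^ n * E * E') K (\<lambda>x. F x * G x) x"
  using assms
proof (induction n arbitrary: F G E E')
  case 0
  then show ?case by (simp add: jet_bound_def abs_mult mult_mono')
next
  case (Suc n)
  have F: "\<bar>F x\<bar> \<le> E" "jet_bound {..n} (E * K) K (deriv F) x" "jet_bound {..n} E K F x"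
    and G: "\<bar>G x\<bar> \<le> E'" "jet_bound {..n} (E' * K) K (deriv G) x" "jet_bound {..n} E' K G x"
    using Suc.prems jet_bound_mono[OF Suc.prems(3) _ order_refl Suc.prems(5), of "{..n}"]
      jet_bound_mono[OF Suc.prems(4) _ order_refl Suc.prems(5), of "{..n}"]
    by (auto simp: jet_bound_atMost_iff[of "Suc n"] jet_bound_deriv_iff)
  have "\<bar>F x * G x\<bar> \<le> 1 * (E * E')" using F(1) G(1) by (simp add: abs_mult mult_mono')
  also have "\<dots> \<le> 2 ^ Suc n * (E * E')"
    using F(1) G(1) by (intro mult_right_mono one_le_power) auto
  finally have "\<bar>F x * G x\<bar> \<le> 2 ^ Suc n * E * E'" by (simp add: mult.assoc)
  moreover have "jet_bound {..n} (2 ^ n * (E * K) * E' + 2 ^ n * E * (E' * K)) K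
      (\<lambda>x. deriv F x * G x + F x * deriv G x) x"
    by (intro jet_bound_add Suc.IH smooth_mult smooth_deriv Suc.prems F G)
  then have "jet_bound {..n} (2 ^ Suc n * E * E' * K) K (deriv (\<lambda>x. F x * G x)) x"
    using Suc.prems by (simp add: deriv_mult_smooth algebra_simps)
  then have "jet_bound {1..Suc n} (2 ^ Suc n * E * E') K (\<lambda>x. F x * G x) x"
    by (simp only: jet_bound_deriv_iff)
  ultimately show ?case by (simp add: jet_bound_atMost_iff)
qed

subsection \<open>Compositions\<close>

primrec chain_jet_const :: "real \<Rightarrow> nat \<Rightarrow> real" where
  "chain_jet_const C 0 = 1"
| "chain_jet_const C (Suc n) = max 1 (2 ^ n * chain_jet_const C n * C)"

lemma chain_jet_const_ge_1: "1 \<le> chain_jet_const C n"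
  by (cases n) auto

lemma jet_bound_compose:
  assumes "smooth_real V" "smooth_real F" "0 \<le> K" "jet_bound {1..n} C K F x" "jet_bound {..n} W 1 V (F x)"
  shows "jet_bound {..n} (chain_jet_const C n * W) K (\<lambda>x. V (F x)) x"
  using assms
proof (induction n arbitrary: V)
  case 0
  then show ?case by (simp add: jet_bound_def)
next
  case (Suc n)
  let ?c = "chain_jet_const C (Suc n)"
  have W: "\<bar>V (F x)\<bar> \<le> W" "jet_bound {..n} W 1 (deriv V) (F x)"
    using Suc.prems(5) jet_bound_deriv_iff[of n W 1 V] by (simp_all add: jet_bound_atMost_iff[of "Suc n"])
  have "jet_bound {..n} (C * K) K (deriv F) x" using Suc.prems(4) by (simp add: jet_bound_deriv_iff)
  moreover have "jet_bound {..n} (chain_jet_const C n * W) K (\<lambda>x. deriv V (F x)) x"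
    using Suc.prems(2,3) W(2)
    by (intro Suc.IH jet_bound_subset[OF Suc.prems(4)] jet_bound_subset[OF W(2)]
      smooth_deriv[OF Suc.prems(1)]) auto
  ultimately have "jet_bound {..n} (2 ^ n * (chain_jet_const C n * W) * (C * K)) K
      (\<lambda>x. deriv V (F x) * deriv F x) x"
    using Suc.prems by (intro jet_bound_mult smooth_compose[OF smooth_deriv]) auto
  moreover have "(2 ^ n * chain_jet_const C n * C) * (W * K) \<le> ?c * (W * K)"
    using W(1) Suc.prems(3) by (intro mult_right_mono) auto
  ultimately have "jet_bound {..n} (?c * W * K) K (deriv (\<lambda>x. V (F x))) x"
    using Suc.prems by (auto simp: deriv_compose_smooth mult_ac elim: jet_bound_mono)
  moreover have "1 * \<bar>V (F x)\<bar> \<le> ?c * W" using W(1) by (intro mult_mono chain_jet_const_ge_1) auto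
  ultimately show ?case by (simp add: jet_bound_atMost_iff[of "Suc n"] jet_bound_deriv_iff)
qed

lemma jet_bound_exp:
  assumes "smooth_real F" "0 \<le> K" "jet_bound {1..n} C K F x" "exp (F x) \<le> Z"
  shows "jet_bound {..n} (chain_jet_const C n * Z) K (\<lambda>x. exp (F x)) x"
proof (rule jet_bound_compose[OF _ assms(1-3)])
  have "deriv exp = (exp :: real \<Rightarrow> real)" using DERIV_exp DERIV_imp_deriv by blast
  then have "(deriv ^^ i) exp = (exp :: real \<Rightarrow> real)" for i by (induction i) auto
  then show "jet_bound {..n} Z 1 exp (F x)" using assms(4) by (simp add: jet_bound_def)
qed (rule smooth_exp[OF smooth_ident])

definition exp_jet_const :: "nat \<Rightarrow> real" where
  "exp_jet_const n = exp 1 * (1 + 2 ^ n * chain_jet_const 1 n)"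

lemma exp_jet_const_ge_1: "1 \<le> exp_jet_const n"
proof -
  have "1 * 1 \<le> exp 1 * (1 + 2 ^ n * chain_jet_const 1 n)"
    using chain_jet_const_ge_1[of 1 n] by (intro mult_mono) auto
  then show ?thesis by (simp add: exp_jet_const_def)
qed

lemma jet_bound_exp_minus_1:
  assumes F: "smooth_real F" and jets: "jet_bound {..n} e 1 F x" and "e \<le> 1"
  shows "jet_bound {..n} (exp_jet_const n * e) 1 (\<lambda>x. exp (F x) - 1) x"
proof -
  let ?c = "exp 1 * (1 + 2 ^ n * chain_jet_const 1 n)"
  have Fx: "\<bar>F x\<bar> \<le> e" "jet_bound {1..n} e 1 F x" using jets by (simp_all add: jet_bound_atMost_iff)
  have "0 \<le> e" using Fx by simp
  have "\<bar>exp (F x) - 1\<bar> \<le> exp 1 * \<bar>F x\<bar>" using Fx \<open>e \<le> 1\<close> by (intro abs_exp_minus_1_le) simp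
  also have "\<dots> \<le> exp 1 * (1 + 2 ^ n * chain_jet_const 1 n) * \<bar>F x\<bar>"
    using chain_jet_const_ge_1[of 1 n] by (intro mult_right_mono) auto
  also have "\<dots> \<le> ?c * e" using Fx chain_jet_const_ge_1[of 1 n] by (intro mult_left_mono) auto
  finally have "\<bar>exp (F x) - 1\<bar> \<le> ?c * e" .
  moreover have "jet_bound {1..n} (?c * e) 1 (\<lambda>x. exp (F x) - 1) x"
  proof (cases n)
    case (Suc k)
    have "jet_bound {..k} (chain_jet_const 1 n * exp 1) 1 (\<lambda>x. exp (F x)) x"
      using Fx \<open>e \<le> 1\<close> Suc jet_bound_mono[OF Fx(2) order_refl \<open>e \<le> 1\<close>]
      by (intro jet_bound_mono[OF jet_bound_exp[OF F, where n=n and C=1 and K=1 and Z="exp 1"]]) auto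
    moreover have "jet_bound {..k} e 1 (deriv F) x" using Fx(2) jet_bound_deriv_iff[of k e 1] Suc by simp
    ultimately have "jet_bound {..k} (2 ^ k * e * (chain_jet_const 1 n * exp 1)) 1
        (\<lambda>x. deriv F x * exp (F x)) x"
      using F by (intro jet_bound_mult) auto
    moreover have "2 ^ k * e * (chain_jet_const 1 n * exp 1) \<le> 2 ^ n * (chain_jet_const 1 n * exp 1 * e)"
      using \<open>0 \<le> e\<close> Suc chain_jet_const_ge_1[of 1 n] by simp
    then have "2 ^ k * e * (chain_jet_const 1 n * exp 1) \<le> ?c * e * 1"
      using \<open>0 \<le> e\<close> by (simp add: algebra_simps add_increasing)
    ultimately have "jet_bound {..k} (?c * e * 1) 1 (deriv (\<lambda>x. exp (F x))) x"
      using F by (auto simp: deriv_exp_smooth elim: jet_bound_mono)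
    then show ?thesis
      unfolding jet_bound_deriv_iff using F Suc by (simp add: jet_bound_diff_const smooth_exp)
  qed (simp add: jet_bound_def)
  ultimately show ?thesis by (simp add: jet_bound_atMost_iff exp_jet_const_def)
qed

lemma funpow_deriv_Suc_compose:
  assumes "smooth_real V" "smooth_real F"
  shows "(deriv ^^ Suc n) (\<lambda>x. V (F x)) x =
    (deriv ^^ n) (\<lambda>x. deriv V (F x)) x + (deriv ^^ n) (\<lambda>x. deriv V (F x) * (deriv F x - 1)) x"
proof -
  have "deriv (\<lambda>x. V (F x)) = (\<lambda>x. deriv V (F x) + deriv V (F x) * (deriv F x - 1))"
    using assms by (simp add: deriv_compose_smooth algebra_simps)
  moreover have "smooth_real (\<lambda>x. deriv V (F x))" using smooth_compose[OF smooth_deriv] assms by blast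
  ultimately show ?thesis
    using assms by (simp add: funpow_swap1 funpow_deriv_add smooth_mult smooth_diff smooth_deriv)
qed

lemma deriv_diff_id: "smooth_real F \<Longrightarrow> deriv (\<lambda>x. F x - x) = (\<lambda>x. deriv F x - 1)"
  by (intro ext DERIV_imp_deriv DERIV_diff smooth_has_derivative DERIV_ident)

lemma jet_bound_deriv_compose_times_diff_id:
  assumes V: "smooth_real V" and F: "smooth_real F" and jets_F: "jet_bound {1..n} L 1 F x"
    and jets_V: "jet_bound {1..Suc n} e 1 V (F x)" and near_id: "jet_bound {1..Suc n} W 1 (\<lambda>x. F x - x) x"
  shows "\<bar>(deriv ^^ n) (\<lambda>x. deriv V (F x) * (deriv F x - 1)) x\<bar> \<le> 2 ^ n * chain_jet_const L n * e * W"
proof -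
  have "jet_bound {..n} e 1 (deriv V) (F x)" using jets_V jet_bound_deriv_iff[of n e 1] by simp
  then have "jet_bound {..n} (chain_jet_const L n * e) 1 (\<lambda>x. deriv V (F x)) x"
    using jet_bound_compose[OF smooth_deriv[OF V] F _ jets_F] by simp
  moreover have "jet_bound {..n} W 1 (\<lambda>x. deriv F x - 1) x"
    using near_id F jet_bound_deriv_iff[of n W 1 "\<lambda>x. F x - x"] by (simp add: deriv_diff_id)
  ultimately have "jet_bound {..n} (2 ^ n * (chain_jet_const L n * e) * W) 1
      (\<lambda>x. deriv V (F x) * (deriv F x - 1)) x"
    using V F by (intro jet_bound_mult smooth_compose[OF smooth_deriv]) auto
  from jet_boundD[OF this, of n] show ?thesis by (simp add: mult.assoc)
qed

lemma funpow_deriv_compose_near_id: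
  assumes "smooth_real V" "smooth_real F" "e \<le> 1" "jet_bound {1..n} e 1 (\<lambda>x. F x - x) x"
    "jet_bound {..n} W 1 V (F x)"
  shows "\<bar>(deriv ^^ n) (\<lambda>x. V (F x)) x - (deriv ^^ n) V (F x)\<bar>
      \<le> (\<Sum>i<n. 2 ^ i * chain_jet_const 2 i) * e * W"
  using assms
proof (induction n arbitrary: V)
  case (Suc n)
  have "jet_bound {1..Suc n} (1 + 1) 1 (\<lambda>x. x + (F x - x)) x"
    using Suc.prems by (intro jet_bound_add) (auto simp: jet_bound_def funpow_deriv_ident elim: order_trans)
  then have "jet_bound {1..n} 2 1 F x" by (auto elim: jet_bound_mono)
  moreover have "jet_bound {1..Suc n} W 1 V (F x)" using Suc.prems(5) by (simp add: jet_bound_atMost_iff)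
  ultimately have "\<bar>(deriv ^^ n) (\<lambda>x. deriv V (F x) * (deriv F x - 1)) x\<bar>
      \<le> 2 ^ n * chain_jet_const 2 n * W * e"
    using Suc.prems by (intro jet_bound_deriv_compose_times_diff_id)
  moreover have "\<bar>(deriv ^^ n) (\<lambda>x. deriv V (F x)) x - (deriv ^^ n) (deriv V) (F x)\<bar>
      \<le> (\<Sum>i<n. 2 ^ i * chain_jet_const 2 i) * e * W"
    using Suc.prems jet_bound_deriv_iff[of n W 1 V "F x"]
    by (intro Suc.IH smooth_deriv) (auto simp: jet_bound_atMost_iff elim: jet_bound_mono)
  ultimately show ?case
    unfolding funpow_deriv_Suc_compose[OF Suc.prems(1,2)] funpow_deriv_Suc[of n V]
    by (simp add: algebra_simps del: right_diff_distrib left_diff_distrib)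
qed simp

lemma funpow_deriv_compose_minus_self:
  assumes "smooth_real V" "smooth_real F" "\<And>x. jet_bound {1..n} L 1 F x" "\<And>y. jet_bound {1..Suc n} e 1 V y"
    "\<And>y. jet_bound {..n} W 1 (\<lambda>x. F x - x) y"
  shows "\<bar>(deriv ^^ n) (\<lambda>x. V (F x) - V x) x\<bar> \<le> (1 + (\<Sum>i<n. 2 ^ i * chain_jet_const L i)) * e * W"
  using assms
proof (induction n arbitrary: V)
  case 0
  have "\<bar>deriv V y\<bar> \<le> e" "\<bar>F x - x\<bar> \<le> W" for y
    using 0(4)[of y] 0(5)[of x] by (simp_all add: jet_bound_def)
  then have "\<bar>V (F x) - V x\<bar> \<le> e * \<bar>F x - x\<bar>" "e * \<bar>F x - x\<bar> \<le> e * W"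
    using smooth_diff_le[OF 0(1) convex_UNIV, of e x "F x"]
    by (auto intro!: mult_left_mono order_trans[OF abs_ge_zero])
  then show ?case by simp
next
  case (Suc n)
  have smooth: "smooth_real (\<lambda>x. V (F x))" "smooth_real (\<lambda>x. deriv V (F x))"
    using smooth_compose[OF _ Suc.prems(2)] Suc.prems(1) by auto
  have "(deriv ^^ Suc n) (\<lambda>x. V (F x) - V x) x = (deriv ^^ n) (\<lambda>x. deriv V (F x) - deriv V x) x
      + (deriv ^^ n) (\<lambda>x. deriv V (F x) * (deriv F x - 1)) x"
    using Suc.prems smooth
    by (simp add: funpow_deriv_diff funpow_deriv_Suc_compose smooth_deriv
      funpow_deriv_Suc[of n V] del: funpow.simps)
  moreover have "\<bar>(deriv ^^ n) (\<lambda>x. deriv V (F x) * (deriv F x - 1)) x\<bar>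
      \<le> 2 ^ n * chain_jet_const L n * e * W"
    using Suc.prems(5)[of x]
    by (intro jet_bound_deriv_compose_times_diff_id Suc.prems(1,2) jet_bound_subset[OF Suc.prems(3)]
        jet_bound_subset[OF Suc.prems(4)]) (auto simp: jet_bound_atMost_iff)
  moreover have "\<bar>(deriv ^^ n) (\<lambda>x. deriv V (F x) - deriv V x) x\<bar>
      \<le> (1 + (\<Sum>i<n. 2 ^ i * chain_jet_const L i)) * e * W"
  proof (rule Suc.IH)
    show "jet_bound {1..Suc n} e 1 (deriv V) y" for y
      using Suc.prems(4)[of y] jet_bound_deriv_iff[of "Suc n" e 1 V y] by (simp add: jet_bound_atMost_iff)
  qed (use Suc.prems(1,2)
    in \<open>auto intro!: jet_bound_subset[OF Suc.prems(3)] jet_bound_subset[OF Suc.prems(5)]\<close>)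
  ultimately show ?case by (simp add: algebra_simps)
qed

subsection \<open>Interpolation\<close>

lemma separated_small_deriv_points:
  fixes x :: "nat \<Rightarrow> real"
  assumes \<phi>: "smooth_real \<phi>" and s: "0 < s"
    and nodes: "\<And>i. i < 2 * N \<Longrightarrow> x i \<in> {p..q} \<and> \<bar>\<phi> (x i)\<bar> \<le> e"
    and sep: "\<And>i. Suc i < 2 * N \<Longrightarrow> x i + s \<le> x (Suc i)"
  obtains z where "\<And>i. i < N \<Longrightarrow> z i \<in> {p..q} \<and> \<bar>deriv \<phi> (z i)\<bar> \<le> 2 * e / s"
    "\<And>i. Suc i < N \<Longrightarrow> z i + s \<le> z (Suc i)"
proof -
  have "\<exists>z. x (2*i) < z \<and> z < x (2*i + 1) \<and> \<bar>deriv \<phi> z\<bar> \<le> 2 * e / s" if "i < N" for i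
  proof -
    have gap: "x (2*i) + s \<le> x (2*i + 1)" using sep[of "2*i"] that by simp
    then have less: "x (2*i) < x (2*i + 1)" using s by simp
    obtain z where z: "x (2*i) < z" "z < x (2*i + 1)"
        "\<phi> (x (2*i + 1)) - \<phi> (x (2*i)) = (x (2*i + 1) - x (2*i)) * deriv \<phi> z"
      by (rule smooth_mvt[OF \<phi> less])
    have "s * \<bar>deriv \<phi> z\<bar> \<le> \<bar>(x (2*i + 1) - x (2*i)) * deriv \<phi> z\<bar>"
      using gap s by (simp add: abs_mult mult_right_mono)
    also have "\<dots> = \<bar>\<phi> (x (2*i + 1)) - \<phi> (x (2*i))\<bar>" by (simp only: z(3))
    also have "\<dots> \<le> 2 * e" using nodes[of "2*i"] nodes[of "2*i + 1"] that by (simp add: abs_le_iff)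
    finally have "\<bar>deriv \<phi> z\<bar> \<le> 2 * e / s" using s by (simp add: pos_le_divide_eq mult.commute)
    then show ?thesis using z(1,2) by auto
  qed
  then obtain z where z: "\<And>i. i < N \<Longrightarrow> x (2*i) < z i \<and> z i < x (2*i + 1) \<and> \<bar>deriv \<phi> (z i)\<bar> \<le> 2 * e / s"
    by metis
  show ?thesis
  proof (rule that)
    fix i assume "i < N"
    then show "z i \<in> {p..q} \<and> \<bar>deriv \<phi> (z i)\<bar> \<le> 2 * e / s"
      using z[of i] nodes[of "2*i"] nodes[of "2*i + 1"] by auto
  next
    fix i assume i: "Suc i < N"
    have "x (2*i + 1) + s \<le> x (2 * Suc i)" using sep[of "2*i + 1"] i by simp
    then show "z i + s \<le> z (Suc i)" using z[OF Suc_lessD[OF i]] z[OF i] by linarith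
  qed
qed

primrec interpolation_const :: "real \<Rightarrow> nat \<Rightarrow> real" where
  "interpolation_const \<Lambda> 0 = 1"
| "interpolation_const \<Lambda> (Suc n) = 1 + 2 * interpolation_const \<Lambda> n * (1 + \<bar>\<Lambda>\<bar>)"

lemma interpolation_const_nonneg: "0 \<le> interpolation_const \<Lambda> n"
  by (induction n) auto

lemma interpolation_const_Suc_ge:
  "0 \<le> b \<Longrightarrow> a + 2 * interpolation_const \<Lambda> n * (1 + \<bar>\<Lambda>\<bar>) * (a + b) \<le> interpolation_const \<Lambda> (Suc n) * (a + b)"
  by (simp add: distrib_right)

lemma abs_le_if_abs_deriv_le:
  assumes "smooth_real F" "\<And>z. z \<in> {p..q} \<Longrightarrow> \<bar>deriv F z\<bar> \<le> B" "a \<in> {p..q}" "b \<in> {p..q}"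
    and "\<bar>F a\<bar> \<le> e" "q - p \<le> L"
  shows "\<bar>F b\<bar> \<le> e + B * L"
proof -
  have "\<bar>F b - F a\<bar> \<le> B * \<bar>b - a\<bar>" using assms(1-4) by (intro smooth_diff_le[of F "{p..q}"]) auto
  also have "\<dots> \<le> B * L" using assms(2)[OF assms(3)] assms(3,4,6) by (intro mult_left_mono) auto
  finally show ?thesis using assms(5) by linarith
qed

text \<open>From $2^n$ separated points at which $\varphi$ is small one passes to $2^{n-1}$ separated points at which
  the derivative is small; after $n$ steps only the bound on the $n$-th derivative is left.\<close>

lemma funpow_deriv_interpolation:
  fixes x :: "nat \<Rightarrow> real"
  assumes "smooth_real \<phi>" "0 < s" "q - p \<le> \<Lambda> * s"
    and "\<And>i. i < 2 ^ n \<Longrightarrow> x i \<in> {p..q} \<and> \<bar>\<phi> (x i)\<bar> \<le> e"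
    and "\<And>i. Suc i < 2 ^ n \<Longrightarrow> x i + s \<le> x (Suc i)"
    and "\<And>y. y \<in> {p..q} \<Longrightarrow> \<bar>(deriv ^^ n) \<phi> y\<bar> \<le> H"
    and "j \<le> n" "y \<in> {p..q}"
  shows "\<bar>(deriv ^^ j) \<phi> y\<bar> \<le> interpolation_const \<Lambda> n * (e / s ^ j + H * s ^ (n - j))"
  using assms
proof (induction n arbitrary: \<phi> e x j y)
  case 0
  have "\<bar>\<phi> (x 0)\<bar> \<le> e" "\<bar>\<phi> y\<bar> \<le> H" using 0(4)[of 0] 0(6)[OF 0(8)] by simp_all
  then show ?case using 0(7) by simp
next
  case (Suc n)
  let ?C = "interpolation_const \<Lambda> n"
  note s = Suc.prems(2)
  have start: "x 0 \<in> {p..q}" "\<bar>\<phi> (x 0)\<bar> \<le> e" using Suc.prems(4)[of 0] by simp_all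
  have nonneg: "0 \<le> e" "0 \<le> H" "0 \<le> ?C"
    using start(2) Suc.prems(6)[OF Suc.prems(8)] interpolation_const_nonneg[of \<Lambda> n] by linarith+
  obtain z where z: "\<And>i. i < 2 ^ n \<Longrightarrow> z i \<in> {p..q} \<and> \<bar>deriv \<phi> (z i)\<bar> \<le> 2 * e / s"
      "\<And>i. Suc i < 2 ^ n \<Longrightarrow> z i + s \<le> z (Suc i)"
    using separated_small_deriv_points[OF Suc.prems(1,2), of "2 ^ n" x p q e] Suc.prems(4,5) by auto
  have IH: "\<bar>(deriv ^^ i) (deriv \<phi>) y\<bar> \<le> ?C * ((2 * e / s) / s ^ i + H * s ^ (n - i))"
    if "i \<le> n" "y \<in> {p..q}" for i y
    using Suc.prems(1-3,6) z that by (intro Suc.IH[where x=z]) (auto simp: funpow_swap1)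
  have "\<bar>(deriv ^^ j) \<phi> y\<bar> \<le> e / s ^ j + 2 * ?C * (1 + \<bar>\<Lambda>\<bar>) * (e / s ^ j + H * s ^ (Suc n - j))"
  proof (cases j)
    case (Suc i)
    have "\<bar>(deriv ^^ j) \<phi> y\<bar> \<le> ?C * ((2 * e / s) / s ^ i + H * s ^ (n - i))"
      using IH[of i y] Suc.prems(7,8) Suc by (simp add: funpow_swap1)
    also have "\<dots> \<le> ?C * (2 * (e / s ^ j + H * s ^ (Suc n - j)))"
      using nonneg s Suc by (intro mult_left_mono) (auto simp: field_simps)
    also have "\<dots> \<le> ?C * (2 * (1 + \<bar>\<Lambda>\<bar>) * (e / s ^ j + H * s ^ (Suc n - j)))"
      using nonneg s by (intro mult_left_mono mult_right_mono) auto
    finally have "\<bar>(deriv ^^ j) \<phi> y\<bar> \<le> 2 * ?C * (1 + \<bar>\<Lambda>\<bar>) * (e / s ^ j + H * s ^ (Suc n - j))"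
      by (simp only: mult_ac)
    moreover have "0 \<le> e / s ^ j" using nonneg s by simp
    ultimately show ?thesis by linarith
  next
    case 0
    have "\<bar>\<phi> y\<bar> \<le> e + ?C * (2 * e / s + H * s ^ n) * (\<Lambda> * s)"
      using IH[of 0] Suc.prems(3,8) start
      by (intro abs_le_if_abs_deriv_le[OF Suc.prems(1), where p = p and q = q and a = "x 0"]) auto
    also have "?C * (2 * e / s + H * s ^ n) * (\<Lambda> * s) = \<Lambda> * ?C * (2 * e + H * s ^ Suc n)"
      using s by (simp add: field_simps)
    also have "e + \<dots> \<le> e + (1 + \<bar>\<Lambda>\<bar>) * ?C * (2 * (e + H * s ^ Suc n))"
      using s nonneg by (intro add_left_mono mult_mono) auto
    also have "\<dots> = e + 2 * ?C * (1 + \<bar>\<Lambda>\<bar>) * (e + H * s ^ Suc n)" by (simp only: mult_ac)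
    finally show ?thesis using 0 by simp
  qed
  also have "\<dots> \<le> interpolation_const \<Lambda> (Suc n) * (e / s ^ j + H * s ^ (Suc n - j))"
    using nonneg s by (intro interpolation_const_Suc_ge) simp
  finally show ?case .
qed

section \<open>Distance to the nearest integer\<close>

lemma dist_int_nonneg [simp]: "0 \<le> dist_int x"
  by (simp add: dist_int_def)

lemma dist_int_le: "dist_int x \<le> \<bar>x - of_int p\<bar>"
  unfolding dist_int_def by (rule round_diff_minimal)

lemma dist_int_le_half: "dist_int x \<le> 1 / 2"
  unfolding dist_int_def using of_int_round_abs_le[of x] by (simp add: abs_minus_commute)

lemma dist_int_attained:
  obtains p where "dist_int x = \<bar>x + of_int p\<bar>"
  using that[of "- round x"] by (simp add: dist_int_def)

lemma dist_int_minus [simp]: "dist_int (- x) = dist_int x"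
proof -
  have "dist_int (- y) \<le> dist_int y" for y
  proof -
    obtain p where "dist_int y = \<bar>y + of_int p\<bar>" by (rule dist_int_attained)
    then show ?thesis using dist_int_le[of "- y" p] by (simp add: abs_minus_commute add.commute)
  qed
  from this[of x] this[of "- x"] show ?thesis by simp
qed

lemma dist_int_add_of_int [simp]: "dist_int (x + of_int p) = dist_int x"
proof -
  have "dist_int (y + of_int n) \<le> dist_int y" for y n
  proof -
    obtain k where "dist_int y = \<bar>y + of_int k\<bar>" by (rule dist_int_attained)
    then show ?thesis using dist_int_le[of "y + of_int n" "n - k"] by simp
  qed
  from this[of x p] this[of "x + of_int p" "- p"] show ?thesis by simp
qed

lemma dist_int_mult_le: "dist_int (real n * x) \<le> real n * dist_int x"
proof -
  obtain k where k: "dist_int x = \<bar>x + of_int k\<bar>" by (rule dist_int_attained)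
  have "dist_int (real n * x) \<le> \<bar>real n * x - of_int (- int n * k)\<bar>" by (rule dist_int_le)
  also have "\<dots> = \<bar>real n * (x + of_int k)\<bar>" by (simp add: algebra_simps)
  finally show ?thesis by (simp add: k abs_mult)
qed

lemma dist_int_multiple_diff_le:
  "dist_int (real (nat \<bar>int i - int j\<bar>) * c) \<le> \<bar>real i * c + of_int p - real j * c\<bar>"
proof (cases "j \<le> i")
  case True
  have "dist_int ((real i - real j) * c) \<le> \<bar>(real i - real j) * c - of_int (- p)\<bar>" by (rule dist_int_le)
  then show ?thesis using True by (simp add: algebra_simps of_nat_diff)
next
  case False
  have "dist_int ((real j - real i) * c) \<le> \<bar>(real j - real i) * c - of_int p\<bar>" by (rule dist_int_le)
  then show ?thesis using False by (simp add: algebra_simps of_nat_diff)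
qed

definition separated_multiples :: "real \<Rightarrow> real \<Rightarrow> nat \<Rightarrow> bool" where
  "separated_multiples \<delta> c l \<longleftrightarrow> (\<forall>j. 1 \<le> j \<longrightarrow> j < l \<longrightarrow> \<delta> \<le> dist_int (real j * c))"

lemma separated_multiples_mono: "separated_multiples \<delta> c l \<Longrightarrow> n \<le> l \<Longrightarrow> separated_multiples \<delta> c n"
  by (simp add: separated_multiples_def)

lemma separated_multiples_dist:
  assumes "separated_multiples \<delta> c l" "\<delta> \<le> 1" "i < l" "j < l" "i \<noteq> j \<or> p \<noteq> 0"
  shows "\<delta> \<le> \<bar>real i * c + of_int p - real j * c\<bar>"
proof (cases "i = j")
  case False
  then have "1 \<le> nat \<bar>int i - int j\<bar>" "nat \<bar>int i - int j\<bar> < l" using assms(3,4) by auto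
  then have "\<delta> \<le> dist_int (real (nat \<bar>int i - int j\<bar>) * c)"
    using assms(1) unfolding separated_multiples_def by blast
  then show ?thesis using dist_int_multiple_diff_le order_trans by blast
qed (use assms in simp)

section \<open>Disjoint intervals\<close>

lemma sum_disjoint_intervals_le:
  assumes "finite I" "\<And>i. i \<in> I \<Longrightarrow> u i < v i" "\<And>i. i \<in> I \<Longrightarrow> a \<le> u i" "\<And>i. i \<in> I \<Longrightarrow> v i \<le> b" "a \<le> (b::real)"
    and "\<And>i j. i \<in> I \<Longrightarrow> j \<in> I \<Longrightarrow> i \<noteq> j \<Longrightarrow> v i \<le> u j \<or> v j \<le> u i"
  shows "(\<Sum>i\<in>I. v i - u i) \<le> b - a"
  using assms
proof (induction "card I" arbitrary: I b)
  case 0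
  then show ?case by simp
next
  case (Suc n)
  have "Max (v ` I) \<in> v ` I" using Suc.hyps(2) Suc.prems(1) by (intro Max_in) auto
  then obtain k where k: "k \<in> I" "Max (v ` I) = v k" by auto
  have last: "v i \<le> v k" if "i \<in> I" for i using that Suc.prems(1) by (simp flip: k(2))
  have "(\<Sum>i\<in>I - {k}. v i - u i) \<le> u k - a"
  proof (rule Suc.hyps(1))
    fix i assume i: "i \<in> I - {k}"
    have "v k \<le> u i \<or> v i \<le> u k" using Suc.prems(6) k(1) i by blast
    then show "v i \<le> u k" using Suc.prems(2)[of i] last[of i] i by fastforce
  qed (use Suc k in auto)
  moreover have "(\<Sum>i\<in>I. v i - u i) = (v k - u k) + (\<Sum>i\<in>I - {k}. v i - u i)"
    using Suc.prems(1) k(1) by (simp add: sum.remove)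
  ultimately show ?case using Suc.prems(4)[OF k(1)] by linarith
qed

lemma sum_disjoint_mod1_intervals_le_1:
  fixes u v :: "'a \<Rightarrow> real"
  assumes fin: "finite I" and less: "\<And>i. i \<in> I \<Longrightarrow> u i < v i"
    and disjoint: "\<And>i j p. i \<in> I \<Longrightarrow> j \<in> I \<Longrightarrow> i \<noteq> j \<or> p \<noteq> 0 \<Longrightarrow> v i + of_int p \<le> u j \<or> v j \<le> u i + of_int p"
  shows "(\<Sum>i\<in>I. v i - u i) \<le> 1"
proof (cases "I = {}")
  case False
  then obtain k where k: "k \<in> I" by auto
  define p where "p i = \<lfloor>u i - u k\<rfloor>" for i
  have p: "u k \<le> u i - of_int (p i)" "u i - of_int (p i) < u k + 1" for i
    unfolding p_def by linarith+
  have "(\<Sum>i\<in>I. (v i - of_int (p i)) - (u i - of_int (p i))) \<le> (u k + 1) - u k"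
  proof (rule sum_disjoint_intervals_le)
    fix i assume i: "i \<in> I"
    have "k \<noteq> i \<or> 1 + p i \<noteq> 0" using p[of i] by auto
    then have "v k + of_int (1 + p i) \<le> u i \<or> v i \<le> u k + of_int (1 + p i)" by (rule disjoint[OF k i])
    then show "v i - of_int (p i) \<le> u k + 1" using p[of i] less[OF k] by auto
  next
    fix i j assume "i \<in> I" "j \<in> I" "i \<noteq> j"
    then show "v i - of_int (p i) \<le> u j - of_int (p j) \<or> v j - of_int (p j) \<le> u i - of_int (p i)"
      using disjoint[of i j "p j - p i"] by auto
  qed (use fin less p in auto)
  then show ?thesis by simp
qed simp

section \<open>Flows conjugate to translations\<close>

locale circle_flow =
  fixes h \<xi> :: "real \<Rightarrow> real"
  assumes h_mono: "strict_mono h" and h_\<xi> [simp]: "h (\<xi> y) = y" and \<xi>_h [simp]: "\<xi> (h x) = x"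
    and h_add_1: "h (x + 1) = h x + 1"
begin

definition \<Phi> :: "real \<Rightarrow> real \<Rightarrow> real" where "\<Phi> r x = \<xi> (h x + r)"

definition disp :: "real \<Rightarrow> real \<Rightarrow> real" where "disp r x = \<Phi> r x - x"

definition smooth_time :: "real \<Rightarrow> bool" where
  "smooth_time r \<longleftrightarrow> smooth_real (\<Phi> r) \<and> (\<forall>x. deriv (\<Phi> r) x > 0)"

definition log_deriv :: "real \<Rightarrow> real \<Rightarrow> real" where "log_deriv r x = ln (deriv (\<Phi> r) x)"

lemma \<xi>_less_iff [simp]: "\<xi> y < \<xi> z \<longleftrightarrow> y < z"
  using strict_mono_less[OF h_mono, of "\<xi> y" "\<xi> z"] by simp

lemma \<xi>_le_iff [simp]: "\<xi> y \<le> \<xi> z \<longleftrightarrow> y \<le> z"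
  using strict_mono_less_eq[OF h_mono, of "\<xi> y" "\<xi> z"] by simp

lemma h_less_iff [simp]: "h x < h y \<longleftrightarrow> x < y" and h_le_iff [simp]: "h x \<le> h y \<longleftrightarrow> x \<le> y"
  using strict_mono_less[OF h_mono] strict_mono_less_eq[OF h_mono] by auto

lemma \<xi>_add_1: "\<xi> (y + 1) = \<xi> y + 1"
  using \<xi>_h[of "\<xi> y + 1"] by (simp add: h_add_1)

lemma h_add_of_int: "h (x + of_int p) = h x + of_int p"
  and \<xi>_add_of_int: "\<xi> (y + of_int p) = \<xi> y + of_int p"
  using shift_of_int[of h 1, OF h_add_1] shift_of_int[of \<xi> 1, OF \<xi>_add_1] by simp_all

lemma continuous_\<xi>: "continuous_on UNIV \<xi>"
proof (rule continuous_onI_mono)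
  have "range \<xi> = UNIV" using \<xi>_h by (metis surjI)
  then show "open (range \<xi>)" by simp
qed simp

lemma continuous_h: "continuous_on UNIV h"
proof (rule continuous_onI_mono)
  have "range h = UNIV" using h_\<xi> by (metis surjI)
  then show "open (range h)" by simp
qed simp

lemma h_\<Phi> [simp]: "h (\<Phi> r x) = h x + r"
  by (simp add: \<Phi>_def)

lemma \<Phi>_add: "\<Phi> (r + s) x = \<Phi> r (\<Phi> s x)"
  by (simp add: \<Phi>_def algebra_simps)

lemma \<Phi>_0 [simp]: "\<Phi> 0 x = x" and \<Phi>_add_of_int: "\<Phi> (r + of_int p) x = \<Phi> r x + of_int p"
  by (simp_all add: \<Phi>_def \<xi>_add_of_int flip: add.assoc)

lemma \<Phi>_of_int: "\<Phi> (of_int p) = (\<lambda>x. x + of_int p)"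
  using \<Phi>_add_of_int[of 0 p] by auto

lemma \<Phi>_add_1: "\<Phi> r (x + 1) = \<Phi> r x + 1"
proof -
  have "h x + 1 + r = h x + r + 1" by simp
  then show ?thesis by (simp only: \<Phi>_def h_add_1 \<xi>_add_1)
qed

lemma \<Phi>_less_iff [simp]: "\<Phi> r x < \<Phi> r y \<longleftrightarrow> x < y" and \<Phi>_le_iff [simp]: "\<Phi> r x \<le> \<Phi> r y \<longleftrightarrow> x \<le> y"
  by (simp_all add: \<Phi>_def)

lemma \<Phi>_less_time_iff [simp]: "\<Phi> r x < \<Phi> s x \<longleftrightarrow> r < s"
  and \<Phi>_le_time_iff [simp]: "\<Phi> r x \<le> \<Phi> s x \<longleftrightarrow> r \<le> s"
  by (simp_all add: \<Phi>_def)

lemma \<Phi>_gt_iff [simp]: "x < \<Phi> s x \<longleftrightarrow> 0 < s" and \<Phi>_ge_iff [simp]: "x \<le> \<Phi> s x \<longleftrightarrow> 0 \<le> s"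
  using \<Phi>_less_time_iff[of 0 x s] \<Phi>_le_time_iff[of 0 x s] by simp_all

lemma between_\<Phi>_times:
  assumes "\<Phi> r x \<le> y" "y \<le> \<Phi> s x"
  obtains t where "r \<le> t" "t \<le> s" "y = \<Phi> t x"
proof (rule that)
  have "h (\<Phi> r x) \<le> h y" "h y \<le> h (\<Phi> s x)" using assms by (simp_all del: h_\<Phi>)
  then show "r \<le> h y - h x" "h y - h x \<le> s" by simp_all
qed (simp add: \<Phi>_def)

lemma \<Phi>_commute: "\<Phi> r (\<Phi> s x) = \<Phi> s (\<Phi> r x)"
  by (metis \<Phi>_add add.commute)

lemma \<Phi>_mult_Suc: "\<Phi> (real (Suc n) * r) x = \<Phi> r (\<Phi> (real n * r) x)"
  by (simp add: algebra_simps flip: \<Phi>_add)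

lemma funpow_\<Phi>: "(\<Phi> c ^^ n) x = \<Phi> (real n * c) x"
proof (induction n)
  case (Suc n)
  then show ?case by (simp only: \<Phi>_mult_Suc) simp
qed simp

lemma continuous_\<Phi>: "continuous_on UNIV (\<Phi> r)" and continuous_\<Phi>_time: "continuous_on UNIV (\<lambda>r. \<Phi> r x)"
  unfolding \<Phi>_def
  by (intro continuous_on_compose2[OF continuous_\<xi>] continuous_intros continuous_h; simp)+

subsection \<open>Displacements\<close>

lemma disp_pos: "0 < r \<Longrightarrow> 0 < disp r x"
  by (simp add: disp_def)

lemma disp_nonneg: "0 \<le> r \<Longrightarrow> 0 \<le> disp r x"
  by (simp add: disp_def)

lemma disp_add: "disp (r + s) x = disp r (\<Phi> s x) + disp s x"
  by (simp add: disp_def \<Phi>_add)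

lemma disp_mono: "r \<le> s \<Longrightarrow> disp r x \<le> disp s x"
  by (simp add: disp_def)

lemma disp_1 [simp]: "disp 1 x = 1"
  using \<Phi>_of_int[of 1] by (simp add: disp_def)

lemma disp_add_1: "disp r (x + 1) = disp r x"
  by (simp add: disp_def \<Phi>_add_1)

lemma continuous_disp: "continuous_on UNIV (disp r)"
  unfolding disp_def by (intro continuous_intros continuous_\<Phi>)

lemma disp_mult: "disp (real n * r) x = (\<Sum>i<n. disp r (\<Phi> (real i * r) x))"
proof (induction n)
  case (Suc n)
  have "disp (real (Suc n) * r) x = disp (r + real n * r) x" by (simp add: algebra_simps)
  then show ?case using Suc by (simp add: disp_add)
qed (simp add: disp_def)

subsection \<open>Smooth times\<close>

lemma smooth_\<Phi>: "smooth_time r \<Longrightarrow> smooth_real (\<Phi> r)"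
  and deriv_\<Phi>_pos: "smooth_time r \<Longrightarrow> deriv (\<Phi> r) x > 0"
  by (auto simp: smooth_time_def)

lemma exp_log_deriv: "smooth_time r \<Longrightarrow> exp (log_deriv r x) = deriv (\<Phi> r) x"
  by (simp add: log_deriv_def deriv_\<Phi>_pos)

lemma deriv_\<Phi>: "smooth_time r \<Longrightarrow> deriv (\<Phi> r) = (\<lambda>x. exp (log_deriv r x))"
  by (simp add: exp_log_deriv)

lemma smooth_log_deriv: "smooth_time r \<Longrightarrow> smooth_real (log_deriv r)"
  unfolding log_deriv_def by (intro smooth_ln smooth_deriv) (auto simp: smooth_\<Phi> deriv_\<Phi>_pos)

lemma log_deriv_add_1: "log_deriv r (x + 1) = log_deriv r x"
  unfolding log_deriv_def using deriv_periodic[of "\<Phi> r" 1, OF \<Phi>_add_1] by simp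

lemma
  assumes "smooth_time r" "smooth_time s"
  shows smooth_time_add: "smooth_time (r + s)"
    and log_deriv_add: "log_deriv (r + s) x = log_deriv r (\<Phi> s x) + log_deriv s x"
proof -
  have comp: "\<Phi> (r + s) = (\<lambda>x. \<Phi> r (\<Phi> s x))" by (auto simp: \<Phi>_add)
  have chain: "deriv (\<Phi> (r + s)) = (\<lambda>x. deriv (\<Phi> r) (\<Phi> s x) * deriv (\<Phi> s) x)"
    unfolding comp by (rule deriv_compose_smooth) (simp_all add: smooth_\<Phi> assms)
  show "smooth_time (r + s)" unfolding smooth_time_def chain
    unfolding comp using smooth_compose[of "\<Phi> r" "\<Phi> s"] smooth_\<Phi> deriv_\<Phi>_pos assms by simp
  show "log_deriv (r + s) x = log_deriv r (\<Phi> s x) + log_deriv s x"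
    unfolding log_deriv_def chain
    using deriv_\<Phi>_pos[OF assms(1), of "\<Phi> s x"] deriv_\<Phi>_pos[OF assms(2), of x] by (simp add: ln_mult)
qed

lemma smooth_time_of_int: "smooth_time (of_int p)" and log_deriv_of_int: "log_deriv (of_int p) = (\<lambda>x. 0)"
proof -
  have "deriv (\<lambda>x. x + real_of_int p) x = 1" for x
    by (rule DERIV_imp_deriv) (auto intro!: derivative_eq_intros)
  then show "smooth_time (of_int p)" "log_deriv (of_int p) = (\<lambda>x. 0)"
    by (auto simp: smooth_time_def log_deriv_def[abs_def] \<Phi>_of_int)
qed

lemma smooth_time_0 [simp]: "smooth_time 0" and log_deriv_0 [simp]: "log_deriv 0 = (\<lambda>x. 0)"
  using smooth_time_of_int[of 0] log_deriv_of_int[of 0] by simp_all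

lemma
  assumes "smooth_time r"
  shows smooth_time_add_of_int: "smooth_time (r + of_int p)"
    and log_deriv_add_of_int: "log_deriv (r + of_int p) = log_deriv r"
  using smooth_time_add[OF smooth_time_of_int assms, of p] log_deriv_add[OF smooth_time_of_int assms, of p]
  by (auto simp: log_deriv_of_int add.commute)

lemma smooth_time_mult: "smooth_time c \<Longrightarrow> smooth_time (real n * c)"
proof (induction n)
  case (Suc n)
  then show ?case using smooth_time_add[of c "real n * c"] by (simp add: algebra_simps)
qed simp

lemma log_deriv_mult_Suc:
  "smooth_time c \<Longrightarrow>
      log_deriv (real (Suc n) * c) x = log_deriv c (\<Phi> (real n * c) x) + log_deriv (real n * c) x"
  using log_deriv_add[of c "real n * c" x] smooth_time_mult[of c n] by (simp add: algebra_simps)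

lemma log_deriv_mult:
  "smooth_time c \<Longrightarrow> log_deriv (real n * c) x = (\<Sum>j<n. log_deriv c (\<Phi> (real j * c) x))"
proof (induction n)
  case (Suc n)
  then show ?case using log_deriv_mult_Suc[of c n x] by simp
qed simp

lemma
  assumes "smooth_time r"
  shows smooth_time_minus: "smooth_time (- r)"
    and log_deriv_minus: "log_deriv (- r) x = - log_deriv r (\<Phi> (- r) x)"
proof -
  have inv: "\<Phi> r (\<Phi> (- r) y) = y" "\<Phi> (- r) (\<Phi> r y) = y" for y
    by (simp_all flip: \<Phi>_add)
  note inverse = smooth_inverse_function[OF smooth_\<Phi>[OF assms] deriv_\<Phi>_pos[OF assms] inv]
  have "deriv (\<Phi> (- r)) y > 0" for y
    using DERIV_imp_deriv[OF inverse(2)[of y]] deriv_\<Phi>_pos[OF assms] by simp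
  then show "smooth_time (- r)" using inverse(1) by (simp add: smooth_time_def)
  then show "log_deriv (- r) x = - log_deriv r (\<Phi> (- r) x)"
    using log_deriv_add[OF assms, of "- r" x] by simp
qed

lemma smooth_disp: "smooth_time r \<Longrightarrow> smooth_real (disp r)"
  unfolding disp_def by (intro smooth_diff) (auto simp: smooth_\<Phi>)

lemma deriv_disp: "smooth_time r \<Longrightarrow> deriv (disp r) = (\<lambda>x. exp (log_deriv r x) - 1)"
  unfolding disp_def[abs_def] by (simp add: deriv_diff_id smooth_\<Phi> deriv_\<Phi>)

lemma disp_\<Phi>_mvt:
  assumes "smooth_time r" "0 < \<beta>"
  obtains z where "x < z" "z < \<Phi> \<beta> x" "disp \<beta> (\<Phi> r x) = exp (log_deriv r z) * disp \<beta> x"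
proof -
  have "x < \<Phi> \<beta> x" using assms by simp
  then obtain z where "x < z" "z < \<Phi> \<beta> x" "\<Phi> r (\<Phi> \<beta> x) - \<Phi> r x = (\<Phi> \<beta> x - x) * deriv (\<Phi> r) z"
    using smooth_mvt[OF smooth_\<Phi>[OF assms(1)]] by blast
  then show ?thesis
    using that[of z] by (simp add: disp_def exp_log_deriv[OF assms(1)] \<Phi>_commute[of \<beta> r] mult.commute)
qed

lemma ln_disp_\<Phi>_mvt:
  assumes "smooth_time r" "0 < \<beta>"
  obtains z where "x < z" "z < \<Phi> \<beta> x" "ln (disp \<beta> (\<Phi> r x)) = log_deriv r z + ln (disp \<beta> x)"
proof -
  obtain z where "x < z" "z < \<Phi> \<beta> x" "disp \<beta> (\<Phi> r x) = exp (log_deriv r z) * disp \<beta> x"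
    using disp_\<Phi>_mvt[OF assms] .
  then show ?thesis using that disp_pos[OF \<open>0 < \<beta>\<close>] by (simp add: ln_mult_pos)
qed

lemma signed_ln_disp_mono:
  assumes r: "smooth_time r" "0 < r" and \<sigma>: "\<sigma> = 1 \<or> \<sigma> = -1" and "a \<le> b"
    and sign: "\<And>z. a \<le> z \<Longrightarrow> z \<le> b \<Longrightarrow> 0 \<le> \<sigma> * log_deriv r z"
  shows "\<sigma> * ln (disp r a) \<le> \<sigma> * ln (disp r b)"
proof (rule DERIV_nonneg_imp_nondecreasing[OF \<open>a \<le> b\<close>])
  fix z assume "a \<le> z" "z \<le> b"
  then have "0 \<le> \<sigma> * (exp (log_deriv r z) - 1)" using sign[of z] \<sigma> by auto
  moreover have "(disp r has_real_derivative exp (log_deriv r z) - 1) (at z)"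
    using smooth_has_derivative[OF smooth_disp[OF r(1)], of z] by (simp add: deriv_disp[OF r(1)])
  then have "((\<lambda>z. \<sigma> * ln (disp r z)) has_real_derivative \<sigma> * (exp (log_deriv r z) - 1) / disp r z) (at z)"
    using disp_pos[OF r(2), of z] by (auto intro!: derivative_eq_intros)
  ultimately show "\<exists>y. ((\<lambda>z. \<sigma> * ln (disp r z)) has_real_derivative y) (at z) \<and> 0 \<le> y"
    using divide_nonneg_pos[OF _ disp_pos[OF r(2), of z]] by blast
qed

lemma disp_\<Phi>_bounds:
  assumes "smooth_time r" "0 < \<beta>"
    and "\<And>z. x \<le> z \<Longrightarrow> z \<le> \<Phi> \<beta> x \<Longrightarrow> lo \<le> log_deriv r z \<and> log_deriv r z \<le> up"
  shows "exp lo * disp \<beta> x \<le> disp \<beta> (\<Phi> r x)" "disp \<beta> (\<Phi> r x) \<le> exp up * disp \<beta> x"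
proof -
  obtain z where z: "x < z" "z < \<Phi> \<beta> x" "disp \<beta> (\<Phi> r x) = exp (log_deriv r z) * disp \<beta> x"
    using disp_\<Phi>_mvt[OF assms(1,2)] .
  then have "exp lo \<le> exp (log_deriv r z)" "exp (log_deriv r z) \<le> exp up" using assms(3)[of z] by auto
  then show "exp lo * disp \<beta> x \<le> disp \<beta> (\<Phi> r x)" "disp \<beta> (\<Phi> r x) \<le> exp up * disp \<beta> x"
    using disp_pos[OF assms(2), of x] z(3) by (simp_all add: mult_right_mono)
qed

lemma jet_bound_\<Phi>:
  assumes "smooth_time w" "jet_bound {..n} L 1 (log_deriv w) x"
  shows "jet_bound {1..Suc n} (chain_jet_const L n * exp L) 1 (\<Phi> w) x"
proof -
  have "jet_bound {..n} (chain_jet_const L n * exp L) 1 (\<lambda>x. exp (log_deriv w x)) x"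
    using assms(2) by (intro jet_bound_exp smooth_log_deriv assms(1)) (auto simp: jet_bound_atMost_iff)
  then show ?thesis
    using jet_bound_deriv_iff[of n "chain_jet_const L n * exp L" 1 "\<Phi> w" x] by (simp add: deriv_\<Phi> assms(1))
qed

lemma jet_bound_compose_\<Phi>:
  assumes "smooth_time w" "jet_bound {..n} L 1 (log_deriv w) x" "m \<le> Suc n"
    and "smooth_real F" "jet_bound {..m} W 1 F (\<Phi> w x)"
  shows "jet_bound {..m} (chain_jet_const (chain_jet_const L n * exp L) m * W) 1 (\<lambda>x. F (\<Phi> w x)) x"
  using jet_bound_\<Phi>[OF assms(1,2)] assms(3)
  by (intro jet_bound_compose smooth_\<Phi> assms) (auto elim: jet_bound_subset)

subsection \<open>Suprema over the circle\<close>

definition max_disp :: "real \<Rightarrow> real" where "max_disp r = (SUP x. disp r x)"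

definition max_log_deriv :: "real \<Rightarrow> real" where "max_log_deriv r = (SUP x. \<bar>log_deriv r x\<bar>)"

lemma max_disp_attained:
  obtains x where "max_disp r = disp r x"
proof -
  obtain x where "\<And>y. disp r y \<le> disp r x"
    using periodic_attains_max[OF continuous_disp[of r] disp_add_1] by blast
  then have "max_disp r = disp r x" unfolding max_disp_def by (intro cSup_eq_maximum) auto
  then show ?thesis by (rule that)
qed

lemma disp_le_max_disp: "disp r x \<le> max_disp r"
proof -
  obtain B where "\<And>y. \<bar>disp r y\<bar> \<le> B" using periodic_bounded[OF continuous_disp[of r] disp_add_1] by blast
  then have "bdd_above (range (disp r))" by (intro bdd_aboveI[of _ B]) (auto simp: abs_le_iff)
  then show ?thesis unfolding max_disp_def by (rule cSUP_upper[OF UNIV_I])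
qed

lemma max_disp_nonneg: "0 \<le> r \<Longrightarrow> 0 \<le> max_disp r"
  using disp_le_max_disp[of r 0] disp_nonneg[of r 0] by simp

lemma max_disp_pos: "0 < r \<Longrightarrow> 0 < max_disp r"
  using disp_le_max_disp[of r 0] disp_pos[of r 0] by simp

lemma max_disp_mono: "r \<le> s \<Longrightarrow> max_disp r \<le> max_disp s"
  unfolding max_disp_def[of r]
  by (intro cSUP_least) (auto intro: order_trans[OF disp_mono disp_le_max_disp])

lemma abs_log_deriv_le_max: "smooth_time r \<Longrightarrow> \<bar>log_deriv r x\<bar> \<le> max_log_deriv r"
proof -
  assume "smooth_time r"
  then obtain B where "\<And>y. \<bar>log_deriv r y\<bar> \<le> B"
    using periodic_bounded[OF smooth_continuous_on[OF smooth_log_deriv] log_deriv_add_1] by blast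
  then have "bdd_above (range (\<lambda>y. \<bar>log_deriv r y\<bar>))" by (intro bdd_aboveI[of _ B]) auto
  then show ?thesis unfolding max_log_deriv_def by (rule cSUP_upper[OF UNIV_I])
qed

lemma max_log_deriv_nonneg: "smooth_time r \<Longrightarrow> 0 \<le> max_log_deriv r"
  using abs_log_deriv_le_max[of r 0] by simp

lemma max_log_deriv_le: "(\<And>x. \<bar>log_deriv r x\<bar> \<le> b) \<Longrightarrow> max_log_deriv r \<le> b"
  unfolding max_log_deriv_def by (rule cSUP_least) auto

lemma max_disp_small:
  assumes "0 < e"
  obtains \<beta> where "0 < \<beta>" "max_disp \<beta> \<le> e"
proof -
  have "uniformly_continuous_on {0..2} \<xi>"
    using compact_uniformly_continuous[of "{0..2}" \<xi>] continuous_on_subset[OF continuous_\<xi>] by auto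
  then obtain d where d: "d > 0" "\<And>y z. y \<in> {0..2} \<Longrightarrow> z \<in> {0..2} \<Longrightarrow> dist z y < d \<Longrightarrow> dist (\<xi> z) (\<xi> y) < e"
    using assms unfolding uniformly_continuous_on_def by metis
  define \<beta> where "\<beta> = min 1 (d / 2)"
  have \<beta>: "0 < \<beta>" "\<beta> \<le> 1" "\<beta> < d" using d(1) by (auto simp: \<beta>_def)
  obtain x where x: "max_disp \<beta> = disp \<beta> x" by (rule max_disp_attained)
  define y where "y = frac (h x)"
  have "h x = y + of_int \<lfloor>h x\<rfloor>" "h x + \<beta> = (y + \<beta>) + of_int \<lfloor>h x\<rfloor>" by (simp_all add: y_def frac_def)
  then have "\<xi> (h x) = \<xi> y + of_int \<lfloor>h x\<rfloor>" "\<xi> (h x + \<beta>) = \<xi> (y + \<beta>) + of_int \<lfloor>h x\<rfloor>"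
    using \<xi>_add_of_int by metis+
  then have "disp \<beta> x = \<xi> (y + \<beta>) - \<xi> y" by (simp add: disp_def \<Phi>_def)
  moreover have "y \<in> {0..2}" "y + \<beta> \<in> {0..2}" using frac_lt_1[of "h x"] \<beta> by (auto simp: y_def)
  then have "dist (\<xi> (y + \<beta>)) (\<xi> y) < e" using \<beta> by (intro d(2)) (auto simp: dist_real_def)
  ultimately have "max_disp \<beta> \<le> e" using x by (simp add: dist_real_def)
  then show ?thesis using \<beta>(1) that by blast
qed

subsection \<open>Disjoint orbit segments\<close>

lemma sum_orbit_segments_le_1:
  assumes \<delta>: "0 < \<delta>" "\<delta> \<le> 1" and c: "separated_multiples \<delta> c l"
  shows "(\<Sum>j<l. disp \<delta> (\<Phi> (real j * c) x)) \<le> 1"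
  unfolding disp_def
proof (rule sum_disjoint_mod1_intervals_le_1)
  fix j k and p :: int assume jk: "j \<in> {..<l}" "k \<in> {..<l}" "j \<noteq> k \<or> p \<noteq> 0"
  have "\<delta> \<le> \<bar>real j * c + of_int p - real k * c\<bar>"
    using jk by (intro separated_multiples_dist[OF c \<delta>(2)]) auto
  then show "\<Phi> \<delta> (\<Phi> (real j * c) x) + of_int p \<le> \<Phi> (real k * c) x \<or>
     \<Phi> \<delta> (\<Phi> (real k * c) x) \<le> \<Phi> (real j * c) x + of_int p"
    unfolding \<Phi>_add_of_int[symmetric] \<Phi>_add[symmetric] \<Phi>_le_time_iff by linarith
qed (use \<delta> in auto)

lemma sum_orbit_segments_le:
  assumes "0 < \<delta>" "\<delta> \<le> 1" "separated_multiples \<delta> c l"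
  shows "(\<Sum>j<l. disp (real J * \<delta>) (\<Phi> (real j * c) x)) \<le> real J"
proof -
  have "(\<Sum>j<l. disp (real J * \<delta>) (\<Phi> (real j * c) x))
      = (\<Sum>i<J. \<Sum>j<l. disp \<delta> (\<Phi> (real j * c) (\<Phi> (real i * \<delta>) x)))"
    unfolding disp_mult by (subst sum.swap) (simp add: \<Phi>_commute)
  also have "\<dots> \<le> (\<Sum>i<J. 1)" by (intro sum_mono sum_orbit_segments_le_1 assms)
  finally show ?thesis by simp
qed

lemma log_deriv_orbit_distortion:
  assumes \<delta>: "0 < \<delta>" "\<delta> \<le> 1" and c: "separated_multiples \<delta> c l"
    and "smooth_time c" and V: "\<And>x y. \<bar>log_deriv c x - log_deriv c y\<bar> \<le> V * \<bar>x - y\<bar>" and "n \<le> l"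
    and y: "x \<le> y" "y \<le> \<Phi> (real J * \<delta>) x"
  shows "\<bar>log_deriv (real n * c) y - log_deriv (real n * c) x\<bar> \<le> V * real J"
proof -
  have V0: "0 \<le> V" using V[of 1 0] by simp
  have "\<bar>log_deriv (real n * c) y - log_deriv (real n * c) x\<bar>
      = \<bar>\<Sum>j<n. log_deriv c (\<Phi> (real j * c) y) - log_deriv c (\<Phi> (real j * c) x)\<bar>"
    by (simp add: log_deriv_mult[OF \<open>smooth_time c\<close>] sum_subtractf)
  also have "\<dots> \<le> (\<Sum>j<n. V * disp (real J * \<delta>) (\<Phi> (real j * c) x))"
  proof (rule order_trans[OF sum_abs sum_mono])
    fix j
    have "\<Phi> (real j * c) y \<le> \<Phi> (real J * \<delta>) (\<Phi> (real j * c) x)"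
      unfolding \<Phi>_commute[of "real J * \<delta>"] using y(2) by simp
    then have "\<bar>\<Phi> (real j * c) y - \<Phi> (real j * c) x\<bar> \<le> disp (real J * \<delta>) (\<Phi> (real j * c) x)"
      using y(1) by (simp add: disp_def)
    then show "\<bar>log_deriv c (\<Phi> (real j * c) y) - log_deriv c (\<Phi> (real j * c) x)\<bar>
        \<le> V * disp (real J * \<delta>) (\<Phi> (real j * c) x)"
      by (rule order_trans[OF V mult_left_mono[OF _ V0]])
  qed
  also have "\<dots> = V * (\<Sum>j<n. disp (real J * \<delta>) (\<Phi> (real j * c) x))" by (simp add: sum_distrib_left)
  also have "\<dots> \<le> V * real J"
    using sum_orbit_segments_le[OF \<delta> separated_multiples_mono[OF c \<open>n \<le> l\<close>], of J x] V0
    by (intro mult_left_mono) auto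
  finally show ?thesis .
qed

end

section \<open>Estimates at one scale\<close>

lemma quadratic_ineq_bound:
  fixes b p q :: real
  assumes "b\<^sup>2 / 2 \<le> p * b + q" "0 \<le> p" "0 \<le> q"
  shows "b \<le> 2 * p + sqrt (2 * q)"
proof -
  have "(b - p)\<^sup>2 \<le> p\<^sup>2 + 2 * q" using assms(1) by (simp add: power2_eq_square algebra_simps)
  then have "b - p \<le> sqrt (p\<^sup>2 + 2 * q)" by (rule real_le_rsqrt)
  also have "\<dots> \<le> sqrt (p\<^sup>2) + sqrt (2 * q)" using assms by (intro sqrt_add_le_add_sqrt) auto
  finally show ?thesis using assms(2) by simp
qed

text \<open>With $u = e^{-B/2}$ one has $u'' = -S u/2$, where $S = B'' - B'^2/2$, so near a critical point of $B$ only
  $S$ enters.\<close>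

lemma flat_near_critical_point:
  assumes B: "smooth_real B" and crit: "deriv B x = 0" and "x \<le> y"
    and S: "\<And>z. x \<le> z \<Longrightarrow> z \<le> y \<Longrightarrow> \<bar>deriv (deriv B) z - (deriv B z)\<^sup>2 / 2\<bar> \<le> T"
    and osc: "\<And>w z. x \<le> w \<Longrightarrow> w \<le> z \<Longrightarrow> z \<le> y \<Longrightarrow> B z - B w \<le> 2 * K"
  shows "\<bar>B y - B x\<bar> \<le> T * exp K * (y - x)\<^sup>2"
proof -
  define u where "u z = exp (- (1/2) * B z)" for z
  have smooth_u: "smooth_real u" unfolding u_def by (intro smooth_exp smooth_cmult B)
  have deriv_u: "deriv u = (\<lambda>z. - (1/2) * deriv B z * u z)"
    unfolding u_def deriv_exp_smooth[OF smooth_cmult[OF B]] deriv_cmult_smooth[OF B] ..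
  have deriv2_u: "\<bar>deriv (deriv u) z\<bar> = 1/2 * \<bar>deriv (deriv B) z - (deriv B z)\<^sup>2 / 2\<bar> * u z" for z
  proof -
    have "deriv (deriv u) = (\<lambda>z. (- (1/2) * deriv (deriv B) z) * u z + (- (1/2) * deriv B z) * deriv u z)"
      unfolding deriv_u using B smooth_u
      by (simp only: deriv_mult_smooth deriv_cmult_smooth smooth_cmult smooth_deriv) (simp only: deriv_u)
    then have "deriv (deriv u) z = - (1/2) * (deriv (deriv B) z - (deriv B z)\<^sup>2 / 2) * u z"
      by (simp only: deriv_u) (simp add: power2_eq_square algebra_simps)
    then show ?thesis by (simp add: abs_mult u_def)
  qed
  have "0 \<le> T" using S[of x] \<open>x \<le> y\<close> by linarith
  have slope: "\<bar>deriv B z\<bar> \<le> T * exp K * (y - x)" if z: "x \<le> z" "z \<le> y" for z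
  proof -
    have "\<bar>deriv u z - deriv u x\<bar> \<le> (1/2 * T * (exp K * u z)) * \<bar>z - x\<bar>"
    proof (rule smooth_diff_le[OF smooth_deriv[OF smooth_u], of "{x..z}"])
      fix w assume w: "w \<in> {x..z}"
      have "- (1/2) * B w \<le> K - (1/2) * B z" using osc[of w z] w z by simp
      then have "u w \<le> exp K * u z" by (simp add: u_def flip: exp_add)
      then show "\<bar>deriv (deriv u) w\<bar> \<le> 1/2 * T * (exp K * u z)"
        unfolding deriv2_u using S[of w] w z \<open>0 \<le> T\<close> by (intro mult_mono) (auto simp: u_def)
    qed (use z in auto)
    also have "\<dots> \<le> (1/2 * T * (exp K * u z)) * (y - x)"
      using z \<open>0 \<le> T\<close> by (intro mult_left_mono) (auto simp: u_def)
    finally have "1/2 * \<bar>deriv B z\<bar> * u z \<le> (1/2 * T * exp K * (y - x)) * u z"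
      by (simp add: deriv_u crit abs_mult mult_ac) (simp add: u_def)
    then show ?thesis by (simp add: u_def)
  qed
  have "\<bar>B y - B x\<bar> \<le> T * exp K * (y - x) * \<bar>y - x\<bar>"
    using \<open>x \<le> y\<close> slope by (intro smooth_diff_le[OF B, of "{x..y}"]) auto
  then show ?thesis using \<open>x \<le> y\<close> by (simp add: power2_eq_square mult.assoc)
qed

locale flow_generators = circle_flow +
  fixes gens :: "real set" and V :: real
  assumes finite_gens: "finite gens" and smooth_gens: "c \<in> gens \<Longrightarrow> smooth_time c" and V_ge_1: "1 \<le> V"
begin

definition gens_jet_const :: "nat \<Rightarrow> real" where
  "gens_jet_const n = (SOME W. 1 \<le> W \<and> (\<forall>c\<in>gens. \<forall>x. jet_bound {..n} W 1 (log_deriv c) x))"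

lemma gens_jet_const_ge_1: "1 \<le> gens_jet_const n"
  and jet_bound_gens: "c \<in> gens \<Longrightarrow> jet_bound {..n} (gens_jet_const n) 1 (log_deriv c) x"
proof -
  obtain W where W: "1 \<le> W" "\<And>p x. p \<in> gens \<times> {..n} \<Longrightarrow> \<bar>(deriv ^^ snd p) (log_deriv (fst p)) x\<bar> \<le> W"
  proof (rule finite_family_periodic_bounded[of "gens \<times> {..n}" "\<lambda>p. (deriv ^^ snd p) (log_deriv (fst p))"])
    fix p x assume "p \<in> gens \<times> {..n}"
    then have "smooth_time (fst p)" using smooth_gens by auto
    then show "continuous_on UNIV ((deriv ^^ snd p) (log_deriv (fst p)))"
      by (intro smooth_continuous_on smooth_funpow_deriv smooth_log_deriv)
    show "(deriv ^^ snd p) (log_deriv (fst p)) (x + 1) = (deriv ^^ snd p) (log_deriv (fst p)) x"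
      by (rule funpow_deriv_periodic) (rule log_deriv_add_1)
  qed (use finite_gens in auto)
  have "jet_bound {..n} W 1 (log_deriv c) x" if "c \<in> gens" for c x
    using W(2)[of "(c, i)" x for i] that by (simp add: jet_bound_def)
  then have "1 \<le> gens_jet_const n \<and> (\<forall>c\<in>gens. \<forall>x. jet_bound {..n} (gens_jet_const n) 1 (log_deriv c) x)"
    unfolding gens_jet_const_def using W(1) by (intro someI_ex[of "\<lambda>W. 1 \<le> W \<and> _ W"]) blast
  then show "1 \<le> gens_jet_const n" "c \<in> gens \<Longrightarrow> jet_bound {..n} (gens_jet_const n) 1 (log_deriv c) x" by auto
qed

lemma lipschitz_gens: "c \<in> gens \<Longrightarrow> \<bar>log_deriv c x - log_deriv c y\<bar> \<le> gens_jet_const 1 * \<bar>x - y\<bar>"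
  using jet_boundD[OF jet_bound_gens[of c 1], of 1]
  by (intro smooth_diff_le[OF smooth_log_deriv[OF smooth_gens] convex_UNIV]) auto

definition schwarzian :: "real \<Rightarrow> real \<Rightarrow> real" where
  "schwarzian r x = deriv (deriv (log_deriv r)) x - (deriv (log_deriv r) x)\<^sup>2 / 2"

lemma schwarzian_eq:
  "schwarzian r
    = (\<lambda>x. deriv (deriv (log_deriv r)) x + (- 1/2) * (deriv (log_deriv r) x * deriv (log_deriv r) x))"
  by (simp add: schwarzian_def[abs_def] power2_eq_square)

lemma smooth_schwarzian: "smooth_time r \<Longrightarrow> smooth_real (schwarzian r)"
  unfolding schwarzian_eq by (intro smooth_add smooth_cmult smooth_mult smooth_deriv smooth_log_deriv)

definition schwarzian_jet_const :: "nat \<Rightarrow> real" where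
  "schwarzian_jet_const n = gens_jet_const (n + 2) + 2 ^ n * (gens_jet_const (n + 2))\<^sup>2 / 2"

lemma schwarzian_jet_const_nonneg: "0 \<le> schwarzian_jet_const n"
  using gens_jet_const_ge_1[of "n + 2"] by (simp add: schwarzian_jet_const_def)

lemma jet_bound_schwarzian_gens:
  assumes "c \<in> gens"
  shows "jet_bound {..n} (schwarzian_jet_const n) 1 (schwarzian c) x"
proof -
  let ?W = "gens_jet_const (n + 2)"
  have smooth: "smooth_real (log_deriv c)" by (rule smooth_log_deriv[OF smooth_gens[OF assms]])
  have "jet_bound {1..Suc (Suc n)} ?W 1 (log_deriv c) x"
    using jet_bound_gens[OF assms, of "n + 2" x] by (simp add: jet_bound_atMost_iff)
  then have jets: "jet_bound {..Suc n} ?W 1 (deriv (log_deriv c)) x"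
    using jet_bound_deriv_iff[of "Suc n" ?W 1 "log_deriv c" x] by simp
  then have first: "jet_bound {..n} ?W 1 (deriv (log_deriv c)) x" by (rule jet_bound_subset) auto
  have second: "jet_bound {..n} ?W 1 (deriv (deriv (log_deriv c))) x"
    using jets jet_bound_deriv_iff[of n ?W 1 "deriv (log_deriv c)" x]
    by (simp add: jet_bound_atMost_iff[of "Suc n"])
  have "jet_bound {..n} (?W + \<bar>- 1/2\<bar> * (2 ^ n * ?W * ?W)) 1 (schwarzian c) x"
    unfolding schwarzian_eq
    by (intro jet_bound_add jet_bound_cmult jet_bound_mult first second smooth_deriv smooth_cmult
      smooth_mult smooth) simp
  then show ?thesis by (simp add: schwarzian_jet_const_def power2_eq_square mult.assoc)
qed

text \<open>The Schwarzian of an iterate is a sum of terms weighted by the square of the derivative; this is what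
  makes the cost of a derivative smaller than the inverse length scale.\<close>

lemma schwarzian_mult:
  assumes c: "smooth_time c"
  shows "schwarzian (real n * c) x
      = (\<Sum>j<n. schwarzian c (\<Phi> (real j * c) x) * exp (2 * log_deriv (real j * c) x))"
proof (induction n)
  case 0
  show ?case by (simp add: schwarzian_def)
next
  case (Suc n)
  let ?F = "\<Phi> (real n * c)" and ?B = "log_deriv (real n * c)"
  have nc: "smooth_time (real n * c)" using c by (rule smooth_time_mult)
  have smooth: "smooth_real (log_deriv c)" "smooth_real ?B" "smooth_real ?F"
    using c nc by (simp_all add: smooth_log_deriv smooth_\<Phi>)
  have "log_deriv (real (Suc n) * c) = (\<lambda>x. log_deriv c (?F x) + ?B x)"
    using log_deriv_mult_Suc[OF c, of n] by (intro ext)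
  then have first: "deriv (log_deriv (real (Suc n) * c))
      = (\<lambda>x. deriv (log_deriv c) (?F x) * exp (?B x) + deriv ?B x)"
    using smooth
    by (simp add: deriv_add_smooth smooth_compose[OF smooth(1,3)]
      deriv_compose_smooth[OF smooth(1,3)] deriv_\<Phi>[OF nc])
  have second: "deriv (deriv (log_deriv (real (Suc n) * c))) =
      (\<lambda>x. (deriv (deriv (log_deriv c)) (?F x) * exp (?B x) * exp (?B x)
        + deriv (log_deriv c) (?F x) * (deriv ?B x * exp (?B x))) + deriv (deriv ?B) x)"
    unfolding first using smooth
    by (simp add: deriv_add_smooth deriv_mult_smooth smooth_mult smooth_deriv
      smooth_exp deriv_\<Phi>[OF nc] deriv_exp_smooth
        smooth_compose[OF smooth_deriv[OF smooth(1)] smooth(3)]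
          deriv_compose_smooth[OF smooth_deriv[OF smooth(1)] smooth(3)])
  have "schwarzian (real (Suc n) * c) x = schwarzian (real n * c) x + schwarzian c (?F x) * exp (2 * ?B x)"
    by (simp only: schwarzian_def fun_cong[OF second, of x] fun_cong[OF first, of x] exp_double)
      (simp add: power2_eq_square algebra_simps)
  then show ?case using Suc by simp
qed

subsection \<open>Iterates of a generator up to a close return\<close>

definition is_scale :: "real \<Rightarrow> bool" where
  "is_scale \<alpha> \<longleftrightarrow> smooth_time \<alpha> \<and> 0 < \<alpha> \<and> \<alpha> \<le> 1 \<and> (\<forall>x. \<bar>log_deriv \<alpha> x\<bar> \<le> V)"

definition scale_step :: "real \<Rightarrow> real \<Rightarrow> real \<Rightarrow> nat \<Rightarrow> bool" where
  "scale_step \<alpha> \<alpha>' c l \<longleftrightarrow> c \<in> gens \<and> 0 < \<alpha>' \<and> \<alpha>' \<le> \<alpha> / 8 \<and> (\<exists>p. \<alpha>' = real l * c + of_int p) \<and>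
     separated_multiples (\<alpha> / 8) c l"

definition distortion :: real where "distortion = exp (8 * gens_jet_const 1)"

definition near_ratio :: real where "near_ratio = 1 + exp V"

lemma distortion_ge_1: "1 \<le> distortion" and near_ratio_ge_1: "1 \<le> near_ratio"
  using gens_jet_const_ge_1[of 1] by (simp_all add: distortion_def near_ratio_def)

lemma is_scale_smooth: "is_scale \<alpha> \<Longrightarrow> smooth_time \<alpha>"
  and is_scale_pos: "is_scale \<alpha> \<Longrightarrow> 0 < \<alpha>"
  and is_scale_le_1: "is_scale \<alpha> \<Longrightarrow> \<alpha> \<le> 1"
  and is_scale_abs_log_deriv_le: "is_scale \<alpha> \<Longrightarrow> \<bar>log_deriv \<alpha> x\<bar> \<le> V"
  by (auto simp: is_scale_def)

lemma is_scale_max_log_deriv_le: "is_scale \<alpha> \<Longrightarrow> max_log_deriv \<alpha> \<le> V"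
  by (rule max_log_deriv_le) (rule is_scale_abs_log_deriv_le)

lemma is_scaleI: "smooth_time \<alpha> \<Longrightarrow> 0 < \<alpha> \<Longrightarrow> \<alpha> \<le> 1 \<Longrightarrow> max_log_deriv \<alpha> \<le> V \<Longrightarrow> is_scale \<alpha>"
  unfolding is_scale_def using abs_log_deriv_le_max order_trans by blast

lemma scale_step_pos: "scale_step \<alpha> \<alpha>' c l \<Longrightarrow> 0 < \<alpha>'"
  and scale_step_le: "scale_step \<alpha> \<alpha>' c l \<Longrightarrow> \<alpha>' \<le> \<alpha> / 8"
  and scale_step_gens: "scale_step \<alpha> \<alpha>' c l \<Longrightarrow> c \<in> gens"
  by (auto simp: scale_step_def)

lemma scale_step_smooth: "scale_step \<alpha> \<alpha>' c l \<Longrightarrow> smooth_time \<alpha>'"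
  and scale_step_log_deriv: "scale_step \<alpha> \<alpha>' c l \<Longrightarrow> log_deriv \<alpha>' = log_deriv (real l * c)"
  using smooth_time_mult[OF smooth_gens]
  by (auto simp: scale_step_def intro: smooth_time_add_of_int log_deriv_add_of_int)

context
  fixes \<alpha> \<alpha>' c :: real and l :: nat
  assumes scale: "is_scale \<alpha>" and step: "scale_step \<alpha> \<alpha>' c l"
begin

lemma iterate_distortion:
  assumes "n \<le> l" "x \<le> y" "y \<le> \<Phi> (real J * (\<alpha> / 8)) x"
  shows "\<bar>log_deriv (real n * c) y - log_deriv (real n * c) x\<bar> \<le> gens_jet_const 1 * real J"
  by (rule log_deriv_orbit_distortion[where \<delta>="\<alpha> / 8" and l=l])
    (use assms step is_scale_pos[OF scale] is_scale_le_1[OF scale] lipschitz_gens smooth_gens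
      in \<open>auto simp: scale_step_def\<close>)

lemma smooth_time_iterate: "smooth_time (real n * c)"
  using step by (intro smooth_time_mult smooth_gens scale_step_gens)

lemma disp_scale_pos: "0 < disp \<alpha> x" and disp_step_pos: "0 < disp \<alpha>' x"
  using is_scale_pos[OF scale] scale_step_pos[OF step] by (simp_all add: disp_pos)

lemma iterate_deriv_le:
  assumes "n \<le> l"
  shows "exp (log_deriv (real n * c) x) * disp \<alpha> x \<le> distortion * disp \<alpha> (\<Phi> (real n * c) x)"
proof -
  let ?K = "8 * gens_jet_const 1"
  have "exp (log_deriv (real n * c) x - ?K) * disp \<alpha> x \<le> disp \<alpha> (\<Phi> (real n * c) x)"
  proof (rule disp_\<Phi>_bounds(1)
      [OF smooth_time_iterate is_scale_pos[OF scale], where up="log_deriv (real n * c) x + ?K"])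
    fix z assume "x \<le> z" "z \<le> \<Phi> \<alpha> x"
    then have "\<bar>log_deriv (real n * c) z - log_deriv (real n * c) x\<bar> \<le> ?K"
      using iterate_distortion[OF assms, of x z 8] by simp
    then show "log_deriv (real n * c) x - ?K \<le> log_deriv (real n * c) z \<and>
        log_deriv (real n * c) z \<le> log_deriv (real n * c) x + ?K" by linarith
  qed
  then show ?thesis by (simp add: exp_diff distortion_def field_simps)
qed

lemma iterate_deriv_le_max:
  assumes "n \<le> l"
  shows "exp (log_deriv (real n * c) x) \<le> distortion * max_disp \<alpha> / disp \<alpha> x"
proof -
  have "distortion * disp \<alpha> (\<Phi> (real n * c) x) \<le> distortion * max_disp \<alpha>"
    using distortion_ge_1 disp_le_max_disp by (intro mult_left_mono) auto
  then show ?thesis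
    using iterate_deriv_le[OF assms, of x] disp_scale_pos[of x] by (simp add: pos_le_divide_eq)
qed

lemma sum_iterate_derivs_le:
  assumes "n \<le> l"
  shows "(\<Sum>j<n. exp (log_deriv (real j * c) x)) * disp \<alpha> x \<le> 8 * distortion"
proof -
  have "(\<Sum>j<n. exp (log_deriv (real j * c) x)) * disp \<alpha> x
      \<le> (\<Sum>j<n. distortion * disp (real 8 * (\<alpha> / 8)) (\<Phi> (real j * c) x))"
    unfolding sum_distrib_right using assms iterate_deriv_le by (intro sum_mono) auto
  also have "\<dots> = distortion * (\<Sum>j<n. disp (real 8 * (\<alpha> / 8)) (\<Phi> (real j * c) x))"
    by (simp add: sum_distrib_left)
  also have "\<dots> \<le> distortion * real 8"
    using step is_scale_pos[OF scale] is_scale_le_1[OF scale] assms distortion_ge_1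
    by (intro mult_left_mono sum_orbit_segments_le)
      (auto simp: scale_step_def intro: separated_multiples_mono)
  finally show ?thesis by simp
qed

lemma sum_iterate_derivs_square_le:
  assumes "n \<le> l"
  shows "(\<Sum>j<n. exp (2 * log_deriv (real j * c) x)) \<le> 8 * distortion\<^sup>2 * max_disp \<alpha> / (disp \<alpha> x)\<^sup>2"
proof -
  let ?b = "distortion * max_disp \<alpha> / disp \<alpha> x"
  have "(\<Sum>j<n. exp (2 * log_deriv (real j * c) x)) \<le> (\<Sum>j<n. exp (log_deriv (real j * c) x) * ?b)"
    unfolding exp_double power2_eq_square using assms iterate_deriv_le_max
    by (intro sum_mono mult_left_mono) auto
  also have "\<dots> = ((\<Sum>j<n. exp (log_deriv (real j * c) x)) * disp \<alpha> x) * (?b / disp \<alpha> x)"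
    using disp_scale_pos[of x] by (simp add: sum_distrib_right sum_divide_distrib)
  also have "\<dots> \<le> 8 * distortion * (?b / disp \<alpha> x)"
    using sum_iterate_derivs_le[OF assms, of x] distortion_ge_1 disp_scale_pos[of x] max_disp_nonneg
      is_scale_pos[OF scale]
    by (intro mult_right_mono) (auto intro!: divide_nonneg_pos mult_nonneg_nonneg)
  finally show ?thesis by (simp add: power2_eq_square mult_ac)
qed

lemma abs_schwarzian_iterate_le:
  assumes "n \<le> l"
  shows "\<bar>schwarzian (real n * c) x\<bar>
      \<le> schwarzian_jet_const 0 * (8 * distortion\<^sup>2 * max_disp \<alpha> / (disp \<alpha> x)\<^sup>2)"
proof -
  note c = scale_step_gens[OF step]
  have "\<bar>schwarzian c y\<bar> \<le> schwarzian_jet_const 0" for y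
    using jet_boundD[OF jet_bound_schwarzian_gens[OF c], of 0 0] by simp
  then have "\<bar>schwarzian (real n * c) x\<bar>
      \<le> (\<Sum>j<n. schwarzian_jet_const 0 * exp (2 * log_deriv (real j * c) x))"
    unfolding schwarzian_mult[OF smooth_gens[OF c]]
    by (intro order_trans[OF sum_abs] sum_mono) (simp add: abs_mult)
  also have "\<dots> \<le> schwarzian_jet_const 0 * (8 * distortion\<^sup>2 * max_disp \<alpha> / (disp \<alpha> x)\<^sup>2)"
    unfolding sum_distrib_left[symmetric] using assms schwarzian_jet_const_nonneg
    by (intro mult_left_mono sum_iterate_derivs_square_le)
  finally show ?thesis .
qed

end

subsection \<open>Comparison of displacements at nearby points\<close>

lemma disp_near_step:
  assumes scale: "is_scale \<alpha>" and "\<bar>s\<bar> \<le> \<alpha>"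
  shows "disp \<alpha> (\<Phi> s x) \<le> near_ratio * disp \<alpha> x"
proof -
  have "- V \<le> log_deriv \<alpha> z \<and> log_deriv \<alpha> z \<le> V" for z
    using is_scale_abs_log_deriv_le[OF scale, of z] by (simp add: abs_le_iff)
  then have forward: "disp \<alpha> (\<Phi> \<alpha> y) \<le> exp V * disp \<alpha> y"
    and backward: "exp (- V) * disp \<alpha> y \<le> disp \<alpha> (\<Phi> \<alpha> y)" for y
    using disp_\<Phi>_bounds[OF is_scale_smooth[OF scale] is_scale_pos[OF scale], of y "- V" V] by auto
  show ?thesis
  proof (cases "s \<ge> 0")
    case True
    have "\<Phi> \<alpha> (\<Phi> s x) \<le> \<Phi> (\<alpha> + \<alpha>) x" using assms(2) by (simp flip: \<Phi>_add)
    moreover have "x \<le> \<Phi> s x" using True by simp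
    ultimately have "disp \<alpha> (\<Phi> s x) \<le> disp (\<alpha> + \<alpha>) x" unfolding disp_def by linarith
    also have "\<dots> = disp \<alpha> (\<Phi> \<alpha> x) + disp \<alpha> x" by (rule disp_add)
    also have "\<dots> \<le> near_ratio * disp \<alpha> x" using forward[of x] by (simp add: near_ratio_def distrib_right)
    finally show ?thesis .
  next
    case False
    have "\<Phi> (- \<alpha>) x \<le> \<Phi> s x" using assms by simp
    moreover have "\<Phi> \<alpha> (\<Phi> s x) \<le> \<Phi> \<alpha> x" using False \<Phi>_le_time_iff[of s x 0] by simp
    ultimately have "disp \<alpha> (\<Phi> s x) \<le> \<Phi> \<alpha> x - \<Phi> (- \<alpha>) x" unfolding disp_def by linarith
    also have "\<dots> = disp \<alpha> (\<Phi> (- \<alpha>) x) + disp \<alpha> x" by (simp add: disp_def flip: \<Phi>_add)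
    also have "disp \<alpha> (\<Phi> (- \<alpha>) x) \<le> exp V * disp \<alpha> x"
      using backward[of "\<Phi> (- \<alpha>) x"] by (simp add: exp_minus field_simps flip: \<Phi>_add)
    finally show ?thesis by (simp add: near_ratio_def algebra_simps)
  qed
qed

lemma disp_near:
  assumes scale: "is_scale \<alpha>" and "\<bar>s\<bar> \<le> real J * \<alpha>"
  shows "disp \<alpha> (\<Phi> s x) \<le> near_ratio ^ J * disp \<alpha> x"
  using assms(2)
proof (induction J arbitrary: s)
  case 0
  then show ?case by simp
next
  case (Suc J)
  define t where "t = (if \<bar>s\<bar> \<le> \<alpha> then s else if s > 0 then \<alpha> else - \<alpha>)"
  have t: "\<bar>t\<bar> \<le> \<alpha>" using is_scale_pos[OF scale] by (auto simp: t_def)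
  have rest: "\<bar>s - t\<bar> \<le> real J * \<alpha>"
    using Suc.prems is_scale_pos[OF scale] by (auto simp: t_def algebra_simps abs_if split: if_splits)
  have "disp \<alpha> (\<Phi> s x) = disp \<alpha> (\<Phi> t (\<Phi> (s - t) x))" by (simp flip: \<Phi>_add)
  also have "\<dots> \<le> near_ratio * disp \<alpha> (\<Phi> (s - t) x)" by (rule disp_near_step[OF scale t])
  also have "\<dots> \<le> near_ratio * (near_ratio ^ J * disp \<alpha> x)"
    using Suc.IH[OF rest] near_ratio_ge_1 by (intro mult_left_mono) auto
  finally show ?case by simp
qed

lemma disp_near_interval:
  assumes scale: "is_scale \<alpha>" and "x \<le> z" "z \<le> \<Phi> (real J * \<alpha>) x"
  shows "disp \<alpha> z \<le> near_ratio ^ J * disp \<alpha> x" "disp \<alpha> x \<le> near_ratio ^ J * disp \<alpha> z"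
proof -
  obtain r where "0 \<le> r" "r \<le> real J * \<alpha>" and z: "z = \<Phi> r x"
    by (rule between_\<Phi>_times[of 0 x z "real J * \<alpha>"]) (use assms in auto)
  then have r: "\<bar>r\<bar> \<le> real J * \<alpha>" "\<bar>- r\<bar> \<le> real J * \<alpha>" by auto
  show "disp \<alpha> z \<le> near_ratio ^ J * disp \<alpha> x" unfolding z by (rule disp_near[OF scale r(1)])
  show "disp \<alpha> x \<le> near_ratio ^ J * disp \<alpha> z"
    using disp_near[OF scale r(2), of z] unfolding z by (simp flip: \<Phi>_add)
qed

lemma disp_ge_near:
  assumes "is_scale \<alpha>" "x \<le> z" "z \<le> \<Phi> (real J * \<alpha>) x"
  shows "disp \<alpha> x / near_ratio ^ J \<le> disp \<alpha> z"
  using disp_near_interval(2)[OF assms] near_ratio_ge_1 by (simp add: divide_le_eq mult.commute)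

lemma disp_multiple_le_near:
  assumes "is_scale \<alpha>"
  shows "disp (real N * \<alpha>) x \<le> real N * near_ratio ^ (2 * N) * (disp \<alpha> x / near_ratio ^ N)"
proof -
  have "disp (real N * \<alpha>) x \<le> (\<Sum>i<N. near_ratio ^ N * disp \<alpha> x)"
    unfolding disp_mult using is_scale_pos[OF assms]
    by (intro sum_mono disp_near_interval(1)[OF assms]) auto
  also have "\<dots> = real N * near_ratio ^ (2 * N) * (disp \<alpha> x / near_ratio ^ N)"
    using near_ratio_ge_1 by (simp add: mult_2 power_add)
  finally show ?thesis .
qed

subsection \<open>First derivatives\<close>

definition roughness_const :: real where
  "roughness_const = 2 * exp V + 4 * distortion * sqrt (schwarzian_jet_const 0) + 1"

definition roughness :: "real \<Rightarrow> real" where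
  "roughness \<alpha> = roughness_const * (max_log_deriv \<alpha> + sqrt (max_disp \<alpha>))"

lemma roughness_const_ge_1: "1 \<le> roughness_const"
  using distortion_ge_1 schwarzian_jet_const_nonneg[of 0] by (simp add: roughness_const_def)

lemma
  assumes "is_scale \<alpha>"
  shows max_log_deriv_le_roughness: "max_log_deriv \<alpha> \<le> roughness \<alpha>"
    and roughness_pos: "0 < roughness \<alpha>"
    and max_disp_le_roughness: "max_disp \<alpha> \<le> (roughness \<alpha>)\<^sup>2"
proof -
  have nonneg: "0 \<le> max_log_deriv \<alpha>" "0 < max_disp \<alpha>"
    using assms by (auto intro: max_log_deriv_nonneg max_disp_pos is_scale_smooth is_scale_pos)
  then have "1 * (max_log_deriv \<alpha> + sqrt (max_disp \<alpha>)) \<le> roughness \<alpha>"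
    unfolding roughness_def by (intro mult_right_mono roughness_const_ge_1) auto
  then have sum_le: "max_log_deriv \<alpha> + sqrt (max_disp \<alpha>) \<le> roughness \<alpha>" by simp
  show "max_log_deriv \<alpha> \<le> roughness \<alpha>" by (rule order_trans[OF _ sum_le]) (use nonneg in simp)
  have sqrt_le: "sqrt (max_disp \<alpha>) \<le> roughness \<alpha>" by (rule order_trans[OF _ sum_le]) (use nonneg in simp)
  show "0 < roughness \<alpha>" by (rule less_le_trans[OF _ sqrt_le]) (use nonneg in simp)
  show "max_disp \<alpha> \<le> (roughness \<alpha>)\<^sup>2" using sqrt_le sqrt_le_D by blast
qed

context
  fixes \<alpha> \<alpha>' c :: real and l :: nat
  assumes scale: "is_scale \<alpha>" and step: "scale_step \<alpha> \<alpha>' c l"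
begin

lemma quadratic_root_le_roughness:
  "2 * (exp V * max_log_deriv \<alpha>) + sqrt (2 * (8 * schwarzian_jet_const 0 * distortion\<^sup>2 * max_disp \<alpha>))
      \<le> roughness \<alpha>"
proof -
  have nonneg: "0 \<le> max_log_deriv \<alpha>" "0 \<le> max_disp \<alpha>"
    using max_log_deriv_nonneg[OF is_scale_smooth[OF scale]] max_disp_nonneg is_scale_pos[OF scale] by auto
  have "2 * (8 * schwarzian_jet_const 0 * distortion\<^sup>2 * max_disp \<alpha>)
      = (4 * distortion)\<^sup>2 * (schwarzian_jet_const 0 * max_disp \<alpha>)"
    by (simp add: power2_eq_square)
  then have sqrt_eq: "sqrt (2 * (8 * schwarzian_jet_const 0 * distortion\<^sup>2 * max_disp \<alpha>))
      = 4 * distortion * sqrt (schwarzian_jet_const 0) * sqrt (max_disp \<alpha>)"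
    using distortion_ge_1 by (simp add: real_sqrt_mult)
  have "0 \<le> distortion * sqrt (schwarzian_jet_const 0)"
    using distortion_ge_1 schwarzian_jet_const_nonneg by simp
  then have "2 * exp V \<le> roughness_const" "4 * distortion * sqrt (schwarzian_jet_const 0) \<le> roughness_const"
    by (simp_all add: roughness_const_def)
  then have "2 * exp V * max_log_deriv \<alpha>
      + 4 * distortion * sqrt (schwarzian_jet_const 0) * sqrt (max_disp \<alpha>)
      \<le> roughness_const * max_log_deriv \<alpha> + roughness_const * sqrt (max_disp \<alpha>)"
    using nonneg by (intro add_mono mult_right_mono) auto
  then show ?thesis unfolding sqrt_eq roughness_def by (simp only: distrib_left mult.assoc)
qed

lemma disp_deriv_log_deriv_critical:
  assumes "n \<le> l" and crit: "deriv (\<lambda>x. disp \<alpha> x * deriv (log_deriv (real n * c)) x) x = 0"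
  shows "\<bar>disp \<alpha> x * deriv (log_deriv (real n * c)) x\<bar> \<le> roughness \<alpha>"
proof -
  let ?B = "log_deriv (real n * c)"
  define g where "g = disp \<alpha> x * deriv ?B x"
  define p where "p = exp V * max_log_deriv \<alpha>"
  define q where "q = 8 * schwarzian_jet_const 0 * distortion\<^sup>2 * max_disp \<alpha>"
  have pq: "0 \<le> p" "0 \<le> q"
    using max_log_deriv_nonneg[OF is_scale_smooth[OF scale]] max_disp_nonneg[of \<alpha>] is_scale_pos[OF scale]
      schwarzian_jet_const_nonneg by (simp_all add: p_def q_def)
  have "smooth_real (disp \<alpha>)" "smooth_real (deriv ?B)"
    using is_scale_smooth[OF scale] smooth_time_iterate[OF scale step]
    by (auto intro: smooth_disp smooth_log_deriv)
  then have "deriv (disp \<alpha>) x * deriv ?B x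
      + disp \<alpha> x * (schwarzian (real n * c) x + (deriv ?B x)\<^sup>2 / 2) = 0"
    using crit by (simp add: deriv_mult_smooth schwarzian_def)
  then have "disp \<alpha> x * (deriv (disp \<alpha>) x * deriv ?B x
      + disp \<alpha> x * (schwarzian (real n * c) x + (deriv ?B x)\<^sup>2 / 2)) = 0"
    by simp
  then have "g\<^sup>2 / 2 = - (deriv (disp \<alpha>) x * g) - (disp \<alpha> x)\<^sup>2 * schwarzian (real n * c) x"
    unfolding g_def by (simp add: power2_eq_square algebra_simps)
  moreover have "\<bar>deriv (disp \<alpha>) x * g\<bar> \<le> p * \<bar>g\<bar>"
  proof -
    have "\<bar>deriv (disp \<alpha>) x\<bar> \<le> exp V * \<bar>log_deriv \<alpha> x\<bar>"
      using abs_exp_minus_1_le[OF is_scale_abs_log_deriv_le[OF scale]]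
      by (simp add: deriv_disp is_scale_smooth[OF scale])
    also have "\<dots> \<le> p" unfolding p_def using abs_log_deriv_le_max[OF is_scale_smooth[OF scale]] by simp
    finally show ?thesis by (simp add: abs_mult mult_right_mono)
  qed
  moreover have "\<bar>(disp \<alpha> x)\<^sup>2 * schwarzian (real n * c) x\<bar> \<le> q"
    using abs_schwarzian_iterate_le[OF scale step assms(1), of x] disp_scale_pos[OF scale step, of x]
    by (simp add: q_def abs_mult field_simps)
  ultimately have "\<bar>g\<bar>\<^sup>2 / 2 \<le> p * \<bar>g\<bar> + q" unfolding power2_abs by linarith
  then have "\<bar>g\<bar> \<le> 2 * p + sqrt (2 * q)" using pq by (rule quadratic_ineq_bound)
  also have "\<dots> \<le> roughness \<alpha>" unfolding p_def q_def by (rule quadratic_root_le_roughness)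
  finally show ?thesis unfolding g_def .
qed

lemma disp_deriv_log_deriv_le_roughness:
  assumes "n \<le> l"
  shows "disp \<alpha> x * \<bar>deriv (log_deriv (real n * c)) x\<bar> \<le> roughness \<alpha>"
proof -
  define G where "G x = disp \<alpha> x * deriv (log_deriv (real n * c)) x" for x
  have smooth_G: "smooth_real G" unfolding G_def
    using is_scale_smooth[OF scale] smooth_time_iterate[OF scale step]
    by (intro smooth_mult smooth_disp smooth_deriv smooth_log_deriv)
  have "continuous_on UNIV (\<lambda>x. (G x)\<^sup>2)"
    using smooth_continuous_on[OF smooth_G] by (intro continuous_intros)
  moreover have "(G (x + 1))\<^sup>2 = (G x)\<^sup>2" for x
    unfolding G_def using deriv_periodic[of "log_deriv (real n * c)" 0]
    by (simp add: disp_add_1 log_deriv_add_1)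
  ultimately obtain x0 where max: "\<And>x. (G x)\<^sup>2 \<le> (G x0)\<^sup>2"
    using periodic_attains_max[of "\<lambda>x. (G x)\<^sup>2"] by blast
  have "((\<lambda>x. (G x)\<^sup>2) has_real_derivative 2 * G x0 * deriv G x0) (at x0)"
    using smooth_has_derivative[OF smooth_G] by (auto intro!: derivative_eq_intros)
  from DERIV_local_max[OF this, of 1] max have "G x0 = 0 \<or> deriv G x0 = 0" by auto
  then have "\<bar>G x0\<bar> \<le> roughness \<alpha>"
    using disp_deriv_log_deriv_critical[OF assms, of x0] roughness_pos[OF scale] unfolding G_def[abs_def]
    by auto
  moreover have "\<bar>G x\<bar> \<le> \<bar>G x0\<bar>" using max[of x] by (simp add: abs_le_square_iff)
  ultimately show ?thesis using disp_scale_pos[OF scale step, of x] by (simp add: G_def abs_mult)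
qed

end

subsection \<open>The recursion for the maximal slope\<close>

definition flatness_const :: real where
  "flatness_const = 8 * schwarzian_jet_const 0 * distortion ^ 3 * near_ratio ^ 4 * (near_ratio + 1)\<^sup>2"

lemma flatness_const_nonneg: "0 \<le> flatness_const"
  using distortion_ge_1 near_ratio_ge_1 schwarzian_jet_const_nonneg by (simp add: flatness_const_def)

context
  fixes \<alpha> \<alpha>' c :: real and l :: nat
  assumes scale: "is_scale \<alpha>" and step: "scale_step \<alpha> \<alpha>' c l"
begin

lemma log_deriv_flat_near_critical:
  assumes crit: "deriv (log_deriv \<alpha>') x = 0" and y: "x \<le> y" "y \<le> \<Phi> (2 * \<alpha>) x"
  shows "\<bar>log_deriv \<alpha>' y - log_deriv \<alpha>' x\<bar> \<le> flatness_const * max_disp \<alpha>"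
proof -
  define T where "T
      = schwarzian_jet_const 0 * (8 * distortion\<^sup>2 * max_disp \<alpha>) * (near_ratio ^ 4 / (disp \<alpha> x)\<^sup>2)"
  note pos = disp_scale_pos[OF scale step]
  have nonneg: "0 \<le> schwarzian_jet_const 0 * (8 * distortion\<^sup>2 * max_disp \<alpha>)"
    using schwarzian_jet_const_nonneg max_disp_nonneg is_scale_pos[OF scale] by simp
  have "\<bar>log_deriv \<alpha>' y - log_deriv \<alpha>' x\<bar> \<le> T * exp (8 * gens_jet_const 1) * (y - x)\<^sup>2"
  proof (rule flat_near_critical_point[OF smooth_log_deriv[OF scale_step_smooth[OF step]] crit y(1)])
    fix z assume z: "x \<le> z" "z \<le> y"
    have "disp \<alpha> x \<le> near_ratio\<^sup>2 * disp \<alpha> z" using disp_near_interval(2)[OF scale, of x z 2] z y by simp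
    then have "(disp \<alpha> x)\<^sup>2 \<le> (near_ratio\<^sup>2 * disp \<alpha> z)\<^sup>2" using pos[of x] by (intro power_mono) auto
    then have "1 / (disp \<alpha> z)\<^sup>2 \<le> near_ratio ^ 4 / (disp \<alpha> x)\<^sup>2"
      using pos[of x] pos[of z] by (simp add: power_mult_distrib field_simps flip: power_mult)
    then have "schwarzian_jet_const 0 * (8 * distortion\<^sup>2 * max_disp \<alpha>) * (1 / (disp \<alpha> z)\<^sup>2) \<le> T"
      unfolding T_def using nonneg by (rule mult_left_mono)
    then show "\<bar>deriv (deriv (log_deriv \<alpha>')) z - (deriv (log_deriv \<alpha>') z)\<^sup>2 / 2\<bar> \<le> T"
      using abs_schwarzian_iterate_le[OF scale step order_refl, of z]
      by (simp add: schwarzian_def scale_step_log_deriv[OF step])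
  next
    fix w z assume wz: "x \<le> w" "w \<le> z" "z \<le> y"
    then have "z \<le> \<Phi> (real 16 * (\<alpha> / 8)) w"
      using y order_trans[of z "\<Phi> (2 * \<alpha>) x" "\<Phi> (2 * \<alpha>) w"] by simp
    then have "\<bar>log_deriv \<alpha>' z - log_deriv \<alpha>' w\<bar> \<le> gens_jet_const 1 * real 16"
      unfolding scale_step_log_deriv[OF step] using wz by (intro iterate_distortion[OF scale step]) auto
    then show "log_deriv \<alpha>' z - log_deriv \<alpha>' w \<le> 2 * (8 * gens_jet_const 1)" by simp
  qed
  also have "\<dots> \<le> T * exp (8 * gens_jet_const 1) * ((near_ratio + 1) * disp \<alpha> x)\<^sup>2"
  proof (intro mult_left_mono power_mono)
    have "y - x \<le> disp (\<alpha> + \<alpha>) x" using y by (simp add: disp_def)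
    also have "\<dots> = disp \<alpha> (\<Phi> \<alpha> x) + disp \<alpha> x" by (rule disp_add)
    also have "\<dots> \<le> (near_ratio + 1) * disp \<alpha> x"
      using disp_near_step[OF scale, of \<alpha> x] is_scale_pos[OF scale] by (simp add: distrib_right)
    finally show "y - x \<le> (near_ratio + 1) * disp \<alpha> x" .
    show "0 \<le> T * exp (8 * gens_jet_const 1)" unfolding T_def using nonneg near_ratio_ge_1 by simp
  qed (use y in simp)
  also have "\<dots> = flatness_const * max_disp \<alpha>"
    using pos[of x] unfolding T_def flatness_const_def distortion_def[symmetric]
    by (simp add: power2_eq_square power3_eq_cube field_simps)
  finally show ?thesis .
qed

text \<open>With the sign $\sigma$ the increments of $\ln m_{\alpha'}$ along the orbit of $\Phi_{\alpha'}$ are bounded from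
  below or from above; the total increment over $\Phi_\alpha$ is a value of $\ln \Phi_\alpha'$.\<close>

lemma multiple_of_log_deriv_lower_bound_le:
  assumes \<sigma>: "\<sigma> = 1 \<or> \<sigma> = -1" and t: "real t * \<alpha>' \<le> \<alpha>" and "0 \<le> w"
    and w: "\<And>z. x \<le> z \<Longrightarrow> z \<le> \<Phi> (2 * \<alpha>) x \<Longrightarrow> w \<le> \<sigma> * log_deriv \<alpha>' z"
  shows "real t * w \<le> max_log_deriv \<alpha>"
proof -
  define g where "g z = \<sigma> * ln (disp \<alpha>' z)" for z
  note smooth = scale_step_smooth[OF step]
  have "real n * w \<le> g (\<Phi> (real n * \<alpha>') x) - g x" if "n \<le> t" for n
    using that
  proof (induction n)
    case (Suc n)
    have "real (Suc n) * \<alpha>' \<le> real t * \<alpha>'"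
      using Suc.prems scale_step_pos[OF step] by (intro mult_right_mono) auto
    then have le: "\<Phi> (real (Suc n) * \<alpha>') x \<le> \<Phi> (2 * \<alpha>) x" using t is_scale_pos[OF scale] by simp
    obtain z where z: "\<Phi> (real n * \<alpha>') x < z" "z < \<Phi> \<alpha>' (\<Phi> (real n * \<alpha>') x)"
        "ln (disp \<alpha>' (\<Phi> \<alpha>' (\<Phi> (real n * \<alpha>') x))) = log_deriv \<alpha>' z + ln (disp \<alpha>' (\<Phi> (real n * \<alpha>') x))"
      by (rule ln_disp_\<Phi>_mvt[OF smooth scale_step_pos[OF step]])
    have "x \<le> \<Phi> (real n * \<alpha>') x" using scale_step_pos[OF step] by simp
    then have "w \<le> \<sigma> * log_deriv \<alpha>' z" using z(1,2) le unfolding \<Phi>_mult_Suc by (intro w) linarith+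
    also have "\<dots> = g (\<Phi> (real (Suc n) * \<alpha>') x) - g (\<Phi> (real n * \<alpha>') x)"
      unfolding g_def \<Phi>_mult_Suc z(3) by (simp add: distrib_left)
    finally show ?case using Suc by (simp add: algebra_simps)
  qed simp
  then have "real t * w \<le> g (\<Phi> (real t * \<alpha>') x) - g x" by simp
  also have "g (\<Phi> (real t * \<alpha>') x) \<le> g (\<Phi> \<alpha> x)"
    unfolding g_def
  proof (rule signed_ln_disp_mono[OF smooth scale_step_pos[OF step] \<sigma>])
    show "\<Phi> (real t * \<alpha>') x \<le> \<Phi> \<alpha> x" using t by simp
    fix z assume "\<Phi> (real t * \<alpha>') x \<le> z" "z \<le> \<Phi> \<alpha> x"
    moreover have "x \<le> \<Phi> (real t * \<alpha>') x" "\<Phi> \<alpha> x \<le> \<Phi> (2 * \<alpha>) x"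
      using scale_step_pos[OF step] is_scale_pos[OF scale] by simp_all
    ultimately show "0 \<le> \<sigma> * log_deriv \<alpha>' z" using w[of z] \<open>0 \<le> w\<close> by linarith
  qed
  also have "g (\<Phi> \<alpha> x) - g x \<le> max_log_deriv \<alpha>"
  proof -
    obtain z where "ln (disp \<alpha>' (\<Phi> \<alpha> x)) = log_deriv \<alpha> z + ln (disp \<alpha>' x)"
      by (rule ln_disp_\<Phi>_mvt[OF is_scale_smooth[OF scale] scale_step_pos[OF step]])
    then have "g (\<Phi> \<alpha> x) - g x = \<sigma> * log_deriv \<alpha> z" unfolding g_def by (simp add: distrib_left)
    then show ?thesis using \<sigma> abs_log_deriv_le_max[OF is_scale_smooth[OF scale], of z] by auto
  qed
  finally show ?thesis by simp
qed

lemma max_log_deriv_recursion: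
  assumes t: "1 \<le> t" "real t * \<alpha>' \<le> \<alpha>"
  shows "max_log_deriv \<alpha>' \<le> max_log_deriv \<alpha> / real t + flatness_const * max_disp \<alpha>"
proof (rule max_log_deriv_le)
  fix x
  let ?b = "flatness_const * max_disp \<alpha>"
  have smooth: "smooth_real (log_deriv \<alpha>')" by (rule smooth_log_deriv[OF scale_step_smooth[OF step]])
  have signed: "\<sigma> * log_deriv \<alpha>' x \<le> max_log_deriv \<alpha> / real t + ?b" if \<sigma>: "\<sigma> = 1 \<or> \<sigma> = -1" for \<sigma>
  proof -
    obtain x0 where max: "\<And>x. \<sigma> * log_deriv \<alpha>' x \<le> \<sigma> * log_deriv \<alpha>' x0"
      using periodic_attains_max[of "\<lambda>x. \<sigma> * log_deriv \<alpha>' x"]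
        smooth_continuous_on[OF smooth_cmult[OF smooth]] log_deriv_add_1 by metis
    have "\<sigma> * deriv (log_deriv \<alpha>') x0 = 0"
      using DERIV_local_max[OF DERIV_cmult[OF smooth_has_derivative[OF smooth]], of 1 x0 \<sigma>] max by simp
    then have crit: "deriv (log_deriv \<alpha>') x0 = 0" using \<sigma> by auto
    define w where "w = \<sigma> * log_deriv \<alpha>' x0 - ?b"
    have "real t * w \<le> max_log_deriv \<alpha>"
    proof (cases "0 \<le> w")
      case True
      show ?thesis
      proof (rule multiple_of_log_deriv_lower_bound_le[OF \<sigma> t(2) True])
        show "w \<le> \<sigma> * log_deriv \<alpha>' z" if "x0 \<le> z" "z \<le> \<Phi> (2 * \<alpha>) x0" for z
          using log_deriv_flat_near_critical[OF crit that] \<sigma> by (auto simp: w_def abs_le_iff)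
      qed
    next
      case False
      then have "real t * w \<le> 0" by (simp add: mult_nonneg_nonpos)
      then show ?thesis using max_log_deriv_nonneg[OF is_scale_smooth[OF scale]] by linarith
    qed
    then have "w \<le> max_log_deriv \<alpha> / real t" using t(1) by (simp add: field_simps)
    then show ?thesis using max[of x] by (simp add: w_def)
  qed
  show "\<bar>log_deriv \<alpha>' x\<bar> \<le> max_log_deriv \<alpha> / real t + ?b" using signed[of 1] signed[of "-1"] by simp
qed

end

subsection \<open>Jets of iterates\<close>

definition schwarzian_term_const :: "real \<Rightarrow> nat \<Rightarrow> real" where
  "schwarzian_term_const C r
      = 2 ^ r * (chain_jet_const (chain_jet_const C r * distortion) r * schwarzian_jet_const r)
     * chain_jet_const (2 * C) r"

primrec iterate_jet_const :: "nat \<Rightarrow> real" where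
  "iterate_jet_const 0 = 1"
| "iterate_jet_const (Suc r) = max 1 (schwarzian_term_const (iterate_jet_const r) r * (8 * distortion\<^sup>2)
     + 2 ^ r * (iterate_jet_const r)\<^sup>2 / 2)"

lemma schwarzian_term_const_nonneg: "0 \<le> schwarzian_term_const C r"
  using schwarzian_jet_const_nonneg chain_jet_const_ge_1[of "chain_jet_const C r * distortion" r]
    chain_jet_const_ge_1[of "2 * C" r]
  by (simp add: schwarzian_term_const_def)

lemma iterate_jet_const_ge_1: "1 \<le> iterate_jet_const r"
  by (cases r) auto

context
  fixes \<alpha> \<alpha>' c :: real and l :: nat
  assumes scale: "is_scale \<alpha>" and step: "scale_step \<alpha> \<alpha>' c l" and rough: "roughness \<alpha> \<le> 1"
begin

lemma jet_bound_schwarzian_term: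
  assumes "j \<le> l" and jets: "jet_bound {1..r} C (roughness \<alpha> / disp \<alpha> x) (log_deriv (real j * c)) x"
  shows "jet_bound {..r} (schwarzian_term_const C r * exp (2 * log_deriv (real j * c) x))
    (roughness \<alpha> / disp \<alpha> x)
    (\<lambda>x. schwarzian c (\<Phi> (real j * c) x) * exp (2 * log_deriv (real j * c) x)) x"
proof -
  let ?K = "roughness \<alpha> / disp \<alpha> x" and ?A = "log_deriv (real j * c)"
  note smooth_j = smooth_time_iterate[OF scale step, of j]
  note smooth_c = smooth_gens[OF scale_step_gens[OF step]]
  have K: "0 \<le> ?K" using roughness_pos[OF scale] disp_scale_pos[OF scale step, of x] by simp
  have "exp (?A x) \<le> distortion * ?K"
  proof -
    have "(roughness \<alpha>)\<^sup>2 \<le> roughness \<alpha>"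
      using rough roughness_pos[OF scale] by (simp add: power2_eq_square mult_left_le)
    then have "max_disp \<alpha> \<le> roughness \<alpha>" using max_disp_le_roughness[OF scale] by linarith
    then have "distortion * max_disp \<alpha> / disp \<alpha> x \<le> distortion * roughness \<alpha> / disp \<alpha> x"
      using distortion_ge_1 disp_scale_pos[OF scale step, of x]
      by (intro divide_right_mono mult_left_mono) auto
    then show ?thesis using iterate_deriv_le_max[OF scale step assms(1), of x] by simp
  qed
  then have "jet_bound {..r} (chain_jet_const C r * (distortion * ?K)) ?K (\<lambda>x. exp (?A x)) x"
    by (intro jet_bound_exp smooth_log_deriv smooth_j K jets)
  then have "jet_bound {..r} (chain_jet_const C r * distortion * ?K) ?K (deriv (\<Phi> (real j * c))) x"
    by (simp add: deriv_\<Phi>[OF smooth_j] mult.assoc)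
  then have "jet_bound {1..r} (chain_jet_const C r * distortion) ?K (\<Phi> (real j * c)) x"
    unfolding jet_bound_deriv_iff by (rule jet_bound_subset) auto
  then have "jet_bound {..r}
      (chain_jet_const (chain_jet_const C r * distortion) r * schwarzian_jet_const r) ?K
      (\<lambda>x. schwarzian c (\<Phi> (real j * c) x)) x"
    by (intro jet_bound_compose smooth_schwarzian smooth_c smooth_\<Phi> smooth_j K
        jet_bound_schwarzian_gens scale_step_gens[OF step])
  moreover have "jet_bound {..r} (chain_jet_const (2 * C) r * exp (2 * ?A x)) ?K (\<lambda>x. exp (2 * ?A x)) x"
    using jet_bound_cmult[OF smooth_log_deriv[OF smooth_j] jets, of 2]
    by (intro jet_bound_exp smooth_cmult smooth_log_deriv smooth_j K) auto
  moreover have "smooth_real (\<lambda>x. schwarzian c (\<Phi> (real j * c) x))"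
    by (rule smooth_compose[OF smooth_schwarzian[OF smooth_c] smooth_\<Phi>[OF smooth_j]])
  ultimately have "jet_bound {..r}
      (2 ^ r * (chain_jet_const (chain_jet_const C r * distortion) r * schwarzian_jet_const r)
        * (chain_jet_const (2 * C) r * exp (2 * ?A x))) ?K
      (\<lambda>x. schwarzian c (\<Phi> (real j * c) x) * exp (2 * ?A x)) x"
    by (intro jet_bound_mult smooth_exp smooth_cmult smooth_log_deriv smooth_j K)
  then show ?thesis by (simp only: schwarzian_term_const_def mult.assoc)
qed

lemma jet_bound_schwarzian_iterate:
  assumes "n \<le> l"
    and jets: "\<And>j. j \<le> l \<Longrightarrow> jet_bound {1..r} C (roughness \<alpha> / disp \<alpha> x) (log_deriv (real j * c)) x"
  shows "jet_bound {..r} (schwarzian_term_const C r * (8 * distortion\<^sup>2) * (roughness \<alpha> / disp \<alpha> x)\<^sup>2)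
    (roughness \<alpha> / disp \<alpha> x)
    (schwarzian (real n * c)) x"
proof -
  let ?K = "roughness \<alpha> / disp \<alpha> x"
  let ?e = "\<lambda>j x. exp (2 * log_deriv (real j * c) x)"
  note smooth_c = smooth_gens[OF scale_step_gens[OF step]]
  have K: "0 \<le> ?K" using roughness_pos[OF scale] disp_scale_pos[OF scale step, of x] by simp
  have "smooth_real (\<lambda>x. schwarzian c (\<Phi> (real j * c) x) * ?e j x)" for j
    by (intro smooth_mult smooth_exp smooth_cmult smooth_log_deriv smooth_time_iterate[OF scale step]
        smooth_compose[OF smooth_schwarzian[OF smooth_c] smooth_\<Phi>])
  then have sum_jets: "jet_bound {..r} (\<Sum>j<n. schwarzian_term_const C r * ?e j x) ?K
      (\<lambda>x. \<Sum>j<n. schwarzian c (\<Phi> (real j * c) x) * ?e j x) x"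
    using assms by (intro jet_bound_sum jet_bound_schwarzian_term jets) auto
  have sum_eq: "(\<lambda>x. \<Sum>j<n. schwarzian c (\<Phi> (real j * c) x) * ?e j x) = schwarzian (real n * c)"
    using schwarzian_mult[OF smooth_c, of n] by (intro ext) simp
  have "(\<Sum>j<n. schwarzian_term_const C r * ?e j x) \<le> schwarzian_term_const C r * (8 * distortion\<^sup>2) * ?K\<^sup>2"
  proof -
    have "(\<Sum>j<n. ?e j x) \<le> 8 * distortion\<^sup>2 * max_disp \<alpha> / (disp \<alpha> x)\<^sup>2"
      by (rule sum_iterate_derivs_square_le[OF scale step assms(1)])
    also have "\<dots> \<le> 8 * distortion\<^sup>2 * (roughness \<alpha>)\<^sup>2 / (disp \<alpha> x)\<^sup>2"
      using max_disp_le_roughness[OF scale] by (intro divide_right_mono mult_left_mono) auto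
    finally show ?thesis unfolding sum_distrib_left[symmetric] mult.assoc
      by (intro mult_left_mono schwarzian_term_const_nonneg) (simp add: power_divide mult.assoc)
  qed
  then show ?thesis by (rule jet_bound_mono[OF sum_jets[unfolded sum_eq] order_refl _ K])
qed

lemma jet_bound_iterate:
  assumes "n \<le> l"
  shows "jet_bound {1..Suc r} (iterate_jet_const r) (roughness \<alpha> / disp \<alpha> x) (log_deriv (real n * c)) x"
  using assms
proof (induction r arbitrary: n)
  case 0
  then show ?case
    using disp_deriv_log_deriv_le_roughness[OF scale step, of n x] disp_scale_pos[OF scale step, of x]
    by (simp add: jet_bound_def field_simps)
next
  case (Suc r)
  let ?K = "roughness \<alpha> / disp \<alpha> x" and ?A' = "deriv (log_deriv (real n * c))"
  let ?C = "iterate_jet_const r" and ?C' = "iterate_jet_const (Suc r)"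
  let ?D = "schwarzian_term_const ?C r * (8 * distortion\<^sup>2)"
  have K: "0 \<le> ?K" using roughness_pos[OF scale] disp_scale_pos[OF scale step, of x] by simp
  have smooth: "smooth_time (real n * c)" by (rule smooth_time_iterate[OF scale step])
  have smooth': "smooth_real ?A'" by (intro smooth_deriv smooth_log_deriv smooth)
  have "jet_bound {..r} (?D * ?K\<^sup>2) ?K (schwarzian (real n * c)) x"
    using Suc.prems by (intro jet_bound_schwarzian_iterate jet_bound_subset[OF Suc.IH]) auto
  moreover have first: "jet_bound {..r} (?C * ?K) ?K ?A' x"
    unfolding jet_bound_deriv_iff by (rule Suc.IH[OF Suc.prems])
  ultimately have "jet_bound {..r} (?D * ?K\<^sup>2 + \<bar>1/2\<bar> * (2 ^ r * (?C * ?K) * (?C * ?K))) ?K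
      (\<lambda>x. schwarzian (real n * c) x + 1/2 * (?A' x * ?A' x)) x"
    by (intro jet_bound_add jet_bound_cmult jet_bound_mult smooth_cmult smooth_mult smooth_schwarzian
      smooth smooth' K)
  moreover have "(\<lambda>x. schwarzian (real n * c) x + 1/2 * (?A' x * ?A' x)) = deriv ?A'"
    by (intro ext) (simp add: schwarzian_def power2_eq_square)
  moreover have "?D * ?K\<^sup>2 + \<bar>1/2\<bar> * (2 ^ r * (?C * ?K) * (?C * ?K)) \<le> ?C' * ?K\<^sup>2"
  proof -
    have "?D * ?K\<^sup>2 + \<bar>1/2\<bar> * (2 ^ r * (?C * ?K) * (?C * ?K)) = (?D + 2 ^ r * ?C\<^sup>2 / 2) * ?K\<^sup>2"
      by (simp add: power2_eq_square algebra_simps)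
    also have "\<dots> \<le> ?C' * ?K\<^sup>2" by (intro mult_right_mono) auto
    finally show ?thesis .
  qed
  ultimately have "jet_bound {..r} (?C' * ?K * ?K) ?K (deriv ?A') x"
    using K by (auto simp: power2_eq_square mult.assoc elim!: jet_bound_mono)
  then have "jet_bound {1..Suc r} (?C' * ?K) ?K ?A' x" by (simp only: jet_bound_deriv_iff)
  moreover have "\<bar>?A' x\<bar> \<le> 1 * ?K"
    using disp_deriv_log_deriv_le_roughness[OF scale step Suc.prems, of x]
      disp_scale_pos[OF scale step, of x]
    by (simp add: field_simps)
  moreover have "1 * ?K \<le> ?C' * ?K" using K by (intro mult_right_mono iterate_jet_const_ge_1)
  ultimately have "jet_bound {..Suc r} (?C' * ?K) ?K ?A' x" by (simp add: jet_bound_atMost_iff)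
  then show ?case by (simp only: jet_bound_deriv_iff)
qed

subsection \<open>The displacement at the next scale\<close>

lemma abs_funpow_deriv_disp_next_le:
  assumes next_scale: "max_log_deriv \<alpha>' \<le> V" and "1 \<le> r"
  shows "\<bar>(deriv ^^ Suc r) (disp \<alpha>') x\<bar>
      \<le> chain_jet_const (iterate_jet_const r) r * exp V * (roughness \<alpha> / disp \<alpha> x) ^ r"
proof -
  note smooth = scale_step_smooth[OF step]
  have smooth_exp: "smooth_real (\<lambda>x. exp (log_deriv \<alpha>' x))" by (intro smooth_exp smooth_log_deriv smooth)
  have "jet_bound {..r} (chain_jet_const (iterate_jet_const r) r * exp V)
      (roughness \<alpha> / disp \<alpha> x) (\<lambda>x. exp (log_deriv \<alpha>' x)) x"
  proof (rule jet_bound_exp[OF smooth_log_deriv[OF smooth]])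
    show "jet_bound {1..r} (iterate_jet_const r) (roughness \<alpha> / disp \<alpha> x) (log_deriv \<alpha>') x"
      unfolding scale_step_log_deriv[OF step] by (rule jet_bound_subset[OF jet_bound_iterate]) auto
    show "exp (log_deriv \<alpha>' x) \<le> exp V"
      using abs_log_deriv_le_max[OF smooth, of x] next_scale by simp
  qed (use roughness_pos[OF scale] disp_scale_pos[OF scale step, of x] in simp)
  moreover have "(deriv ^^ Suc r) (disp \<alpha>') x = (deriv ^^ r) (\<lambda>x. exp (log_deriv \<alpha>' x)) x"
    using funpow_deriv_diff[OF smooth_exp smooth_const, of r 1] \<open>1 \<le> r\<close>
    by (simp add: funpow_deriv_Suc deriv_disp[OF smooth] funpow_deriv_const del: funpow.simps)
  ultimately show ?thesis using jet_boundD by fastforce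
qed

lemma disp_next_almost_invariant:
  assumes "i \<le> N"
  shows "\<bar>disp \<alpha>' (\<Phi> (real i * \<alpha>) x) - disp \<alpha>' x\<bar>
    \<le> exp (real N * V) * (real N * max_log_deriv \<alpha>) * disp \<alpha>' x"
proof -
  note smooth = is_scale_smooth[OF scale]
  obtain z where z: "disp \<alpha>' (\<Phi> (real i * \<alpha>) x) = exp (log_deriv (real i * \<alpha>) z) * disp \<alpha>' x"
    by (rule disp_\<Phi>_mvt[OF smooth_time_mult[OF smooth] scale_step_pos[OF step]])
  have "\<bar>log_deriv (real i * \<alpha>) z\<bar> \<le> (\<Sum>j<i. max_log_deriv \<alpha>)"
    unfolding log_deriv_mult[OF smooth]
    by (intro order_trans[OF sum_abs] sum_mono abs_log_deriv_le_max smooth)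
  also have "\<dots> \<le> real N * max_log_deriv \<alpha>"
    using assms max_log_deriv_nonneg[OF smooth] by (simp add: mult_right_mono)
  finally have small: "\<bar>log_deriv (real i * \<alpha>) z\<bar> \<le> real N * max_log_deriv \<alpha>" .
  also have "\<dots> \<le> real N * V" using is_scale_max_log_deriv_le[OF scale] by (intro mult_left_mono) auto
  finally have "\<bar>exp (log_deriv (real i * \<alpha>) z) - 1\<bar> \<le> exp (real N * V) * \<bar>log_deriv (real i * \<alpha>) z\<bar>"
    by (rule abs_exp_minus_1_le)
  also have "\<dots> \<le> exp (real N * V) * (real N * max_log_deriv \<alpha>)" using small by (intro mult_left_mono) auto
  finally have "\<bar>exp (log_deriv (real i * \<alpha>) z) - 1\<bar> * disp \<alpha>' x
      \<le> exp (real N * V) * (real N * max_log_deriv \<alpha>) * disp \<alpha>' x"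
    using disp_step_pos[OF scale step, of x] by (intro mult_right_mono) auto
  moreover have "\<bar>disp \<alpha>' (\<Phi> (real i * \<alpha>) x) - disp \<alpha>' x\<bar>
      = \<bar>exp (log_deriv (real i * \<alpha>) z) - 1\<bar> * \<bar>disp \<alpha>' x\<bar>"
    by (simp add: z left_diff_distrib flip: abs_mult)
  ultimately show ?thesis using disp_step_pos[OF scale step, of x] by simp
qed

end

definition next_disp_const :: "nat \<Rightarrow> real" where
  "next_disp_const R = (let N = 2 ^ Suc R in
     1 + interpolation_const (real N * near_ratio ^ (2 * N)) (Suc R) *
       (exp (real N * V) * real N * near_ratio ^ N + chain_jet_const (iterate_jet_const R) R * exp V))"

lemma next_disp_const_ge_1: "1 \<le> next_disp_const R"
  using interpolation_const_nonneg near_ratio_ge_1 chain_jet_const_ge_1[of "iterate_jet_const R" R]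
  by (simp add: next_disp_const_def Let_def)

context
  fixes \<alpha> \<alpha>' c :: real and l :: nat
  assumes scale: "is_scale \<alpha>" and step: "scale_step \<alpha> \<alpha>' c l" and rough: "roughness \<alpha> \<le> 1"
    and next_scale: "max_log_deriv \<alpha>' \<le> V"
begin

lemma abs_funpow_deriv_disp_next_le_near:
  assumes "1 \<le> R" "x \<le> z" "z \<le> \<Phi> (real N * \<alpha>) x"
  shows "\<bar>(deriv ^^ Suc R) (disp \<alpha>') z\<bar>
    \<le> chain_jet_const (iterate_jet_const R) R * exp V * (roughness \<alpha> / (disp \<alpha> x / near_ratio ^ N)) ^ R"
proof -
  have "0 < disp \<alpha> x / near_ratio ^ N" using disp_scale_pos[OF scale step] near_ratio_ge_1 by simp
  then have "roughness \<alpha> / disp \<alpha> z \<le> roughness \<alpha> / (disp \<alpha> x / near_ratio ^ N)"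
    using disp_ge_near[OF scale assms(2,3)] roughness_pos[OF scale] by (intro frac_le) auto
  then have "(roughness \<alpha> / disp \<alpha> z) ^ R \<le> (roughness \<alpha> / (disp \<alpha> x / near_ratio ^ N)) ^ R"
    using roughness_pos[OF scale] disp_scale_pos[OF scale step, of z] by (intro power_mono) auto
  then have "chain_jet_const (iterate_jet_const R) R * exp V * (roughness \<alpha> / disp \<alpha> z) ^ R
      \<le> chain_jet_const (iterate_jet_const R) R * exp V * (roughness \<alpha> / (disp \<alpha> x / near_ratio ^ N)) ^ R"
    using chain_jet_const_ge_1[of "iterate_jet_const R" R] by (intro mult_left_mono) auto
  then show ?thesis
    using abs_funpow_deriv_disp_next_le[OF scale step rough next_scale \<open>1 \<le> R\<close>, of z] by linarith
qed

lemma deriv_disp_next_interpolation: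
  fixes R :: nat and x :: real
  assumes "1 \<le> R" and y: "x \<le> y" "y \<le> \<Phi> \<alpha> x"
  defines "N \<equiv> 2 ^ Suc R"
  defines "s \<equiv> disp \<alpha> x / near_ratio ^ N"
  shows "\<bar>deriv (disp \<alpha>') y\<bar> \<le> interpolation_const (real N * near_ratio ^ (2 * N)) (Suc R) *
    (exp (real N * V) * (real N * max_log_deriv \<alpha>) * disp \<alpha>' x / s
      + chain_jet_const (iterate_jet_const R) R * exp V * (roughness \<alpha> / s) ^ R * s ^ R)"
proof -
  note smooth = scale_step_smooth[OF step]
  have s: "0 < s" using disp_scale_pos[OF scale step] near_ratio_ge_1 by (simp add: s_def)
  define \<phi> where "\<phi> z = disp \<alpha>' z - disp \<alpha>' x" for z
  have deriv_\<phi>: "(deriv ^^ Suc i) \<phi> = (deriv ^^ Suc i) (disp \<alpha>')" for i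
    unfolding \<phi>_def using funpow_deriv_diff[OF smooth_disp[OF smooth] smooth_const, of "Suc i"]
    by (simp add: funpow_deriv_const del: funpow.simps)
  have "\<bar>(deriv ^^ 1) \<phi> y\<bar> \<le> interpolation_const (real N * near_ratio ^ (2 * N)) (Suc R) *
    (exp (real N * V) * (real N * max_log_deriv \<alpha>) * disp \<alpha>' x / s ^ 1
      + chain_jet_const (iterate_jet_const R) R * exp V * (roughness \<alpha> / s) ^ R * s ^ (Suc R - 1))"
  proof (rule funpow_deriv_interpolation[where p=x and q="\<Phi> (real N * \<alpha>) x" and x="\<lambda>i. \<Phi> (real i * \<alpha>) x"])
    show "smooth_real \<phi>" unfolding \<phi>_def by (intro smooth_diff smooth_disp smooth smooth_const)
    show "\<Phi> (real N * \<alpha>) x - x \<le> real N * near_ratio ^ (2 * N) * s"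
      using disp_multiple_le_near[OF scale, of N x] by (simp add: s_def disp_def)
  next
    fix i :: nat assume "i < 2 ^ Suc R"
    then have "i \<le> N" by (simp add: N_def)
    then show "\<Phi> (real i * \<alpha>) x \<in> {x..\<Phi> (real N * \<alpha>) x} \<and>
        \<bar>\<phi> (\<Phi> (real i * \<alpha>) x)\<bar> \<le> exp (real N * V) * (real N * max_log_deriv \<alpha>) * disp \<alpha>' x"
      using disp_next_almost_invariant[OF scale step rough, of i N x] is_scale_pos[OF scale]
      by (simp add: \<phi>_def)
  next
    fix i :: nat assume "Suc i < 2 ^ Suc R"
    then have "i \<le> N" by (simp add: N_def)
    then have "s \<le> disp \<alpha> (\<Phi> (real i * \<alpha>) x)"
      unfolding s_def using is_scale_pos[OF scale] by (intro disp_ge_near[OF scale]) auto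
    then show "\<Phi> (real i * \<alpha>) x + s \<le> \<Phi> (real (Suc i) * \<alpha>) x"
      by (simp add: disp_def \<Phi>_mult_Suc del: of_nat_Suc)
  next
    fix z assume "z \<in> {x..\<Phi> (real N * \<alpha>) x}"
    then show "\<bar>(deriv ^^ Suc R) \<phi> z\<bar>
        \<le> chain_jet_const (iterate_jet_const R) R * exp V * (roughness \<alpha> / s) ^ R"
      unfolding deriv_\<phi> s_def by (intro abs_funpow_deriv_disp_next_le_near \<open>1 \<le> R\<close>) auto
  next
    have "1 \<le> real N" using one_le_power[of "2 :: real" "Suc R"] by (simp add: N_def)
    then have "1 * \<alpha> \<le> real N * \<alpha>" using is_scale_pos[OF scale] by (intro mult_right_mono) auto
    then have "\<Phi> \<alpha> x \<le> \<Phi> (real N * \<alpha>) x" by simp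
    then have "y \<le> \<Phi> (real N * \<alpha>) x" using y(2) by linarith
    then show "y \<in> {x..\<Phi> (real N * \<alpha>) x}" using y(1) by simp
  qed (use s in auto)
  then show ?thesis using deriv_\<phi>[of 0] by simp
qed

lemma abs_deriv_disp_next_le:
  assumes "1 \<le> R" "x \<le> y" "y \<le> \<Phi> \<alpha> x"
  shows "\<bar>deriv (disp \<alpha>') y\<bar>
      \<le> next_disp_const R * (max_log_deriv \<alpha> * disp \<alpha>' x / disp \<alpha> x + roughness \<alpha> ^ R)"
proof -
  define N where "N = (2 :: nat) ^ Suc R"
  define C where "C = interpolation_const (real N * near_ratio ^ (2 * N)) (Suc R)"
  define D where "D = exp (real N * V) * real N * near_ratio ^ N"
  define E where "E = chain_jet_const (iterate_jet_const R) R * exp V"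
  define p where "p = max_log_deriv \<alpha> * disp \<alpha>' x / disp \<alpha> x"
  define q where "q = roughness \<alpha> ^ R"
  have ratio: "0 < near_ratio" using near_ratio_ge_1 by simp
  have nonneg: "0 \<le> C" "0 \<le> D" "0 \<le> E" "0 \<le> p" "0 \<le> q"
    using interpolation_const_nonneg near_ratio_ge_1 chain_jet_const_ge_1[of "iterate_jet_const R" R]
      max_log_deriv_nonneg[OF is_scale_smooth[OF scale]] disp_scale_pos[OF scale step, of x]
      disp_step_pos[OF scale step, of x] roughness_pos[OF scale]
        by (auto simp: C_def D_def E_def p_def q_def)
  have "\<bar>deriv (disp \<alpha>') y\<bar>
      \<le> C * (exp (real N * V) * (real N * max_log_deriv \<alpha>) * disp \<alpha>' x / (disp \<alpha> x / near_ratio ^ N)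
      + E * (roughness \<alpha> / (disp \<alpha> x / near_ratio ^ N)) ^ R * (disp \<alpha> x / near_ratio ^ N) ^ R)"
    using deriv_disp_next_interpolation[OF assms] by (simp only: C_def E_def N_def)
  also have "\<dots> = C * (D * p + E * q)"
    using disp_scale_pos[OF scale step, of x] ratio
    by (simp add: D_def p_def q_def power_divide power_mult_distrib)
  also have "\<dots> \<le> C * ((D + E) * (p + q))"
    using nonneg by (intro mult_left_mono) (simp_all add: distrib_left distrib_right)
  also have "\<dots> \<le> (1 + C * (D + E)) * (p + q)" using nonneg by (simp add: distrib_right mult.assoc)
  also have "1 + C * (D + E) = next_disp_const R"
    by (simp only: next_disp_const_def Let_def C_def D_def E_def N_def)
  finally show ?thesis by (simp only: p_def q_def)
qed

end

end

section \<open>Passing through the scales\<close>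

lemma floor_multiple:
  fixes a b :: real
  assumes "0 < b" "0 \<le> a"
  obtains t :: nat where "real t * b \<le> a" "a < real (Suc t) * b"
proof
  let ?t = "nat \<lfloor>a / b\<rfloor>"
  have "0 \<le> a / b" using assms by simp
  then have "real ?t \<le> a / b" "a / b < real (Suc ?t)" by linarith+
  then show "real ?t * b \<le> a" "a < real (Suc ?t) * b"
    using assms by (simp_all only: pos_le_divide_eq pos_divide_less_eq)
qed

lemma powr_le_half_steps:
  fixes a b e :: real
  assumes "0 < b" "8 * b \<le> a" "a < real (Suc t) * b" "e \<le> 1 / 2"
  shows "a powr e \<le> real t / 2 * b powr e"
proof -
  define \<tau> where "\<tau> = a / b"
  have \<tau>: "8 \<le> \<tau>" "\<tau> < real t + 1" using assms by (simp_all add: \<tau>_def field_simps)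
  have "\<tau> powr e \<le> \<tau> powr (1/2)" using \<tau> assms by (intro powr_mono) auto
  also have "\<dots> = sqrt \<tau>" using \<tau> by (simp add: powr_half_sqrt)
  also have "\<dots> \<le> real t / 2"
  proof -
    have "(16/7)\<^sup>2 \<le> \<tau>" using \<tau> by (simp add: power2_eq_square)
    then have "16/7 \<le> sqrt \<tau>" using real_le_rsqrt by blast
    then have "16/7 * sqrt \<tau> \<le> sqrt \<tau> * sqrt \<tau>" using \<tau> by (intro mult_right_mono) auto
    also have "\<dots> = \<tau>" using \<tau> by simp
    finally show ?thesis using \<tau> by linarith
  qed
  finally have "\<tau> powr e * b powr e \<le> real t / 2 * b powr e" by (intro mult_right_mono) auto
  moreover have "\<tau> powr e * b powr e = a powr e" using assms by (simp add: \<tau>_def flip: powr_mult)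
  ultimately show ?thesis by simp
qed

context flow_generators
begin

definition dichotomy_const :: "nat \<Rightarrow> real" where
  "dichotomy_const R = 16 * next_disp_const (Suc R)"

lemma dichotomy_const_ge_1: "1 \<le> dichotomy_const R"
  using next_disp_const_ge_1[of "Suc R"] by (simp add: dichotomy_const_def)

lemma steps_ge_8:
  assumes "scale_step \<alpha> \<alpha>' c l" "\<alpha> < real (Suc t) * \<alpha>'"
  shows "8 \<le> t"
proof -
  have "8 * \<alpha>' < real (Suc t) * \<alpha>'" using scale_step_le[OF assms(1)] assms(2) by linarith
  then have "8 < real (Suc t)" using scale_step_pos[OF assms(1)] by (simp only: mult_less_cancel_right_pos)
  then show ?thesis by linarith
qed

lemma scale_step_orbit:
  assumes "scale_step \<alpha> \<alpha>' c l" "real t * \<alpha>' \<le> \<alpha>" "i \<le> t"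
  shows "x \<le> \<Phi> (real i * \<alpha>') x" "\<Phi> (real i * \<alpha>') x \<le> \<Phi> \<alpha> x"
proof -
  have "real i * \<alpha>' \<le> real t * \<alpha>'"
    using assms(3) scale_step_pos[OF assms(1)] by (intro mult_right_mono) auto
  then show "\<Phi> (real i * \<alpha>') x \<le> \<Phi> \<alpha> x" using assms(2) by simp
  show "x \<le> \<Phi> (real i * \<alpha>') x" using scale_step_pos[OF assms(1)] by simp
qed

lemma multiple_disp_next_le:
  assumes step: "scale_step \<alpha> \<alpha>' c l" and t: "real t * \<alpha>' \<le> \<alpha>"
    and lower: "\<And>y. x \<le> y \<Longrightarrow> y \<le> \<Phi> \<alpha> x \<Longrightarrow> 7/8 * disp \<alpha>' x \<le> disp \<alpha>' y"
  shows "7/8 * real t * disp \<alpha>' x \<le> disp \<alpha> x"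
proof -
  have "7/8 * real t * disp \<alpha>' x = (\<Sum>i<t. 7/8 * disp \<alpha>' x)" by simp
  also have "\<dots> \<le> disp (real t * \<alpha>') x"
    unfolding disp_mult using scale_step_orbit[OF step t] by (intro sum_mono lower) auto
  also have "\<dots> \<le> disp \<alpha> x" by (rule disp_mono[OF t])
  finally show ?thesis .
qed

context
  fixes \<alpha> \<alpha>' c :: real and l R :: nat
  assumes scale: "is_scale \<alpha>" and step: "scale_step \<alpha> \<alpha>' c l" and next_scale: "max_log_deriv \<alpha>' \<le> V"
    and small: "dichotomy_const R * roughness \<alpha> \<le> 1"
begin

lemma roughness_le_1: "roughness \<alpha> \<le> 1"
proof -
  have "1 * roughness \<alpha> \<le> dichotomy_const R * roughness \<alpha>"
    using roughness_pos[OF scale] by (intro mult_right_mono dichotomy_const_ge_1) auto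
  then show ?thesis using small by linarith
qed

lemma deriv_disp_next_le_roughness:
  assumes "x \<le> y" "y \<le> \<Phi> \<alpha> x"
  shows "\<bar>deriv (disp \<alpha>') y\<bar>
    \<le> next_disp_const (Suc R) * (roughness \<alpha> * (disp \<alpha>' x / disp \<alpha> x) + roughness \<alpha> ^ Suc R)"
proof -
  have "max_log_deriv \<alpha> * (disp \<alpha>' x / disp \<alpha> x) \<le> roughness \<alpha> * (disp \<alpha>' x / disp \<alpha> x)"
    using disp_scale_pos[OF scale step, of x] disp_step_pos[OF scale step, of x]
    by (intro mult_right_mono max_log_deriv_le_roughness scale) simp
  then have "next_disp_const (Suc R) * (max_log_deriv \<alpha> * disp \<alpha>' x / disp \<alpha> x + roughness \<alpha> ^ Suc R)
      \<le> next_disp_const (Suc R) * (roughness \<alpha> * (disp \<alpha>' x / disp \<alpha> x) + roughness \<alpha> ^ Suc R)"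
    using next_disp_const_ge_1[of "Suc R"] by (intro mult_left_mono) auto
  then show ?thesis
    using abs_deriv_disp_next_le[OF scale step roughness_le_1 next_scale _ assms, of "Suc R"] by simp
qed

lemma disp_next_variation:
  assumes y: "x \<le> y" "y \<le> \<Phi> \<alpha> x"
  shows "\<bar>disp \<alpha>' y - disp \<alpha>' x\<bar>
    \<le> next_disp_const (Suc R) * (roughness \<alpha> * disp \<alpha>' x + roughness \<alpha> ^ Suc R * disp \<alpha> x)"
proof -
  let ?b = "next_disp_const (Suc R) * (roughness \<alpha> * (disp \<alpha>' x / disp \<alpha> x) + roughness \<alpha> ^ Suc R)"
  note pos = disp_scale_pos[OF scale step, of x]
  have "\<bar>disp \<alpha>' y - disp \<alpha>' x\<bar> \<le> ?b * \<bar>y - x\<bar>"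
    using deriv_disp_next_le_roughness y is_scale_pos[OF scale]
    by (intro smooth_diff_le[OF smooth_disp[OF scale_step_smooth[OF step]], of "{x..\<Phi> \<alpha> x}"]) auto
  also have "\<dots> \<le> ?b * disp \<alpha> x"
    using y next_disp_const_ge_1[of "Suc R"] roughness_pos[OF scale] pos disp_step_pos[OF scale step, of x]
    by (intro mult_left_mono) (auto simp: disp_def)
  also have "\<dots> = next_disp_const (Suc R) * (roughness \<alpha> * disp \<alpha>' x + roughness \<alpha> ^ Suc R * disp \<alpha> x)"
    using pos by (simp add: distrib_right)
  finally show ?thesis .
qed

lemma disp_next_nearly_constant:
  assumes large: "roughness \<alpha> ^ R * disp \<alpha> x \<le> disp \<alpha>' x" and y: "x \<le> y" "y \<le> \<Phi> \<alpha> x"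
  shows "\<bar>deriv (disp \<alpha>') y\<bar> \<le> dichotomy_const R * roughness \<alpha> * (disp \<alpha>' x / disp \<alpha> x)"
    and "7/8 * disp \<alpha>' x \<le> disp \<alpha>' y"
proof -
  let ?C = "next_disp_const (Suc R)" and ?\<eta> = "roughness \<alpha>" and ?q = "disp \<alpha>' x / disp \<alpha> x"
  note pos = disp_scale_pos[OF scale step, of x] disp_step_pos[OF scale step, of x] roughness_pos[OF scale]
  have "?\<eta> ^ R \<le> ?q" using large pos by (simp add: field_simps)
  then have "?\<eta> ^ Suc R \<le> ?\<eta> * ?q" unfolding power_Suc using pos by (intro mult_left_mono) auto
  moreover have "0 \<le> ?\<eta> * ?q" using pos by simp
  ultimately have "?C * (?\<eta> * ?q + ?\<eta> ^ Suc R) \<le> ?C * (16 * (?\<eta> * ?q))"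
    using next_disp_const_ge_1[of "Suc R"] by (intro mult_left_mono) linarith+
  then show "\<bar>deriv (disp \<alpha>') y\<bar> \<le> dichotomy_const R * ?\<eta> * ?q"
    using deriv_disp_next_le_roughness[OF y] by (simp add: dichotomy_const_def mult_ac)
  have "?\<eta> ^ Suc R * disp \<alpha> x \<le> ?\<eta> * disp \<alpha>' x" using large pos by (simp add: mult.assoc)
  then have "?C * (?\<eta> * disp \<alpha>' x + ?\<eta> ^ Suc R * disp \<alpha> x) \<le> ?C * (?\<eta> * disp \<alpha>' x + ?\<eta> * disp \<alpha>' x)"
    using next_disp_const_ge_1[of "Suc R"] by (intro mult_left_mono add_left_mono) auto
  also have "\<dots> = (dichotomy_const R * ?\<eta>) * (disp \<alpha>' x / 8)" by (simp add: dichotomy_const_def)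
  also have "\<dots> \<le> 1 * (disp \<alpha>' x / 8)" using small pos by (intro mult_right_mono) auto
  finally show "7/8 * disp \<alpha>' x \<le> disp \<alpha>' y" using disp_next_variation[OF y] by linarith
qed

lemma many_steps_if_disp_next_small:
  assumes small_disp: "disp \<alpha>' x < roughness \<alpha> ^ R * disp \<alpha> x"
    and t: "real t * \<alpha>' \<le> \<alpha>" "\<alpha> < real (Suc t) * \<alpha>'"
  shows "1 \<le> dichotomy_const R * roughness \<alpha> ^ R * real (Suc t)"
proof -
  let ?C = "next_disp_const (Suc R)" and ?b = "roughness \<alpha> ^ R * disp \<alpha> x"
  note pos = disp_scale_pos[OF scale step, of x] disp_step_pos[OF scale step, of x] roughness_pos[OF scale]
  have upper: "disp \<alpha>' y \<le> 16 * ?C * ?b" if y: "x \<le> y" "y \<le> \<Phi> \<alpha> x" for y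
  proof -
    have "roughness \<alpha> * disp \<alpha>' x \<le> 1 * ?b"
      using small_disp pos roughness_le_1 by (intro mult_mono) auto
    moreover have "roughness \<alpha> ^ Suc R * disp \<alpha> x \<le> 1 * ?b"
      using pos roughness_le_1 by (simp add: mult.assoc mult_left_le_one_le)
    ultimately have "?C * (roughness \<alpha> * disp \<alpha>' x + roughness \<alpha> ^ Suc R * disp \<alpha> x) \<le> ?C * (2 * ?b)"
      using next_disp_const_ge_1[of "Suc R"] by (intro mult_left_mono) auto
    moreover have "1 * ?b \<le> ?C * ?b"
      using next_disp_const_ge_1[of "Suc R"] pos by (intro mult_right_mono) auto
    ultimately have "disp \<alpha>' y \<le> 3 * (?C * ?b)" using disp_next_variation[OF y] small_disp by linarith
    also have "\<dots> \<le> 16 * (?C * ?b)" using next_disp_const_ge_1[of "Suc R"] pos by simp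
    finally show ?thesis by simp
  qed
  have "disp \<alpha> x \<le> disp (real (Suc t) * \<alpha>') x" using t by (intro disp_mono) simp
  also have "\<dots> \<le> (\<Sum>i<Suc t. 16 * ?C * ?b)"
    unfolding disp_mult using scale_step_orbit[OF step t(1)] by (intro sum_mono upper) auto
  finally have "1 * disp \<alpha> x \<le> (dichotomy_const R * roughness \<alpha> ^ R * real (Suc t)) * disp \<alpha> x"
    by (simp add: dichotomy_const_def mult_ac)
  then show ?thesis using pos(1) by (simp only: mult_le_cancel_right_pos)
qed

end

end

locale diophantine_flow = flow_generators +
  fixes P :: nat and \<alpha>\<^sub>0 :: real
  assumes P_ge_1: "1 \<le> P" and \<alpha>\<^sub>0: "0 < \<alpha>\<^sub>0" "\<alpha>\<^sub>0 \<le> 1"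
    and ex_step: "0 < \<alpha> \<Longrightarrow> \<alpha> < \<alpha>\<^sub>0 \<Longrightarrow> \<exists>\<alpha>' c l. scale_step \<alpha> \<alpha>' c l \<and> \<alpha> ^ P \<le> \<alpha>'"
    and ex_scale: "0 < e \<Longrightarrow> \<exists>\<alpha>. is_scale \<alpha> \<and> \<alpha> < e"
begin

definition next_scale :: "real \<Rightarrow> real" where
  "next_scale \<alpha> = (SOME \<alpha>'. \<exists>c l. scale_step \<alpha> \<alpha>' c l \<and> \<alpha> ^ P \<le> \<alpha>')"

lemma next_scale:
  assumes "0 < \<alpha>" "\<alpha> < \<alpha>\<^sub>0"
  obtains c l where "scale_step \<alpha> (next_scale \<alpha>) c l" "\<alpha> ^ P \<le> next_scale \<alpha>"
  using someI_ex[OF ex_step[OF assms]] that unfolding next_scale_def by blast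

lemma next_scale_steps:
  assumes "0 < \<alpha>" "\<alpha> < \<alpha>\<^sub>0"
  obtains c l t where "scale_step \<alpha> (next_scale \<alpha>) c l" "\<alpha> ^ P \<le> next_scale \<alpha>"
    "real t * next_scale \<alpha> \<le> \<alpha>" "\<alpha> < real (Suc t) * next_scale \<alpha>" "8 \<le> t"
proof -
  obtain c l where step: "scale_step \<alpha> (next_scale \<alpha>) c l" "\<alpha> ^ P \<le> next_scale \<alpha>"
    using next_scale[OF assms] .
  moreover obtain t where t: "real t * next_scale \<alpha> \<le> \<alpha>" "\<alpha> < real (Suc t) * next_scale \<alpha>"
    using floor_multiple[OF scale_step_pos[OF step(1)] less_imp_le[OF assms(1)]] .
  ultimately show ?thesis using that steps_ge_8 by blast
qed

lemma next_scale_is_scale: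
  assumes \<alpha>: "is_scale \<alpha>" "\<alpha> < \<alpha>\<^sub>0" and "max_log_deriv (next_scale \<alpha>) \<le> V"
  shows "is_scale (next_scale \<alpha>)" and "next_scale \<alpha> \<le> \<alpha>"
proof -
  obtain c l where step: "scale_step \<alpha> (next_scale \<alpha>) c l"
    by (rule next_scale[OF is_scale_pos[OF \<alpha>(1)] \<alpha>(2)])
  show le: "next_scale \<alpha> \<le> \<alpha>" using scale_step_le[OF step] is_scale_pos[OF \<alpha>(1)] by linarith
  show "is_scale (next_scale \<alpha>)"
    using le is_scale_le_1[OF \<alpha>(1)] assms(3) scale_step_smooth[OF step] scale_step_pos[OF step]
    by (intro is_scaleI) auto
qed

subsection \<open>Arbitrarily small scales with small slopes\<close>

lemma max_log_deriv_next_scale_le: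
  assumes \<alpha>: "is_scale \<alpha>" "\<alpha> < \<alpha>\<^sub>0"
  shows "max_log_deriv (next_scale \<alpha>) \<le> max_log_deriv \<alpha> / 8 + flatness_const * max_disp \<alpha>"
proof -
  obtain c l t where step: "scale_step \<alpha> (next_scale \<alpha>) c l"
    and t: "real t * next_scale \<alpha> \<le> \<alpha>" "8 \<le> t"
    by (rule next_scale_steps[OF is_scale_pos[OF \<alpha>(1)] \<alpha>(2)])
  have "max_log_deriv (next_scale \<alpha>) \<le> max_log_deriv \<alpha> / real t + flatness_const * max_disp \<alpha>"
    using t by (intro max_log_deriv_recursion[OF \<alpha>(1) step]) auto
  moreover have "max_log_deriv \<alpha> / real t \<le> max_log_deriv \<alpha> / 8"
    using t max_log_deriv_nonneg[OF is_scale_smooth[OF \<alpha>(1)]] by (intro divide_left_mono) auto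
  ultimately show ?thesis by linarith
qed

lemma iterated_scales_slope_decay:
  assumes \<beta>: "is_scale \<beta>" "\<beta> < \<alpha>\<^sub>0" and e: "0 \<le> e" "2 * e \<le> V"
    and small: "\<And>\<alpha>. \<alpha> \<le> \<beta> \<Longrightarrow> flatness_const * max_disp \<alpha> \<le> e"
  shows "is_scale ((next_scale ^^ n) \<beta>)" "(next_scale ^^ n) \<beta> \<le> \<beta>"
    "max_log_deriv ((next_scale ^^ n) \<beta>) \<le> V / 4 ^ n + 2 * e"
proof -
  have "is_scale ((next_scale ^^ n) \<beta>) \<and> (next_scale ^^ n) \<beta> \<le> \<beta> \<and>
      max_log_deriv ((next_scale ^^ n) \<beta>) \<le> V / 4 ^ n + 2 * e"
  proof (induction n)
    case 0
    then show ?case using \<beta> is_scale_max_log_deriv_le[OF \<beta>(1)] e by simp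
  next
    case (Suc n)
    define \<alpha> where "\<alpha> = (next_scale ^^ n) \<beta>"
    have \<alpha>: "is_scale \<alpha>" "\<alpha> < \<alpha>\<^sub>0" "\<alpha> \<le> \<beta>" and IH: "max_log_deriv \<alpha> \<le> V / 4 ^ n + 2 * e"
      using Suc \<beta>(2) by (auto simp: \<alpha>_def)
    have step: "max_log_deriv (next_scale \<alpha>) \<le> max_log_deriv \<alpha> / 8 + e"
      using max_log_deriv_next_scale_le[OF \<alpha>(1,2)] small[OF \<alpha>(3)] by linarith
    then have "max_log_deriv (next_scale \<alpha>) \<le> V"
      using is_scale_max_log_deriv_le[OF \<alpha>(1)] e V_ge_1 by linarith
    then have "is_scale (next_scale \<alpha>)" "next_scale \<alpha> \<le> \<beta>" using next_scale_is_scale[OF \<alpha>(1,2)] \<alpha>(3) by auto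
    moreover have "max_log_deriv (next_scale \<alpha>) \<le> V / 4 ^ Suc n + 2 * e"
    proof -
      have "V / 4 ^ Suc n = V / 4 ^ n / 4" "0 \<le> V / 4 ^ n" using V_ge_1 by simp_all
      then show ?thesis using step IH e(1) by linarith
    qed
    ultimately show ?case by (simp add: \<alpha>_def)
  qed
  then show "is_scale ((next_scale ^^ n) \<beta>)" "(next_scale ^^ n) \<beta> \<le> \<beta>"
    "max_log_deriv ((next_scale ^^ n) \<beta>) \<le> V / 4 ^ n + 2 * e" by auto
qed

lemma ex_scale_small_disp_slope:
  assumes e: "0 < e"
  obtains \<alpha> where "is_scale \<alpha>" "\<alpha> < e" "\<alpha> < \<alpha>\<^sub>0" "max_disp \<alpha> \<le> e" "max_log_deriv \<alpha> \<le> e"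
proof -
  define d where "d = min e V / 4"
  have d: "0 < d" "4 * d \<le> e" "2 * d \<le> V" using e V_ge_1 by (auto simp: d_def)
  obtain r where r: "0 < r" "max_disp r \<le> min e (d / (flatness_const + 1))"
    using max_disp_small[of "min e (d / (flatness_const + 1))"] e d flatness_const_nonneg by auto
  obtain \<beta> where \<beta>: "is_scale \<beta>" "\<beta> < min r (min \<alpha>\<^sub>0 e)"
    using ex_scale[of "min r (min \<alpha>\<^sub>0 e)"] r \<alpha>\<^sub>0 e by auto
  have disp: "max_disp \<alpha> \<le> e" "flatness_const * max_disp \<alpha> \<le> d" if "\<alpha> \<le> \<beta>" for \<alpha>
  proof -
    have disp_le: "max_disp \<alpha> \<le> max_disp r" using that \<beta>(2) by (intro max_disp_mono) simp
    then show "max_disp \<alpha> \<le> e" using r(2) by simp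
    have "flatness_const * max_disp \<alpha> \<le> flatness_const * (d / (flatness_const + 1))"
      using disp_le r(2) flatness_const_nonneg by (intro mult_left_mono) auto
    also have "\<dots> \<le> d" using flatness_const_nonneg d(1) by (simp add: field_simps)
    finally show "flatness_const * max_disp \<alpha> \<le> d" .
  qed
  obtain n where "2 * V / e < 4 ^ n" using real_arch_pow[of 4 "2 * V / e"] by auto
  then have "V / 4 ^ n \<le> e / 2" using e by (simp add: field_simps)
  have "\<beta> < \<alpha>\<^sub>0" "\<beta> < e" using \<beta>(2) by simp_all
  note iter = iterated_scales_slope_decay[OF \<beta>(1) \<open>\<beta> < \<alpha>\<^sub>0\<close> less_imp_le[OF d(1)] d(3) disp(2), of n]
  have "max_log_deriv ((next_scale ^^ n) \<beta>) \<le> e" using iter(3) d(2) \<open>V / 4 ^ n \<le> e / 2\<close> by linarith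
  then show ?thesis
    using that[OF iter(1)] iter(2) disp(1)[OF iter(2)] \<open>\<beta> < \<alpha>\<^sub>0\<close> \<open>\<beta> < e\<close> by linarith
qed

subsection \<open>Power decay of the roughness\<close>

definition slope_decay_const :: real where "slope_decay_const = 2 * (flatness_const + 1)"

definition roughness_decay_const :: real where
  "roughness_decay_const = roughness_const * (slope_decay_const + 1)"

definition power_decay :: "real \<Rightarrow> real \<Rightarrow> bool" where
  "power_decay \<kappa> \<alpha> \<longleftrightarrow> is_scale \<alpha> \<and> max_disp \<alpha> \<le> \<alpha> powr (2 * real P * \<kappa>) \<and>
    max_log_deriv \<alpha> \<le> slope_decay_const * \<alpha> powr \<kappa>"

definition decay_threshold :: real where
  "decay_threshold = 1 / (dichotomy_const (4 * P\<^sup>2) * roughness_decay_const\<^sup>2 * slope_decay_const)"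

lemma slope_decay_const_ge_2: "2 \<le> slope_decay_const"
  using flatness_const_nonneg by (simp add: slope_decay_const_def)

lemma roughness_decay_const_ge_1: "1 \<le> roughness_decay_const"
  using mult_mono[OF roughness_const_ge_1, of 1 "slope_decay_const + 1"]
    roughness_const_ge_1 slope_decay_const_ge_2
  by (simp add: roughness_decay_const_def)

lemma decay_threshold_pos: "0 < decay_threshold"
  and decay_threshold_less_1: "decay_threshold < 1"
  and slope_decay_threshold: "slope_decay_const * decay_threshold \<le> 1"
  and roughness_decay_threshold: "roughness_decay_const\<^sup>2 * decay_threshold \<le> 1"
  and dichotomy_decay_threshold: "dichotomy_const (4 * P\<^sup>2) * roughness_decay_const * decay_threshold \<le> 1"
proof -
  let ?D = "dichotomy_const (4 * P\<^sup>2)" and ?C = "roughness_decay_const" and ?Q = "slope_decay_const"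
  have square: "1 \<le> ?C\<^sup>2" "?C \<le> ?C\<^sup>2"
    using one_le_power[OF roughness_decay_const_ge_1] self_le_power[OF roughness_decay_const_ge_1, of 2]
    by simp_all
  note ge_1 = dichotomy_const_ge_1[of "4 * P\<^sup>2"] roughness_decay_const_ge_1 slope_decay_const_ge_2 square
  have prod: "1 * 1 * ?Q \<le> ?D * ?C\<^sup>2 * ?Q" "1 * ?C\<^sup>2 * 1 \<le> ?D * ?C\<^sup>2 * ?Q" "?D * ?C * 1 \<le> ?D * ?C\<^sup>2 * ?Q"
    using ge_1 by (intro mult_mono; simp)+
  have pos: "0 < ?D * ?C\<^sup>2 * ?Q" using prod(1) slope_decay_const_ge_2 by linarith
  then show "0 < decay_threshold" by (simp add: decay_threshold_def)
  have quotient: "x * decay_threshold = x / (?D * ?C\<^sup>2 * ?Q)" for x by (simp add: decay_threshold_def)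
  show "?Q * decay_threshold \<le> 1" "?C\<^sup>2 * decay_threshold \<le> 1" "?D * ?C * decay_threshold \<le> 1"
    unfolding quotient divide_le_eq_1_pos[OF pos] using prod by simp_all
  have "1 < ?D * ?C\<^sup>2 * ?Q" using prod(1) slope_decay_const_ge_2 by linarith
  then show "decay_threshold < 1" by (simp add: decay_threshold_def)
qed

lemma roughness_le_powr:
  assumes \<alpha>: "power_decay \<kappa> \<alpha>" and "0 < \<kappa>"
  shows "roughness \<alpha> \<le> roughness_decay_const * \<alpha> powr \<kappa>"
proof -
  have scale: "is_scale \<alpha>" and disp: "max_disp \<alpha> \<le> \<alpha> powr (2 * real P * \<kappa>)"
    and slope: "max_log_deriv \<alpha> \<le> slope_decay_const * \<alpha> powr \<kappa>" using \<alpha> by (auto simp: power_decay_def)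
  have "sqrt (max_disp \<alpha>) \<le> sqrt (\<alpha> powr (2 * real P * \<kappa>))" using disp by (rule real_sqrt_le_mono)
  also have "\<dots> = \<alpha> powr (real P * \<kappa>)" by (simp add: powr_powr flip: powr_half_sqrt)
  also have "\<dots> \<le> \<alpha> powr \<kappa>"
    using is_scale_pos[OF scale] is_scale_le_1[OF scale] P_ge_1 \<open>0 < \<kappa>\<close> by (intro powr_mono') auto
  finally have "max_log_deriv \<alpha> + sqrt (max_disp \<alpha>) \<le> (slope_decay_const + 1) * \<alpha> powr \<kappa>"
    using slope by (simp add: distrib_right)
  then show ?thesis
    unfolding roughness_def roughness_decay_const_def using roughness_const_ge_1
    by (simp add: mult.assoc mult_left_mono)
qed

context
  fixes \<kappa> \<alpha> :: real
  assumes \<kappa>: "0 < \<kappa>" "4 * real P * \<kappa> \<le> 1"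
    and decay: "power_decay \<kappa> \<alpha>" and below: "\<alpha> < \<alpha>\<^sub>0" and threshold: "\<alpha> powr \<kappa> \<le> decay_threshold"
begin

lemma scale_of_decay: "is_scale \<alpha>"
  using decay by (simp add: power_decay_def)

lemma powr_le_next_powr:
  assumes "0 \<le> e"
  shows "\<alpha> powr (real P * e) \<le> next_scale \<alpha> powr e"
proof -
  note pos = is_scale_pos[OF scale_of_decay]
  obtain c l where "\<alpha> ^ P \<le> next_scale \<alpha>" by (rule next_scale[OF pos below])
  then have "(\<alpha> ^ P) powr e \<le> next_scale \<alpha> powr e" using assms pos by (intro powr_mono2) auto
  then show ?thesis using pos by (simp add: powr_powr flip: powr_realpow)
qed

lemma max_log_deriv_next_decay: "max_log_deriv (next_scale \<alpha>) \<le> slope_decay_const * next_scale \<alpha> powr \<kappa>"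
proof -
  let ?v = "next_scale \<alpha> powr \<kappa>"
  note pos = is_scale_pos[OF scale_of_decay]
  obtain c l t where step: "scale_step \<alpha> (next_scale \<alpha>) c l"
    and t: "real t * next_scale \<alpha> \<le> \<alpha>" "\<alpha> < real (Suc t) * next_scale \<alpha>" "8 \<le> t"
    using next_scale_steps[OF pos below] .
  have "1 * \<kappa> \<le> real P * \<kappa>" using P_ge_1 \<kappa> by (intro mult_right_mono) auto
  then have "\<kappa> \<le> 1 / 2" using \<kappa> by linarith
  then have "\<alpha> powr \<kappa> \<le> real t / 2 * ?v"
    using scale_step_pos[OF step] scale_step_le[OF step] t by (intro powr_le_half_steps) auto
  then have "slope_decay_const * \<alpha> powr \<kappa> \<le> slope_decay_const * (real t / 2 * ?v)"
    using slope_decay_const_ge_2 by (intro mult_left_mono) auto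
  also have "\<dots> = (flatness_const + 1) * ?v * real t" by (simp add: slope_decay_const_def)
  finally have "max_log_deriv \<alpha> \<le> (flatness_const + 1) * ?v * real t"
    using decay unfolding power_decay_def by linarith
  then have "max_log_deriv \<alpha> / real t \<le> (flatness_const + 1) * ?v" using t(3) by (simp add: divide_le_eq)
  moreover have "flatness_const * max_disp \<alpha> \<le> flatness_const * ?v"
  proof (rule mult_left_mono[OF _ flatness_const_nonneg])
    have "max_disp \<alpha> \<le> \<alpha> powr (2 * real P * \<kappa>)" using decay by (simp add: power_decay_def)
    also have "\<dots> \<le> \<alpha> powr (real P * \<kappa>)"
      using pos is_scale_le_1[OF scale_of_decay] \<kappa> by (intro powr_mono') auto
    also have "\<dots> \<le> ?v" using \<kappa> by (intro powr_le_next_powr) auto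
    finally show "max_disp \<alpha> \<le> ?v" .
  qed
  moreover have "max_log_deriv (next_scale \<alpha>) \<le> max_log_deriv \<alpha> / real t + flatness_const * max_disp \<alpha>"
    using t by (intro max_log_deriv_recursion[OF scale_of_decay step]) auto
  moreover have "(flatness_const + 1) * ?v + flatness_const * ?v \<le> slope_decay_const * ?v"
    by (simp add: slope_decay_const_def distrib_right)
  ultimately show ?thesis by linarith
qed

lemma next_scale_below_threshold: "next_scale \<alpha> powr \<kappa> \<le> decay_threshold"
  and max_log_deriv_next_le_1: "max_log_deriv (next_scale \<alpha>) \<le> 1"
proof -
  note pos = is_scale_pos[OF scale_of_decay]
  obtain c l where step: "scale_step \<alpha> (next_scale \<alpha>) c l" by (rule next_scale[OF pos below])
  have "next_scale \<alpha> powr \<kappa> \<le> \<alpha> powr \<kappa>"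
    using scale_step_pos[OF step] scale_step_le[OF step] pos \<kappa> by (intro powr_mono2) auto
  then show le: "next_scale \<alpha> powr \<kappa> \<le> decay_threshold" using threshold by linarith
  then have "slope_decay_const * next_scale \<alpha> powr \<kappa> \<le> slope_decay_const * decay_threshold"
    using slope_decay_const_ge_2 by (intro mult_left_mono) auto
  then show "max_log_deriv (next_scale \<alpha>) \<le> 1"
    using max_log_deriv_next_decay slope_decay_threshold by linarith
qed

lemma dichotomy_applies: "dichotomy_const (4 * P\<^sup>2) * roughness \<alpha> \<le> 1"
proof -
  have "roughness \<alpha> \<le> roughness_decay_const * decay_threshold"
    using roughness_le_powr[OF decay \<kappa>(1)] mult_left_mono[OF threshold, of roughness_decay_const]
      roughness_decay_const_ge_1 by linarith
  then have "dichotomy_const (4 * P\<^sup>2) * roughness \<alpha>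
      \<le> dichotomy_const (4 * P\<^sup>2) * (roughness_decay_const * decay_threshold)"
    using dichotomy_const_ge_1[of "4 * P\<^sup>2"] by (intro mult_left_mono) auto
  then show ?thesis using dichotomy_decay_threshold by (simp add: mult.assoc)
qed

lemma roughness_power_le_next_powr: "roughness \<alpha> ^ (4 * P\<^sup>2) \<le> next_scale \<alpha> powr (2 * real P * \<kappa>)"
proof -
  let ?u = "\<alpha> powr \<kappa>" and ?C = roughness_decay_const
  have "?C\<^sup>2 * ?u \<le> ?C\<^sup>2 * decay_threshold" using threshold by (intro mult_left_mono) auto
  then have "(?C\<^sup>2 * ?u) * ?u \<le> 1 * ?u" using roughness_decay_threshold by (intro mult_right_mono) auto
  then have square: "(?C * ?u)\<^sup>2 \<le> ?u" by (simp add: power2_eq_square mult_ac)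
  have "roughness \<alpha> ^ (4 * P\<^sup>2) \<le> (?C * ?u) ^ (4 * P\<^sup>2)"
    using roughness_le_powr[OF decay \<kappa>(1)] roughness_pos[OF scale_of_decay] by (intro power_mono) auto
  also have "\<dots> = ((?C * ?u)\<^sup>2) ^ (2 * P\<^sup>2)" by (simp flip: power_mult)
  also have "\<dots> \<le> ?u ^ (2 * P\<^sup>2)" using square by (intro power_mono) auto
  also have "\<dots> = \<alpha> powr (real P * (2 * real P * \<kappa>))"
    using is_scale_pos[OF scale_of_decay]
    by (simp add: powr_powr power2_eq_square mult_ac flip: powr_realpow)
  also have "\<dots> \<le> next_scale \<alpha> powr (2 * real P * \<kappa>)" using \<kappa> by (intro powr_le_next_powr) auto
  finally show ?thesis .
qed

lemma max_disp_next_decay: "max_disp (next_scale \<alpha>) \<le> next_scale \<alpha> powr (2 * real P * \<kappa>)"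
proof -
  let ?\<alpha>' = "next_scale \<alpha>" and ?R = "4 * P\<^sup>2" and ?v = "next_scale \<alpha> powr (2 * real P * \<kappa>)"
  note pos = is_scale_pos[OF scale_of_decay]
  obtain c l t where step: "scale_step \<alpha> ?\<alpha>' c l"
    and t: "real t * ?\<alpha>' \<le> \<alpha>" "\<alpha> < real (Suc t) * ?\<alpha>'" "8 \<le> t"
    using next_scale_steps[OF pos below] .
  obtain x where x: "max_disp ?\<alpha>' = disp ?\<alpha>' x" by (rule max_disp_attained)
  have disp_x: "disp \<alpha> x \<le> \<alpha> powr (2 * real P * \<kappa>)"
    using disp_le_max_disp[of \<alpha> x] decay by (simp add: power_decay_def)
  show ?thesis
  proof (cases "roughness \<alpha> ^ ?R * disp \<alpha> x \<le> disp ?\<alpha>' x")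
    case True
    have V: "max_log_deriv ?\<alpha>' \<le> V" using max_log_deriv_next_le_1 V_ge_1 by linarith
    have "7/8 * real t * disp ?\<alpha>' x \<le> disp \<alpha> x"
      by (rule multiple_disp_next_le[OF step t(1)])
        (rule disp_next_nearly_constant(2)[OF scale_of_decay step V dichotomy_applies True])
    also have "\<dots> \<le> real t / 2 * ?v"
      using disp_x powr_le_half_steps[OF scale_step_pos[OF step] _ t(2), of "2 * real P * \<kappa>"]
        scale_step_le[OF step] \<kappa> by linarith
    finally have "real t * (7/8 * disp ?\<alpha>' x) \<le> real t * (1/2 * ?v)" by simp
    then have "7/8 * disp ?\<alpha>' x \<le> 1/2 * ?v" using t(3) by (simp only: mult_le_cancel_left_pos)
    then show ?thesis using x powr_ge_zero[of ?\<alpha>' "2 * real P * \<kappa>"] by linarith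
  next
    case False
    have "disp \<alpha> x \<le> 1"
      using disp_x powr_mono2[of "2 * real P * \<kappa>" \<alpha> 1] pos is_scale_le_1[OF scale_of_decay] \<kappa> by simp
    then have "roughness \<alpha> ^ ?R * disp \<alpha> x \<le> roughness \<alpha> ^ ?R"
      using roughness_pos[OF scale_of_decay] by (intro mult_left_le) auto
    then show ?thesis using False x roughness_power_le_next_powr by linarith
  qed
qed

lemma power_decay_next: "power_decay \<kappa> (next_scale \<alpha>)" and next_scale_below: "next_scale \<alpha> < \<alpha>\<^sub>0"
proof -
  have "max_log_deriv (next_scale \<alpha>) \<le> V" using max_log_deriv_next_le_1 V_ge_1 by linarith
  note next_scale_is_scale[OF scale_of_decay below this]
  then show "power_decay \<kappa> (next_scale \<alpha>)" "next_scale \<alpha> < \<alpha>\<^sub>0"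
    using max_disp_next_decay max_log_deriv_next_decay below by (auto simp: power_decay_def)
qed

end

lemma ex_power_decay_start:
  obtains \<kappa> \<beta> where "0 < \<kappa>" "4 * real P * \<kappa> \<le> 1" "power_decay \<kappa> \<beta>" "\<beta> < \<alpha>\<^sub>0" "\<beta> powr \<kappa> \<le> decay_threshold"
proof -
  let ?d = decay_threshold
  note d = decay_threshold_pos decay_threshold_less_1
  have dP: "0 < ?d ^ (4 * P)" "?d ^ (4 * P) \<le> ?d ^ (2 * P)" "?d ^ (4 * P) \<le> ?d"
    using d P_ge_1 power_decreasing[of 1 "4 * P" ?d] by (auto intro!: power_decreasing)
  obtain \<beta> where \<beta>: "is_scale \<beta>" "\<beta> < ?d ^ (4 * P)" "\<beta> < \<alpha>\<^sub>0" "max_disp \<beta> \<le> ?d ^ (4 * P)"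
    "max_log_deriv \<beta> \<le> ?d ^ (4 * P)"
    using ex_scale_small_disp_slope[OF dP(1)] .
  have \<beta>01: "0 < \<beta>" "\<beta> < 1" using is_scale_pos[OF \<beta>(1)] \<beta>(3) \<alpha>\<^sub>0 by auto
  define \<kappa> where "\<kappa> = ln ?d / ln \<beta>"
  have ln_neg: "ln \<beta> < 0" "ln ?d < 0" using \<beta>01 d by auto
  have \<beta>\<kappa>: "\<beta> powr \<kappa> = ?d" using \<beta>01 d ln_neg by (simp add: powr_def \<kappa>_def)
  have "0 < \<kappa>" using ln_neg by (simp add: \<kappa>_def divide_neg_neg)
  moreover have "4 * real P * \<kappa> \<le> 1"
  proof -
    have "ln \<beta> < ln (?d ^ (4 * P))" using \<beta>01 dP \<beta>(2) by (subst ln_less_cancel_iff) auto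
    then have "ln \<beta> < 4 * real P * ln ?d" using d by (simp add: ln_realpow)
    then show ?thesis using ln_neg by (simp add: \<kappa>_def field_simps)
  qed
  moreover have "power_decay \<kappa> \<beta>"
  proof -
    have "\<beta> powr (2 * real P * \<kappa>) = (\<beta> powr \<kappa>) ^ (2 * P)"
      using \<beta>01 by (simp add: powr_powr mult_ac flip: powr_realpow)
    then have "max_disp \<beta> \<le> \<beta> powr (2 * real P * \<kappa>)" using \<beta>(4) dP(2) \<beta>\<kappa> by simp
    moreover have "1 * ?d \<le> slope_decay_const * ?d"
      using slope_decay_const_ge_2 d by (intro mult_right_mono) auto
    ultimately show ?thesis using \<beta>(1,5) dP(3) \<beta>\<kappa> by (simp add: power_decay_def)
  qed
  ultimately show ?thesis using that \<beta>(3) \<beta>\<kappa> by simp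
qed

theorem ex_roughness_decay:
  "\<exists>\<kappa>>0. \<exists>s. \<forall>k. is_scale (s k) \<and> s k < \<alpha>\<^sub>0 \<and> s (Suc k) = next_scale (s k) \<and>
    max_log_deriv (s (Suc k)) \<le> 1 \<and> roughness (s k) \<le> roughness_decay_const * s k powr \<kappa>"
proof -
  obtain \<kappa> \<beta> where \<kappa>: "0 < \<kappa>" "4 * real P * \<kappa> \<le> 1"
    and \<beta>: "power_decay \<kappa> \<beta>" "\<beta> < \<alpha>\<^sub>0" "\<beta> powr \<kappa> \<le> decay_threshold"
    by (rule ex_power_decay_start)
  define s where "s k = (next_scale ^^ k) \<beta>" for k
  have s_Suc: "s (Suc k) = next_scale (s k)" for k by (simp add: s_def)
  have invariant: "power_decay \<kappa> (s k) \<and> s k < \<alpha>\<^sub>0 \<and> s k powr \<kappa> \<le> decay_threshold" for k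
  proof (induction k)
    case 0
    then show ?case using \<beta> by (simp add: s_def)
  next
    case (Suc k)
    then have inv: "power_decay \<kappa> (s k)" "s k < \<alpha>\<^sub>0" "s k powr \<kappa> \<le> decay_threshold" by auto
    show ?case unfolding s_Suc
      using power_decay_next[OF \<kappa> inv] next_scale_below[OF \<kappa> inv] next_scale_below_threshold[OF \<kappa> inv]
      by blast
  qed
  have "max_log_deriv (s (Suc k)) \<le> 1" "roughness (s k) \<le> roughness_decay_const * s k powr \<kappa>"
    "is_scale (s k)" for k
    using invariant[of k] max_log_deriv_next_le_1[OF \<kappa>] roughness_le_powr[OF _ \<kappa>(1)] s_Suc[of k]
    by (auto simp: power_decay_def)
  then show ?thesis using \<kappa>(1) invariant s_Suc by blast
qed

text \<open>In the second alternative of the dichotomy the number $t$ of steps is larger than every power of $1/\alpha$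
  allowed by the arithmetic condition, once the powers of $\eta$ are known to be powers of $\alpha$.\<close>

lemma few_steps:
  assumes scale: "is_scale \<alpha>" and below: "\<alpha> < \<alpha>\<^sub>0" and t: "real t * next_scale \<alpha> \<le> \<alpha>" "8 \<le> t"
    and rough: "roughness \<alpha> \<le> C * \<alpha> powr \<kappa>" and small: "C\<^sup>2 * \<alpha> powr \<kappa> \<le> 1" and n: "real P + 1 \<le> \<kappa> * real n"
    and D: "0 < D" "4 * D * \<alpha> < 1"
  shows "D * roughness \<alpha> ^ (2 * n) * real (Suc t) < 1"
proof -
  note \<alpha> = is_scale_pos[OF scale] is_scale_le_1[OF scale]
  obtain c l where power: "\<alpha> ^ P \<le> next_scale \<alpha>" by (rule next_scale[OF \<alpha>(1) below])
  have "(C\<^sup>2 * \<alpha> powr \<kappa>) * \<alpha> powr \<kappa> \<le> 1 * \<alpha> powr \<kappa>" using small by (intro mult_right_mono) auto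
  then have square: "(C * \<alpha> powr \<kappa>)\<^sup>2 \<le> \<alpha> powr \<kappa>" by (simp add: power2_eq_square mult_ac)
  have "roughness \<alpha> ^ (2 * n) \<le> (C * \<alpha> powr \<kappa>) ^ (2 * n)"
    using rough roughness_pos[OF scale] by (intro power_mono) auto
  also have "\<dots> = ((C * \<alpha> powr \<kappa>)\<^sup>2) ^ n" by (rule power_mult)
  also have "\<dots> \<le> (\<alpha> powr \<kappa>) ^ n" using square by (intro power_mono) auto
  also have "\<dots> = \<alpha> powr (\<kappa> * real n)" using \<alpha> by (simp add: powr_powr flip: powr_realpow)
  also have "\<dots> \<le> \<alpha> powr (real P + 1)" using \<alpha> n by (intro powr_mono') auto
  also have "\<dots> = \<alpha> ^ P * \<alpha>" using \<alpha> by (simp add: powr_add powr_realpow)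
  also have "\<dots> \<le> next_scale \<alpha> * \<alpha>" using power \<alpha> by (intro mult_right_mono) auto
  finally have "real (Suc t) * roughness \<alpha> ^ (2 * n) \<le> real (Suc t) * (next_scale \<alpha> * \<alpha>)"
    by (intro mult_left_mono) auto
  also have "\<dots> \<le> 2 * (real t * next_scale \<alpha>) * \<alpha>"
  proof -
    have "0 \<le> next_scale \<alpha>" using power \<alpha> zero_le_power[of \<alpha> P] by linarith
    then have "real (Suc t) * next_scale \<alpha> \<le> 2 * real t * next_scale \<alpha>"
      using t(2) by (intro mult_right_mono) auto
    then have "real (Suc t) * next_scale \<alpha> * \<alpha> \<le> 2 * real t * next_scale \<alpha> * \<alpha>"
      by (rule mult_right_mono) (use \<alpha> in simp)
    then show ?thesis by (simp only: mult.assoc)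
  qed
  also have "\<dots> \<le> 2 * 1 * \<alpha>" using t(1) \<alpha> by (intro mult_right_mono) auto
  also have "\<dots> \<le> 4 * \<alpha>" using \<alpha> by simp
  finally have "D * (real (Suc t) * roughness \<alpha> ^ (2 * n)) \<le> D * (4 * \<alpha>)"
    using D by (intro mult_left_mono) auto
  then show ?thesis using D(2) by (simp add: mult_ac)
qed

end

locale scale_sequence = flow_generators +
  fixes s :: "nat \<Rightarrow> real" and \<kappa> C G :: real and P :: nat
  assumes s_scale: "is_scale (s k)" and s_step: "\<exists>b l. scale_step (s k) (s (Suc k)) b l"
    and s_power_le: "s k ^ P \<le> s (Suc k)" and P_ge_1: "1 \<le> P"
    and s_roughness: "roughness (s k) \<le> C * s k powr \<kappa>" and s_roughness_le_1: "roughness (s k) \<le> 1"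
    and \<kappa>_pos: "0 < \<kappa>" and C_pos: "0 < C" and G_ge_1: "1 \<le> G"
    and s_deriv_disp: "x \<le> y \<Longrightarrow> y \<le> \<Phi> (s k) x \<Longrightarrow>
      \<bar>deriv (disp (s (Suc k))) y\<bar> \<le> G * roughness (s k) * (disp (s (Suc k)) x / disp (s k) x)"
    and s_disp: "x \<le> y \<Longrightarrow> y \<le> \<Phi> (s k) x \<Longrightarrow> 7/8 * disp (s (Suc k)) x \<le> disp (s (Suc k)) y"

lemma ex_powr_threshold:
  fixes s :: "nat \<Rightarrow> real"
  assumes "s \<longlonglongrightarrow> 0" "\<And>k. 0 < s k" "0 < \<kappa>"
  obtains K where "\<And>k. K \<le> k \<Longrightarrow> A * s k powr \<kappa> < 1" "\<And>k. K \<le> k \<Longrightarrow> B * s k < 1"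
proof -
  have "(\<lambda>k. s k powr \<kappa>) \<longlonglongrightarrow> 0"
    using assms tendsto_zero_powrI[OF assms(1) tendsto_const[of \<kappa>]] by (auto simp: less_imp_le)
  then have "(\<lambda>k. A * s k powr \<kappa>) \<longlonglongrightarrow> 0" "(\<lambda>k. B * s k) \<longlonglongrightarrow> 0"
    using assms(1) by (auto intro: tendsto_mult_right_zero)
  then have "\<forall>\<^sub>F k in sequentially. A * s k powr \<kappa> < 1 \<and> B * s k < 1"
    by (intro eventually_conj) (auto dest: order_tendstoD(2)[of _ _ _ 1])
  then show ?thesis using that unfolding eventually_sequentially by blast
qed

lemma (in diophantine_flow) next_scale_sequence_tendsto_0:
  assumes "\<And>k. is_scale (s k)" "\<And>k. s k < \<alpha>\<^sub>0" "\<And>k. s (Suc k) = next_scale (s k)"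
  shows "s \<longlonglongrightarrow> 0"
proof -
  note s_pos = is_scale_pos[OF assms(1)]
  have "s k \<le> 1 / 8 ^ k" for k
  proof (induction k)
    case (Suc k)
    obtain c l where "scale_step (s k) (s (Suc k)) c l"
      unfolding assms(3) by (rule next_scale[OF s_pos assms(2)])
    then show ?case using Suc scale_step_le by fastforce
  qed (use is_scale_le_1[OF assms(1)] in simp)
  then show ?thesis
    using s_pos by (intro tendsto_sandwich[OF _ _ tendsto_const LIMSEQ_realpow_zero[of "1 / 8"]])
      (auto simp: power_one_over less_imp_le)
qed

theorem (in diophantine_flow) ex_scale_sequence:
  obtains s \<kappa> C G where "scale_sequence h \<xi> gens V s \<kappa> C G P"
proof -
  let ?C = roughness_decay_const
  obtain \<kappa> s where \<kappa>: "0 < \<kappa>" and s: "\<And>k. is_scale (s k)" "\<And>k. s k < \<alpha>\<^sub>0" "\<And>k. s (Suc k) = next_scale (s k)"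
    and slope: "\<And>k. max_log_deriv (s (Suc k)) \<le> 1" and rough: "\<And>k. roughness (s k) \<le> ?C * s k powr \<kappa>"
    using ex_roughness_decay by blast
  note s_pos = is_scale_pos[OF s(1)]
  obtain n :: nat where "(real P + 1) / \<kappa> \<le> real n" using real_arch_simple by blast
  then have n: "real P + 1 \<le> \<kappa> * real n" using \<kappa> by (simp add: field_simps)
  define D where "D = dichotomy_const (2 * n)"
  have D: "1 \<le> D" unfolding D_def by (rule dichotomy_const_ge_1)
  obtain K where "\<And>k. K \<le> k \<Longrightarrow> (D * ?C + ?C\<^sup>2) * s k powr \<kappa> < 1" "\<And>k. K \<le> k \<Longrightarrow> 4 * D * s k < 1"
    using ex_powr_threshold[OF next_scale_sequence_tendsto_0[of s, OF s] s_pos \<kappa>] by blast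
  then have K: "\<And>k. (D * ?C + ?C\<^sup>2) * s (k + K) powr \<kappa> < 1" "\<And>k. 4 * D * s (k + K) < 1" by simp_all
  have "scale_sequence h \<xi> gens V (\<lambda>k. s (k + K)) \<kappa> ?C D P"
  proof unfold_locales
    fix k
    let ?\<alpha> = "s (k + K)" and ?\<alpha>' = "s (Suc k + K)"
    obtain c l t where step: "scale_step ?\<alpha> ?\<alpha>' c l" and "?\<alpha> ^ P \<le> ?\<alpha>'"
      and t: "real t * ?\<alpha>' \<le> ?\<alpha>" "?\<alpha> < real (Suc t) * ?\<alpha>'" "8 \<le> t"
      using next_scale_steps[OF s_pos s(2), of "k + K"] s(3)[of "k + K"] by auto
    then show "\<exists>b l. scale_step ?\<alpha> ?\<alpha>' b l" "?\<alpha> ^ P \<le> ?\<alpha>'" by auto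
    have "0 \<le> D * ?C * ?\<alpha> powr \<kappa>" "0 \<le> ?C\<^sup>2 * ?\<alpha> powr \<kappa>" using D roughness_decay_const_ge_1 by simp_all
    then have linear: "D * ?C * ?\<alpha> powr \<kappa> \<le> 1" and square: "?C\<^sup>2 * ?\<alpha> powr \<kappa> \<le> 1"
      using K(1)[of k] unfolding distrib_right by linarith+
    have "D * roughness ?\<alpha> \<le> D * (?C * ?\<alpha> powr \<kappa>)" using rough D by (intro mult_left_mono) auto
    then have small: "D * roughness ?\<alpha> \<le> 1" using linear by (simp add: mult.assoc)
    have "1 * roughness ?\<alpha> \<le> D * roughness ?\<alpha>"
      using D less_imp_le[OF roughness_pos[OF s(1)]] by (intro mult_right_mono)
    then show "roughness ?\<alpha> \<le> 1" using small by linarith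
    have "\<not> 1 \<le> D * roughness ?\<alpha> ^ (2 * n) * real (Suc t)"
      using few_steps[OF s(1,2) _ t(3) rough square n _ K(2)] t(1) D s(3)[of "k + K"] by (simp add: not_le)
    moreover have V: "max_log_deriv ?\<alpha>' \<le> V" using slope[of "k + K"] V_ge_1 by simp
    ultimately have "roughness ?\<alpha> ^ (2 * n) * disp ?\<alpha> x \<le> disp ?\<alpha>' x" for x
      using many_steps_if_disp_next_small[OF s(1) step V small[unfolded D_def] _ t(1,2)] unfolding D_def
      by (meson not_le)
    note nearly_constant = disp_next_nearly_constant[OF s(1) step V small[unfolded D_def] this,
      folded D_def]
    fix x y assume "x \<le> y" "y \<le> \<Phi> ?\<alpha> x"
    then show "\<bar>deriv (disp ?\<alpha>') y\<bar> \<le> D * roughness ?\<alpha> * (disp ?\<alpha>' x / disp ?\<alpha> x)"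
      "7/8 * disp ?\<alpha>' x \<le> disp ?\<alpha>' y"
      using nearly_constant by blast+
  qed (use s(1) rough \<kappa> D P_ge_1 roughness_decay_const_ge_1 in auto)
  then show ?thesis by (rule that)
qed

section \<open>Expansions along the scales\<close>

context scale_sequence
begin

lemma s_smooth: "smooth_time (s k)" and s_pos: "0 < s k" and s_le_1: "s k \<le> 1"
  using is_scale_smooth is_scale_pos is_scale_le_1 s_scale by auto

lemma s_Suc_le: "s (Suc k) \<le> s k / 8"
  using s_step[of k] scale_step_le by blast

lemma s_add_le: "s (k + n) \<le> s k / 8 ^ n"
proof (induction n)
  case (Suc n)
  then show ?case using s_Suc_le[of "k + n"] by simp
qed simp

lemma s_antimono: "j \<le> k \<Longrightarrow> s k \<le> s j"
proof -
  assume "j \<le> k"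
  then obtain n where "k = j + n" using le_Suc_ex by blast
  moreover have "s j / 8 ^ n \<le> s j" using s_pos[of j] by (simp add: field_simps)
  ultimately show ?thesis using s_add_le[of j n] by simp
qed

lemma s_tendsto_0: "s \<longlonglongrightarrow> 0"
proof (rule tendsto_sandwich[of "\<lambda>_. 0" _ _ "\<lambda>k. s 0 * (1/8) ^ k"])
  have "(\<lambda>k. s 0 * (1/8) ^ k) \<longlonglongrightarrow> s 0 * 0"
    by (intro tendsto_mult tendsto_const LIMSEQ_realpow_zero) auto
  then show "(\<lambda>k. s 0 * (1/8) ^ k) \<longlonglongrightarrow> 0" by simp
  show "\<forall>\<^sub>F k in sequentially. s k \<le> s 0 * (1/8) ^ k"
    using s_add_le[of 0] by (simp add: power_one_over)
qed (use s_pos in \<open>auto simp: less_imp_le\<close>)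

lemma s_less_eventually:
  assumes "0 < e"
  obtains K where "\<And>k. K \<le> k \<Longrightarrow> s k < e"
  using order_tendstoD(2)[OF s_tendsto_0 assms] that unfolding eventually_sequentially by blast

lemma s_powr_le_1: "0 < \<beta> \<Longrightarrow> s k powr \<beta> \<le> 1"
  using powr_mono2[of \<beta> "s k" 1] s_pos[of k] s_le_1[of k] by simp

lemma s_powr_small:
  assumes "0 < \<beta>" "0 < e"
  obtains K where "\<And>k. K \<le> k \<Longrightarrow> D * s k powr \<beta> \<le> e"
proof -
  have "(\<lambda>k. s k powr \<beta>) \<longlonglongrightarrow> 0"
    using assms tendsto_zero_powrI[OF s_tendsto_0 tendsto_const[of \<beta>]] s_pos by (auto simp: less_imp_le)
  then have "(\<lambda>k. D * s k powr \<beta>) \<longlonglongrightarrow> 0" by (rule tendsto_mult_right_zero)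
  from order_tendstoD(2)[OF this assms(2)] show ?thesis
    using that unfolding eventually_sequentially by (meson less_imp_le)
qed

lemma sum_s_powr_le:
  assumes "0 < \<beta>"
  obtains B where "0 < B" "\<And>n N. (\<Sum>k<N. s (n + k) powr \<beta>) \<le> B * s n powr \<beta>"
proof -
  define q where "q = (1/8 :: real) powr \<beta>"
  have "(1/8 :: real) powr \<beta> < 1 powr \<beta>" using assms by (intro powr_less_mono2) auto
  then have q: "0 < q" "q < 1" by (simp_all add: q_def)
  have "(\<Sum>k<N. s (n + k) powr \<beta>) \<le> 1 / (1 - q) * s n powr \<beta>" for n N
  proof -
    have "s (n + k) powr \<beta> \<le> s n powr \<beta> * q ^ k" for k
    proof (induction k)
      case (Suc k)
      have "s (n + Suc k) powr \<beta> \<le> (s (n + k) / 8) powr \<beta>"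
        using s_Suc_le[of "n + k"] s_pos[of "Suc (n + k)"] assms by (intro powr_mono2) auto
      also have "\<dots> = s (n + k) powr \<beta> * q" by (simp add: q_def powr_divide s_pos less_imp_le)
      also have "\<dots> \<le> s n powr \<beta> * q ^ k * q" using Suc q by (intro mult_right_mono) auto
      finally show ?case by (simp add: mult_ac)
    qed simp
    then have "(\<Sum>k<N. s (n + k) powr \<beta>) \<le> (\<Sum>k<N. s n powr \<beta> * q ^ k)" by (rule sum_mono)
    also have "\<dots> = s n powr \<beta> * ((1 - q ^ N) / (1 - q))"
      using q by (simp add: sum_gp_strict flip: sum_distrib_left)
    also have "\<dots> \<le> s n powr \<beta> * (1 / (1 - q))" using q by (intro mult_left_mono divide_right_mono) auto
    finally show ?thesis by (simp add: mult_ac)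
  qed
  then show ?thesis using q by (intro that[of "1 / (1 - q)"]) auto
qed

primrec expansions :: "nat \<Rightarrow> nat \<Rightarrow> real set" where
  "expansions n 0 = {0}"
| "expansions n (Suc N) =
    {real b * s (Suc (n + N)) + w | w b. w \<in> expansions n N \<and> real b * s (Suc (n + N)) \<le> s (n + N)}"

lemma ex_expansion_near:
  assumes "0 \<le> r" "r \<le> s n"
  obtains v where "v \<in> expansions n N" "0 \<le> r - v" "r - v \<le> s (n + N)"
proof -
  have "\<exists>v\<in>expansions n N. 0 \<le> r - v \<and> r - v \<le> s (n + N)"
  proof (induction N)
    case 0
    then show ?case using assms by simp
  next
    case (Suc N)
    then obtain v where v: "v \<in> expansions n N" "0 \<le> r - v" "r - v \<le> s (n + N)" by blast
    obtain b where b: "real b * s (Suc (n + N)) \<le> r - v" "r - v < real (Suc b) * s (Suc (n + N))"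
      using floor_multiple[OF s_pos v(2)] .
    then show ?case using v
      by (intro bexI[of _ "real b * s (Suc (n + N)) + v"])
        (auto simp: algebra_simps intro!: exI[of _ v] exI[of _ b])
  qed
  then show ?thesis using that by blast
qed

lemma smooth_time_expansion: "v \<in> expansions n N \<Longrightarrow> smooth_time v"
  by (induction N arbitrary: v) (auto intro!: smooth_time_add smooth_time_mult s_smooth)

lemma le_at_\<Phi>_if_le_at_expansions:
  assumes r: "0 \<le> r" "r \<le> s n" and cont: "continuous_on UNIV (f :: real \<Rightarrow> real)"
    and bound: "\<And>N v. v \<in> expansions n N \<Longrightarrow> f (\<Phi> v x) \<le> B"
  shows "f (\<Phi> r x) \<le> B"
proof -
  have "\<forall>N. \<exists>v. v \<in> expansions n N \<and> 0 \<le> r - v \<and> r - v \<le> s (n + N)" using ex_expansion_near[OF r] by metis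
  then obtain v where v: "\<And>N. v N \<in> expansions n N" "\<And>N. 0 \<le> r - v N" "\<And>N. r - v N \<le> s (n + N)" by metis
  have "(\<lambda>N. s (n + N)) \<longlonglongrightarrow> 0"
    using LIMSEQ_ignore_initial_segment[OF s_tendsto_0, of n] by (simp add: add.commute)
  then have "(\<lambda>N. r - v N) \<longlonglongrightarrow> 0"
    using tendsto_sandwich[of "\<lambda>_. 0" "\<lambda>N. r - v N" sequentially "\<lambda>N. s (n + N)" 0] v by simp
  then have "(\<lambda>N. r - (r - v N)) \<longlonglongrightarrow> r - 0" by (intro tendsto_intros)
  then have v_lim: "v \<longlonglongrightarrow> r" by simp
  have "continuous_on UNIV (\<lambda>t. f (\<Phi> t x))"
    by (rule continuous_on_compose2[OF cont continuous_\<Phi>_time]) auto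
  then have "isCont (\<lambda>t. f (\<Phi> t x)) r" by (simp add: continuous_on_eq_continuous_at)
  then have "(\<lambda>N. f (\<Phi> (v N) x)) \<longlonglongrightarrow> f (\<Phi> r x)" using v_lim by (rule isCont_tendsto_compose)
  then show ?thesis by (rule LIMSEQ_le_const2) (use bound v(1) in blast)
qed

definition jet_decay :: "nat \<Rightarrow> real \<Rightarrow> real \<Rightarrow> nat \<Rightarrow> bool" where
  "jet_decay n \<beta> B K \<longleftrightarrow> (\<forall>k b x. K \<le> k \<longrightarrow> real b * s (Suc k) \<le> s k \<longrightarrow>
     jet_bound {..n} (B * s k powr \<beta>) 1 (log_deriv (real b * s (Suc k))) x)"

lemma jet_decayD:
  "jet_decay n \<beta> B K \<Longrightarrow> K \<le> k \<Longrightarrow> real b * s (Suc k) \<le> s k \<Longrightarrow>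
     jet_bound {..n} (B * s k powr \<beta>) 1 (log_deriv (real b * s (Suc k))) x"
  by (simp add: jet_decay_def)

lemma ex_jet_bound_expansions:
  assumes decay: "jet_decay n \<beta> B K" and \<beta>: "0 < \<beta>" and B: "0 < B"
  shows "\<exists>E>0. \<exists>K'\<ge>K. \<forall>j\<ge>K'. E * s j powr \<beta> \<le> 1 \<and>
    (\<forall>N. \<forall>v\<in>expansions j N. \<forall>x. jet_bound {..n} (E * s j powr \<beta>) 1 (log_deriv v) x)"
proof -
  define D where "D = chain_jet_const (chain_jet_const 1 n * exp 1) n"
  have D: "1 \<le> D" unfolding D_def by (rule chain_jet_const_ge_1)
  obtain T where T: "T > 0" "\<And>j N. (\<Sum>k<N. s (j + k) powr \<beta>) \<le> T * s j powr \<beta>"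
    using sum_s_powr_le[OF \<beta>] by blast
  define E where "E = D * B * T"
  have E: "0 < E" using D B T by (simp add: E_def)
  have sum_le: "D * B * (\<Sum>k<N. s (j + k) powr \<beta>) \<le> E * s j powr \<beta>" for j N
    using mult_left_mono[OF T(2)[of j N], of "D * B"] D B by (simp add: E_def mult.assoc)
  obtain K1 where K1: "\<And>k. K1 \<le> k \<Longrightarrow> E * s k powr \<beta> \<le> 1" using s_powr_small[OF \<beta>, of 1 E] by auto
  have jets: "jet_bound {..n} (D * B * (\<Sum>k<N. s (j + k) powr \<beta>)) 1 (log_deriv v) x"
    if j: "max K K1 \<le> j" and "v \<in> expansions j N" for j N v x
    using that(2)
  proof (induction N arbitrary: v x)
    case 0
    then show ?case by (simp add: jet_bound_def funpow_deriv_const)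
  next
    case (Suc N)
    then obtain w b where w: "w \<in> expansions j N" and b: "real b * s (Suc (j + N)) \<le> s (j + N)"
      and v: "v = real b * s (Suc (j + N)) + w" by auto
    let ?r = "real b * s (Suc (j + N))"
    have smooth: "smooth_time w" "smooth_time ?r"
      using smooth_time_expansion[OF w] smooth_time_mult[OF s_smooth] by auto
    have "E * s j powr \<beta> \<le> 1" using K1 j by simp
    then have "jet_bound {..n} 1 1 (log_deriv w) x"
      using sum_le[of j N] by (intro jet_bound_mono[OF Suc.IH[OF w]]) auto
    then have "jet_bound {..n} (D * (B * s (j + N) powr \<beta>)) 1 (\<lambda>x. log_deriv ?r (\<Phi> w x)) x"
      unfolding D_def using j b
      by (intro jet_bound_compose_\<Phi> smooth smooth_log_deriv jet_decayD[OF decay]) auto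
    moreover have "log_deriv v = (\<lambda>x. log_deriv ?r (\<Phi> w x) + log_deriv w x)"
      unfolding v using log_deriv_add[OF smooth(2,1)] by auto
    moreover have "smooth_real (\<lambda>x. log_deriv ?r (\<Phi> w x))"
      by (rule smooth_compose[OF smooth_log_deriv[OF smooth(2)] smooth_\<Phi>[OF smooth(1)]])
    ultimately have "jet_bound {..n} (D * (B * s (j + N) powr \<beta>)
        + D * B * (\<Sum>k<N. s (j + k) powr \<beta>)) 1 (log_deriv v) x"
      using jet_bound_add[OF _ smooth_log_deriv[OF smooth(1)] _ Suc.IH[OF w]] by simp
    then show ?case by (simp add: distrib_left mult.assoc add.commute)
  qed
  have "jet_bound {..n} (E * s j powr \<beta>) 1 (log_deriv v) x"
    if "max K K1 \<le> j" "v \<in> expansions j N" for j N v x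
    using jet_bound_mono[OF jets[OF that] order_refl sum_le] by simp
  then show ?thesis using E K1 by (intro exI[of _ E] conjI exI[of _ "max K K1"]) auto
qed

subsection \<open>Slopes along one scale\<close>

lemma log_deriv_next_le:
  assumes "x \<le> y" "y \<le> \<Phi> (s k) x"
  shows "\<bar>log_deriv (s (Suc k)) y\<bar> \<le> exp V * G * roughness (s k) * (disp (s (Suc k)) x / disp (s k) x)"
proof -
  have "\<bar>log_deriv (s (Suc k)) y\<bar> \<le> exp V * \<bar>exp (log_deriv (s (Suc k)) y) - 1\<bar>"
    by (rule abs_le_exp_minus_1[OF is_scale_abs_log_deriv_le[OF s_scale]])
  also have "\<dots> \<le> exp V * (G * roughness (s k) * (disp (s (Suc k)) x / disp (s k) x))"
    using s_deriv_disp[OF assms] unfolding deriv_disp[OF s_smooth] by (intro mult_left_mono) auto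
  finally show ?thesis by (simp add: mult.assoc)
qed

lemma abs_log_deriv_multiple_le:
  assumes "real b * s (Suc k) \<le> s k"
  shows "\<bar>log_deriv (real b * s (Suc k)) x\<bar> \<le> 2 * exp V * G * roughness (s k)"
proof -
  let ?q = "disp (s (Suc k)) x / disp (s k) x"
  obtain c l where step: "scale_step (s k) (s (Suc k)) c l" using s_step by blast
  have "\<bar>log_deriv (real b * s (Suc k)) x\<bar> \<le> (\<Sum>i<b. exp V * G * roughness (s k) * ?q)"
    unfolding log_deriv_mult[OF s_smooth] using scale_step_orbit[OF step assms]
    by (intro order_trans[OF sum_abs] sum_mono log_deriv_next_le) auto
  also have "\<dots> = exp V * G * roughness (s k) * (real b * ?q)" by simp
  also have "\<dots> \<le> exp V * G * roughness (s k) * 2"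
  proof (rule mult_left_mono)
    have "7/8 * real b * disp (s (Suc k)) x \<le> disp (s k) x"
      by (rule multiple_disp_next_le[OF step assms]) (rule s_disp)
    then have "7/8 * (real b * ?q) \<le> 1" using disp_pos[OF s_pos, of k x] by (simp add: field_simps)
    moreover have "q \<le> 2" if "7/8 * q \<le> 1" for q :: real using that by linarith
    ultimately show "real b * ?q \<le> 2" by blast
    show "0 \<le> exp V * G * roughness (s k)" using roughness_pos[OF s_scale, of k] G_ge_1 by simp
  qed
  finally show ?thesis by simp
qed

lemma jet_decay_0: "jet_decay 0 (min \<kappa> 1) (2 * exp V * G * C) 0"
proof -
  have "\<bar>log_deriv (real b * s (Suc k)) x\<bar> \<le> (2 * exp V * G * C) * s k powr min \<kappa> 1"
    if "real b * s (Suc k) \<le> s k" for b k x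
  proof -
    have "s k powr \<kappa> \<le> s k powr min \<kappa> 1" using s_pos[of k] s_le_1[of k] by (intro powr_mono') auto
    then have "C * s k powr \<kappa> \<le> C * s k powr min \<kappa> 1" using C_pos by (intro mult_left_mono) auto
    then have "roughness (s k) \<le> C * s k powr min \<kappa> 1" using s_roughness[of k] by linarith
    then have "2 * exp V * G * roughness (s k) \<le> 2 * exp V * G * (C * s k powr min \<kappa> 1)"
      using G_ge_1 by (intro mult_left_mono) auto
    then show ?thesis by (intro order_trans[OF abs_log_deriv_multiple_le[OF that]]) (simp only: mult.assoc)
  qed
  then show ?thesis by (simp add: jet_decay_def jet_bound_def)
qed

section \<open>The conjugacy is bi-Lipschitz\<close>

lemma ex_disp_\<Phi>_le_exp_1:
  "\<exists>j. \<forall>\<beta> r x. 0 < \<beta> \<longrightarrow> 0 \<le> r \<longrightarrow> r \<le> s j \<longrightarrow> disp \<beta> (\<Phi> r x) \<le> exp 1 * disp \<beta> x"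
proof -
  have "0 < min \<kappa> 1" "0 < 2 * exp V * G * C" using \<kappa>_pos C_pos G_ge_1 by simp_all
  from ex_jet_bound_expansions[OF jet_decay_0 this] obtain E j
    where small: "E * s j powr min \<kappa> 1 \<le> 1"
    and jets: "\<And>N v x. v \<in> expansions j N \<Longrightarrow> jet_bound {..0} (E * s j powr min \<kappa> 1) 1 (log_deriv v) x"
    by (meson order_refl)
  have "disp \<beta> (\<Phi> r x) \<le> exp 1 * disp \<beta> x" if "0 < \<beta>" "0 \<le> r" "r \<le> s j" for \<beta> r x
  proof (rule le_at_\<Phi>_if_le_at_expansions[OF that(2,3) continuous_disp])
    fix N v assume v: "v \<in> expansions j N"
    have "\<bar>log_deriv v z\<bar> \<le> 1" for z using jet_boundD[OF jets[OF v], of 0 z] small by simp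
    then have "-1 \<le> log_deriv v z \<and> log_deriv v z \<le> 1" for z by (metis abs_le_iff minus_le_iff)
    then show "disp \<beta> (\<Phi> v x) \<le> exp 1 * disp \<beta> x"
      using disp_\<Phi>_bounds(2)[OF smooth_time_expansion[OF v] that(1), of x "-1" 1] by simp
  qed
  then show ?thesis by blast
qed

lemma ex_disp_comparable:
  obtains Q where "1 \<le> Q" "\<And>\<beta> x y. 0 < \<beta> \<Longrightarrow> disp \<beta> y \<le> Q * disp \<beta> x"
proof -
  obtain j where short: "\<And>\<beta> r x. 0 < \<beta> \<Longrightarrow> 0 \<le> r \<Longrightarrow> r \<le> s j \<Longrightarrow> disp \<beta> (\<Phi> r x) \<le> exp 1 * disp \<beta> x"
    using ex_disp_\<Phi>_le_exp_1 by blast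
  have multiple: "disp \<beta> (\<Phi> (real i * r) x) \<le> exp 1 ^ i * disp \<beta> x" if "0 < \<beta>" "0 \<le> r" "r \<le> s j" for \<beta> r x i
  proof (induction i)
    case (Suc i)
    have "disp \<beta> (\<Phi> (real (Suc i) * r) x) \<le> exp 1 * disp \<beta> (\<Phi> (real i * r) x)"
      unfolding \<Phi>_mult_Suc by (rule short[OF that])
    also have "\<dots> \<le> exp 1 * (exp 1 ^ i * disp \<beta> x)" using Suc by (intro mult_left_mono) auto
    finally show ?case by simp
  qed simp
  obtain J :: nat where J: "1 / s j \<le> real J" using real_arch_simple by blast
  have "0 < 1 / s j" using s_pos[of j] by simp
  then have J_pos: "0 < real J" using J by linarith
  have "disp \<beta> y \<le> exp 1 ^ J * disp \<beta> x" if "0 < \<beta>" for \<beta> x y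
  proof -
    define r where "r = frac (h y - h x)"
    have r: "0 \<le> r" "r \<le> 1" unfolding r_def by (simp_all add: less_imp_le[OF frac_lt_1])
    then have "r / real J \<le> 1 / real J" using J_pos by (intro divide_right_mono) auto
    also have "\<dots> \<le> s j" using J J_pos s_pos[of j] by (simp add: field_simps)
    finally have "r / real J \<le> s j" .
    then have "disp \<beta> (\<Phi> (real J * (r / real J)) x) \<le> exp 1 ^ J * disp \<beta> x"
      using J_pos r by (intro multiple[OF that]) auto
    moreover have "y = \<Phi> r x + of_int \<lfloor>h y - h x\<rfloor>"
      using \<Phi>_add_of_int[of r "\<lfloor>h y - h x\<rfloor>" x] by (simp add: r_def frac_def \<Phi>_def)
    then have "disp \<beta> y = disp \<beta> (\<Phi> r x)"
      using shift_of_int[of "disp \<beta>" 0 "\<Phi> r x" "\<lfloor>h y - h x\<rfloor>"] disp_add_1 by simp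
    ultimately show ?thesis using J_pos by simp
  qed
  then show ?thesis by (intro that[of "exp 1 ^ J"]) (auto simp: one_le_power)
qed

lemma ex_disp_linear: "\<exists>Q\<ge>1. \<forall>\<beta> x. 0 < \<beta> \<longrightarrow> \<beta> \<le> 1 \<longrightarrow> \<beta> \<le> Q * disp \<beta> x \<and> disp \<beta> x \<le> Q * \<beta>"
proof -
  obtain Q where Q: "Q \<ge> 1" "\<And>\<beta> x y. 0 < \<beta> \<Longrightarrow> disp \<beta> y \<le> Q * disp \<beta> x" using ex_disp_comparable by blast
  have "\<beta> \<le> 2 * Q * disp \<beta> x \<and> disp \<beta> x \<le> 2 * Q * \<beta>" if \<beta>: "0 < \<beta>" "\<beta> \<le> 1" for \<beta> x
  proof
    obtain n where n: "real n * \<beta> \<le> 1" "1 < real (Suc n) * \<beta>" using floor_multiple[OF \<beta>(1) zero_le_one] .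
    have pos: "0 < Q * disp \<beta> x" "0 < disp \<beta> x" using \<beta> Q(1) by (simp_all add: disp_pos)
    have "n \<noteq> 0" using n(2) \<beta>(2) by (intro notI) simp
    then have "1 * \<beta> \<le> real n * \<beta>" using \<beta> by (intro mult_right_mono) auto
    moreover have "real (Suc n) * \<beta> = real n * \<beta> + \<beta>" by (simp add: distrib_right)
    ultimately have twice: "1 \<le> 2 * real n * \<beta>" "real (Suc n) * \<beta> \<le> 2" using n by linarith+
    have "real n * disp \<beta> x = (\<Sum>i<n. disp \<beta> x)" by simp
    also have "\<dots> \<le> Q * disp (real n * \<beta>) x"
      unfolding disp_mult sum_distrib_left by (intro sum_mono Q(2) \<beta>)
    also have "\<dots> \<le> Q * 1" using disp_mono[OF n(1), of x] Q(1) by (intro mult_left_mono) auto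
    finally have "2 * \<beta> * (real n * disp \<beta> x) \<le> 2 * \<beta> * Q" using \<beta> by (intro mult_left_mono) auto
    moreover have "1 * disp \<beta> x \<le> 2 * real n * \<beta> * disp \<beta> x" using twice pos by (intro mult_right_mono) auto
    ultimately show "disp \<beta> x \<le> 2 * Q * \<beta>" by (simp add: mult_ac)
    have "1 \<le> disp (real (Suc n) * \<beta>) x" using disp_mono[of 1 "real (Suc n) * \<beta>" x] n by simp
    also have "\<dots> \<le> (\<Sum>i<Suc n. Q * disp \<beta> x)" unfolding disp_mult by (intro sum_mono Q(2) \<beta>)
    also have "\<dots> = real (Suc n) * (Q * disp \<beta> x)" by simp
    finally have "\<beta> * 1 \<le> \<beta> * (real (Suc n) * (Q * disp \<beta> x))" using \<beta> by (intro mult_left_mono) auto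
    also have "\<dots> = (real (Suc n) * \<beta>) * (Q * disp \<beta> x)" by (simp only: mult_ac)
    also have "\<dots> \<le> 2 * (Q * disp \<beta> x)" using twice pos by (intro mult_right_mono) auto
    finally show "\<beta> \<le> 2 * Q * disp \<beta> x" by simp
  qed
  then show ?thesis using Q(1) by (intro exI[of _ "2 * Q"]) auto
qed

definition lip_const :: real where
  "lip_const = (SOME Q. 1 \<le> Q \<and> (\<forall>\<beta> x. 0 < \<beta> \<longrightarrow> \<beta> \<le> 1 \<longrightarrow> \<beta> \<le> Q * disp \<beta> x \<and> disp \<beta> x \<le> Q * \<beta>))"

lemma lip_const_ge_1: "1 \<le> lip_const"
  and le_disp: "0 < \<beta> \<Longrightarrow> \<beta> \<le> 1 \<Longrightarrow> \<beta> \<le> lip_const * disp \<beta> x"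
  and disp_le: "0 < \<beta> \<Longrightarrow> \<beta> \<le> 1 \<Longrightarrow> disp \<beta> x \<le> lip_const * \<beta>"
  using someI_ex[OF ex_disp_linear, folded lip_const_def] by auto

lemma max_disp_s_le: "max_disp (s k) \<le> lip_const * s k"
  using max_disp_attained[of "s k"] disp_le[OF s_pos s_le_1] by metis

lemma disp_s_ge: "s k / lip_const \<le> disp (s k) x"
  using le_disp[OF s_pos s_le_1, of k x] lip_const_ge_1 by (simp add: field_simps)

subsection \<open>The roughness is of the order of the square root of the scale\<close>

definition slope_ratio_const :: real where "slope_ratio_const = exp V * G * lip_const\<^sup>2"

lemma slope_ratio_const_pos: "0 < slope_ratio_const"
  using G_ge_1 lip_const_ge_1 by (simp add: slope_ratio_const_def)

lemma max_log_deriv_next_le_ratio: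
  "max_log_deriv (s (Suc k)) \<le> slope_ratio_const * roughness (s k) * (s (Suc k) / s k)"
proof (rule max_log_deriv_le)
  fix x
  have nonneg: "0 \<le> exp V * G * roughness (s k)" using roughness_pos[OF s_scale, of k] G_ge_1 by simp
  have "\<bar>log_deriv (s (Suc k)) x\<bar> \<le> exp V * G * roughness (s k) * (disp (s (Suc k)) x / disp (s k) x)"
    using s_pos[of k] by (intro log_deriv_next_le) auto
  also have "\<dots> \<le> exp V * G * roughness (s k) * ((lip_const * s (Suc k)) / (s k / lip_const))"
    using nonneg s_pos[of k] s_pos[of "Suc k"] lip_const_ge_1
    by (intro mult_left_mono frac_le disp_le disp_s_ge s_pos s_le_1) auto
  finally show "\<bar>log_deriv (s (Suc k)) x\<bar> \<le> slope_ratio_const * roughness (s k) * (s (Suc k) / s k)"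
    by (simp add: slope_ratio_const_def power2_eq_square mult_ac)
qed

context
  fixes Q :: real and k :: nat
  assumes Q: "2 * (flatness_const * lip_const) \<le> Q" "sqrt lip_const \<le> Q" "0 < Q"
    and slope: "max_log_deriv (s k) \<le> Q * sqrt (s k)"
begin

lemma slope_sqrt_step_close:
  assumes close: "(s k)\<^sup>2 \<le> s (Suc k)"
  shows "max_log_deriv (s (Suc k)) \<le> Q * sqrt (s (Suc k))"
proof -
  let ?\<alpha> = "s k" and ?\<alpha>' = "s (Suc k)"
  obtain c l where step: "scale_step ?\<alpha> ?\<alpha>' c l" using s_step by blast
  obtain t where t: "real t * ?\<alpha>' \<le> ?\<alpha>" "?\<alpha> < real (Suc t) * ?\<alpha>'"
    using floor_multiple[OF s_pos less_imp_le[OF s_pos]] .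
  have t_pos: "0 < t" using steps_ge_8[OF step t(2)] by simp
  have "sqrt ?\<alpha> \<le> real t / 2 * sqrt ?\<alpha>'"
    using powr_le_half_steps[OF s_pos _ t(2), of "1/2"] s_Suc_le[of k]
    by (simp add: powr_half_sqrt s_pos less_imp_le)
  then have "Q * sqrt ?\<alpha> \<le> Q * (real t / 2 * sqrt ?\<alpha>')" using Q(3) by (intro mult_left_mono) auto
  with slope have "max_log_deriv ?\<alpha> \<le> Q * (real t / 2 * sqrt ?\<alpha>')" by (rule order_trans)
  also have "\<dots> = Q / 2 * sqrt ?\<alpha>' * real t" by simp
  finally have "max_log_deriv ?\<alpha> \<le> Q / 2 * sqrt ?\<alpha>' * real t" .
  then have "max_log_deriv ?\<alpha> / real t \<le> Q / 2 * sqrt ?\<alpha>'" using t_pos by (simp add: divide_le_eq)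
  moreover have "flatness_const * max_disp ?\<alpha> \<le> Q / 2 * sqrt ?\<alpha>'"
  proof -
    have "flatness_const * max_disp ?\<alpha> \<le> flatness_const * (lip_const * ?\<alpha>)"
      by (intro mult_left_mono max_disp_s_le flatness_const_nonneg)
    also have "\<dots> = flatness_const * lip_const * ?\<alpha>" by simp
    also have "\<dots> \<le> Q / 2 * sqrt ?\<alpha>'"
      using Q(1,3) real_le_rsqrt[OF close] s_pos[of k] by (intro mult_mono) auto
    finally show ?thesis .
  qed
  moreover have "max_log_deriv ?\<alpha>' \<le> max_log_deriv ?\<alpha> / real t + flatness_const * max_disp ?\<alpha>"
    using max_log_deriv_recursion[OF s_scale step _ t(1)] t_pos by simp
  ultimately show ?thesis by linarith
qed

lemma slope_sqrt_step_far:
  assumes far: "s (Suc k) \<le> (s k)\<^sup>2" and small: "2 * slope_ratio_const * roughness_const * sqrt (s k) \<le> 1"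
  shows "max_log_deriv (s (Suc k)) \<le> Q * sqrt (s (Suc k))"
proof -
  let ?\<alpha> = "s k" and ?\<alpha>' = "s (Suc k)"
  have "sqrt (max_disp ?\<alpha>) \<le> sqrt (lip_const * ?\<alpha>)" by (rule real_sqrt_le_mono[OF max_disp_s_le])
  also have "\<dots> = sqrt lip_const * sqrt ?\<alpha>" by (rule real_sqrt_mult)
  also have "\<dots> \<le> Q * sqrt ?\<alpha>" using Q(2) s_pos[of k] by (intro mult_right_mono) auto
  finally have "max_log_deriv ?\<alpha> + sqrt (max_disp ?\<alpha>) \<le> 2 * Q * sqrt ?\<alpha>" using slope by simp
  then have rough: "roughness ?\<alpha> \<le> roughness_const * (2 * Q * sqrt ?\<alpha>)"
    unfolding roughness_def using roughness_const_ge_1 by (intro mult_left_mono) auto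
  have "max_log_deriv ?\<alpha>' \<le> slope_ratio_const * roughness ?\<alpha> * (?\<alpha>' / ?\<alpha>)"
    by (rule max_log_deriv_next_le_ratio)
  also have "\<dots> \<le> slope_ratio_const * (roughness_const * (2 * Q * sqrt ?\<alpha>)) * (?\<alpha>' / ?\<alpha>)"
    using rough slope_ratio_const_pos s_pos[of k] s_pos[of "Suc k"]
    by (intro mult_right_mono mult_left_mono) auto
  also have "\<dots> = (2 * slope_ratio_const * roughness_const * sqrt ?\<alpha>) * Q * (?\<alpha>' / ?\<alpha>)" by simp
  also have "\<dots> \<le> 1 * Q * (?\<alpha>' / ?\<alpha>)"
    using small Q(3) s_pos[of k] s_pos[of "Suc k"] by (intro mult_right_mono) auto
  also have "\<dots> \<le> 1 * Q * sqrt ?\<alpha>'"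
  proof (rule mult_left_mono)
    have "sqrt ?\<alpha>' \<le> ?\<alpha>" using far s_pos[of k] by (simp add: real_le_lsqrt)
    then have "sqrt ?\<alpha>' * sqrt ?\<alpha>' \<le> ?\<alpha> * sqrt ?\<alpha>'" using s_pos[of "Suc k"] by (intro mult_right_mono) auto
    then show "?\<alpha>' / ?\<alpha> \<le> sqrt ?\<alpha>'"
      using s_pos[of k] s_pos[of "Suc k"] by (simp add: divide_le_eq mult.commute)
  qed (use Q(3) in simp)
  finally show ?thesis by simp
qed

end

lemma ex_slope_sqrt_bound:
  obtains Q where "0 < Q" "\<And>k. max_log_deriv (s k) \<le> Q * sqrt (s k)"
proof -
  obtain K where small: "\<And>k. K \<le> k \<Longrightarrow> 2 * slope_ratio_const * roughness_const * sqrt (s k) \<le> 1"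
    using s_powr_small[of "1/2" 1 "2 * slope_ratio_const * roughness_const"]
    by (auto simp: powr_half_sqrt s_pos less_imp_le)
  define Q where "Q = 2 * (flatness_const * lip_const) + sqrt lip_const + V / sqrt (s K) + 1"
  have sK: "0 < sqrt (s K)" using s_pos by simp
  have "0 \<le> flatness_const * lip_const" "0 \<le> sqrt lip_const" "0 \<le> V / sqrt (s K)"
    using flatness_const_nonneg lip_const_ge_1 V_ge_1 sK by simp_all
  then have Q: "2 * (flatness_const * lip_const) \<le> Q" "sqrt lip_const \<le> Q" "0 < Q" "V / sqrt (s K) \<le> Q"
    by (simp_all add: Q_def add_nonneg_pos add_increasing add_increasing2)
  have early: "max_log_deriv (s k) \<le> Q * sqrt (s k)" if "k \<le> K" for k
  proof -
    have "max_log_deriv (s k) \<le> V" by (rule is_scale_max_log_deriv_le[OF s_scale])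
    also have "\<dots> = V / sqrt (s K) * sqrt (s K)" using sK by simp
    also have "\<dots> \<le> Q * sqrt (s k)"
      using Q s_antimono[OF that] less_imp_le[OF s_pos] by (intro mult_mono) auto
    finally show ?thesis .
  qed
  have "max_log_deriv (s (K + n)) \<le> Q * sqrt (s (K + n))" for n
  proof (induction n)
    case 0
    then show ?case using early[of K] by simp
  next
    case (Suc n)
    then show ?case
      using slope_sqrt_step_close[OF Q(1-3) Suc] slope_sqrt_step_far[OF Q(1-3) Suc _ small] by fastforce
  qed
  then have "max_log_deriv (s k) \<le> Q * sqrt (s k)" for k
    using early[of k] le_Suc_ex[of K k] by (cases "k \<le> K") auto
  then show ?thesis using that Q(3) by blast
qed

lemma ex_roughness_sqrt_bound:
  obtains K where "0 < K" "\<And>k. roughness (s k) \<le> K * sqrt (s k)"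
proof -
  obtain Q where Q: "Q > 0" "\<And>k. max_log_deriv (s k) \<le> Q * sqrt (s k)" using ex_slope_sqrt_bound by blast
  have "roughness (s k) \<le> roughness_const * (Q + sqrt lip_const) * sqrt (s k)" for k
  proof -
    have "sqrt (max_disp (s k)) \<le> sqrt lip_const * sqrt (s k)"
      using real_sqrt_le_mono[OF max_disp_s_le[of k]] by (simp add: real_sqrt_mult)
    then have "max_log_deriv (s k) + sqrt (max_disp (s k)) \<le> (Q + sqrt lip_const) * sqrt (s k)"
      using Q(2)[of k] by (simp add: distrib_right)
    then show ?thesis
      unfolding roughness_def using roughness_const_ge_1 by (simp add: mult.assoc mult_left_mono)
  qed
  moreover have "0 < roughness_const * (Q + sqrt lip_const)"
    using roughness_const_ge_1 Q lip_const_ge_1 by (simp add: add_pos_nonneg)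
  ultimately show ?thesis using that by blast
qed

end

section \<open>Decay of all jets along the scales\<close>

lemma ex_small_deriv_between:
  assumes "smooth_real F" "a < b" "\<bar>F a\<bar> \<le> A" "\<bar>F b\<bar> \<le> A"
  obtains z where "a < z" "z < b" "\<bar>deriv F z\<bar> \<le> 2 * A / (b - a)"
proof -
  obtain z where z: "a < z" "z < b" "F b - F a = (b - a) * deriv F z" using smooth_mvt[OF assms(1,2)] .
  have "(b - a) * \<bar>deriv F z\<bar> = \<bar>F b - F a\<bar>" unfolding z(3) using \<open>a < b\<close> by (simp add: abs_mult)
  also have "\<dots> \<le> 2 * A" using assms by linarith
  finally show ?thesis using that[OF z(1,2)] \<open>a < b\<close> by (simp add: field_simps)
qed

lemma jet_bound_Suc_if_oscillation_small:
  assumes F: "smooth_real F" "\<And>x. F (x + 1) = F x" and A: "\<And>y. jet_bound {..n} A 1 F y"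
    and small: "\<And>x W. (\<And>y. jet_bound {..Suc n} W 1 F y) \<Longrightarrow>
      \<exists>z. \<bar>(deriv ^^ Suc n) F z\<bar> \<le> T \<and> \<bar>(deriv ^^ Suc n) F z - (deriv ^^ Suc n) F x\<bar> \<le> W / 4"
  shows "jet_bound {..Suc n} (max A (2 * T)) 1 F y"
proof -
  let ?D = "(deriv ^^ Suc n) F"
  have "continuous_on UNIV (\<lambda>x. \<bar>?D x\<bar>)"
    by (intro continuous_on_rabs smooth_continuous_on smooth_funpow_deriv F)
  moreover have "\<bar>?D (x + 1)\<bar> = \<bar>?D x\<bar>" for x by (subst funpow_deriv_periodic) (rule F, rule refl)
  ultimately obtain x where x: "\<And>y. \<bar>?D y\<bar> \<le> \<bar>?D x\<bar>" using periodic_attains_max by metis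
  define W where "W = max A \<bar>?D x\<bar>"
  have jets: "jet_bound {..Suc n} B 1 F y" if "A \<le> B" "\<bar>?D x\<bar> \<le> B" for B y
    unfolding jet_bound_atMost_Suc
    using jet_bound_mono[OF A order_refl that(1)] order_trans[OF x that(2)] by (simp del: funpow.simps)
  obtain z where z: "\<bar>?D z\<bar> \<le> T" "\<bar>?D z - ?D x\<bar> \<le> W / 4"
    using small[OF jets, of W x] by (auto simp: W_def)
  have "\<bar>?D x\<bar> \<le> max A (2 * T)"
  proof (cases "\<bar>?D x\<bar> \<le> A")
    case False
    then have "W = \<bar>?D x\<bar>" by (simp add: W_def)
    then have "\<bar>?D x\<bar> \<le> 2 * T" using z by linarith
    then show ?thesis by simp
  qed simp
  then show ?thesis by (intro jets) auto
qed

lemma funpow_deriv_le_local_oscillation: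
  assumes F: "smooth_real F" and \<rho>: "0 < \<rho>" and "1 \<le> j" "j \<le> R"
    and osc: "\<And>y. y \<in> {x..x + \<rho>} \<Longrightarrow> \<bar>(deriv ^^ n) F y - (deriv ^^ n) F x\<bar> \<le> e"
    and top: "\<And>y. \<bar>(deriv ^^ (n + R)) F y\<bar> \<le> H"
  shows "\<bar>(deriv ^^ (n + j)) F x\<bar>
      \<le> interpolation_const (2 ^ R) R * (e / (\<rho> / 2 ^ R) ^ j + H * (\<rho> / 2 ^ R) ^ (R - j))"
proof -
  define \<phi> where "\<phi> y = (deriv ^^ n) F y - (deriv ^^ n) F x" for y
  have \<phi>: "smooth_real \<phi>" unfolding \<phi>_def by (intro smooth_diff smooth_funpow_deriv smooth_const F)
  have deriv_\<phi>: "(deriv ^^ i) \<phi> y = (deriv ^^ (n + i)) F y" if "1 \<le> i" for i y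
    unfolding \<phi>_def
    using funpow_deriv_diff[OF smooth_funpow_deriv[OF F, of n] smooth_const, of i "(deriv ^^ n) F x"] that
    by (simp add: funpow_deriv_const funpow_add add.commute)
  have "\<bar>(deriv ^^ j) \<phi> x\<bar>
      \<le> interpolation_const (2 ^ R) R * (e / (\<rho> / 2 ^ R) ^ j + H * (\<rho> / 2 ^ R) ^ (R - j))"
  proof (rule funpow_deriv_interpolation[OF \<phi>, where x = "\<lambda>i. x + real i * (\<rho> / 2 ^ R)"])
    fix i :: nat assume "i < 2 ^ R"
    then have "real i \<le> real (2 ^ R)" by (subst of_nat_le_iff) simp
    then have "real i * (\<rho> / 2 ^ R) \<le> 2 ^ R * (\<rho> / 2 ^ R)" using \<rho> by (intro mult_right_mono) auto
    then have "x + real i * (\<rho> / 2 ^ R) \<in> {x..x + \<rho>}" using \<rho> by simp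
    then show "x + real i * (\<rho> / 2 ^ R) \<in> {x..x + \<rho>} \<and> \<bar>\<phi> (x + real i * (\<rho> / 2 ^ R))\<bar> \<le> e"
      unfolding \<phi>_def using osc by blast
  next
    show "\<bar>(deriv ^^ R) \<phi> y\<bar> \<le> H" for y using deriv_\<phi>[of R y] top[of y] \<open>1 \<le> j\<close> \<open>j \<le> R\<close> by simp
  qed (use \<rho> \<open>j \<le> R\<close> in \<open>auto simp: distrib_right add_divide_distrib\<close>)
  then show ?thesis using deriv_\<phi>[OF \<open>1 \<le> j\<close>] by simp
qed

lemma funpow_deriv_le_local_oscillation_2:
  assumes "smooth_real F" and \<rho>: "0 < \<rho>" "\<rho> \<le> 1" and "2 \<le> R" and j: "1 \<le> j" "j \<le> 2"
    and osc: "\<And>y. y \<in> {x..x + \<rho>} \<Longrightarrow> \<bar>(deriv ^^ n) F y - (deriv ^^ n) F x\<bar> \<le> e"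
    and top: "\<And>y. \<bar>(deriv ^^ (n + R)) F y\<bar> \<le> H"
  shows "\<bar>(deriv ^^ (n + j)) F x\<bar> \<le> interpolation_const (2 ^ R) R * (4 ^ R * (e / \<rho>\<^sup>2) + H * \<rho> ^ (R - 2))"
proof -
  let ?\<sigma> = "\<rho> / 2 ^ R"
  have \<sigma>: "0 < ?\<sigma>" "?\<sigma> \<le> \<rho>" "?\<sigma> \<le> 1"
    using \<rho> one_le_power[of "2::real" R] by (auto simp: field_simps intro: order_trans)
  have nonneg: "0 \<le> e" "0 \<le> H" using osc[of x] top[of x] \<rho> by auto
  have "e / ?\<sigma> ^ j \<le> e / ?\<sigma>\<^sup>2" using \<sigma> j nonneg by (intro divide_left_mono power_decreasing) auto
  also have "?\<sigma>\<^sup>2 = \<rho>\<^sup>2 / 4 ^ R"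
    by (simp add: power_divide power_mult[symmetric] mult.commute[of R 2]) (simp add: power_mult)
  also have "e / (\<rho>\<^sup>2 / 4 ^ R) = 4 ^ R * (e / \<rho>\<^sup>2)" by simp
  finally have first_le: "e / ?\<sigma> ^ j \<le> 4 ^ R * (e / \<rho>\<^sup>2)" .
  have "?\<sigma> ^ (R - j) \<le> \<rho> ^ (R - j)" using \<sigma> by (intro power_mono) auto
  also have "\<dots> \<le> \<rho> ^ (R - 2)" using \<rho> j by (intro power_decreasing) auto
  finally have "H * ?\<sigma> ^ (R - j) \<le> H * \<rho> ^ (R - 2)" using nonneg by (intro mult_left_mono)
  from mult_left_mono[OF add_mono[OF first_le this] interpolation_const_nonneg[of "2 ^ R" R]] show ?thesis
    using funpow_deriv_le_local_oscillation[OF assms(1) \<rho>(1) j(1) order_trans[OF j(2) \<open>2 \<le> R\<close>] osc top]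
    by linarith
qed

lemma powr_hoelder_scale_le:
  fixes \<alpha> b :: real
  assumes "0 < \<alpha>" "\<alpha> \<le> 1" "0 < b"
  defines "\<rho> \<equiv> \<alpha> powr (1/2 + b / 8)"
  shows "\<rho> powr b / \<rho>\<^sup>2 \<le> \<alpha> powr (-1 + b / 4)"
proof -
  have "0 < \<rho>" using assms by simp
  then have "\<rho> powr b / \<rho>\<^sup>2 = \<rho> powr (b - 2)" by (simp add: powr_diff)
  also have "\<dots> = \<alpha> powr ((1/2 + b / 8) * (b - 2))" by (simp add: \<rho>_def powr_powr)
  also have "(1/2 + b / 8) * (b - 2) = -1 + b / 4 + b * b / 8" by (simp add: field_simps)
  also have "\<alpha> powr \<dots> \<le> \<alpha> powr (-1 + b / 4)" using assms by (intro powr_mono') auto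
  finally show ?thesis .
qed

lemma powr_growth_scale_le:
  fixes \<alpha> \<sigma> :: real
  assumes "0 < \<alpha>" "\<alpha> \<le> 1" "2 \<le> R" and R: "real P + (real n + 1) / 2 \<le> \<sigma> * (real R - 2)"
  shows "\<alpha> powr (- (real (n + R - 1) / 2)) * (\<alpha> powr (1/2 + \<sigma>)) ^ (R - 2) \<le> \<alpha> ^ P"
proof -
  have "(\<alpha> powr (1/2 + \<sigma>)) ^ (R - 2) = \<alpha> powr ((1/2 + \<sigma>) * (real R - 2))"
    using assms by (simp add: powr_powr of_nat_diff flip: powr_realpow)
  then have "\<alpha> powr (- (real (n + R - 1) / 2)) * (\<alpha> powr (1/2 + \<sigma>)) ^ (R - 2)
      = \<alpha> powr (- (real (n + R - 1) / 2) + (1/2 + \<sigma>) * (real R - 2))" by (simp only: powr_add)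
  also have "- (real (n + R - 1) / 2) + (1/2 + \<sigma>) * (real R - 2) = \<sigma> * (real R - 2) - (real n + 1) / 2"
    using \<open>2 \<le> R\<close> by (simp add: of_nat_diff field_simps)
  also have "\<alpha> powr \<dots> \<le> \<alpha> powr real P" using assms by (intro powr_mono') auto
  finally show ?thesis using \<open>0 < \<alpha>\<close> by (simp add: powr_realpow)
qed

context circle_flow
begin

definition oscillation_const :: "nat \<Rightarrow> real \<Rightarrow> real" where
  "oscillation_const n B = exp_jet_const n * ((\<Sum>i<n. 2 ^ i * chain_jet_const 2 i)
     + (1 + (\<Sum>i<n. 2 ^ i * chain_jet_const (chain_jet_const B n * exp B) i)))"

lemma oscillation_const_nonneg: "0 \<le> oscillation_const n B"
  unfolding oscillation_const_def using exp_jet_const_ge_1[of n] chain_jet_const_ge_1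
  by (intro mult_nonneg_nonneg add_nonneg_nonneg sum_nonneg) (auto intro: order_trans[OF zero_le_one])

text \<open>Since $\Phi_v$ and $\Phi_w$ commute, the displacement of $\Phi_w$ is almost invariant under $\Phi_v$.\<close>

lemma funpow_deriv_disp_oscillation:
  assumes v: "smooth_time v" "\<And>y. jet_bound {..n} e 1 (log_deriv v) y" and e: "exp_jet_const n * e \<le> 1"
    and w: "smooth_time w" "\<And>y. jet_bound {..n} B 1 (log_deriv w) y"
      and W: "\<And>y. jet_bound {..n} W 1 (disp w) y"
  shows "\<bar>(deriv ^^ n) (disp w) (\<Phi> v x) - (deriv ^^ n) (disp w) x\<bar> \<le> oscillation_const n B * e * W"
proof -
  let ?e = "exp_jet_const n * e"
  have "0 \<le> e" using v(2) by (rule jet_bound_nonneg)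
  then have "1 * e \<le> ?e" using exp_jet_const_ge_1 by (intro mult_right_mono)
  then have "e \<le> 1" using e by linarith
  note smooth = smooth_disp[OF v(1)] smooth_disp[OF w(1)] smooth_\<Phi>[OF v(1)] smooth_\<Phi>[OF w(1)]
  have jets_v: "jet_bound {1..Suc n} ?e 1 (disp v) y" for y
    using jet_bound_exp_minus_1[OF smooth_log_deriv[OF v(1)] v(2) \<open>e \<le> 1\<close>, of y]
      jet_bound_deriv_iff[of n ?e 1 "disp v" y]
    by (simp add: deriv_disp[OF v(1)])
  have "\<bar>(deriv ^^ n) (\<lambda>x. disp w (\<Phi> v x)) x - (deriv ^^ n) (disp w) (\<Phi> v x)\<bar>
      \<le> (\<Sum>i<n. 2 ^ i * chain_jet_const 2 i) * ?e * W"
    using jet_bound_subset[OF jets_v[of x], of "{1..n}"] W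
    by (intro funpow_deriv_compose_near_id smooth e) (auto simp: disp_def[abs_def])
  moreover have "\<bar>(deriv ^^ n) (\<lambda>x. disp v (\<Phi> w x) - disp v x) x\<bar>
      \<le> (1 + (\<Sum>i<n. 2 ^ i * chain_jet_const (chain_jet_const B n * exp B) i)) * ?e * W"
    using jet_bound_subset[OF jet_bound_\<Phi>[OF w], of "{1..n}"] W
    by (intro funpow_deriv_compose_minus_self smooth jets_v) (auto simp: disp_def[abs_def])
  moreover have "(\<lambda>x. disp w (\<Phi> v x)) = (\<lambda>x. disp w x + (disp v (\<Phi> w x) - disp v x))"
    by (auto simp: disp_def \<Phi>_commute[of w v])
  then have "(deriv ^^ n) (\<lambda>x. disp w (\<Phi> v x)) x
      = (deriv ^^ n) (disp w) x + (deriv ^^ n) (\<lambda>x. disp v (\<Phi> w x) - disp v x) x"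
    using funpow_deriv_add[OF smooth(2) smooth_diff[OF smooth_compose[OF smooth(1,4)] smooth(1)], of n]
    by simp
  ultimately have "\<bar>(deriv ^^ n) (disp w) (\<Phi> v x) - (deriv ^^ n) (disp w) x\<bar>
      \<le> (\<Sum>i<n. 2 ^ i * chain_jet_const 2 i) * ?e * W
        + (1 + (\<Sum>i<n. 2 ^ i * chain_jet_const (chain_jet_const B n * exp B) i)) * ?e * W" by linarith
  also have "\<dots> = oscillation_const n B * e * W" by (simp add: oscillation_const_def algebra_simps)
  finally show ?thesis .
qed

lemma jet_bound_log_deriv_Suc:
  assumes w: "smooth_time w"
    and B: "jet_bound {..n} B 1 (log_deriv w) x" and W: "jet_bound {..Suc (Suc n)} W 1 (disp w) x"
  shows "jet_bound {..Suc n} (exp B * (1 + 2 ^ n * chain_jet_const B n) * W) 1 (log_deriv w) x"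
proof -
  let ?c = "exp B * (1 + 2 ^ n * chain_jet_const B n) * W"
  note smooth = smooth_log_deriv[OF w] smooth_disp[OF w]
  have "0 \<le> W" using W by (rule jet_bound_nonneg)
  have c: "exp B * W \<le> ?c" "2 ^ n * W * (chain_jet_const B n * exp B) \<le> ?c * 1"
    using \<open>0 \<le> W\<close> chain_jet_const_ge_1[of B n] by (simp_all add: algebra_simps)
  have log_deriv_B: "\<bar>log_deriv w x\<bar> \<le> B" "jet_bound {1..n} B 1 (log_deriv w) x"
    using B by (simp_all add: jet_bound_atMost_iff)
  have "\<bar>deriv (disp w) x\<bar> \<le> W" using jet_boundD[OF W, of 1] by simp
  then have "exp B * \<bar>exp (log_deriv w x) - 1\<bar> \<le> exp B * W" by (simp add: deriv_disp[OF w])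
  then have "\<bar>log_deriv w x\<bar> \<le> ?c" using abs_le_exp_minus_1[OF log_deriv_B(1)] c(1) by linarith
  moreover have "deriv (log_deriv w) = (\<lambda>x. deriv (deriv (disp w)) x * exp ((-1) * log_deriv w x))"
    using smooth
    by (simp add: deriv_disp[OF w] deriv_diff_smooth smooth_exp deriv_exp_smooth exp_minus mult.assoc)
  moreover have "jet_bound {..n} (2 ^ n * W * (chain_jet_const B n * exp B)) 1
      (\<lambda>x. deriv (deriv (disp w)) x * exp ((-1) * log_deriv w x)) x"
  proof (rule jet_bound_mult)
    have "jet_bound {1..Suc (Suc n)} W 1 (disp w) x" by (rule jet_bound_subset[OF W]) auto
    then have "jet_bound {..Suc n} (W * 1) 1 (deriv (disp w)) x" by (subst jet_bound_deriv_iff)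
    from jet_bound_subset[OF this, of "{1..Suc n}"] show "jet_bound {..n} W 1 (deriv (deriv (disp w))) x"
      using jet_bound_deriv_iff[of n W 1 "deriv (disp w)" x] by simp
    show "jet_bound {..n} (chain_jet_const B n * exp B) 1 (\<lambda>x. exp ((-1) * log_deriv w x)) x"
      using jet_bound_cmult[OF smooth(1) log_deriv_B(2), of "-1"] log_deriv_B(1)
      by (intro jet_bound_exp smooth_cmult smooth) auto
    show "smooth_real (\<lambda>x. exp ((-1) * log_deriv w x))" by (intro smooth_exp smooth_cmult smooth)
  qed (use smooth in \<open>auto intro: smooth_deriv\<close>)
  ultimately have "jet_bound {..n} (?c * 1) 1 (deriv (log_deriv w)) x"
    using jet_bound_mono[OF _ order_refl c(2)] by simp
  then have "jet_bound {1..Suc n} ?c 1 (log_deriv w) x" by (subst (asm) jet_bound_deriv_iff)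
  then show ?thesis using \<open>\<bar>log_deriv w x\<bar> \<le> ?c\<close> by (simp add: jet_bound_atMost_iff)
qed

lemma jet_bound_log_deriv_mult_Suc:
  assumes w: "smooth_time w" and W: "\<And>y. jet_bound {..Suc n} W 1 (log_deriv w) y"
    and B: "\<And>q. q < b \<Longrightarrow> jet_bound {..n} B 1 (log_deriv (real q * w)) x"
  shows "jet_bound {..Suc n} (real b * (chain_jet_const (chain_jet_const B n * exp B) (Suc n) * W)) 1
    (log_deriv (real b * w)) x"
proof -
  note smooth = smooth_log_deriv[OF w] smooth_time_mult[OF w]
  have "jet_bound {..Suc n} (\<Sum>q<b. chain_jet_const (chain_jet_const B n * exp B) (Suc n) * W) 1
      (\<lambda>x. \<Sum>q<b. log_deriv w (\<Phi> (real q * w) x)) x"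
    using smooth_compose[OF smooth(1) smooth_\<Phi>[OF smooth(2)]]
    by (intro jet_bound_sum jet_bound_compose_\<Phi> smooth B W) auto
  moreover have "log_deriv (real b * w) = (\<lambda>x. \<Sum>q<b. log_deriv w (\<Phi> (real q * w) x))"
    using log_deriv_mult[OF w] by auto
  ultimately show ?thesis by simp
qed

end

context scale_sequence
begin

lemma jet_decay_mono: "jet_decay n \<beta> B K \<Longrightarrow> m \<le> n \<Longrightarrow> jet_decay m \<beta> B K"
  unfolding jet_decay_def by (meson jet_bound_subset atMost_subset_iff)

lemma jet_bound_log_deriv_multiple:
  assumes "jet_decay n \<beta> B K" "0 < \<beta>" "0 < B" "K \<le> k" "real b * s (Suc k) \<le> s k"
  shows "jet_bound {..n} B 1 (log_deriv (real b * s (Suc k))) x"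
proof (rule jet_bound_mono[OF jet_decayD[OF assms(1,4,5)] order_refl])
  show "B * s k powr \<beta> \<le> B" using s_powr_le_1[OF \<open>0 < \<beta>\<close>, of k] \<open>0 < B\<close> by simp
qed simp

lemma jet_bound_log_deriv_next:
  assumes "jet_decay n \<beta> B K" "0 < \<beta>" "0 < B" "K \<le> k"
  shows "jet_bound {..n} B 1 (log_deriv (s (Suc k))) x"
proof -
  have "real 1 * s (Suc k) \<le> s k" using s_antimono[of k "Suc k"] by simp
  from jet_bound_log_deriv_multiple[OF assms this] show ?thesis by simp
qed

lemma ex_disp_oscillation_bound:
  assumes decay: "jet_decay n \<beta> B K" and \<beta>: "0 < \<beta>" and B: "0 < B"
  shows "\<exists>D\<ge>0. \<exists>K'\<ge>K. \<forall>k\<ge>K'. \<forall>j\<ge>K'. \<forall>r x W. 0 \<le> r \<longrightarrow> r \<le> s j \<longrightarrow>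
      (\<forall>y. jet_bound {..n} W 1 (disp (s (Suc k))) y) \<longrightarrow>
     \<bar>(deriv ^^ n) (disp (s (Suc k))) (\<Phi> r x) - (deriv ^^ n) (disp (s (Suc k))) x\<bar> \<le> D * s j powr \<beta> * W"
proof -
  obtain E K1 where E: "0 < E" "K \<le> K1"
    and jets: "\<And>j N v x. K1 \<le> j \<Longrightarrow> v \<in> expansions j N \<Longrightarrow> jet_bound {..n} (E * s j powr \<beta>) 1 (log_deriv v) x"
    using ex_jet_bound_expansions[OF assms] by blast
  obtain K2 where small: "\<And>j. K2 \<le> j \<Longrightarrow> exp_jet_const n * E * s j powr \<beta> \<le> 1"
    using s_powr_small[OF \<beta>, of 1 "exp_jet_const n * E"] by auto
  have osc: "\<bar>(deriv ^^ n) (disp (s (Suc k))) (\<Phi> r x) - (deriv ^^ n) (disp (s (Suc k))) x\<bar>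
      \<le> oscillation_const n B * E * s j powr \<beta> * W"
    if "max K1 K2 \<le> k" "max K1 K2 \<le> j"
      and r: "0 \<le> r" "r \<le> s j" and W: "\<And>y. jet_bound {..n} W 1 (disp (s (Suc k))) y"
    for k j r x W
  proof (rule le_at_\<Phi>_if_le_at_expansions[OF r,
        where f = "\<lambda>y. \<bar>(deriv ^^ n) (disp (s (Suc k))) y - (deriv ^^ n) (disp (s (Suc k))) x\<bar>"])
    show "continuous_on UNIV (\<lambda>y. \<bar>(deriv ^^ n) (disp (s (Suc k))) y - (deriv ^^ n) (disp (s (Suc k))) x\<bar>)"
      by (intro continuous_on_rabs smooth_continuous_on smooth_diff smooth_funpow_deriv smooth_const
        smooth_disp s_smooth)
    fix N v assume v: "v \<in> expansions j N"
    have "\<bar>(deriv ^^ n) (disp (s (Suc k))) (\<Phi> v x) - (deriv ^^ n) (disp (s (Suc k))) x\<bar>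
        \<le> oscillation_const n B * (E * s j powr \<beta>) * W"
    proof (rule funpow_deriv_disp_oscillation[OF smooth_time_expansion[OF v] jets[OF _ v] _ s_smooth _ W])
      show "exp_jet_const n * (E * s j powr \<beta>) \<le> 1" using small that(2) by (simp add: mult.assoc)
    qed (use that(1,2) E(2) jet_bound_log_deriv_next[OF assms] in auto)
    then show "\<bar>(deriv ^^ n) (disp (s (Suc k))) (\<Phi> v x) - (deriv ^^ n) (disp (s (Suc k))) x\<bar>
        \<le> oscillation_const n B * E * s j powr \<beta> * W" by (simp add: mult.assoc)
  qed
  show ?thesis
  proof (intro exI[of _ "oscillation_const n B * E"] exI[of _ "max K1 K2"] conjI allI impI)
    show "0 \<le> oscillation_const n B * E" using E(1) oscillation_const_nonneg by simp
    show "K \<le> max K1 K2" using E(2) by simp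
  qed (rule osc; blast)
qed

lemma jet_bound_disp_Suc_if_oscillation:
  assumes w: "smooth_time w" and A: "\<And>y. jet_bound {..n} A 1 (disp w) y"
    and osc: "\<And>r x W. 0 \<le> r \<Longrightarrow> r \<le> s j \<Longrightarrow> (\<And>y. jet_bound {..Suc n} W 1 (disp w) y) \<Longrightarrow>
      \<bar>(deriv ^^ Suc n) (disp w) (\<Phi> r x) - (deriv ^^ Suc n) (disp w) x\<bar> \<le> W / 4"
  shows "jet_bound {..Suc n} (max A (2 * (2 * A * lip_const / s j))) 1 (disp w) y"
proof (rule jet_bound_Suc_if_oscillation_small[OF smooth_disp[OF w] disp_add_1 A])
  fix x W assume W: "\<And>y. jet_bound {..Suc n} W 1 (disp w) y"
  let ?F = "(deriv ^^ n) (disp w)"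
  have "\<bar>?F y\<bar> \<le> A" for y using jet_boundD[OF A, of n] by simp
  moreover have "smooth_real ?F" by (intro smooth_funpow_deriv smooth_disp w)
  ultimately obtain z where z: "x < z" "z < \<Phi> (s j) x" "\<bar>deriv ?F z\<bar> \<le> 2 * A / (\<Phi> (s j) x - x)"
    using ex_small_deriv_between[of ?F x "\<Phi> (s j) x" A] s_pos[of j] by auto
  note z(3)
  also have "2 * A / (\<Phi> (s j) x - x) \<le> 2 * A / (s j / lip_const)"
    using disp_s_ge[of j x] jet_bound_nonneg[OF A] s_pos[of j] lip_const_ge_1
    by (intro frac_le) (auto simp: disp_def)
  finally have deriv_z: "\<bar>(deriv ^^ Suc n) (disp w) z\<bar> \<le> 2 * A * lip_const / s j" by simp
  obtain r where r: "0 \<le> r" "r \<le> s j" "z = \<Phi> r x" using between_\<Phi>_times[of 0 x z "s j"] z by auto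
  show "\<exists>z. \<bar>(deriv ^^ Suc n) (disp w) z\<bar> \<le> 2 * A * lip_const / s j \<and>
      \<bar>(deriv ^^ Suc n) (disp w) z - (deriv ^^ Suc n) (disp w) x\<bar> \<le> W / 4"
    using deriv_z osc[OF r(1,2) W, of x] r(3) by blast
qed

lemma ex_jet_bound_disp:
  assumes "jet_decay n \<beta> B K" and \<beta>: "0 < \<beta>" and B: "0 < B"
  shows "\<exists>D>0. \<exists>K'\<ge>K. \<forall>k\<ge>K'. \<forall>y. jet_bound {..n} (D * s (Suc k)) 1 (disp (s (Suc k))) y"
  using assms(1)
proof (induction n)
  case 0
  have "jet_bound {..0} (lip_const * s (Suc k)) 1 (disp (s (Suc k))) y" for k y
    using disp_le[OF s_pos s_le_1, of "Suc k" y] disp_nonneg[OF less_imp_le[OF s_pos], of "Suc k" y]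
    by (simp add: jet_bound_def)
  then show ?case using lip_const_ge_1 by (intro exI[of _ lip_const]) auto
next
  case (Suc n)
  obtain D K1 where D: "0 < D" "K \<le> K1"
    and jets: "\<And>k y. K1 \<le> k \<Longrightarrow> jet_bound {..n} (D * s (Suc k)) 1 (disp (s (Suc k))) y"
    using Suc.IH[OF jet_decay_mono[OF Suc.prems]] by auto
  obtain E K2 where E: "0 \<le> E"
    and osc: "\<And>k j r x W. K2 \<le> k \<Longrightarrow> K2 \<le> j \<Longrightarrow> 0 \<le> r \<Longrightarrow> r \<le> s j \<Longrightarrow>
        (\<forall>y. jet_bound {..Suc n} W 1 (disp (s (Suc k))) y) \<Longrightarrow>
      \<bar>(deriv ^^ Suc n) (disp (s (Suc k))) (\<Phi> r x) - (deriv ^^ Suc n) (disp (s (Suc k))) x\<bar>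
          \<le> E * s j powr \<beta> * W"
    using ex_disp_oscillation_bound[OF Suc.prems \<beta> B] by metis
  obtain K3 where K3: "\<And>k. K3 \<le> k \<Longrightarrow> E * s k powr \<beta> \<le> 1/4" using s_powr_small[OF \<beta>, of "1/4" E] by auto
  define j where "j = max K2 K3"
  define D' where "D' = max D (2 * (2 * D * lip_const / s j))"
  have "jet_bound {..Suc n} (D' * s (Suc k)) 1 (disp (s (Suc k))) y" if k: "max K1 K2 \<le> k" for k y
  proof -
    have "jet_bound {..Suc n} (max (D * s (Suc k)) (2 * (2 * (D * s (Suc k)) * lip_const / s j))) 1
        (disp (s (Suc k))) y"
    proof (rule jet_bound_disp_Suc_if_oscillation[OF s_smooth jets])
      fix r x W assume r: "0 \<le> r" "r \<le> s j" and W: "\<And>y. jet_bound {..Suc n} W 1 (disp (s (Suc k))) y"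
      have "\<bar>(deriv ^^ Suc n) (disp (s (Suc k))) (\<Phi> r x) - (deriv ^^ Suc n) (disp (s (Suc k))) x\<bar>
          \<le> E * s j powr \<beta> * W"
        using k W by (intro osc r) (auto simp: j_def)
      also have "\<dots> \<le> 1/4 * W"
        using K3[of j] jet_bound_nonneg[OF W] by (intro mult_right_mono) (auto simp: j_def)
      finally show "\<bar>(deriv ^^ Suc n) (disp (s (Suc k))) (\<Phi> r x) - (deriv ^^ Suc n) (disp (s (Suc k))) x\<bar>
          \<le> W / 4" by simp
    qed (use k in simp)
    moreover have "max (D * s (Suc k)) (2 * (2 * (D * s (Suc k)) * lip_const / s j)) = D' * s (Suc k)"
      unfolding D'_def max_mult_distrib_right using s_pos[of "Suc k"] by (simp add: mult_ac)
    ultimately show ?thesis by simp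
  qed
  then show ?case using D by (intro exI[of _ D'] conjI exI[of _ "max K1 K2"]) (auto simp: D'_def)
qed

lemma ex_scale_below:
  assumes "0 < q" "q \<le> s K"
  obtains j where "K \<le> j" "q \<le> s j" "s (Suc j) < q"
proof -
  define m where "m = (LEAST j. s j < q)"
  have "\<exists>j. s j < q" using order_tendstoD(2)[OF s_tendsto_0 assms(1)] eventually_happens by fastforce
  then have m: "s m < q" unfolding m_def by (rule LeastI_ex)
  then have "K < m" using assms(2) s_antimono[of m K] by fastforce
  moreover have "q \<le> s j" if "j < m" for j using not_less_Least that unfolding m_def by fastforce
  ultimately show ?thesis using m by (intro that[of "m - 1"]) auto
qed

lemma ex_disp_hoelder:
  assumes "jet_decay n \<beta> B K" "0 < \<beta>" "\<beta> \<le> 1" "0 < B"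
  shows "\<exists>D\<ge>0. \<exists>K'\<ge>K. \<exists>r>0. \<forall>k\<ge>K'. \<forall>x y W. x \<le> y \<longrightarrow> y - x \<le> r \<longrightarrow>
      (\<forall>y. jet_bound {..n} W 1 (disp (s (Suc k))) y) \<longrightarrow>
     \<bar>(deriv ^^ n) (disp (s (Suc k))) y - (deriv ^^ n) (disp (s (Suc k))) x\<bar>
         \<le> D * (y - x) powr (\<beta> / real P) * W"
proof -
  let ?\<beta> = "\<beta> / real P"
  have \<beta>: "0 < ?\<beta>" "?\<beta> \<le> 1" using assms(2,3) P_ge_1 by (simp_all add: field_simps)
  obtain E J where E: "0 \<le> E" "K \<le> J"
    and osc: "\<And>k j r x W. J \<le> k \<Longrightarrow> J \<le> j \<Longrightarrow> 0 \<le> r \<Longrightarrow> r \<le> s j \<Longrightarrow> (\<forall>y. jet_bound {..n} W 1 (disp (s (Suc k))) y) \<Longrightarrow>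
      \<bar>(deriv ^^ n) (disp (s (Suc k))) (\<Phi> r x) - (deriv ^^ n) (disp (s (Suc k))) x\<bar> \<le> E * s j powr \<beta> * W"
    using ex_disp_oscillation_bound[OF assms(1,2,4)] by metis
  have Q: "1 \<le> lip_const" by (rule lip_const_ge_1)
  have "\<bar>(deriv ^^ n) (disp (s (Suc k))) y - (deriv ^^ n) (disp (s (Suc k))) x\<bar>
      \<le> E * lip_const * (y - x) powr ?\<beta> * W"
    if k: "J \<le> k" and xy: "x \<le> y" "y - x \<le> s J / lip_const"
      and W: "\<forall>y. jet_bound {..n} W 1 (disp (s (Suc k))) y" for k x y W
  proof (cases "x = y")
    case False
    define q where "q = lip_const * (y - x)"
    have q: "0 < q" "q \<le> s J" using xy Q False by (simp_all add: q_def field_simps)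
    obtain i where i: "J \<le> i" "q \<le> s i" "s (Suc i) < q" using ex_scale_below[OF q] .
    have "lip_const * (y - x) \<le> lip_const * disp (s i) x"
      using le_disp[OF s_pos s_le_1, of i x] i(2) by (simp add: q_def)
    then have "y \<le> \<Phi> (s i) x" using Q by (simp add: disp_def)
    then obtain r where r: "0 \<le> r" "r \<le> s i" "y = \<Phi> r x" using between_\<Phi>_times[of 0 x y "s i"] xy by auto
    have "s i powr \<beta> = (s i ^ P) powr ?\<beta>"
      using s_pos[of i] P_ge_1 by (simp add: powr_powr flip: powr_realpow)
    also have "\<dots> \<le> q powr ?\<beta>" using s_power_le[of i] i(3) \<beta> s_pos[of i] by (intro powr_mono2) auto
    also have "\<dots> = lip_const powr ?\<beta> * (y - x) powr ?\<beta>" using Q xy by (simp add: q_def powr_mult)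
    also have "\<dots> \<le> lip_const powr 1 * (y - x) powr ?\<beta>" using Q \<beta> by (intro mult_right_mono powr_mono) auto
    finally have "s i powr \<beta> \<le> lip_const * (y - x) powr ?\<beta>" using Q by simp
    then have "E * s i powr \<beta> * W \<le> E * (lip_const * (y - x) powr ?\<beta>) * W"
      using E(1) jet_bound_nonneg[OF W[rule_format]] by (intro mult_right_mono mult_left_mono) auto
    then show ?thesis using osc[OF k i(1) r(1,2) W, of x] r(3) by (simp add: mult.assoc)
  qed simp
  then show ?thesis using E Q s_pos[of J]
    by (intro exI[of _ "E * lip_const"] conjI exI[of _ J] exI[of _ "s J / lip_const"] allI impI) auto
qed

lemma ex_funpow_deriv_disp_growth:
  assumes "1 \<le> r"
  obtains H where "0 < H" "\<And>k y. \<bar>(deriv ^^ Suc r) (disp (s (Suc k))) y\<bar> \<le> H * s k powr (- (real r / 2))"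
proof -
  obtain Q where Q: "0 < Q" "\<And>k. roughness (s k) \<le> Q * sqrt (s k)" using ex_roughness_sqrt_bound by blast
  define c where "c = chain_jet_const (iterate_jet_const r) r * exp V"
  have c: "0 < c" using chain_jet_const_ge_1[of "iterate_jet_const r" r] by (simp add: c_def)
  have "\<bar>(deriv ^^ Suc r) (disp (s (Suc k))) y\<bar>
      \<le> c * (Q * lip_const) ^ r * s k powr (- (real r / 2))" for k y
  proof -
    obtain b l where step: "scale_step (s k) (s (Suc k)) b l" using s_step by blast
    have "roughness (s k) / disp (s k) y \<le> (Q * sqrt (s k)) / (s k / lip_const)"
      using Q lip_const_ge_1 s_pos[of k] roughness_pos[OF s_scale, of k]
      by (intro frac_le disp_s_ge) (auto simp: less_imp_le)
    also have "\<dots> = Q * lip_const * (s k powr (1/2) / s k powr 1)"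
      using s_pos[of k] by (simp add: powr_half_sqrt)
    also have "s k powr (1/2) / s k powr 1 = s k powr (-1/2)" using powr_diff[of "s k" "1/2" 1] by simp
    finally have ratio: "roughness (s k) / disp (s k) y \<le> Q * lip_const * s k powr (-1/2)" .
    have "\<bar>(deriv ^^ Suc r) (disp (s (Suc k))) y\<bar> \<le> c * (roughness (s k) / disp (s k) y) ^ r"
      unfolding c_def
      by (rule abs_funpow_deriv_disp_next_le[OF s_scale step s_roughness_le_1
        is_scale_max_log_deriv_le[OF s_scale] assms])
    also have "\<dots> \<le> c * (Q * lip_const * s k powr (-1/2)) ^ r"
      using c ratio roughness_pos[OF s_scale, of k] disp_pos[OF s_pos, of k y]
      by (intro mult_left_mono power_mono) auto
    also have "\<dots> = c * (Q * lip_const) ^ r * s k powr (- (real r / 2))"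
      using s_pos[of k] by (simp add: power_mult_distrib powr_powr flip: powr_realpow)
    finally show ?thesis .
  qed
  then show ?thesis using c Q lip_const_ge_1 by (intro that[of "c * (Q * lip_const) ^ r"]) auto
qed

lemma one_le_s_powr: "\<beta> \<le> 0 \<Longrightarrow> 1 \<le> s k powr \<beta>"
  using powr_mono'[of \<beta> 0 "s k"] s_pos[of k] s_le_1[of k] by simp

lemma funpow_deriv_disp_le_if_hoelder:
  assumes b: "0 < b" "b \<le> 1" and nonneg: "0 \<le> E" "0 \<le> D" "0 \<le> H" and j: "1 \<le> j" "j \<le> 2"
    and R: "2 \<le> R" "real P + (real n + 1) / 2 \<le> b / 8 * (real R - 2)"
    and hoelder: "\<And>x y. x \<le> y \<Longrightarrow> y - x \<le> s k powr (1/2) \<Longrightarrow>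
      \<bar>(deriv ^^ n) (disp (s (Suc k))) y - (deriv ^^ n) (disp (s (Suc k))) x\<bar>
          \<le> E * (y - x) powr b * (D * s (Suc k))"
    and growth: "\<And>y. \<bar>(deriv ^^ (n + R)) (disp (s (Suc k))) y\<bar> \<le> H * s k powr (- (real (n + R - 1) / 2))"
  shows "\<bar>(deriv ^^ (n + j)) (disp (s (Suc k))) x\<bar>
    \<le> interpolation_const (2 ^ R) R * (4 ^ R * E * D + H) * (s (Suc k) * s k powr (-1 + b / 4))"
proof -
  let ?w = "s (Suc k)" and ?g = "s k powr (-1 + b / 4)" and ?I = "interpolation_const (2 ^ R) R"
  define \<rho> where "\<rho> = s k powr (1/2 + b / 8)"
  have "\<rho> \<le> s k powr (1/2)" unfolding \<rho>_def using s_pos[of k] s_le_1 b by (intro powr_mono') auto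
  then have \<rho>: "0 < \<rho>" "\<rho> \<le> 1" "\<rho> \<le> s k powr (1/2)"
    using s_powr_le_1[of "1/2" k] s_pos[of k] by (auto simp: \<rho>_def)
  have w: "0 < ?w" by (rule s_pos)
  have osc: "\<bar>(deriv ^^ n) (disp ?w) y - (deriv ^^ n) (disp ?w) x\<bar> \<le> E * \<rho> powr b * (D * ?w)"
    if "y \<in> {x..x + \<rho>}" for y
  proof -
    have "\<bar>(deriv ^^ n) (disp ?w) y - (deriv ^^ n) (disp ?w) x\<bar> \<le> E * (y - x) powr b * (D * ?w)"
      using that \<rho> by (intro hoelder) auto
    also have "\<dots> \<le> E * \<rho> powr b * (D * ?w)"
      using that b nonneg w by (intro mult_right_mono mult_left_mono powr_mono2) auto
    finally show ?thesis .
  qed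
  have "E * \<rho> powr b * (D * ?w) / \<rho>\<^sup>2 = E * D * ?w * (\<rho> powr b / \<rho>\<^sup>2)" by simp
  also have "\<dots> \<le> E * D * ?w * ?g"
    unfolding \<rho>_def using powr_hoelder_scale_le[OF s_pos s_le_1 b(1), of k] nonneg w
    by (intro mult_left_mono) auto
  finally have first_le: "E * \<rho> powr b * (D * ?w) / \<rho>\<^sup>2 \<le> E * D * ?w * ?g" .
  have "s k powr (- (real (n + R - 1) / 2)) * \<rho> ^ (R - 2) \<le> s k ^ P"
    unfolding \<rho>_def by (rule powr_growth_scale_le[OF s_pos s_le_1 R])
  also have "\<dots> \<le> ?w * ?g"
    using mult_mono[OF s_power_le[of k] one_le_s_powr[of "-1 + b / 4" k]] b w s_pos[of k] by simp
  finally have "H * s k powr (- (real (n + R - 1) / 2)) * \<rho> ^ (R - 2) \<le> H * (?w * ?g)"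
    using nonneg(3) unfolding mult.assoc by (rule mult_left_mono)
  with first_le have "4 ^ R * (E * \<rho> powr b * (D * ?w) / \<rho>\<^sup>2)
      + H * s k powr (- (real (n + R - 1) / 2)) * \<rho> ^ (R - 2)
      \<le> 4 ^ R * (E * D * ?w * ?g) + H * (?w * ?g)" by (intro add_mono mult_left_mono) auto
  also have "\<dots> = (4 ^ R * E * D + H) * (?w * ?g)" by (simp add: algebra_simps)
  finally have "?I * (4 ^ R * (E * \<rho> powr b * (D * ?w) / \<rho>\<^sup>2)
      + H * s k powr (- (real (n + R - 1) / 2)) * \<rho> ^ (R - 2))
      \<le> ?I * (4 ^ R * E * D + H) * (?w * ?g)"
    unfolding mult.assoc[of ?I] by (rule mult_left_mono[OF _ interpolation_const_nonneg])
  then show ?thesis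
    using funpow_deriv_le_local_oscillation_2[OF smooth_disp[OF s_smooth] \<rho>(1,2) R(1) j osc growth]
    by (rule order_trans[rotated])
qed

lemma ex_jet_bound_disp_next:
  assumes decay: "jet_decay n \<beta> B K" and \<beta>: "0 < \<beta>" "\<beta> \<le> 1" and B: "0 < B"
  defines "\<gamma> \<equiv> \<beta> / real P / 4"
  shows "\<exists>D>0. \<exists>K'\<ge>K. \<forall>k\<ge>K'. \<forall>y.
    jet_bound {..Suc (Suc n)} (D * (s (Suc k) * s k powr (-1 + \<gamma>))) 1 (disp (s (Suc k))) y"
proof -
  let ?b = "\<beta> / real P"
  have b: "0 < ?b" "?b \<le> 1" using \<beta> P_ge_1 by (simp_all add: field_simps)
  obtain D1 K1 where D1: "0 < D1" "K \<le> K1"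
    and low: "\<And>k y. K1 \<le> k \<Longrightarrow> jet_bound {..n} (D1 * s (Suc k)) 1 (disp (s (Suc k))) y"
    using ex_jet_bound_disp[OF decay \<beta>(1) B] by blast
  obtain E K2 r where E: "0 \<le> E" "0 < r"
    and hoelder: "\<And>k x y W. K2 \<le> k \<Longrightarrow> x \<le> y \<Longrightarrow> y - x \<le> r \<Longrightarrow> (\<forall>y. jet_bound {..n} W 1 (disp (s (Suc k))) y) \<Longrightarrow>
      \<bar>(deriv ^^ n) (disp (s (Suc k))) y - (deriv ^^ n) (disp (s (Suc k))) x\<bar> \<le> E * (y - x) powr ?b * W"
    using ex_disp_hoelder[OF decay \<beta> B] by metis
  obtain R :: nat where R: "2 \<le> R" "real P + (real n + 1) / 2 \<le> ?b / 8 * (real R - 2)"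
  proof -
    obtain r where "real P + (real n + 1) / 2 < real r * (?b / 8)"
      using reals_Archimedean3[of "?b / 8"] b by auto
    moreover have "?b / 8 * (real (r + 2) - 2) = real r * (?b / 8)" by simp
    ultimately show ?thesis using that[of "r + 2"] by linarith
  qed
  have "1 \<le> n + R - 1" "Suc (n + R - 1) = n + R" using R(1) by simp_all
  then obtain H where H: "0 < H"
    "\<And>k y. \<bar>(deriv ^^ (n + R)) (disp (s (Suc k))) y\<bar> \<le> H * s k powr (- (real (n + R - 1) / 2))"
    using ex_funpow_deriv_disp_growth[of "n + R - 1"] by metis
  obtain K3 where K3: "\<And>k. K3 \<le> k \<Longrightarrow> s k powr (1/2) \<le> r" using s_powr_small[of "1/2" r 1] E(2) by auto
  define D2 where "D2 = interpolation_const (2 ^ R) R * (4 ^ R * E * D1 + H)"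
  have D2: "0 \<le> D2" using E D1 H interpolation_const_nonneg by (simp add: D2_def)
  have "jet_bound {..Suc (Suc n)} ((D1 + D2) * (s (Suc k) * s k powr (-1 + \<gamma>))) 1 (disp (s (Suc k))) y"
    if k: "max (max K1 K2) K3 \<le> k" for k y
  proof -
    let ?W = "s (Suc k) * s k powr (-1 + \<gamma>)"
    have W: "0 < ?W" "s (Suc k) \<le> ?W"
      using one_le_s_powr[of "-1 + \<gamma>" k] b s_pos[of "Suc k"] s_pos[of k] by (simp_all add: \<gamma>_def)
    have "D1 * s (Suc k) \<le> D1 * ?W" using W D1(1) by (intro mult_left_mono) auto
    moreover have "0 \<le> D1 * ?W" "0 \<le> D2 * ?W" using W D1(1) D2 by simp_all
    ultimately have le: "D1 * s (Suc k) \<le> (D1 + D2) * ?W" "D2 * ?W \<le> (D1 + D2) * ?W"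
      unfolding distrib_right by linarith+
    have "\<bar>(deriv ^^ (n + j)) (disp (s (Suc k))) y\<bar> \<le> (D1 + D2) * ?W" if "1 \<le> j" "j \<le> 2" for j
      using funpow_deriv_disp_le_if_hoelder[OF b E(1) less_imp_le[OF D1(1)] less_imp_le[OF H(1)] that R
        hoelder H(2), where x = y]
        k K3[of k] low le(2) unfolding D2_def \<gamma>_def by force
    from this[of 1] this[of 2] show ?thesis
      using k jet_bound_mono[OF low order_refl le(1)] by (simp add: jet_bound_atMost_Suc)
  qed
  moreover have "0 < D1 + D2" using D1 D2 by simp
  moreover have "K \<le> max (max K1 K2) K3" using D1(2) by simp
  ultimately show ?thesis by blast
qed

lemma jet_decay_Suc:
  assumes decay: "jet_decay n \<beta> B K" and \<beta>: "0 < \<beta>" "\<beta> \<le> 1" and B: "0 < B"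
  shows "\<exists>\<gamma>>0. \<gamma> \<le> 1 \<and> (\<exists>B'>0. \<exists>K'. jet_decay (Suc n) \<gamma> B' K')"
proof -
  define \<gamma> where "\<gamma> = \<beta> / real P / 4"
  have \<gamma>: "0 < \<gamma>" "\<gamma> \<le> 1" using \<beta> P_ge_1 by (auto simp: \<gamma>_def field_simps)
  obtain D K' where D: "0 < D" "K \<le> K'"
    and disp_jets: "\<And>k y. K' \<le> k \<Longrightarrow>
        jet_bound {..Suc (Suc n)} (D * (s (Suc k) * s k powr (-1 + \<gamma>))) 1 (disp (s (Suc k))) y"
    using ex_jet_bound_disp_next[OF assms, folded \<gamma>_def] by blast
  define A where "A = exp B * (1 + 2 ^ n * chain_jet_const B n) * D"
  define T where "T = chain_jet_const (chain_jet_const B n * exp B) (Suc n)"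
  have AT: "0 < A" "1 \<le> T" using D(1) chain_jet_const_ge_1[of B n] unfolding A_def T_def
    by (auto intro!: mult_pos_pos add_pos_nonneg chain_jet_const_ge_1)
  have "jet_bound {..Suc n} (T * A * s k powr \<gamma>) 1 (log_deriv (real b * s (Suc k))) x"
    if k: "K' \<le> k" and b: "real b * s (Suc k) \<le> s k" for k b x
  proof -
    let ?w = "s (Suc k)" and ?W = "A * (s (Suc k) * s k powr (-1 + \<gamma>))"
    have next_jets: "jet_bound {..Suc n} ?W 1 (log_deriv ?w) y" for y
      using jet_bound_log_deriv_Suc[OF s_smooth jet_bound_log_deriv_next[OF decay \<beta>(1) B] disp_jets[OF k]]
        k D(2)
      by (simp add: A_def mult.assoc)
    have "jet_bound {..Suc n} (real b * (T * ?W)) 1 (log_deriv (real b * ?w)) x"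
      unfolding T_def
    proof (rule jet_bound_log_deriv_mult_Suc[OF s_smooth next_jets])
      fix q assume "q < b"
      then have "real q * ?w \<le> real b * ?w" using s_pos[of "Suc k"] by (intro mult_right_mono) auto
      then have "real q * ?w \<le> s k" using b by linarith
      then show "jet_bound {..n} B 1 (log_deriv (real q * ?w)) x"
        using k D(2) by (intro jet_bound_log_deriv_multiple[OF decay \<beta>(1) B]) auto
    qed
    moreover have "real b * (T * ?W) \<le> T * A * s k powr \<gamma>"
    proof -
      have "real b * (T * ?W) = (T * A) * ((real b * ?w) * s k powr (-1 + \<gamma>))" by simp
      also have "\<dots> \<le> (T * A) * (s k * s k powr (-1 + \<gamma>))"
        using b AT by (intro mult_left_mono mult_right_mono) auto
      also have "s k * s k powr (-1 + \<gamma>) = s k powr \<gamma>" using s_pos[of k] by (simp add: powr_mult_base)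
      finally show ?thesis .
    qed
    ultimately show ?thesis using jet_bound_mono[OF _ order_refl] by simp
  qed
  then have "jet_decay (Suc n) \<gamma> (T * A) K'" by (simp add: jet_decay_def)
  moreover have "0 < T * A" using AT by simp
  ultimately show ?thesis using \<gamma> by blast
qed

theorem ex_jet_decay: "\<exists>\<beta>>0. \<beta> \<le> 1 \<and> (\<exists>B>0. \<exists>K. jet_decay n \<beta> B K)"
proof (induction n)
  case 0
  have "0 < min \<kappa> 1" "0 < 2 * exp V * G * C" using \<kappa>_pos C_pos G_ge_1 by simp_all
  then show ?case using jet_decay_0 by (meson min.cobounded2)
next
  case (Suc n)
  then show ?case using jet_decay_Suc by blast
qed

end

section \<open>Smoothness of the conjugacy\<close>

lemma abs_deriv_le_landau:
  assumes "smooth_real F" "\<And>x. \<bar>F x\<bar> \<le> A" "\<And>x. \<bar>deriv (deriv F) x\<bar> \<le> B" "0 < t"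
  shows "\<bar>deriv F x\<bar> \<le> 2 * A / t + B * t"
proof -
  obtain z where z: "x < z" "z < x + t" "\<bar>deriv F z\<bar> \<le> 2 * A / t"
    using ex_small_deriv_between[OF assms(1), of x "x + t" A] assms(2,4) by auto
  have "\<bar>deriv F z - deriv F x\<bar> \<le> B * \<bar>z - x\<bar>"
    using smooth_diff_le[OF smooth_deriv[OF assms(1)] convex_UNIV, of B x z] assms(3) by simp
  also have "\<dots> \<le> B * t" using z assms(3)[of 0] by (intro mult_left_mono) auto
  finally show ?thesis using z(3) by linarith
qed

lemma uniform_limit_deriv:
  assumes v: "\<And>k. smooth_real (v k)" and lim: "uniform_limit UNIV v f sequentially"
    and B: "\<And>k x. \<bar>deriv (deriv (v k)) x\<bar> \<le> B"
  obtains g where "uniform_limit UNIV (\<lambda>k. deriv (v k)) g sequentially"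
    "\<And>x. (f has_real_derivative g x) (at x)"
proof -
  have "uniformly_Cauchy_on UNIV (\<lambda>k. deriv (v k))"
  proof (rule uniformly_Cauchy_onI)
    fix e :: real assume "0 < e"
    have "0 \<le> B" using B[of 0 0] by linarith
    define t where "t = e / (4 * (B + 1))"
    have t: "0 < t" "2 * B * t < e / 2" using \<open>0 < e\<close> \<open>0 \<le> B\<close> by (simp_all add: t_def field_simps)
    have "uniformly_Cauchy_on UNIV v" using lim by (intro uniformly_convergent_Cauchy uniformly_convergentI)
    then obtain M where M: "\<And>x m n. M \<le> m \<Longrightarrow> M \<le> n \<Longrightarrow> dist (v m x) (v n x) < e * t / 4"
      using t \<open>0 < e\<close> unfolding uniformly_Cauchy_on_def
      by (metis UNIV_I divide_pos_pos mult_pos_pos zero_less_numeral)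
    have "dist (deriv (v m) x) (deriv (v n) x) < e" if "M \<le> m" "M \<le> n" for m n x
    proof -
      have "\<bar>deriv (\<lambda>x. v m x - v n x) x\<bar> \<le> 2 * (e * t / 4) / t + 2 * B * t"
      proof (rule abs_deriv_le_landau[OF smooth_diff[OF v v] _ _ t(1)])
        show "\<bar>v m x - v n x\<bar> \<le> e * t / 4" for x using M[OF that, of x] by (simp add: dist_real_def)
        show "\<bar>deriv (deriv (\<lambda>x. v m x - v n x)) x\<bar> \<le> 2 * B" for x
          using B[of m x] B[of n x] by (simp add: deriv_diff_smooth v smooth_deriv)
      qed
      then show ?thesis using t by (simp add: deriv_diff_smooth v dist_real_def)
    qed
    then show "\<exists>M. \<forall>x\<in>UNIV. \<forall>m\<ge>M. \<forall>n\<ge>M. dist (deriv (v m) x) (deriv (v n) x) < e" by blast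
  qed
  then obtain g where g: "uniform_limit UNIV (\<lambda>k. deriv (v k)) g sequentially"
    using Cauchy_uniformly_convergent uniformly_convergent_on_def by blast
  have "\<exists>G. \<forall>x\<in>UNIV. (\<lambda>k. v k x) \<longlonglongrightarrow> G x \<and> (G has_derivative (\<lambda>t. g x * t)) (at x within UNIV)"
  proof (rule has_derivative_sequence)
    show "(v k has_derivative (\<lambda>t. deriv (v k) x * t)) (at x within UNIV)" for k x
      using smooth_has_derivative[OF v, of k x] by (simp add: has_field_derivative_def)
    show "\<forall>\<^sub>F k in sequentially. \<forall>x\<in>UNIV. \<forall>t. norm (deriv (v k) x * t - g x * t) \<le> e * norm t"
      if "0 < e" for e
      using uniform_limitD[OF g that]
      by eventually_elim (auto simp: dist_real_def
        abs_mult simp flip: left_diff_distrib intro!: mult_right_mono intro: less_imp_le)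
    show "(\<lambda>k. v k 0) \<longlonglongrightarrow> f 0" using tendsto_uniform_limitI[OF lim] by simp
  qed simp_all
  then obtain G where G: "\<And>x. (\<lambda>k. v k x) \<longlonglongrightarrow> G x" "\<And>x. (G has_real_derivative g x) (at x)"
    by (auto simp: has_field_derivative_def)
  have "G = f" using LIMSEQ_unique[OF G(1)] tendsto_uniform_limitI[OF lim] by blast
  then show ?thesis using that[OF g] G(2) by blast
qed

definition bounded_jet_limit :: "nat \<Rightarrow> (real \<Rightarrow> real) \<Rightarrow> bool" where
  "bounded_jet_limit n f
      \<longleftrightarrow> (\<exists>E. \<forall>e>0. \<exists>v. smooth_real v \<and> (\<forall>x. \<bar>v x - f x\<bar> \<le> e) \<and> (\<forall>x. jet_bound {1..n} E 1 v x))"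

lemma bounded_jet_limit_deriv:
  assumes "bounded_jet_limit (Suc (Suc n)) f"
  obtains g where "\<And>x. (f has_real_derivative g x) (at x)" "bounded_jet_limit (Suc n) g"
proof -
  obtain E where "\<forall>e>0. \<exists>v. smooth_real v \<and> (\<forall>x. \<bar>v x - f x\<bar> \<le> e) \<and>
      (\<forall>x. jet_bound {1..Suc (Suc n)} E 1 v x)"
    using assms unfolding bounded_jet_limit_def by blast
  then have "\<forall>k::nat. \<exists>v. smooth_real v \<and> (\<forall>x. \<bar>v x - f x\<bar> \<le> inverse (real (Suc k))) \<and>
      (\<forall>x. jet_bound {1..Suc (Suc n)} E 1 v x)"
    by simp
  then obtain v where v: "\<And>k. smooth_real (v k)" "\<And>k x. \<bar>v k x - f x\<bar> \<le> inverse (real (Suc k))"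
    "\<And>k x. jet_bound {1..Suc (Suc n)} E 1 (v k) x" by metis
  have "uniform_limit UNIV v f sequentially"
  proof (rule uniform_limitI)
    fix e :: real assume "0 < e"
    with LIMSEQ_inverse_real_of_nat have "\<forall>\<^sub>F k in sequentially. inverse (real (Suc k)) < e"
      by (rule order_tendstoD)
    then show "\<forall>\<^sub>F k in sequentially. \<forall>x\<in>UNIV. dist (v k x) (f x) < e"
      by eventually_elim (use v(2) in \<open>auto simp: dist_real_def intro: le_less_trans\<close>)
  qed
  moreover have "\<bar>deriv (deriv (v k)) x\<bar> \<le> E" for k x
    using jet_boundD[OF v(3), of "Suc (Suc 0)" k x] by simp
  ultimately obtain g where g: "uniform_limit UNIV (\<lambda>k. deriv (v k)) g sequentially"
    "\<And>x. (f has_real_derivative g x) (at x)"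
    using uniform_limit_deriv[of v f E, OF v(1)] by blast
  have "\<exists>w. smooth_real w \<and> (\<forall>x. \<bar>w x - g x\<bar> \<le> e) \<and> (\<forall>x. jet_bound {1..Suc n} E 1 w x)" if e: "0 < e" for e
  proof -
    obtain k where "\<And>x. dist (deriv (v k) x) (g x) < e"
      using eventually_happens'[OF sequentially_bot uniform_limitD[OF g(1) e]] by auto
    moreover have "jet_bound {1..Suc n} E 1 (deriv (v k)) x" for x
      unfolding jet_bound_def
    proof
      fix i assume "i \<in> {1..Suc n}"
      then show "\<bar>(deriv ^^ i) (deriv (v k)) x\<bar> \<le> E * 1 ^ i"
        using jet_boundD[OF v(3), of "Suc i" k x] by (simp add: funpow_deriv_Suc del: funpow.simps)
    qed
    ultimately show ?thesis using smooth_deriv[OF v(1), of k] by (auto simp: dist_real_def less_imp_le)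
  qed
  then have "bounded_jet_limit (Suc n) g" unfolding bounded_jet_limit_def by blast
  then show ?thesis using that g(2) by blast
qed

lemma higher_differentiable_if_bounded_jet_limit:
  "bounded_jet_limit (Suc n) f \<Longrightarrow> higher_differentiable n f"
proof (induction n arbitrary: f)
  case (Suc n)
  obtain g where "\<And>x. (f has_real_derivative g x) (at x)" "bounded_jet_limit (Suc n) g"
    using bounded_jet_limit_deriv[OF Suc.prems] by blast
  then show ?case using Suc.IH by (intro higher_differentiable_SucI)
qed simp

lemma mono_shift_quasi_linear:
  fixes G :: "real \<Rightarrow> real"
  assumes "mono G" "\<And>z. G (z + 1 / real n) = G z + 1" "0 < n"
  shows "\<bar>G y - G z - real n * (y - z)\<bar> \<le> 1"
proof -
  define p where "p = \<lfloor>real n * (y - z)\<rfloor>"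
  have p: "of_int p \<le> real n * (y - z)" "real n * (y - z) < of_int (p + 1)" unfolding p_def by linarith+
  have "G ((x + 1) / real n) = G (x / real n) + 1" for x
    using assms(2)[of "x / real n"] by (simp add: add_divide_distrib)
  from shift_of_int[of "\<lambda>x. G (x / real n)", OF this, of "real n * z"]
  have shift: "G (z + of_int q / real n) = G z + of_int q" for q
    using \<open>0 < n\<close> by (simp add: add_divide_distrib)
  have "z + of_int p / real n \<le> y" "y \<le> z + of_int (p + 1) / real n"
    using p \<open>0 < n\<close> by (simp_all add: field_simps)
  then have "G z + of_int p \<le> G y" "G y \<le> G z + of_int (p + 1)"
    using \<open>mono G\<close> unfolding mono_def by (metis shift)+
  then show ?thesis using p by (simp add: abs_le_iff)
qed

context circle_flow
begin

primrec multiple_jet_const :: "nat \<Rightarrow> nat \<Rightarrow> real" where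
  "multiple_jet_const n 0 = 0"
| "multiple_jet_const n (Suc q) =
    chain_jet_const (chain_jet_const (multiple_jet_const n q) n * exp (multiple_jet_const n q)) n
        + multiple_jet_const n q"

lemma jet_bound_log_deriv_mult:
  assumes v: "smooth_time v" "\<And>y. jet_bound {..n} 1 1 (log_deriv v) y"
  shows "jet_bound {..n} (multiple_jet_const n q) 1 (log_deriv (real q * v)) x"
proof (induction q arbitrary: x)
  case 0
  then show ?case by (simp add: jet_bound_def funpow_deriv_const)
next
  case (Suc q)
  let ?w = "real q * v" and ?c = "multiple_jet_const n q"
  note smooth = smooth_log_deriv[OF v(1)] smooth_time_mult[OF v(1), of q]
  have "jet_bound {..n} (chain_jet_const (chain_jet_const ?c n * exp ?c) n * 1) 1
      (\<lambda>x. log_deriv v (\<Phi> ?w x)) x"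
    by (intro jet_bound_compose_\<Phi> smooth Suc v(2)) simp
  moreover have "log_deriv (real (Suc q) * v) = (\<lambda>x. log_deriv v (\<Phi> ?w x) + log_deriv ?w x)"
    using log_deriv_mult_Suc[OF v(1)] by auto
  ultimately show ?case
    using jet_bound_add[OF smooth_compose[OF smooth(1) smooth_\<Phi>[OF smooth(2)]]
      smooth_log_deriv[OF smooth(2)] _ Suc] by simp
qed

lemma abs_\<Phi>_diff_le_max_disp:
  assumes "\<bar>r - r'\<bar> \<le> e"
  shows "\<bar>\<Phi> r x - \<Phi> r' x\<bar> \<le> max_disp e"
  using assms
proof (induction r r' rule: linorder_wlog)
  case (le r r')
  have "\<Phi> r' x - \<Phi> r x = disp (r' - r) (\<Phi> r x)" by (simp add: disp_def flip: \<Phi>_add)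
  moreover have "disp (r' - r) (\<Phi> r x) \<le> disp e (\<Phi> r x)" using le by (intro disp_mono) simp
  ultimately show ?case using disp_nonneg[of "r' - r" "\<Phi> r x"] disp_le_max_disp[of e "\<Phi> r x"] le by linarith
qed (simp add: abs_minus_commute)

lemma uniform_orbit_average:
  assumes "0 < n"
  shows "\<bar>((\<Sum>q<n. \<Phi> (real q / real n) x) - (\<Sum>q<n. \<Phi> (real q / real n) y)) / real n - (h x - h y)\<bar>
    \<le> 1 / real n"
proof -
  define G where "G z = (\<Sum>q<n. \<xi> (z + real q / real n))" for z
  have "\<bar>G (h x) - G (h y) - real n * (h x - h y)\<bar> \<le> 1"
  proof (rule mono_shift_quasi_linear[OF _ _ assms])
    show "mono G" unfolding G_def mono_def by (intro allI impI sum_mono) simp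
    fix z
    have "G (z + 1 / real n) - G z = (\<Sum>q<n. \<xi> (z + real (Suc q) / real n) - \<xi> (z + real q / real n))"
      unfolding G_def by (simp add: sum_subtractf add_divide_distrib add.assoc)
    also have "\<dots> = \<xi> (z + real n / real n) - \<xi> (z + real 0 / real n)"
      using sum_lessThan_telescope[of "\<lambda>q. \<xi> (z + real q / real n)" n] by simp
    finally show "G (z + 1 / real n) = G z + 1" using assms by (simp add: \<xi>_add_1)
  qed
  moreover have "(G (h x) - G (h y)) / real n - (h x - h y)
      = (G (h x) - G (h y) - real n * (h x - h y)) / real n"
    using assms by (simp add: field_simps)
  ultimately have "\<bar>(G (h x) - G (h y)) / real n - (h x - h y)\<bar>
    \<le> 1 / real n"
    by (simp add: divide_right_mono)
  then show ?thesis by (simp add: G_def \<Phi>_def)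
qed

lemma orbit_average:
  assumes "0 < n" "\<And>q. q < n \<Longrightarrow> \<bar>t q - real q / real n\<bar> \<le> e"
  shows "\<bar>((\<Sum>q<n. \<Phi> (t q) x) - (\<Sum>q<n. \<Phi> (t q) y)) / real n - (h x - h y)\<bar> \<le> 2 * max_disp e + 1 / real n"
proof -
  have near: "\<bar>(\<Sum>q<n. \<Phi> (t q) z) / real n - (\<Sum>q<n. \<Phi> (real q / real n) z) / real n\<bar> \<le> max_disp e" for z
  proof -
    have "\<bar>(\<Sum>q<n. \<Phi> (t q) z) - (\<Sum>q<n. \<Phi> (real q / real n) z)\<bar> \<le> (\<Sum>q<n. max_disp e)"
      unfolding sum_subtractf[symmetric] using assms(2)
      by (intro order_trans[OF sum_abs] sum_mono abs_\<Phi>_diff_le_max_disp) simp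
    then show ?thesis using \<open>0 < n\<close> by (simp add: field_simps flip: diff_divide_distrib)
  qed
  show ?thesis using near[of x] near[of y] uniform_orbit_average[OF \<open>0 < n\<close>, of x y]
    by (simp add: diff_divide_distrib)
qed

end

context scale_sequence
begin

lemma ex_bounded_jet_time_near:
  "\<exists>E. \<forall>r\<in>{0..1}. \<forall>e>0. \<exists>t. smooth_time t \<and> \<bar>t - r\<bar> \<le> e \<and> (\<forall>x. jet_bound {1..Suc n} E 1 (\<Phi> t) x)"
proof -
  obtain \<beta> B K where "0 < \<beta>" "0 < B" "jet_decay n \<beta> B K" using ex_jet_decay by blast
  from ex_jet_bound_expansions[OF this(3,1,2)] obtain E j where E: "E * s j powr \<beta> \<le> 1"
    and jets: "\<And>N v x. v \<in> expansions j N \<Longrightarrow> jet_bound {..n} (E * s j powr \<beta>) 1 (log_deriv v) x"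
    by (meson order_refl)
  obtain J :: nat where J: "1 / s j \<le> real J" using real_arch_simple by blast
  have "0 < 1 / s j" using s_pos[of j] by simp
  then have J_pos: "0 < real J" using J by linarith
  define L where "L = multiple_jet_const n J"
  have "\<exists>t. smooth_time t \<and> \<bar>t - r\<bar> \<le> e \<and>
      (\<forall>x. jet_bound {1..Suc n} (chain_jet_const L n * exp L) 1 (\<Phi> t) x)"
    if r: "r \<in> {0..1}" and e: "0 < e" for r e
  proof -
    have "r / real J \<le> 1 / real J" using r J_pos by (intro divide_right_mono) auto
    also have "\<dots> \<le> s j" using J J_pos s_pos[of j] by (simp add: field_simps)
    finally have r_J: "0 \<le> r / real J" "r / real J \<le> s j" using r J_pos by simp_all
    have "0 < e / real J" using e J_pos by simp
    then obtain N where N: "\<And>k. N \<le> k \<Longrightarrow> s k < e / real J" using s_less_eventually by blast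
    obtain v where v: "v \<in> expansions j N" "0 \<le> r / real J - v" "r / real J - v \<le> s (j + N)"
      using ex_expansion_near[OF r_J] .
    have "r / real J - v \<le> e / real J" using v(3) N[of "j + N"] by simp
    then have "real J * (r / real J - v) \<le> e" "0 \<le> real J * (r / real J - v)"
      using J_pos v(2) by (simp_all add: pos_le_divide_eq mult.commute)
    then have "\<bar>real J * v - r\<bar> \<le> e" using J_pos by (simp add: right_diff_distrib)
    moreover have smooth_v: "smooth_time v" by (rule smooth_time_expansion[OF v(1)])
    moreover have "jet_bound {..n} 1 1 (log_deriv v) y" for y
      using jet_bound_mono[OF jets[OF v(1)] order_refl E] by simp
    then have "jet_bound {1..Suc n} (chain_jet_const L n * exp L) 1 (\<Phi> (real J * v)) x" for x
      unfolding L_def by (intro jet_bound_\<Phi> jet_bound_log_deriv_mult smooth_time_mult smooth_v)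
    ultimately show ?thesis using smooth_time_mult[OF smooth_v] by blast
  qed
  then show ?thesis by blast
qed

lemma bounded_jet_limit_h: "bounded_jet_limit (Suc n) (\<lambda>x. h x - h 0)"
proof -
  obtain E where E: "\<And>r e. r \<in> {0..1} \<Longrightarrow> 0 < e \<Longrightarrow>
      \<exists>t. smooth_time t \<and> \<bar>t - r\<bar> \<le> e \<and> (\<forall>x. jet_bound {1..Suc n} E 1 (\<Phi> t) x)"
    using ex_bounded_jet_time_near by blast
  have "\<exists>v. smooth_real v \<and> (\<forall>x. \<bar>v x - (h x - h 0)\<bar> \<le> e) \<and> (\<forall>x. jet_bound {1..Suc n} E 1 v x)"
    if e: "0 < e" for e
  proof -
    obtain b where b: "0 < b" "max_disp b \<le> e / 4" using max_disp_small[of "e / 4"] e by auto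
    obtain N :: nat where N: "2 / e < real N" using reals_Archimedean2 by blast
    have "0 < 2 / e" using e by simp
    then have N_pos: "0 < N" using N by (intro Nat.gr0I) auto
    have N_le: "1 / real N \<le> e / 2" using N N_pos e by (simp add: field_simps)
    have "\<forall>q. \<exists>t. q < N \<longrightarrow> smooth_time t \<and> \<bar>t - real q / real N\<bar> \<le> b \<and>
        (\<forall>x. jet_bound {1..Suc n} E 1 (\<Phi> t) x)"
      using E[OF _ b(1)] by (simp add: divide_le_eq_1)
    then obtain t where t: "\<And>q. q < N \<Longrightarrow> smooth_time (t q)" "\<And>q. q < N \<Longrightarrow> \<bar>t q - real q / real N\<bar> \<le> b"
      "\<And>q x. q < N \<Longrightarrow> jet_bound {1..Suc n} E 1 (\<Phi> (t q)) x" by metis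
    define u where "u x = 1 / real N * (\<Sum>q<N. \<Phi> (t q) x)" for x
    have smooth_sum_\<Phi>: "smooth_real (\<lambda>x. \<Sum>q<N. \<Phi> (t q) x)" by (intro smooth_sum smooth_\<Phi> t(1)) auto
    then have smooth_u: "smooth_real u" unfolding u_def by (rule smooth_cmult)
    have "\<bar>(u x - u 0) - (h x - h 0)\<bar> \<le> e" for x
      using orbit_average[OF N_pos t(2), of x 0] b(2) N_le by (simp add: u_def diff_divide_distrib)
    moreover have "jet_bound {1..Suc n} (\<Sum>q<N. E) 1 (\<lambda>x. \<Sum>q<N. \<Phi> (t q) x) x" for x
      by (intro jet_bound_sum smooth_\<Phi> t) auto
    then have "jet_bound {1..Suc n} E 1 u x" for x
      unfolding u_def
      using jet_bound_cmult[OF smooth_sum_\<Phi>, of "{1..Suc n}" "real N * E" 1 x "1 / real N"] N_pos by simp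
    then have "jet_bound {1..Suc n} E 1 (\<lambda>x. u x - u 0) x" for x
      using smooth_u by (subst jet_bound_diff_const) auto
    ultimately show ?thesis using smooth_u by (intro exI[of _ "\<lambda>x. u x - u 0"]) (auto intro: smooth_diff)
  qed
  then show ?thesis unfolding bounded_jet_limit_def by blast
qed

lemma smooth_h: "smooth_real h"
proof -
  have "smooth_real (\<lambda>x. h x - h 0)"
    unfolding smooth_iff_higher_differentiable
    using higher_differentiable_if_bounded_jet_limit[OF bounded_jet_limit_h] by blast
  then have "smooth_real (\<lambda>x. (h x - h 0) + h 0)" by (intro smooth_add smooth_const)
  then show ?thesis by simp
qed

lemma h_diff_ge:
  assumes "r \<le> t" "h t - h r \<le> 1"
  shows "(t - r) / lip_const \<le> h t - h r"
proof (cases "r = t")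
  case False
  then have "0 < h t - h r" using assms by simp
  then have "disp (h t - h r) r \<le> lip_const * (h t - h r)" using assms(2) by (rule disp_le)
  then show ?thesis using lip_const_ge_1 by (simp add: disp_def \<Phi>_def pos_divide_le_eq mult.commute)
qed simp

lemma deriv_h_pos: "0 < deriv h x"
proof -
  have deriv: "((\<lambda>t. h t - t / lip_const) has_real_derivative deriv h x - 1 / lip_const) (at x)"
    using lip_const_ge_1 by (auto intro!: derivative_eq_intros smooth_has_derivative[OF smooth_h])
  have "0 \<le> deriv h x - 1 / lip_const"
  proof (rule mono_on_imp_deriv_nonneg[OF _ deriv])
    let ?U = "{t. \<bar>h t - h x\<bar> < 1/2}"
    show "mono_on ?U (\<lambda>t. h t - t / lip_const)"
    proof (rule mono_onI)
      fix r t assume "r \<in> ?U" "t \<in> ?U" "r \<le> t"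
      moreover have "h t - h r \<le> \<bar>h t - h x\<bar> + \<bar>h r - h x\<bar>" by linarith
      ultimately have "(t - r) / lip_const \<le> h t - h r" by (intro h_diff_ge) auto
      then show "h r - r / lip_const \<le> h t - t / lip_const" by (simp add: diff_divide_distrib)
    qed
    have "open ?U" by (intro open_Collect_less continuous_intros continuous_h)
    then show "x \<in> interior ?U" by (simp add: interior_open)
  qed
  moreover have "0 < 1 / lip_const" using lip_const_ge_1 by simp
  ultimately show ?thesis by linarith
qed

end

section \<open>Irrational rotations\<close>

lemma irrational_mult_add_of_int_eq_0_iff:
  fixes \<tau> :: real
  assumes "\<tau> \<notin> \<rat>"
  shows "of_int j * \<tau> + of_int p = 0 \<longleftrightarrow> j = 0 \<and> p = 0"
proof (cases "j = 0")
  case False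
  have "of_int j * \<tau> + of_int p \<noteq> 0"
  proof
    assume "of_int j * \<tau> + of_int p = 0"
    then have "\<tau> = of_int (- p) / of_int j" using False by (simp add: field_simps)
    then show False using assms by (metis Rats_divide Rats_of_int)
  qed
  then show ?thesis using False by simp
qed simp

lemma dist_int_irrational_mult_pos:
  assumes "\<tau> \<notin> \<rat>" "0 < j"
  shows "0 < dist_int (real j * \<tau>)"
proof -
  obtain p where "dist_int (real j * \<tau>) = \<bar>real j * \<tau> + of_int p\<bar>" by (rule dist_int_attained)
  then show ?thesis using irrational_mult_add_of_int_eq_0_iff[OF assms(1), of "int j" p] assms(2) by simp
qed

lemma nat_multiples_mod1_dense:
  fixes \<tau> :: real
  assumes "\<tau> \<notin> \<rat>" "y < z"
  obtains n :: nat and p :: int where "0 < n" "y < real n * \<tau> + of_int p" "real n * \<tau> + of_int p < z"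
proof -
  obtain q k where k: "0 < k" "\<bar>of_int k * \<tau> - of_int q - (y + z) / 2\<bar> < (z - y) / 2"
    by (rule sequence_of_fractional_parts_is_dense[of \<tau> "(z - y) / 2" "(y + z) / 2"]) (use assms in auto)
  have "real (nat k) = of_int k" using k(1) by simp
  moreover have "y < of_int k * \<tau> - of_int q" "of_int k * \<tau> - of_int q < z"
    using k(2) by (simp_all add: abs_less_iff field_simps)
  ultimately show ?thesis using that[of "nat k" "- q"] k(1) by simp
qed

definition best_denominator :: "real \<Rightarrow> nat \<Rightarrow> bool" where
  "best_denominator \<tau> q \<longleftrightarrow> 0 < q \<and> (\<forall>j. 0 < j \<longrightarrow> j < q \<longrightarrow> dist_int (real q * \<tau>) < dist_int (real j * \<tau>))"

lemma ex_best_denominator: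
  assumes "\<tau> \<notin> \<rat>" "0 < e"
  obtains q where "N < q" "dist_int (real q * \<tau>) < e" "best_denominator \<tau> q"
proof -
  define \<delta> where "\<delta> = Min (insert e ((\<lambda>j. dist_int (real j * \<tau>)) ` {1..N}))"
  have "0 < \<delta>" unfolding \<delta>_def using assms dist_int_irrational_mult_pos by (subst Min_gr_iff) auto
  have \<delta>_le: "\<delta> \<le> e" "\<And>j. 0 < j \<Longrightarrow> j \<le> N \<Longrightarrow> \<delta> \<le> dist_int (real j * \<tau>)"
    unfolding \<delta>_def by (rule Min_le, simp, simp)+
  let ?P = "\<lambda>q. 0 < q \<and> dist_int (real q * \<tau>) < \<delta>"
  define q where "q = (LEAST q. ?P q)"
  obtain n p where n: "0 < n" "- \<delta> < real n * \<tau> + of_int p" "real n * \<tau> + of_int p < \<delta>"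
    using nat_multiples_mod1_dense[OF assms(1), of "- \<delta>" \<delta>] \<open>0 < \<delta>\<close> by auto
  then have "?P n" using dist_int_le[of "real n * \<tau>" "- p"] by simp
  then have q: "?P q" unfolding q_def by (rule LeastI[of ?P])
  have "\<delta> \<le> dist_int (real j * \<tau>)" if "0 < j" "j < q" for j
    using not_less_Least[of j ?P] that unfolding q_def by auto
  then have "best_denominator \<tau> q" unfolding best_denominator_def using q less_le_trans by blast
  moreover have "N < q" using q \<delta>_le(2)[of q] by (cases "N < q") auto
  moreover have "dist_int (real q * \<tau>) < e" using q \<delta>_le(1) by simp
  ultimately show ?thesis using that by blast
qed

lemma best_denominator_separates:
  assumes "best_denominator \<tau> q" "i < q" "j < q" "i \<noteq> j \<or> p \<noteq> 0"
  shows "dist_int (real q * \<tau>) < \<bar>real i * \<tau> + of_int p - real j * \<tau>\<bar>"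
proof (cases "i = j")
  case True
  then have "1 \<le> \<bar>real_of_int p\<bar>" using assms(4) by auto
  then show ?thesis using dist_int_le_half[of "real q * \<tau>"] True by simp
next
  case False
  then have "0 < nat \<bar>int i - int j\<bar>" "nat \<bar>int i - int j\<bar> < q" using assms(2,3) by auto
  then have "dist_int (real q * \<tau>) < dist_int (real (nat \<bar>int i - int j\<bar>) * \<tau>)"
    using assms(1) unfolding best_denominator_def by blast
  then show ?thesis using dist_int_multiple_diff_le less_le_trans by blast
qed

section \<open>Lifts of circle homeomorphisms\<close>

locale circle_lift =
  fixes F :: "real \<Rightarrow> real"
  assumes strict_mono_F: "strict_mono F" and F_add_1: "F (x + 1) = F x + 1"
begin

lemma F_add_of_int: "F (x + of_int p) = F x + of_int p"
  using shift_of_int[of F 1, OF F_add_1] by simp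

lemma funpow_add_of_int: "(F ^^ n) (x + of_int p) = (F ^^ n) x + of_int p"
  by (induction n) (simp_all add: F_add_of_int)

lemma funpow_less_iff [simp]: "(F ^^ n) x < (F ^^ n) y \<longleftrightarrow> x < y"
  by (induction n) (simp_all add: strict_mono_less[OF strict_mono_F])

lemma funpow_le_iff [simp]: "(F ^^ n) x \<le> (F ^^ n) y \<longleftrightarrow> x \<le> y"
  by (simp flip: linorder_not_less)

subsection \<open>The rotation number\<close>

lemma funpow_disp_near_orbit_0: "\<bar>(F ^^ n) x - x - (F ^^ n) 0\<bar> \<le> 1"
proof -
  let ?p = "\<lfloor>x\<rfloor>"
  have "(F ^^ n) (0 + of_int ?p) \<le> (F ^^ n) x" "(F ^^ n) x \<le> (F ^^ n) (0 + of_int (?p + 1))" by simp_all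
  then have "(F ^^ n) 0 + of_int ?p \<le> (F ^^ n) x" "(F ^^ n) x \<le> (F ^^ n) 0 + of_int (?p + 1)"
    unfolding funpow_add_of_int .
  moreover have "of_int ?p \<le> x" "x < of_int (?p + 1)" by linarith+
  ultimately show ?thesis unfolding abs_le_iff of_int_add of_int_1 by linarith
qed

lemma funpow_mult_0_near: "\<bar>(F ^^ (k * n)) 0 - real k * (F ^^ n) 0\<bar> \<le> real k"
proof (induction k)
  case (Suc k)
  have "(F ^^ (Suc k * n)) 0 = (F ^^ n) ((F ^^ (k * n)) 0)" by (simp add: funpow_add)
  then have "\<bar>(F ^^ (Suc k * n)) 0 - (F ^^ (k * n)) 0 - (F ^^ n) 0\<bar> \<le> 1"
    using funpow_disp_near_orbit_0[of n "(F ^^ (k * n)) 0"] by simp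
  then show ?case using Suc by (simp add: algebra_simps abs_le_iff)
qed simp

lemma mean_disp_near:
  assumes "0 < k" "0 < n"
  shows "\<bar>(F ^^ k) 0 / real k - (F ^^ n) 0 / real n\<bar> \<le> 1 / real n + 1 / real k"
proof -
  have mult: "\<bar>(F ^^ (k * n)) 0 / real (k * n) - (F ^^ n) 0 / real n\<bar> \<le> 1 / real n"
    if "0 < k" "0 < n" for k n
  proof -
    have "(F ^^ (k * n)) 0 / real (k * n) - (F ^^ n) 0 / real n
        = ((F ^^ (k * n)) 0 - real k * (F ^^ n) 0) / real (k * n)"
      using that by (simp add: field_simps)
    also have "\<bar>\<dots>\<bar> \<le> real k / real (k * n)"
      unfolding abs_divide abs_of_nat using funpow_mult_0_near by (rule divide_right_mono) simp
    finally show ?thesis using that by simp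
  qed
  show ?thesis using mult[OF assms] mult[OF assms(2,1)] by (simp add: mult.commute abs_le_iff)
qed

lemma mean_disp_tendsto_rotation_number: "(\<lambda>n. (F ^^ n) 0 / real n) \<longlonglongrightarrow> rotation_number F"
proof -
  have "Cauchy (\<lambda>n. (F ^^ n) 0 / real n)"
  proof (rule metric_CauchyI)
    fix e :: real assume "0 < e"
    have "\<forall>\<^sub>F n in sequentially. 1 / real n < e / 2"
      using \<open>0 < e\<close> by (intro order_tendstoD(2)[OF lim_1_over_n]) simp
    then obtain N where N: "\<And>n. N \<le> n \<Longrightarrow> 1 / real n < e / 2" unfolding eventually_sequentially by blast
    have "dist ((F ^^ k) 0 / real k) ((F ^^ n) 0 / real n) < e" if "max N 1 \<le> k" "max N 1 \<le> n" for k n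
      using mean_disp_near[of k n] N[of k] N[of n] that by (simp add: dist_real_def)
    then show "\<exists>M. \<forall>k\<ge>M. \<forall>n\<ge>M. dist ((F ^^ k) 0 / real k) ((F ^^ n) 0 / real n) < e" by blast
  qed
  then have "convergent (\<lambda>n. (F ^^ n) 0 / real n)" by (rule Cauchy_convergent)
  then show ?thesis by (simp add: rotation_number_def convergent_LIMSEQ_iff)
qed

lemma funpow_0_near_rotation: "\<bar>(F ^^ n) 0 - real n * rotation_number F\<bar> \<le> 1"
proof (cases "n = 0")
  case False
  have "\<bar>rotation_number F - (F ^^ n) 0 / real n\<bar> \<le> 1 / real n"
  proof (rule LIMSEQ_le)
    show "(\<lambda>k. \<bar>(F ^^ k) 0 / real k - (F ^^ n) 0 / real n\<bar>) \<longlonglongrightarrow> \<bar>rotation_number F - (F ^^ n) 0 / real n\<bar>"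
      by (intro tendsto_intros mean_disp_tendsto_rotation_number)
    have "(\<lambda>k. 1 / real n + 1 / real k) \<longlonglongrightarrow> 1 / real n + 0" by (intro tendsto_intros lim_1_over_n)
    then show "(\<lambda>k. 1 / real n + 1 / real k) \<longlonglongrightarrow> 1 / real n" by simp
    show "\<exists>N. \<forall>k\<ge>N. \<bar>(F ^^ k) 0 / real k - (F ^^ n) 0 / real n\<bar> \<le> 1 / real n + 1 / real k"
      using mean_disp_near False by (intro exI[of _ 1]) auto
  qed
  then have "real n * \<bar>rotation_number F - (F ^^ n) 0 / real n\<bar> \<le> 1" using False by (simp add: field_simps)
  moreover have "(F ^^ n) 0 - real n * rotation_number F
      = - (real n * (rotation_number F - (F ^^ n) 0 / real n))"
    using False by (simp add: right_diff_distrib)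
  ultimately show ?thesis by (simp add: abs_mult)
qed simp

lemma funpow_near_rotation: "\<bar>(F ^^ n) x - x - real n * rotation_number F\<bar> \<le> 2"
  using funpow_disp_near_orbit_0[of n x] funpow_0_near_rotation[of n] by linarith

subsection \<open>Semiconjugacy to a rotation\<close>

text \<open>Comparing the orbit of $0$ with iterates of $x$ on both sides avoids negative powers of $F$.\<close>

definition orbit_bounds :: "real \<Rightarrow> real set" where
  "orbit_bounds x = {(real a - real b) * rotation_number F + of_int p | a b p. (F ^^ a) 0 + of_int p
      \<le> (F ^^ b) x}"

definition poincare_map :: "real \<Rightarrow> real" where "poincare_map x = Sup (orbit_bounds x)"

lemma orbit_bounds_nonempty: "orbit_bounds x \<noteq> {}"
  unfolding orbit_bounds_def by (auto intro!: exI[of _ 0] exI[of _ "\<lfloor>x\<rfloor>"])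

lemma bdd_above_orbit_bounds: "bdd_above (orbit_bounds x)"
proof (rule bdd_aboveI)
  fix y assume "y \<in> orbit_bounds x"
  then obtain a b p where "y = (real a - real b) * rotation_number F + of_int p"
    "(F ^^ a) 0 + of_int p \<le> (F ^^ b) x"
    by (auto simp: orbit_bounds_def)
  then show "y \<le> x + 4"
    using funpow_near_rotation[of a 0] funpow_near_rotation[of b x] by (simp add: abs_le_iff algebra_simps)
qed

lemma mono_poincare_map: "mono poincare_map"
proof
  fix x y :: real assume "x \<le> y"
  then have "(F ^^ b) x \<le> (F ^^ b) y" for b by simp
  then have "orbit_bounds x \<subseteq> orbit_bounds y" unfolding orbit_bounds_def using order_trans by fast
  then show "poincare_map x \<le> poincare_map y"
    unfolding poincare_map_def by (intro cSup_subset_mono orbit_bounds_nonempty bdd_above_orbit_bounds)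
qed

lemma poincare_map_eq_add:
  assumes "\<And>z. z \<in> orbit_bounds x \<Longrightarrow> z + k \<in> orbit_bounds y"
    "\<And>z. z \<in> orbit_bounds y \<Longrightarrow> z - k \<in> orbit_bounds x"
  shows "poincare_map y = poincare_map x + k"
proof (rule antisym)
  have "z \<le> poincare_map x + k" if "z \<in> orbit_bounds y" for z
    using cSup_upper[OF assms(2)[OF that] bdd_above_orbit_bounds] by (simp add: poincare_map_def)
  then show "poincare_map y \<le> poincare_map x + k"
    unfolding poincare_map_def[of y] by (intro cSup_least orbit_bounds_nonempty)
  have "z \<le> poincare_map y - k" if "z \<in> orbit_bounds x" for z
    using cSup_upper[OF assms(1)[OF that] bdd_above_orbit_bounds] by (simp add: poincare_map_def)
  then have "poincare_map x \<le> poincare_map y - k"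
    unfolding poincare_map_def[of x] by (intro cSup_least orbit_bounds_nonempty)
  then show "poincare_map x + k \<le> poincare_map y" by simp
qed

lemma poincare_map_add_1: "poincare_map (x + 1) = poincare_map x + 1"
proof (rule poincare_map_eq_add)
  have shift: "z + of_int k \<in> orbit_bounds (y + of_int k)" if z: "z \<in> orbit_bounds y" for z y k
  proof -
    obtain a b p where "z = (real a - real b) * rotation_number F + of_int p"
      "(F ^^ a) 0 + of_int p \<le> (F ^^ b) y"
      using z by (auto simp: orbit_bounds_def)
    then have "z + of_int k = (real a - real b) * rotation_number F + of_int (p + k)"
      "(F ^^ a) 0 + of_int (p + k) \<le> (F ^^ b) (y + of_int k)" by (simp_all add: funpow_add_of_int)
    then show ?thesis unfolding orbit_bounds_def by blast
  qed
  show "z + 1 \<in> orbit_bounds (x + 1)" if "z \<in> orbit_bounds x" for z using shift[OF that, of 1] by simp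
  show "z - 1 \<in> orbit_bounds x" if "z \<in> orbit_bounds (x + 1)" for z using shift[OF that, of "- 1"] by simp
qed

lemma poincare_map_F: "poincare_map (F x) = poincare_map x + rotation_number F"
proof (rule poincare_map_eq_add)
  fix z assume "z \<in> orbit_bounds x"
  then obtain a b p where z: "z = (real a - real b) * rotation_number F + of_int p"
    "(F ^^ a) 0 + of_int p \<le> (F ^^ b) x"
    by (auto simp: orbit_bounds_def)
  have "F ((F ^^ a) 0 + of_int p) \<le> F ((F ^^ b) x)" using z(2) strict_mono_less_eq[OF strict_mono_F] by simp
  then have "(F ^^ Suc a) 0 + of_int p \<le> (F ^^ b) (F x)" by (simp add: F_add_of_int funpow_swap1)
  moreover have "z + rotation_number F = (real (Suc a) - real b) * rotation_number F + of_int p"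
    using z(1) by (simp add: algebra_simps)
  ultimately show "z + rotation_number F \<in> orbit_bounds (F x)" unfolding orbit_bounds_def by blast
next
  fix z assume "z \<in> orbit_bounds (F x)"
  then obtain a b p where z: "z = (real a - real b) * rotation_number F + of_int p"
    "(F ^^ a) 0 + of_int p \<le> (F ^^ b) (F x)"
    by (auto simp: orbit_bounds_def)
  then have "(F ^^ a) 0 + of_int p \<le> (F ^^ Suc b) x" by (simp add: funpow_swap1)
  moreover have "z - rotation_number F = (real a - real (Suc b)) * rotation_number F + of_int p"
    using z(1) by (simp add: algebra_simps)
  ultimately show "z - rotation_number F \<in> orbit_bounds x" unfolding orbit_bounds_def by blast
qed

end

locale rotation_semiconjugacy = circle_lift +
  fixes H :: "real \<Rightarrow> real" and \<tau> :: real
  assumes mono_H: "mono H" and H_add_1: "H (x + 1) = H x + 1" and H_F: "H (F x) = H x + \<tau>"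
    and irrational: "\<tau> \<notin> \<rat>"
begin

lemma H_add_of_int: "H (x + of_int p) = H x + of_int p"
  using shift_of_int[of H 1, OF H_add_1] by simp

lemma H_funpow: "H ((F ^^ n) x) = H x + real n * \<tau>"
  by (induction n) (auto simp: H_F algebra_simps)

lemma less_if_H_less: "H x < H y \<Longrightarrow> x < y"
  using monoD[OF mono_H, of y x] by (meson linorder_not_less)

lemma ex_H_between:
  assumes "y < z"
  obtains x where "y < H x" "H x < z"
proof -
  have "y - H 0 < z - H 0" using assms by simp
  then obtain n p where "y - H 0 < real n * \<tau> + of_int p" "real n * \<tau> + of_int p < z - H 0"
    using nat_multiples_mod1_dense[OF irrational] by blast
  then show ?thesis by (intro that[of "(F ^^ n) 0 + of_int p"]) (auto simp: H_funpow H_add_of_int)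
qed

lemma surj_H: "surj H"
proof -
  have "\<exists>x. H x = y" for y
  proof -
    let ?A = "{t. H t \<le> y}"
    define p where "p = \<lfloor>y - H 0\<rfloor>"
    have "H (0 + of_int p) \<le> y" "y < H (0 + of_int (p + 1))" unfolding H_add_of_int p_def by linarith+
    then have "of_int p \<in> ?A" "\<And>t. t \<in> ?A \<Longrightarrow> t \<le> of_int (p + 1)"
      using less_if_H_less[OF le_less_trans, of _ y] by (auto simp: less_imp_le)
    then have A: "?A \<noteq> {}" "bdd_above ?A" unfolding bdd_above_def by blast+
    have Sup_A: "\<And>t. H t \<le> y \<Longrightarrow> t \<le> Sup ?A" "\<And>z. z < Sup ?A \<Longrightarrow> \<exists>t. H t \<le> y \<and> z < t"
      using cSup_upper[OF _ A(2)] less_cSupD[OF A(1)] by auto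
    have "\<not> H (Sup ?A) < y"
    proof
      assume "H (Sup ?A) < y"
      then obtain z where "H (Sup ?A) < H z" "H z < y" by (rule ex_H_between)
      then show False using Sup_A(1)[of z] less_if_H_less[of "Sup ?A" z] by simp
    qed
    moreover have "\<not> y < H (Sup ?A)"
    proof
      assume "y < H (Sup ?A)"
      then obtain z where z: "y < H z" "H z < H (Sup ?A)" by (rule ex_H_between)
      then obtain t where "H t \<le> y" "z < t" using Sup_A(2) less_if_H_less by blast
      then show False using z(1) monoD[OF mono_H, of z t] by simp
    qed
    ultimately show ?thesis by (intro exI[of _ "Sup ?A"]) simp
  qed
  then show ?thesis by (metis surjI)
qed

end

lemma (in circle_lift) rotation_semiconjugacy_poincare_map:
  "rotation_number F \<notin> \<rat> \<Longrightarrow> rotation_semiconjugacy F poincare_map (rotation_number F)"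
  by unfold_locales (simp_all add: mono_poincare_map poincare_map_add_1 poincare_map_F)

section \<open>Denjoy's theorem\<close>

lemma deriv_circle_diffeo_lift_pos:
  assumes "circle_diffeo_lift F"
  shows "0 < deriv F x"
proof -
  have F: "smooth_real F" "smooth_real (inv F)" "strict_mono F" "bij F"
    using assms by (auto simp: circle_diffeo_lift_def)
  have "((\<lambda>y. inv F (F y)) has_real_derivative deriv (inv F) (F x) * deriv F x) (at x)"
    by (rule DERIV_chain2[OF smooth_has_derivative[OF F(2)] smooth_has_derivative[OF F(1)]])
  then have "((\<lambda>y. y) has_real_derivative deriv (inv F) (F x) * deriv F x) (at x)"
    using F(4) by (simp add: bij_is_inj inv_f_f)
  then have "deriv (inv F) (F x) * deriv F x = 1" using DERIV_ident DERIV_unique by blast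
  then have "deriv F x \<noteq> 0" by auto
  moreover have "0 \<le> deriv F x"
    using mono_on_imp_deriv_nonneg[of UNIV F "deriv F x" x] smooth_has_derivative[OF F(1)] F(3)
    by (auto simp: strict_mono_mono mono_imp_mono_on)
  ultimately show ?thesis by simp
qed

lemma circle_lift_if_diffeo: "circle_diffeo_lift F \<Longrightarrow> circle_lift F"
  by (simp add: circle_diffeo_lift_def circle_lift_def)

lemma smooth_periodic_lipschitz:
  assumes "smooth_real w" "\<And>x. w (x + 1) = w x"
  obtains V where "0 \<le> V" "\<And>x y. \<bar>w x - w y\<bar> \<le> V * \<bar>x - y\<bar>"
proof -
  obtain V where V: "\<And>x. \<bar>deriv w x\<bar> \<le> V"
    using periodic_bounded[of "deriv w"] smooth_continuous_on[OF smooth_deriv[OF assms(1)]]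
      deriv_periodic[of w 0] assms(2) by auto
  moreover have "0 \<le> V" using V[of 0] by linarith
  ultimately show ?thesis using that smooth_diff_le[OF assms(1) convex_UNIV, of V] by auto
qed

locale diffeo_semiconjugacy = rotation_semiconjugacy +
  assumes diffeo: "circle_diffeo_lift F"
begin

definition log_slope :: "real \<Rightarrow> real" where "log_slope x = ln (deriv F x)"

lemma smooth_F: "smooth_real F" and bij_F: "bij F"
  using diffeo by (auto simp: circle_diffeo_lift_def)

lemma smooth_log_slope: "smooth_real log_slope"
  unfolding log_slope_def by (intro smooth_ln smooth_deriv smooth_F deriv_circle_diffeo_lift_pos diffeo)

lemma log_slope_add_of_int: "log_slope (x + of_int p) = log_slope x"
  using shift_of_int[of log_slope 0] deriv_periodic[of F 1, OF F_add_1] by (simp add: log_slope_def)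

lemma smooth_funpow: "smooth_real (F ^^ n)"
proof (induction n)
  case (Suc n)
  have "F ^^ Suc n = (\<lambda>x. F ((F ^^ n) x))" by auto
  then show ?case using smooth_compose[OF smooth_F Suc] by simp
qed (simp add: id_def)

lemma deriv_funpow: "deriv (F ^^ n) x = exp (\<Sum>i<n. log_slope ((F ^^ i) x))"
proof (induction n)
  case (Suc n)
  have compose: "F ^^ Suc n = (\<lambda>x. F ((F ^^ n) x))" by auto
  have "deriv (F ^^ Suc n) x = deriv F ((F ^^ n) x) * deriv (F ^^ n) x"
    unfolding compose by (simp add: deriv_compose_smooth smooth_F smooth_funpow)
  then show ?case using Suc deriv_circle_diffeo_lift_pos[OF diffeo]
    by (simp add: exp_add log_slope_def del: funpow.simps)
qed (simp add: id_def)

lemma collapsed_lengths_tendsto_0: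
  assumes "a < b" "H a = H b"
  shows "(\<lambda>n. (F ^^ n) b - (F ^^ n) a) \<longlonglongrightarrow> 0"
proof -
  have "(\<Sum>n<N. (F ^^ n) b - (F ^^ n) a) \<le> 1" for N
  proof (rule sum_disjoint_mod1_intervals_le_1)
    fix i j :: nat and p :: int assume "i \<noteq> j \<or> p \<noteq> 0"
    then have "of_int (int i - int j) * \<tau> + of_int p \<noteq> 0"
      using irrational_mult_add_of_int_eq_0_iff[OF irrational, of "int i - int j" p] by auto
    then have "H ((F ^^ i) b + of_int p) < H ((F ^^ j) a) \<or> H ((F ^^ j) b) < H ((F ^^ i) a + of_int p)"
      by (simp add: H_funpow H_add_of_int assms(2) left_diff_distrib) linarith
    then show "(F ^^ i) b + of_int p \<le> (F ^^ j) a \<or> (F ^^ j) b \<le> (F ^^ i) a + of_int p"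
      using less_if_H_less less_imp_le by blast
  qed (use assms in auto)
  then have "(\<Sum>n\<le>N. (F ^^ n) b - (F ^^ n) a) \<le> 1" for N unfolding lessThan_Suc_atMost[symmetric] .
  then have "summable (\<lambda>n. (F ^^ n) b - (F ^^ n) a)"
    using assms(1) by (intro bounded_imp_summable[of _ 1]) (auto simp: less_imp_le)
  then show ?thesis by (rule summable_LIMSEQ_zero)
qed

lemma sum_return_segments_le_1:
  assumes q: "best_denominator \<tau> q" and H_y: "H y = H x - real q * \<tau>"
    and p: "dist_int (real q * \<tau>) = \<bar>real q * \<tau> + of_int p\<bar>"
  shows "(\<Sum>i<q. \<bar>(F ^^ i) x - ((F ^^ i) y - of_int p)\<bar>) \<le> 1"
proof -
  let ?d = "real q * \<tau> + of_int p"
  define X where "X i = (F ^^ i) x" for i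
  define Y where "Y i = (F ^^ i) y - of_int p" for i
  have H_X: "H (X i) = H x + real i * \<tau>" and H_Y: "H (Y i) = H x + real i * \<tau> - ?d" for i
    using H_add_of_int[of "(F ^^ i) y" "- p"] by (simp_all add: X_def Y_def H_funpow H_y)
  have "0 < q" using q by (simp add: best_denominator_def)
  then have "?d \<noteq> 0" using dist_int_irrational_mult_pos[OF irrational, of q] p by simp
  then have "H (X i) \<noteq> H (Y i)" for i by (simp add: H_X H_Y)
  then have X_neq_Y: "X i \<noteq> Y i" for i by metis
  have "(\<Sum>i<q. max (X i) (Y i) - min (X i) (Y i)) \<le> 1"
  proof (rule sum_disjoint_mod1_intervals_le_1)
    fix i j and r :: int assume "i \<in> {..<q}" "j \<in> {..<q}" "i \<noteq> j \<or> r \<noteq> 0"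
    then have "\<bar>?d\<bar> < \<bar>real i * \<tau> + of_int r - real j * \<tau>\<bar>" using best_denominator_separates[OF q] p by auto
    then consider "real i * \<tau> + of_int r + \<bar>?d\<bar> < real j * \<tau>" | "real j * \<tau> + \<bar>?d\<bar> < real i * \<tau> + of_int r"
      by linarith
    then show "max (X i) (Y i) + of_int r \<le> min (X j) (Y j) \<or> max (X j) (Y j) \<le> min (X i) (Y i) + of_int r"
    proof cases
      case step: 1
      have "X i + of_int r < X j" "X i + of_int r < Y j" "Y i + of_int r < X j" "Y i + of_int r < Y j"
        by (rule less_if_H_less; unfold H_X H_Y H_add_of_int; use step in linarith)+
      then show ?thesis by linarith
    next
      case step: 2
      have "X j < X i + of_int r" "Y j < X i + of_int r" "X j < Y i + of_int r" "Y j < Y i + of_int r"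
        by (rule less_if_H_less; unfold H_X H_Y H_add_of_int; use step in linarith)+
      then show ?thesis by linarith
    qed
  next
    show "min (X i) (Y i) < max (X i) (Y i)" for i using X_neq_Y[of i] by linarith
  qed simp
  moreover have "max (X i) (Y i) - min (X i) (Y i) = \<bar>X i - Y i\<bar>" for i by (auto simp: max_def min_def)
  ultimately show ?thesis by (simp add: X_def Y_def)
qed

lemma ex_deriv_funpow_return_comparable:
  "\<exists>V. \<forall>q x y. best_denominator \<tau> q \<longrightarrow> H y = H x - real q * \<tau> \<longrightarrow>
      deriv (F ^^ q) y * exp (- V) \<le> deriv (F ^^ q) x"
proof -
  have "log_slope (x + 1) = log_slope x" for x using log_slope_add_of_int[of x 1] by simp
  then obtain V where V: "0 \<le> V" "\<And>x y. \<bar>log_slope x - log_slope y\<bar> \<le> V * \<bar>x - y\<bar>"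
    using smooth_periodic_lipschitz[OF smooth_log_slope] by blast
  have "deriv (F ^^ q) y * exp (- V) \<le> deriv (F ^^ q) x"
    if q: "best_denominator \<tau> q" and H_y: "H y = H x - real q * \<tau>" for q x y
  proof -
    obtain p where p: "dist_int (real q * \<tau>) = \<bar>real q * \<tau> + of_int p\<bar>" by (rule dist_int_attained)
    have "(\<Sum>i<q. log_slope ((F ^^ i) y)) - (\<Sum>i<q. log_slope ((F ^^ i) x))
        = (\<Sum>i<q. log_slope ((F ^^ i) y - of_int p) - log_slope ((F ^^ i) x))"
      using log_slope_add_of_int[of _ "- p"] by (simp add: sum_subtractf)
    also have "\<dots> \<le> (\<Sum>i<q. V * \<bar>(F ^^ i) x - ((F ^^ i) y - of_int p)\<bar>)"
    proof (rule sum_mono)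
      show "log_slope ((F ^^ i) y - of_int p) - log_slope ((F ^^ i) x)
          \<le> V * \<bar>(F ^^ i) x - ((F ^^ i) y - of_int p)\<bar>" for i
        using V(2)[of "(F ^^ i) x" "(F ^^ i) y - of_int p"] by linarith
    qed
    also have "\<dots> \<le> V * 1"
      unfolding sum_distrib_left[symmetric] by (intro mult_left_mono sum_return_segments_le_1 q H_y p V)
    finally have "exp ((\<Sum>i<q. log_slope ((F ^^ i) y)) + - V) \<le> exp (\<Sum>i<q. log_slope ((F ^^ i) x))" by simp
    then show ?thesis unfolding exp_add deriv_funpow .
  qed
  then show ?thesis by blast
qed

text \<open>If $H$ collapsed $[a, b]$, then $F^q(a, b)$ and $F^{-q}(a, b)$ would have lengths whose product
  stays bounded below along best denominators $q$, because the segments joining $F^i x$ to $F^{i-q} y$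
  for $i < q$ are disjoint modulo 1; but the lengths of the disjoint intervals $F^n(a, b)$ tend to 0.\<close>

lemma collapsed_length_ge:
  assumes ab: "a < b" "H a = H b"
    and comparable: "\<And>x y. H y = H x - real q * \<tau> \<Longrightarrow> deriv (F ^^ q) y * exp (- V) \<le> deriv (F ^^ q) x"
  shows "exp (- V) * (b - a)\<^sup>2 \<le> (F ^^ q) b - (F ^^ q) a"
proof -
  have "surj (F ^^ q)" by (rule bij_is_surj[OF bij_fn[OF bij_F]])
  then obtain a' b' where "a = (F ^^ q) a'" "b = (F ^^ q) b'" using surjD[of "F ^^ q"] by blast
  then have preimage: "(F ^^ q) a' = a" "(F ^^ q) b' = b" by simp_all
  have H_preimage: "H a' = H a - real q * \<tau>" "H b' = H a - real q * \<tau>"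
    using H_funpow[of q a'] H_funpow[of q b'] preimage ab(2) by simp_all
  have "a' < b'" using funpow_less_iff[of q a' b'] preimage ab(1) by simp
  have "b' - a' \<le> 1" using less_if_H_less[of b' "a' + 1"] H_preimage H_add_1[of a'] by simp
  obtain x where x: "a < x" "x < b" "(F ^^ q) b - (F ^^ q) a = (b - a) * deriv (F ^^ q) x"
    using smooth_mvt[OF smooth_funpow ab(1)] by blast
  obtain y where y: "a' < y" "y < b'" "b - a = (b' - a') * deriv (F ^^ q) y"
    using smooth_mvt[OF smooth_funpow[of q] \<open>a' < b'\<close>] unfolding preimage by blast
  have "H x = H a" "H y = H a - real q * \<tau>"
    using monoD[OF mono_H, of a x] monoD[OF mono_H, of x b] monoD[OF mono_H, of a' y]
      monoD[OF mono_H, of y b']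
      x y ab H_preimage by simp_all
  then have "deriv (F ^^ q) y * exp (- V) \<le> deriv (F ^^ q) x" by (intro comparable) simp
  moreover have "b - a \<le> 1 * deriv (F ^^ q) y"
    unfolding y(3) using \<open>b' - a' \<le> 1\<close> by (intro mult_right_mono) (auto simp: deriv_funpow)
  then have "(b - a) * exp (- V) \<le> deriv (F ^^ q) y * exp (- V)" by (intro mult_right_mono) auto
  ultimately have "(b - a) * exp (- V) \<le> deriv (F ^^ q) x" by linarith
  then have "(b - a) * ((b - a) * exp (- V)) \<le> (b - a) * deriv (F ^^ q) x"
    using ab by (intro mult_left_mono) auto
  then show ?thesis unfolding x(3) by (simp add: power2_eq_square mult_ac)
qed

theorem inj_H: "inj H"
proof (rule ccontr)
  assume "\<not> inj H"
  then obtain a b where ab: "a < b" "H a = H b" unfolding inj_def by (metis linorder_neq_iff)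
  obtain V where V: "\<And>q x y. best_denominator \<tau> q \<Longrightarrow> H y = H x - real q * \<tau> \<Longrightarrow>
      deriv (F ^^ q) y * exp (- V) \<le> deriv (F ^^ q) x"
    using ex_deriv_funpow_return_comparable by blast
  have "\<forall>\<^sub>F n in sequentially. (F ^^ n) b - (F ^^ n) a < exp (- V) * (b - a)\<^sup>2"
    using ab by (intro order_tendstoD(2)[OF collapsed_lengths_tendsto_0]) auto
  then obtain N where N: "\<And>n. N \<le> n \<Longrightarrow> (F ^^ n) b - (F ^^ n) a < exp (- V) * (b - a)\<^sup>2"
    unfolding eventually_sequentially by blast
  obtain q where q: "N < q" "best_denominator \<tau> q" using ex_best_denominator[OF irrational zero_less_one] .
  show False using collapsed_length_ge[OF ab V[OF q(2)]] N[of q] q(1) by simp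
qed

end

theorem denjoy:
  assumes "circle_diffeo_lift F" "rotation_number F \<notin> \<rat>"
  obtains h \<xi> where "circle_flow h \<xi>" "F = circle_flow.\<Phi> h \<xi> (rotation_number F)"
proof -
  interpret circle_lift F using assms(1) by (rule circle_lift_if_diffeo)
  interpret rotation_semiconjugacy F poincare_map "rotation_number F"
    using assms(2) by (rule rotation_semiconjugacy_poincare_map)
  interpret diffeo_semiconjugacy F poincare_map "rotation_number F" by unfold_locales (rule assms(1))
  have flow: "circle_flow poincare_map (inv poincare_map)"
    by unfold_locales
      (simp_all add: strict_mono_iff_mono mono_H inj_H surj_f_inv_f[OF surj_H] H_add_1)
  have "F x = circle_flow.\<Phi> poincare_map (inv poincare_map) (rotation_number F) x" for x
    unfolding circle_flow.\<Phi>_def[OF flow] H_F[symmetric] by (simp add: inv_f_f[OF inj_H])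
  then show ?thesis using that[OF flow] by blast
qed

section \<open>Simultaneously Diophantine families\<close>

definition diophantine :: "'a set \<Rightarrow> ('a \<Rightarrow> real) \<Rightarrow> real \<Rightarrow> real \<Rightarrow> bool" where
  "diophantine I c \<nu> C \<longleftrightarrow> (\<forall>k>0. \<exists>i\<in>I. C * real k powr (- \<nu>) \<le> dist_int (real k * c i))"

lemma ex_common_denominator:
  fixes c :: "'a \<Rightarrow> real"
  assumes "finite I" "\<And>i. i \<in> I \<Longrightarrow> c i \<in> \<rat>"
  shows "\<exists>k>0. \<forall>i\<in>I. real k * c i \<in> \<int>"
  using assms
proof (induction I rule: finite_induct)
  case empty
  then show ?case by (intro exI[of _ 1]) auto
next
  case (insert j I)
  then obtain k where k: "0 < k" "\<forall>i\<in>I. real k * c i \<in> \<int>" by auto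
  have "c j \<in> \<rat>" using insert by simp
  then obtain a b where ab: "0 < b" "c j = of_int a / of_int b" by (rule Rats_cases')
  have "real (k * nat b) * c j = of_int (int k * a)" using ab by simp
  then have "real (k * nat b) * c j \<in> \<int>" by (simp only: Ints_of_int)
  moreover have "real (k * nat b) * c i \<in> \<int>" if "i \<in> I" for i
  proof -
    have "real (k * nat b) * c i = real (nat b) * (real k * c i)" by simp
    then show ?thesis using k(2) that by (simp only:) (auto intro!: Ints_mult)
  qed
  ultimately show ?case using k(1) ab(1) by (intro exI[of _ "k * nat b"]) auto
qed

lemma diophantine_imp_irrational:
  assumes "diophantine I c \<nu> C" "0 < C" "finite I"
  obtains i where "i \<in> I" "c i \<notin> \<rat>"
proof -
  have "\<not> (\<forall>i\<in>I. c i \<in> \<rat>)"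
  proof
    assume "\<forall>i\<in>I. c i \<in> \<rat>"
    then obtain k where k: "0 < k" "\<forall>i\<in>I. real k * c i \<in> \<int>"
      using ex_common_denominator[OF assms(3)] by blast
    obtain i where i: "i \<in> I" "C * real k powr (- \<nu>) \<le> dist_int (real k * c i)"
      using assms(1) k(1) unfolding diophantine_def by blast
    obtain p where "real k * c i = of_int p" using k(2) i(1) by (metis Ints_cases)
    then have "dist_int (real k * c i) \<le> 0" using dist_int_le[of "real k * c i" p] by simp
    then show False using i(2) mult_pos_pos[OF \<open>0 < C\<close>, of "real k powr (- \<nu>)"] k(1) by simp
  qed
  then show ?thesis using that by blast
qed

definition first_return :: "real \<Rightarrow> real \<Rightarrow> nat \<Rightarrow> bool" where
  "first_return \<delta> c l \<longleftrightarrow> 0 < l \<and> dist_int (real l * c) \<le> \<delta> \<and> separated_multiples \<delta> c l"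

lemma ex_first_return:
  assumes "0 < \<delta>" "\<delta> \<le> 1"
  shows "\<exists>l. first_return \<delta> c l \<and> real l \<le> 2 / \<delta>"
proof -
  let ?P = "\<lambda>l. 0 < l \<and> dist_int (real l * c) \<le> \<delta>"
  define N where "N = nat \<lceil>1 / \<delta>\<rceil>"
  have N: "1 / \<delta> \<le> real N" "real N \<le> 1 / \<delta> + 1"
    unfolding N_def using assms by (simp_all add: of_nat_ceiling)
  have "0 < 1 / \<delta>" using assms by simp
  then have "0 < N" using N(1) by (intro Nat.gr0I) auto
  obtain p k where k: "0 < k" "k \<le> int N" "\<bar>of_int k * c - of_int p\<bar> < 1 / real N"
    using Dirichlet_approx[OF \<open>0 < N\<close>, of c] by blast
  have "1 / real N \<le> \<delta>" using N(1) \<open>0 < N\<close> assms(1) by (simp add: field_simps)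
  then have P_k: "?P (nat k)" using dist_int_le[of "real (nat k) * c" p] k by simp
  have "real (nat k) \<le> real N" "1 \<le> 1 / \<delta>" using k assms by simp_all
  then have "real (Least ?P) \<le> 2 / \<delta>" using Least_le[of ?P, OF P_k] N(2) by linarith
  moreover have "separated_multiples \<delta> c (Least ?P)"
    unfolding separated_multiples_def using not_less_Least[of _ ?P] by fastforce
  ultimately show ?thesis using LeastI[of ?P, OF P_k] unfolding first_return_def by blast
qed

text \<open>Apply the Diophantine condition to the product of the $L_i$.\<close>

lemma diophantine_multiples_ge:
  assumes dio: "diophantine I c \<nu> C" "0 < \<nu>" "0 < C"
    and "finite I" and L: "\<And>i. i \<in> I \<Longrightarrow> 0 < L i \<and> real (L i) \<le> M"
  shows "\<exists>i\<in>I. C * M powr (- (real (card I) * (\<nu> + 1))) \<le> dist_int (real (L i) * c i)"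
proof -
  define k where "k = (\<Prod>i\<in>I. L i)"
  have k: "0 < k" unfolding k_def using L by (intro prod_pos) auto
  obtain i where i: "i \<in> I" "C * real k powr (- \<nu>) \<le> dist_int (real k * c i)"
    using dio(1) k unfolding diophantine_def by blast
  have "0 < real (L i)" "real (L i) \<le> M" using L[OF i(1)] by auto
  then have M: "0 < M" by linarith
  have "real k = (\<Prod>i\<in>I. real (L i))" by (simp add: k_def)
  also have "\<dots> \<le> (\<Prod>i\<in>I. M)" using L by (intro prod_mono) auto
  also have "\<dots> = M powr real (card I)" using M by (simp add: powr_realpow)
  finally have k_le: "real k \<le> M powr real (card I)" .
  have "L i dvd k" unfolding k_def using i(1) \<open>finite I\<close> by (intro dvd_prodI) auto
  then obtain n where n: "k = L i * n" by (auto simp: dvd_def)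
  then have "n \<le> k" using L[OF i(1)] by (cases "L i") auto
  have "dist_int (real k * c i) = dist_int (real n * (real (L i) * c i))" by (simp add: n mult_ac)
  also have "\<dots> \<le> real n * dist_int (real (L i) * c i)" by (rule dist_int_mult_le)
  also have "\<dots> \<le> real k * dist_int (real (L i) * c i)" using \<open>n \<le> k\<close> by (intro mult_right_mono) auto
  finally have "C * real k powr (- \<nu>) / real k \<le> dist_int (real (L i) * c i)"
    using i(2) k by (simp add: pos_divide_le_eq mult.commute)
  have "M powr (- (real (card I) * (\<nu> + 1))) = (M powr real (card I)) powr (- (\<nu> + 1))"
    by (simp only: powr_powr mult_minus_right)
  also have "\<dots> \<le> real k powr (- (\<nu> + 1))" using k_le k \<open>0 < \<nu>\<close> by (intro powr_mono2') auto
  finally have "C * M powr (- (real (card I) * (\<nu> + 1))) \<le> C * real k powr (- (\<nu> + 1))"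
    using \<open>0 < C\<close> by (intro mult_left_mono) auto
  also have "\<dots> = C * real k powr (- \<nu>) / real k" using k powr_diff[of "real k" "- \<nu>" 1] by simp
  also have "\<dots> \<le> dist_int (real (L i) * c i)" by fact
  finally show ?thesis using i(1) by blast
qed

lemma diophantine_first_return_ge:
  assumes dio: "diophantine I c \<nu> C" "0 < \<nu>" "0 < C" and "finite I"
  shows "\<exists>P\<ge>1. \<exists>\<alpha>\<^sub>0. 0 < \<alpha>\<^sub>0 \<and> \<alpha>\<^sub>0 \<le> 1 \<and> (\<forall>\<alpha>. 0 < \<alpha> \<longrightarrow> \<alpha> < \<alpha>\<^sub>0 \<longrightarrow>
    (\<exists>i\<in>I. \<exists>l. first_return (\<alpha> / 8) (c i) l \<and> \<alpha> ^ P \<le> dist_int (real l * c i)))"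
proof -
  define D where "D = real (card I) * (\<nu> + 1)"
  define n where "n = nat \<lceil>D\<rceil>"
  define \<alpha>\<^sub>0 where "\<alpha>\<^sub>0 = min 1 (C * 16 powr (- D))"
  have "\<exists>i\<in>I. \<exists>l. first_return (\<alpha> / 8) (c i) l \<and> \<alpha> ^ Suc n \<le> dist_int (real l * c i)" if \<alpha>: "0 < \<alpha>"
    "\<alpha> < \<alpha>\<^sub>0" for \<alpha>
  proof -
    have "\<alpha> \<le> 1" using \<alpha> by (simp add: \<alpha>\<^sub>0_def)
    then have "\<forall>i. \<exists>l. first_return (\<alpha> / 8) (c i) l \<and> real l \<le> 2 / (\<alpha> / 8)"
      using \<alpha> by (intro allI ex_first_return) auto
    then obtain L where L: "\<And>i. first_return (\<alpha> / 8) (c i) (L i)" "\<And>i. real (L i) \<le> 16 / \<alpha>"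
      by (auto simp: choice_iff)
    then obtain i where i: "i \<in> I" "C * (16 / \<alpha>) powr (- D) \<le> dist_int (real (L i) * c i)"
      using diophantine_multiples_ge[OF assms, of L "16 / \<alpha>"] unfolding first_return_def D_def by auto
    have "D \<le> real n" unfolding n_def by linarith
    then have "\<alpha> powr real n \<le> \<alpha> powr D" using \<alpha> \<open>\<alpha> \<le> 1\<close> by (intro powr_mono') auto
    then have "\<alpha> ^ Suc n \<le> \<alpha> * \<alpha> powr D" using \<alpha> by (simp add: powr_realpow)
    also have "\<dots> \<le> (C * 16 powr (- D)) * \<alpha> powr D" using \<alpha> by (intro mult_right_mono) (auto simp: \<alpha>\<^sub>0_def)
    also have "\<dots> = C * (16 / \<alpha>) powr (- D)" using \<alpha> by (simp add: powr_divide powr_minus_divide)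
    finally show ?thesis using i L(1) by (meson order_trans)
  qed
  moreover have "0 < \<alpha>\<^sub>0" "\<alpha>\<^sub>0 \<le> 1" using \<open>0 < C\<close> by (simp_all add: \<alpha>\<^sub>0_def)
  ultimately show ?thesis by (intro exI[of _ "Suc n"] conjI exI[of _ \<alpha>\<^sub>0]) auto
qed

section \<open>Gaps between orbit points\<close>

text \<open>From a point $ic + p$ with $i < q$ one reaches another such point strictly to the right, by
  adding $q'c$ or $(q' - q)c$; both displacements are less than $2\delta$.\<close>

lemma orbit_gap_if_positive_return:
  assumes "0 < q'" "q' < q" and \<delta>: "real q' * c + of_int p' = \<delta>"
    "0 < \<delta>" and \<epsilon>: "\<bar>real q * c + of_int p\<bar> < \<delta>"
  shows "\<exists>i<q. \<exists>p. \<bar>r - real i * c - of_int p\<bar> \<le> 2 * \<delta>"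
proof -
  define X where "X i = real i * c + of_int \<lfloor>r - real i * c\<rfloor>" for i
  have X_le: "X i \<le> r" for i unfolding X_def by linarith
  have X_greatest: "real i * c + of_int p \<le> X i" if "real i * c + of_int p \<le> r" for i p
  proof -
    have "p \<le> \<lfloor>r - real i * c\<rfloor>" using that by (simp add: le_floor_iff)
    then show ?thesis unfolding X_def by simp
  qed
  have "finite {..<q}" "{..<q} \<noteq> {}" using assms(1,2) by auto
  then obtain i where i: "i < q" and X_max: "\<And>j. j < q \<Longrightarrow> X j \<le> X i"
    using ex_is_arg_min_if_finite[of "{..<q}" "\<lambda>j. - X j"] by (auto simp: is_arg_min_linorder)
  define s where "s = \<lfloor>r - real i * c\<rfloor>"
  have X_i: "X i = real i * c + of_int s" by (simp add: X_def s_def)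
  have "r < X i + 2 * \<delta>"
  proof (cases "i + q' < q")
    case True
    have next_point: "real (i + q') * c + of_int (s + p') = X i + \<delta>"
      using \<delta>(1) by (simp add: X_i algebra_simps)
    have "\<not> X i + \<delta> \<le> r"
      using X_greatest[of "i + q'" "s + p'"] X_max[OF True] \<delta>(2) unfolding next_point by linarith
    then show ?thesis using \<delta>(2) by linarith
  next
    case False
    have in_range: "i + q' - q < q" using i assms by linarith
    have next_point: "real (i + q' - q) * c + of_int (s + p' - p) = X i + \<delta> - (real q * c + of_int p)"
      using \<delta>(1) False by (simp add: X_i of_nat_diff algebra_simps)
    have "\<not> X i + \<delta> - (real q * c + of_int p) \<le> r"
      using X_greatest[of "i + q' - q" "s + p' - p"] X_max[OF in_range] \<epsilon> unfolding next_point by linarith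
    then show ?thesis using \<epsilon> by linarith
  qed
  then have "\<bar>r - real i * c - of_int s\<bar> \<le> 2 * \<delta>" using X_le[of i] X_i \<delta>(2) by linarith
  then show ?thesis using i by blast
qed

lemma orbit_gap_if_return:
  assumes "0 < q'" "q' < q" "dist_int (real q * c) < dist_int (real q' * c)"
  shows "\<exists>i<q. \<exists>p. \<bar>r - real i * c - of_int p\<bar> \<le> 2 * dist_int (real q' * c)"
proof -
  let ?\<delta> = "dist_int (real q' * c)"
  obtain p' where p': "?\<delta> = \<bar>real q' * c + of_int p'\<bar>" by (rule dist_int_attained)
  obtain p where p: "dist_int (real q * c) = \<bar>real q * c + of_int p\<bar>" by (rule dist_int_attained)
  have "0 < ?\<delta>" using dist_int_nonneg assms(3) by (rule le_less_trans)
  show ?thesis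
  proof (cases "0 \<le> real q' * c + of_int p'")
    case True
    then show ?thesis
      using assms p p' \<open>0 < ?\<delta>\<close> by (intro orbit_gap_if_positive_return[of q' q c p' _ p]) auto
  next
    case False
    have "\<bar>real q * - c + of_int (- p)\<bar> = dist_int (real q * c)"
      unfolding p by (simp add: abs_minus_commute)
    then have "\<exists>i<q. \<exists>s. \<bar>- r - real i * (- c) - of_int s\<bar> \<le> 2 * ?\<delta>"
      using False assms p' \<open>0 < ?\<delta>\<close>
      by (intro orbit_gap_if_positive_return[of q' q "- c" "- p'" _ "- p"]) auto
    then obtain i s where "i < q" "\<bar>- r - real i * (- c) - of_int s\<bar> \<le> 2 * ?\<delta>" by blast
    then have "\<bar>r - real i * c - of_int (- s)\<bar> \<le> 2 * ?\<delta>" by (simp add: abs_le_iff)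
    then show ?thesis using \<open>i < q\<close> by blast
  qed
qed

lemma best_denominator_orbit_gaps:
  assumes "best_denominator c q" "1 < q"
  obtains \<delta> where "0 < \<delta>" "\<delta> \<le> 1" "dist_int (real q * c) \<le> \<delta>" "separated_multiples \<delta> c q"
    "\<And>r. \<exists>i<q. \<exists>p. \<bar>r - real i * c - of_int p\<bar> \<le> 2 * \<delta>"
proof -
  have "finite {1..<q}" "{1..<q} \<noteq> {}" using \<open>1 < q\<close> by auto
  then obtain q' where q': "1 \<le> q'" "q' < q"
    and least: "\<And>j. j \<in> {1..<q} \<Longrightarrow> dist_int (real q' * c) \<le> dist_int (real j * c)"
    using ex_is_arg_min_if_finite[of "{1..<q}" "\<lambda>j. dist_int (real j * c)"]
    by (auto simp: is_arg_min_linorder)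
  have less: "dist_int (real q * c) < dist_int (real q' * c)"
    using assms(1) q' by (simp add: best_denominator_def)
  show ?thesis
  proof (rule that[of "dist_int (real q' * c)"])
    show "0 < dist_int (real q' * c)" using dist_int_nonneg less by (rule le_less_trans)
    show "dist_int (real q' * c) \<le> 1" using dist_int_le_half[of "real q' * c"] by simp
    show "separated_multiples (dist_int (real q' * c)) c q"
      unfolding separated_multiples_def using least by simp
    show "\<exists>i<q. \<exists>p. \<bar>r - real i * c - of_int p\<bar> \<le> 2 * dist_int (real q' * c)" for r
      using q' less by (intro orbit_gap_if_return) auto
  qed (use less in simp)
qed

section \<open>Commuting diffeomorphisms as a flow\<close>

lemma continuous_Ints_valued_constant:
  fixes D :: "real \<Rightarrow> real"
  assumes "continuous_on UNIV D" "\<And>x. D x \<in> \<int>"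
  obtains k where "\<And>x. D x = of_int k"
proof -
  have "D constant_on UNIV"
  proof (rule continuous_discrete_range_constant[OF connected_UNIV assms(1)])
    fix x
    have "1 \<le> norm (D y - D x)" if "D y \<noteq> D x" for y
      using Ints_nonzero_abs_ge1[of "D y - D x"] assms(2) that by simp
    then show "\<exists>e>0. \<forall>y. y \<in> UNIV \<and> D y \<noteq> D x \<longrightarrow> e \<le> norm (D y - D x)" by (intro exI[of _ 1]) auto
  qed
  then show ?thesis using assms(2)[of 0] that by (auto simp: constant_on_def elim: Ints_cases)
qed

lemma periodic_no_drift:
  fixes u :: "real \<Rightarrow> real"
  assumes "continuous_on UNIV u" "\<And>y. u (y + 1) = u y" "\<And>y. u (y + \<tau>) = u y + k"
  shows "k = 0"
proof -
  obtain B where B: "\<And>y. \<bar>u y\<bar> \<le> B" using periodic_bounded[OF assms(1,2)] by blast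
  have multiples: "u (real n * \<tau>) = u 0 + real n * k" for n
  proof (induction n)
    case (Suc n)
    then show ?case using assms(3)[of "real n * \<tau>"] by (simp add: algebra_simps)
  qed simp
  have "real n * \<bar>k\<bar> \<le> 2 * B" for n
  proof -
    have "\<bar>real n * k\<bar> \<le> 2 * B" using multiples[of n] B[of 0] B[of "real n * \<tau>"] by linarith
    then show ?thesis by (simp add: abs_mult)
  qed
  then show ?thesis using real_archimedian_rdiv_eq_0[of "\<bar>k\<bar>" "2 * B"] B[of 0] by fastforce
qed

lemma constant_if_irrational_invariant:
  fixes u :: "real \<Rightarrow> real"
  assumes cont: "continuous_on UNIV u"
    and per: "\<And>y. u (y + 1) = u y" and inv: "\<And>y. u (y + \<tau>) = u y" and "\<tau> \<notin> \<rat>"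
  shows "u z = u 0"
proof -
  let ?S = "{real n * \<tau> + of_int p | n p. True}"
  have "\<exists>y\<in>?S. dist y x < e" if e: "0 < e" for x e
  proof -
    have "x - e < x + e" using e by simp
    then obtain n p where "x - e < real n * \<tau> + of_int p" "real n * \<tau> + of_int p < x + e"
      using nat_multiples_mod1_dense[OF \<open>\<tau> \<notin> \<rat>\<close>] by blast
    then have "dist (real n * \<tau> + of_int p) x < e" by (simp add: dist_real_def abs_less_iff)
    then show ?thesis by blast
  qed
  then have "z \<in> closure ?S" by (simp add: closure_approachable)
  moreover have "continuous_on (closure ?S) u" using continuous_on_subset[OF cont] by blast
  moreover have "u (real n * \<tau>) = u 0" for n
  proof (induction n)
    case (Suc n)
    then show ?case using inv[of "real n * \<tau>"] by (simp add: algebra_simps)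
  qed simp
  then have "u x = u 0" if "x \<in> ?S" for x using that shift_of_int[of u 0] per by auto
  ultimately show ?thesis using continuous_constant_on_closure by blast
qed

context circle_flow
begin

lemma circle_lift_\<Phi>: "circle_lift (\<Phi> c)"
  by unfold_locales (simp_all add: strict_mono_def \<Phi>_add_1)

lemma rotation_number_\<Phi>: "rotation_number (\<Phi> c) = c"
proof -
  interpret circle_lift "\<Phi> c" by (rule circle_lift_\<Phi>)
  have "continuous_on UNIV (\<lambda>y. h y - y)" by (intro continuous_intros continuous_h)
  then obtain B where B: "\<And>y. \<bar>h y - y\<bar> \<le> B"
    using periodic_bounded[of "\<lambda>y. h y - y"] h_add_1 by auto
  have "real n * \<bar>c - rotation_number (\<Phi> c)\<bar> \<le> 2 * B + 2" for n
  proof -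
    have "\<bar>\<Phi> (real n * c) 0 - real n * rotation_number (\<Phi> c)\<bar> \<le> 2"
      using funpow_near_rotation[of n 0] by (simp add: funpow_\<Phi>)
    moreover have "\<bar>h 0 + real n * c - \<Phi> (real n * c) 0\<bar> \<le> B" using B[of "\<Phi> (real n * c) 0"] by simp
    moreover have "\<bar>h 0\<bar> \<le> B" using B[of 0] by simp
    ultimately have "\<bar>real n * (c - rotation_number (\<Phi> c))\<bar> \<le> 2 * B + 2"
      unfolding right_diff_distrib by linarith
    then show ?thesis by (simp add: abs_mult)
  qed
  then have "\<bar>c - rotation_number (\<Phi> c)\<bar> = 0"
    using B[of 0] by (intro real_archimedian_rdiv_eq_0[of _ "2 * B + 2"]) auto
  then show ?thesis by simp
qed

text \<open>A map commuting with an irrational $\Phi_\tau$ becomes, in the coordinate $h$, a map whose displacement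
  is invariant under a dense set of translations.\<close>

lemma centralizer_\<Phi>:
  assumes \<tau>: "\<tau> \<notin> \<rat>" and g: "continuous_on UNIV g" "\<And>x. g (x + 1) = g x + 1"
    and comm: "\<And>x. g (\<Phi> \<tau> x) - \<Phi> \<tau> (g x) \<in> \<int>"
  obtains c where "g = \<Phi> c"
proof -
  define u where "u y = h (g (\<xi> y)) - y" for y
  have "continuous_on UNIV (\<lambda>x. g (\<Phi> \<tau> x) - \<Phi> \<tau> (g x))"
    by (intro continuous_on_diff continuous_on_compose2[OF g(1)]
      continuous_on_compose2[OF continuous_\<Phi>] continuous_\<Phi> g(1)) auto
  then obtain k where k: "\<And>x. g (\<Phi> \<tau> x) - \<Phi> \<tau> (g x) = of_int k"
    using continuous_Ints_valued_constant comm by blast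
  have "g (\<xi> (y + \<tau>)) = \<Phi> \<tau> (g (\<xi> y)) + of_int k" for y
    using k[of "\<xi> y"] unfolding \<Phi>_def[of \<tau> "\<xi> y"] h_\<xi> by linarith
  then have u_\<tau>: "u (y + \<tau>) = u y + of_int k" for y by (simp add: u_def h_add_of_int)
  have u_1: "u (y + 1) = u y" for y by (simp add: u_def \<xi>_add_1 g(2) h_add_1)
  have cont_u: "continuous_on UNIV u" unfolding u_def
    by (intro continuous_on_diff continuous_on_compose2[OF continuous_h]
      continuous_on_compose2[OF g(1)] continuous_\<xi> continuous_on_id) auto
  have "real_of_int k = 0" using periodic_no_drift[OF cont_u u_1 u_\<tau>] .
  then have u_const: "u z = u 0" for z
    using u_\<tau> by (intro constant_if_irrational_invariant[OF cont_u u_1 _ \<tau>]) auto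
  have "h (g x) = h x + u 0" for x using u_const[of "h x"] by (simp add: u_def algebra_simps)
  then have "g x = \<Phi> (u 0) x" for x unfolding \<Phi>_def by (metis \<xi>_h)
  then show ?thesis using that by blast
qed

lemma circle_diffeo_lift_h:
  assumes "smooth_real h" "\<And>x. 0 < deriv h x"
  shows "circle_diffeo_lift h"
proof -
  have "inv h = \<xi>" by (rule inv_equality) simp_all
  moreover have "smooth_real \<xi>" using assms by (intro smooth_inverse_function(1)[of h \<xi>]) auto
  moreover have "bij h" by (rule bij_betw_byWitness[of _ \<xi>]) auto
  ultimately show ?thesis using assms(1) h_mono h_add_1 by (simp add: circle_diffeo_lift_def)
qed

subsection \<open>The Denjoy--Koksma inequality\<close>

lemma log_deriv_orbit_oscillation:
  assumes "0 < \<delta>" "\<delta> \<le> 1" "separated_multiples \<delta> c l" "smooth_time c"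
    and V: "\<And>x y. \<bar>log_deriv c x - log_deriv c y\<bar> \<le> V * \<bar>x - y\<bar>" and "n \<le> l" and r: "\<bar>r\<bar> \<le> real J * \<delta>"
  shows "\<bar>log_deriv (real n * c) (\<Phi> r y) - log_deriv (real n * c) y\<bar> \<le> V * real J"
proof (cases "0 \<le> r")
  case True
  then show ?thesis using log_deriv_orbit_distortion[OF assms(1-4) V assms(6), of y "\<Phi> r y" J] r by simp
next
  case False
  have "\<Phi> r y \<le> \<Phi> 0 y" using False by (simp only: \<Phi>_le_time_iff)
  moreover have "\<Phi> 0 y \<le> \<Phi> (real J * \<delta> + r) y" using r by (simp only: \<Phi>_le_time_iff)
  ultimately have "\<bar>log_deriv (real n * c) y - log_deriv (real n * c) (\<Phi> r y)\<bar> \<le> V * real J"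
    using log_deriv_orbit_distortion[OF assms(1-4) V assms(6), of "\<Phi> r y" y J] by (simp add: \<Phi>_add)
  then show ?thesis by (simp add: abs_minus_commute)
qed

lemma ex_log_deriv_eq_0:
  assumes "smooth_time r"
  obtains z where "log_deriv r z = 0"
proof -
  obtain z where "\<Phi> r 1 - \<Phi> r 0 = (1 - 0) * deriv (\<Phi> r) z"
    using smooth_mvt[OF smooth_\<Phi>[OF assms] zero_less_one] by blast
  then show ?thesis using that[of z] \<Phi>_add_1[of r 0] by (simp add: log_deriv_def)
qed

lemma log_deriv_diff_commute:
  assumes "smooth_time r" "smooth_time s"
  shows "log_deriv r (\<Phi> s x) - log_deriv r x = log_deriv s (\<Phi> r x) - log_deriv s x"
  using log_deriv_add[OF assms, of x] log_deriv_add[OF assms(2,1), of x] unfolding add.commute[of s r]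
  by linarith

theorem denjoy_koksma:
  assumes c: "smooth_time c" and V: "\<And>x y. \<bar>log_deriv c x - log_deriv c y\<bar> \<le> V * \<bar>x - y\<bar>"
    and q: "best_denominator c q" "1 < q"
  shows "\<bar>log_deriv (real q * c) x\<bar> \<le> 3 * V"
proof -
  obtain \<delta> where \<delta>: "0 < \<delta>" "\<delta> \<le> 1" "dist_int (real q * c) \<le> \<delta>" "separated_multiples \<delta> c q"
    and gaps: "\<And>r. \<exists>i<q. \<exists>p. \<bar>r - real i * c - of_int p\<bar> \<le> 2 * \<delta>"
    using best_denominator_orbit_gaps[OF q] by blast
  note oscillation = log_deriv_orbit_oscillation[OF \<delta>(1,2,4) c V]
  have smooth: "smooth_time (real n * c)" for n by (rule smooth_time_mult[OF c])
  obtain z where z: "log_deriv (real q * c) z = 0" using ex_log_deriv_eq_0[OF smooth] .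
  obtain i p where i: "i < q" "\<bar>(h x - h z) - real i * c - of_int p\<bar> \<le> 2 * \<delta>" using gaps by blast
  define t where "t = real i * c + of_int p"
  have "x = \<Phi> ((h x - h z) - t) (\<Phi> t z)" by (simp add: \<Phi>_def flip: \<Phi>_add)
  then have near_x: "\<bar>log_deriv (real q * c) x - log_deriv (real q * c) (\<Phi> t z)\<bar> \<le> V * real 2"
    using oscillation[of q "(h x - h z) - t" 2 "\<Phi> t z"] i(2) by (simp add: t_def algebra_simps)
  obtain s where s: "dist_int (real q * c) = \<bar>real q * c + of_int s\<bar>" by (rule dist_int_attained)
  have "log_deriv (real q * c) (\<Phi> t z)
      = log_deriv (real i * c) (\<Phi> (real q * c) z) - log_deriv (real i * c) z"
    using log_deriv_diff_commute[OF smooth[of q] smooth_time_add_of_int[OF smooth[of i]], of p z] z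
    by (simp add: t_def log_deriv_add_of_int smooth)
  also have "log_deriv (real i * c) (\<Phi> (real q * c) z)
      = log_deriv (real i * c) (\<Phi> (real q * c + of_int s) z)"
    unfolding \<Phi>_add_of_int using shift_of_int[of "log_deriv (real i * c)" 0] log_deriv_add_1 by simp
  finally have "\<bar>log_deriv (real q * c) (\<Phi> t z)\<bar> \<le> V * real 1"
    using oscillation[of i "real q * c + of_int s" 1 z] i(1) s \<delta>(3) by simp
  then show ?thesis using near_x by simp
qed

end

section \<open>Smoothness of the common conjugacy\<close>

context flow_generators
begin

lemma is_scale_best_return:
  assumes V: "3 * gens_jet_const 1 \<le> V" and c: "c \<in> gens" "c \<notin> \<rat>" and q: "best_denominator c q" "1 < q"
  shows "is_scale (dist_int (real q * c))"
proof -
  obtain p where p: "dist_int (real q * c) = \<bar>real q * c + of_int p\<bar>" by (rule dist_int_attained)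
  define r where "r = real q * c + of_int p"
  have smooth: "smooth_time (real q * c)" by (rule smooth_time_mult[OF smooth_gens[OF c(1)]])
  have r: "smooth_time r" "log_deriv r = log_deriv (real q * c)"
    unfolding r_def using smooth_time_add_of_int[OF smooth] log_deriv_add_of_int[OF smooth] by auto
  have log_deriv_r: "\<bar>log_deriv r x\<bar> \<le> V" for x
    using denjoy_koksma[OF smooth_gens[OF c(1)] lipschitz_gens[OF c(1)] q, of x] V unfolding r(2)
    by linarith
  have "smooth_time \<bar>r\<bar> \<and> (\<forall>x. \<bar>log_deriv \<bar>r\<bar> x\<bar> \<le> V)"
    using log_deriv_r smooth_time_minus[OF r(1)] log_deriv_minus[OF r(1)] r(1) by (cases "0 \<le> r") auto
  moreover have "0 < dist_int (real q * c)" using dist_int_irrational_mult_pos[OF c(2)] q(2) by simp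
  moreover have "dist_int (real q * c) \<le> 1" using dist_int_le_half[of "real q * c"] by simp
  ultimately show ?thesis unfolding is_scale_def p r_def by blast
qed

lemma scale_step_if_first_return:
  assumes l: "first_return (\<alpha> / 8) c l" and "0 < dist_int (real l * c)" and c: "c \<in> gens" "- c \<in> gens"
  shows "\<exists>b. scale_step \<alpha> (dist_int (real l * c)) b l"
proof -
  obtain p where p: "dist_int (real l * c) = \<bar>real l * c + of_int p\<bar>" by (rule dist_int_attained)
  define b where "b = (if 0 \<le> real l * c + of_int p then c else - c)"
  have "dist_int (real l * c) = real l * b + of_int (if 0 \<le> real l * c + of_int p then p else - p)"
    unfolding p b_def by simp
  then have "\<exists>p. dist_int (real l * c) = real l * b + of_int p" by blast
  moreover have "separated_multiples (\<alpha> / 8) b l"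
    using l by (simp add: b_def first_return_def separated_multiples_def)
  ultimately show ?thesis
    using assms unfolding scale_step_def first_return_def by (intro exI[of _ b]) (auto simp: b_def)
qed

end

theorem (in circle_flow) smooth_conjugacy_if_diophantine:
  assumes "finite I" and smooth: "\<And>i. i \<in> I \<Longrightarrow> smooth_time (c i)"
    and dio: "diophantine I c \<nu> C" "0 < \<nu>" "0 < C"
  shows "smooth_real h" "0 < deriv h x"
proof -
  define gens where "gens = c ` I \<union> (\<lambda>i. - c i) ` I"
  interpret unit: flow_generators h \<xi> gens 1
    by unfold_locales (use assms(1) smooth smooth_time_minus in \<open>auto simp: gens_def\<close>)
  define V where "V = max 1 (3 * unit.gens_jet_const 1)"
  interpret flow_generators h \<xi> gens V
    by unfold_locales (use unit.finite_gens unit.smooth_gens in \<open>auto simp: V_def\<close>)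
  obtain P \<alpha>\<^sub>0 where P: "1 \<le> P" "0 < \<alpha>\<^sub>0" "\<alpha>\<^sub>0 \<le> 1"
    and returns: "\<And>\<alpha>. 0 < \<alpha> \<Longrightarrow> \<alpha> < \<alpha>\<^sub>0 \<Longrightarrow>
      \<exists>i\<in>I. \<exists>l. first_return (\<alpha> / 8) (c i) l \<and> \<alpha> ^ P \<le> dist_int (real l * c i)"
    using diophantine_first_return_ge[OF dio assms(1)] by blast
  obtain i where i: "i \<in> I" "c i \<notin> \<rat>" using diophantine_imp_irrational[OF dio(1,3) assms(1)] .
  interpret diophantine_flow h \<xi> gens V P \<alpha>\<^sub>0
  proof unfold_locales
    fix \<alpha> :: real assume \<alpha>: "0 < \<alpha>" "\<alpha> < \<alpha>\<^sub>0"
    obtain j l where "j \<in> I" "first_return (\<alpha> / 8) (c j) l" "\<alpha> ^ P \<le> dist_int (real l * c j)"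
      using returns[OF \<alpha>] by blast
    moreover have "0 < \<alpha> ^ P" using \<alpha> by simp
    ultimately show "\<exists>\<alpha>' c l. scale_step \<alpha> \<alpha>' c l \<and> \<alpha> ^ P \<le> \<alpha>'"
      using scale_step_if_first_return[of \<alpha> "c j" l] unfolding gens_def
      by (meson UnCI image_eqI less_le_trans)
  next
    fix e :: real assume "0 < e"
    then obtain q where "1 < q" "dist_int (real q * c i) < e" "best_denominator (c i) q"
      using ex_best_denominator[OF i(2)] by blast
    then show "\<exists>\<alpha>. is_scale \<alpha> \<and> \<alpha> < e"
      using is_scale_best_return[of "c i" q] i unfolding gens_def V_def by auto
  qed (use P in auto)
  obtain s \<kappa> C' G where "scale_sequence h \<xi> gens V s \<kappa> C' G P" using ex_scale_sequence .
  then interpret scale_sequence h \<xi> gens V s \<kappa> C' G P .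
  show "smooth_real h" "0 < deriv h x" by (rule smooth_h deriv_h_pos)+
qed

lemma diophantine_if_Max_ge:
  fixes \<theta> :: "'a \<Rightarrow> real"
  assumes "finite I" "I \<noteq> {}" and shift: "\<And>i. i \<in> I \<Longrightarrow> \<theta> i - c i \<in> \<int>"
    and Max_ge: "\<And>k :: int. k \<noteq> 0 \<Longrightarrow>
        C * \<bar>real_of_int k\<bar> powr (- \<nu>) \<le> Max ((\<lambda>i. dist_int (of_int k * \<theta> i)) ` I)"
  shows "diophantine I c \<nu> C"
  unfolding diophantine_def
proof (intro allI impI)
  fix k :: nat assume "0 < k"
  have "Max ((\<lambda>i. dist_int (real k * \<theta> i)) ` I) \<in> (\<lambda>i. dist_int (real k * \<theta> i)) ` I"
    using assms(1,2) by (intro Max_in) auto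
  then obtain i where i: "i \<in> I" "Max ((\<lambda>i. dist_int (real k * \<theta> i)) ` I) = dist_int (real k * \<theta> i)" by auto
  obtain p where "\<theta> i - c i = of_int p" using shift[OF i(1)] by (rule Ints_cases)
  then have "real k * \<theta> i = real k * c i + of_int (int k * p)"
    by (simp add: algebra_simps flip: distrib_left)
  then have "dist_int (real k * \<theta> i) = dist_int (real k * c i)" by (simp only: dist_int_add_of_int)
  then show "\<exists>i\<in>I. C * real k powr (- \<nu>) \<le> dist_int (real k * c i)"
    using Max_ge[of "int k"] i \<open>0 < k\<close> by auto
qed

lemma commuting_diffeos_flow:
  assumes diffeo: "\<And>i. i \<in> I \<Longrightarrow> circle_diffeo_lift (F i)"
    and comm: "\<And>i j x. i \<in> I \<Longrightarrow> j \<in> I \<Longrightarrow> F i (F j x) - F j (F i x) \<in> \<int>"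
    and "j \<in> I" "rotation_number (F j) \<notin> \<rat>"
  obtains h \<xi> where "circle_flow h \<xi>" "\<And>i. i \<in> I \<Longrightarrow> F i = circle_flow.\<Phi> h \<xi> (rotation_number (F i))"
    "\<And>i. i \<in> I \<Longrightarrow> circle_flow.smooth_time h \<xi> (rotation_number (F i))"
proof -
  obtain h \<xi> where flow: "circle_flow h \<xi>" and F_j: "F j = circle_flow.\<Phi> h \<xi> (rotation_number (F j))"
    using denjoy[OF diffeo assms(4)] \<open>j \<in> I\<close> by blast
  interpret circle_flow h \<xi> by (rule flow)
  have F: "F i = \<Phi> (rotation_number (F i))" if i: "i \<in> I" for i
  proof -
    have "continuous_on UNIV (F i)" "\<And>x. F i (x + 1) = F i x + 1"
      using diffeo[OF i] by (auto simp: circle_diffeo_lift_def smooth_continuous_on)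
    moreover have "F i (\<Phi> (rotation_number (F j)) x) - \<Phi> (rotation_number (F j)) (F i x) \<in> \<int>" for x
      using comm[OF i \<open>j \<in> I\<close>] unfolding F_j[symmetric] .
    ultimately obtain b where "F i = \<Phi> b" using centralizer_\<Phi>[OF assms(4)] by blast
    then show ?thesis by (simp add: rotation_number_\<Phi>)
  qed
  moreover have "smooth_time (rotation_number (F i))" if "i \<in> I" for i
    unfolding smooth_time_def F[OF that, symmetric]
    using diffeo[OF that] deriv_circle_diffeo_lift_pos[OF diffeo[OF that]]
    by (auto simp: circle_diffeo_lift_def)
  ultimately show ?thesis using that[OF flow] by blast
qed

theorem theorem1:
  fixes d :: nat and \<theta> :: "nat \<Rightarrow> real" and F :: "nat \<Rightarrow> real \<Rightarrow> real"
  assumes "d \<ge> 2"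
    and "\<exists>\<nu>>0. \<exists>C>0. \<forall>k::int. k \<noteq> 0 \<longrightarrow>
           Max ((\<lambda>i. dist_int (of_int k * \<theta> i)) ` {..<d}) \<ge> C * \<bar>real_of_int k\<bar> powr (- \<nu>)"
    and "\<forall>i<d. circle_diffeo_lift (F i)"
    and "\<forall>i<d. \<theta> i - rotation_number (F i) \<in> \<int>"
    and "\<forall>i<d. \<forall>j<d. \<forall>x. F i (F j x) - F j (F i x) \<in> \<int>"
  shows "\<exists>H. circle_diffeo_lift H \<and> (\<forall>i<d. \<forall>x. H (F i x) - (H x + \<theta> i) \<in> \<int>)"
proof -
  let ?I = "{..<d}" and ?c = "\<lambda>i. rotation_number (F i)"
  have "?I \<noteq> {}" using assms(1) by (simp add: lessThan_empty_iff)
  then obtain \<nu> C where dio: "diophantine ?I ?c \<nu> C" "0 < \<nu>" "0 < C"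
    using assms(2,4) diophantine_if_Max_ge[of ?I \<theta> ?c] by (metis finite_lessThan lessThan_iff)
  obtain j where "j \<in> ?I" "?c j \<notin> \<rat>" using diophantine_imp_irrational[OF dio(1,3) finite_lessThan] .
  then obtain h \<xi> where flow: "circle_flow h \<xi>" and F: "\<And>i. i \<in> ?I \<Longrightarrow> F i = circle_flow.\<Phi> h \<xi> (?c i)"
    and smooth: "\<And>i. i \<in> ?I \<Longrightarrow> circle_flow.smooth_time h \<xi> (?c i)"
    using commuting_diffeos_flow[of ?I F j] assms(3,5) by (metis lessThan_iff)
  interpret circle_flow h \<xi> by (rule flow)
  have "circle_diffeo_lift h"
    by (intro circle_diffeo_lift_h smooth_conjugacy_if_diophantine[OF finite_lessThan smooth dio])
  moreover have "h (F i x) - (h x + \<theta> i) \<in> \<int>" if "i < d" for i x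
  proof -
    have "h (F i x) - (h x + \<theta> i) = - (\<theta> i - ?c i)" using F[of i] that h_\<Phi>[of "?c i" x] by simp
    then show ?thesis using assms(4) that by (metis Ints_minus)
  qed
  ultimately show ?thesis by blast
qed

end
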